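(* Let $\mathscr{P}$ be an additive category. Then brutal truncation at degree zero, sending a totally acyclic complex $C$ to $\beta_{\ge 0}(C)$ and (the homotopy class of) a chain map $f$ to the image of $\beta_{\ge 0}(f)$ in the Verdier quotient, induces a (well-defined) fully faithful triangle functor $$\beta_{\mathscr{P}} \colon \mathbf{K}_{\rm tac} \mathscr{P} \to \mathbf{K}^{-,\rm b} \mathscr{P} / \mathbf{K}^{\rm b} \mathscr{P}.$$
   Context: Complexes in the additive category $\mathscr{P}$ are written $\cdots \to C_{n+1} \xrightarrow{d_{n+1}} C_n \xrightarrow{d_n} C_{n-1} \to \cdots$. $\mathbf{K}\mathscr{P}$ is the homotopy category of complexes in $\mathscr{P}$, triangulated in the usual way via mapping cones, with suspension $\Sigma$ given by $(\Sigma C)_n = C_{n-1}$ and differential $-d$. A complex $C$ is acyclic if the complex of abelian groups $\mathrm{Hom}_{\mathscr{P}}(P,C)$ is acyclic for every object $P \in \mathscr{P}$. It is totally acyclic if, in addition, $\mathrm{Hom}_{\mathscr{P}}(C,P)$ is acyclic for every $P \in \mathscr{P}$. It is eventually acyclic if for every $P \in \mathscr{P}$ one has $\mathrm{H}_n(\mathrm{Hom}_{\mathscr{P}}(P,C)) = 0$ for $|n| \gg 0$. The following are full triangulated subcategories of $\mathbf{K}\mathscr{P}$ (defined up to isomorphism in $\mathbf{K}\mathscr{P}$): $\mathbf{K}_{\rm tac}\mathscr{P}$, consisting of the totally acyclic complexes; $\mathbf{K}^{-,\rm b}\mathscr{P}$, consisting of the eventually acyclic complexes $C$ with $C_n = 0$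 for $n \ll 0$; and $\mathbf{K}^{\rm b}\mathscr{P}$, consisting of the complexes with $C_n = 0$ for $|n| \gg 0$. The quotient $\mathbf{K}^{-,\rm b}\mathscr{P}/\mathbf{K}^{\rm b}\mathscr{P}$ is the Verdier quotient. For an integer $n$, the brutal truncation $\beta_{\ge n}(C)$ is the complex $\cdots \to C_{n+2} \xrightarrow{d_{n+2}} C_{n+1} \xrightarrow{d_{n+1}} C_n \to 0 \to 0 \to \cdots$ (and similarly for chain maps). Brutal truncation does not itself define a functor between homotopy categories. *)

theory Defs
  imports "HOL-Algebra.Elementary_Groups"
begin

section \<open>Additive categories\<close>

text \<open>
  Hom-sets are given as a family of abelian groups indexed by pairs of objects. Hom-sets of
  different pairs need not be disjoint, so composition carries its three objects:
  \<open>Cmp \<C> X Y Z g f\<close> is the composite of \<open>f : X \<rightarrow> Y\<close> and \<open>g : Y \<rightarrow> Z\<close>.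
  Abelian groups are those of \<open>HOL-Algebra.Group\<close>, so the addition, zero and negation of
  morphisms appear in multiplicative notation.
\<close>

record ('o, 'm) cat =
  Obj :: "'o set"
  Hom :: "'o \<Rightarrow> 'o \<Rightarrow> 'm monoid"
  Idn :: "'o \<Rightarrow> 'm"
  Cmp :: "'o \<Rightarrow> 'o \<Rightarrow> 'o \<Rightarrow> 'm \<Rightarrow> 'm \<Rightarrow> 'm"

abbreviation mor :: "('o, 'm, 'z) cat_scheme \<Rightarrow> 'o \<Rightarrow> 'o \<Rightarrow> 'm set"
  where "mor \<C> X Y \<equiv> carrier (Hom \<C> X Y)"

abbreviation zero_mor :: "('o, 'm, 'z) cat_scheme \<Rightarrow> 'o \<Rightarrow> 'o \<Rightarrow> 'm"
  where "zero_mor \<C> X Y \<equiv> \<one>\<^bsub>Hom \<C> X Y\<^esub>"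

locale category =
  fixes \<C> :: "('o, 'm, 'z) cat_scheme"
  assumes Idn_mor: "X \<in> Obj \<C> \<Longrightarrow> Idn \<C> X \<in> mor \<C> X X"
    and Cmp_mor: "\<lbrakk>X \<in> Obj \<C>; Y \<in> Obj \<C>; Z \<in> Obj \<C>; f \<in> mor \<C> X Y; g \<in> mor \<C> Y Z\<rbrakk>
      \<Longrightarrow> Cmp \<C> X Y Z g f \<in> mor \<C> X Z"
    and Cmp_Idn_left: "\<lbrakk>X \<in> Obj \<C>; Y \<in> Obj \<C>; f \<in> mor \<C> X Y\<rbrakk> \<Longrightarrow> Cmp \<C> X Y Y (Idn \<C> Y) f = f"
    and Cmp_Idn_right: "\<lbrakk>X \<in> Obj \<C>; Y \<in> Obj \<C>; f \<in> mor \<C> X Y\<rbrakk> \<Longrightarrow> Cmp \<C> X X Y f (Idn \<C> X) = f"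
    and Cmp_assoc: "\<lbrakk>W \<in> Obj \<C>; X \<in> Obj \<C>; Y \<in> Obj \<C>; Z \<in> Obj \<C>;
        f \<in> mor \<C> W X; g \<in> mor \<C> X Y; h \<in> mor \<C> Y Z\<rbrakk>
      \<Longrightarrow> Cmp \<C> W Y Z h (Cmp \<C> W X Y g f) = Cmp \<C> W X Z (Cmp \<C> X Y Z h g) f"

locale preadditive_category = category +
  assumes Hom_comm_group: "\<lbrakk>X \<in> Obj \<C>; Y \<in> Obj \<C>\<rbrakk> \<Longrightarrow> comm_group (Hom \<C> X Y)"
    and Cmp_add_right: "\<lbrakk>X \<in> Obj \<C>; Y \<in> Obj \<C>; Z \<in> Obj \<C>; g \<in> mor \<C> Y Z\<rbrakk>
      \<Longrightarrow> (\<lambda>f. Cmp \<C> X Y Z g f) \<in> hom (Hom \<C> X Y) (Hom \<C> X Z)"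
    and Cmp_add_left: "\<lbrakk>X \<in> Obj \<C>; Y \<in> Obj \<C>; Z \<in> Obj \<C>; f \<in> mor \<C> X Y\<rbrakk>
      \<Longrightarrow> (\<lambda>g. Cmp \<C> X Y Z g f) \<in> hom (Hom \<C> Y Z) (Hom \<C> X Z)"

definition zero_object :: "('o, 'm, 'z) cat_scheme \<Rightarrow> 'o \<Rightarrow> bool"
  where "zero_object \<C> Z \<longleftrightarrow> Z \<in> Obj \<C> \<and>
    (\<forall>X\<in>Obj \<C>. mor \<C> X Z = {zero_mor \<C> X Z} \<and> mor \<C> Z X = {zero_mor \<C> Z X})"

record ('o, 'm) biprod =
  bsum :: 'o
  in1 :: 'm
  in2 :: 'm
  pr1 :: 'm
  pr2 :: 'm

definition biproduct :: "('o, 'm, 'z) cat_scheme \<Rightarrow> 'o \<Rightarrow> 'o \<Rightarrow> ('o, 'm) biprod \<Rightarrow> bool"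
  where "biproduct \<C> A B b \<longleftrightarrow>
    bsum b \<in> Obj \<C> \<and>
    in1 b \<in> mor \<C> A (bsum b) \<and> in2 b \<in> mor \<C> B (bsum b) \<and>
    pr1 b \<in> mor \<C> (bsum b) A \<and> pr2 b \<in> mor \<C> (bsum b) B \<and>
    Cmp \<C> A (bsum b) A (pr1 b) (in1 b) = Idn \<C> A \<and>
    Cmp \<C> B (bsum b) B (pr2 b) (in2 b) = Idn \<C> B \<and>
    Cmp \<C> B (bsum b) A (pr1 b) (in2 b) = zero_mor \<C> B A \<and>
    Cmp \<C> A (bsum b) B (pr2 b) (in1 b) = zero_mor \<C> A B \<and>
    Cmp \<C> (bsum b) A (bsum b) (in1 b) (pr1 b)
      \<otimes>\<^bsub>Hom \<C> (bsum b) (bsum b)\<^esub> Cmp \<C> (bsum b) B (bsum b) (in2 b) (pr2 b) = Idn \<C> (bsum b)"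

locale additive_category = preadditive_category +
  assumes ex_zero_object: "\<exists>Z. zero_object \<C> Z"
    and ex_biproduct: "\<lbrakk>A \<in> Obj \<C>; B \<in> Obj \<C>\<rbrakk> \<Longrightarrow> \<exists>b. biproduct \<C> A B b"

text \<open>
  Zero objects and biproducts exist in an additive category but are not part of its data; the
  constructions of mapping cones and truncations use arbitrary but fixed choices.
\<close>

definition the_zero :: "('o, 'm, 'z) cat_scheme \<Rightarrow> 'o"
  where "the_zero \<C> = (SOME Z. zero_object \<C> Z)"

definition the_biprod :: "('o, 'm, 'z) cat_scheme \<Rightarrow> 'o \<Rightarrow> 'o \<Rightarrow> ('o, 'm) biprod"
  where "the_biprod \<C> A B = (SOME b. biproduct \<C> A B b)"

definition iso_mor :: "('o, 'm, 'z) cat_scheme \<Rightarrow> 'o \<Rightarrow> 'o \<Rightarrow> 'm \<Rightarrow> bool"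
  where "iso_mor \<C> X Y f \<longleftrightarrow> f \<in> mor \<C> X Y \<and>
    (\<exists>g\<in>mor \<C> Y X. Cmp \<C> X Y X g f = Idn \<C> X \<and> Cmp \<C> Y X Y f g = Idn \<C> Y)"

definition isomorphic :: "('o, 'm, 'z) cat_scheme \<Rightarrow> 'o \<Rightarrow> 'o \<Rightarrow> bool"
  where "isomorphic \<C> X Y \<longleftrightarrow> (\<exists>f. iso_mor \<C> X Y f)"

definition iso_closure :: "('o, 'm, 'z) cat_scheme \<Rightarrow> 'o set \<Rightarrow> 'o set"
  where "iso_closure \<C> S = {X \<in> Obj \<C>. \<exists>Y\<in>S. isomorphic \<C> X Y}"


section \<open>Categories with suspension and distinguished triangles; triangle functors\<close>

text \<open>A triangle \<open>X \<rightarrow> Y \<rightarrow> Z \<rightarrow> \<Sigma> X\<close> is the tuple \<open>(X, Y, Z, u, v, w)\<close>.\<close>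

type_synonym ('o, 'm) triangle = "'o \<times> 'o \<times> 'o \<times> 'm \<times> 'm \<times> 'm"

record ('o, 'm) tricat = "('o, 'm) cat" +
  SuspO :: "'o \<Rightarrow> 'o"
  SuspM :: "'o \<Rightarrow> 'o \<Rightarrow> 'm \<Rightarrow> 'm"
  Dist :: "('o, 'm) triangle set"

definition triangles :: "('o, 'm, 'z) tricat_scheme \<Rightarrow> ('o, 'm) triangle set"
  where "triangles \<T> = {(X, Y, Z, u, v, w). X \<in> Obj \<T> \<and> Y \<in> Obj \<T> \<and> Z \<in> Obj \<T> \<and>
    u \<in> mor \<T> X Y \<and> v \<in> mor \<T> Y Z \<and> w \<in> mor \<T> Z (SuspO \<T> X)}"

fun triangle_iso ::
  "('o, 'm, 'z) tricat_scheme \<Rightarrow> ('o, 'm) triangle \<Rightarrow> ('o, 'm) triangle \<Rightarrow> bool"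
  where "triangle_iso \<T> (X, Y, Z, u, v, w) (X', Y', Z', u', v', w') \<longleftrightarrow>
    (\<exists>a b c. iso_mor \<T> X X' a \<and> iso_mor \<T> Y Y' b \<and> iso_mor \<T> Z Z' c \<and>
      Cmp \<T> X Y Y' b u = Cmp \<T> X X' Y' u' a \<and>
      Cmp \<T> Y Z Z' c v = Cmp \<T> Y Y' Z' v' b \<and>
      Cmp \<T> Z (SuspO \<T> X) (SuspO \<T> X') (SuspM \<T> X X' a) w = Cmp \<T> Z Z' (SuspO \<T> X') w' c)"

text \<open>Replaces a class of standard triangles by all triangles isomorphic to a standard one.\<close>

definition saturate_triangles :: "('o, 'm) tricat \<Rightarrow> ('o, 'm) tricat"
  where "saturate_triangles \<T> =
    \<T>\<lparr>Dist := {t \<in> triangles \<T>. \<exists>t'\<in>Dist \<T>. triangle_iso \<T> t t'}\<rparr>"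

definition full_sub :: "('o, 'm) tricat \<Rightarrow> 'o set \<Rightarrow> ('o, 'm) tricat"
  where "full_sub \<T> S = \<T>\<lparr>Obj := S,
    Dist := {(X, Y, Z, u, v, w). (X, Y, Z, u, v, w) \<in> Dist \<T> \<and> X \<in> S \<and> Y \<in> S \<and> Z \<in> S}\<rparr>"

definition additive_functor ::
  "('o, 'm, 'y) cat_scheme \<Rightarrow> ('p, 'n, 'z) cat_scheme \<Rightarrow> ('o \<Rightarrow> 'p) \<Rightarrow> ('o \<Rightarrow> 'o \<Rightarrow> 'm \<Rightarrow> 'n) \<Rightarrow> bool"
  where "additive_functor \<S> \<T> Fo Fm \<longleftrightarrow>
    (\<forall>X\<in>Obj \<S>. Fo X \<in> Obj \<T>) \<and>
    (\<forall>X\<in>Obj \<S>. \<forall>Y\<in>Obj \<S>. Fm X Y \<in> hom (Hom \<S> X Y) (Hom \<T> (Fo X) (Fo Y))) \<and>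
    (\<forall>X\<in>Obj \<S>. Fm X X (Idn \<S> X) = Idn \<T> (Fo X)) \<and>
    (\<forall>X\<in>Obj \<S>. \<forall>Y\<in>Obj \<S>. \<forall>Z\<in>Obj \<S>. \<forall>f\<in>mor \<S> X Y. \<forall>g\<in>mor \<S> Y Z.
      Fm X Z (Cmp \<S> X Y Z g f) = Cmp \<T> (Fo X) (Fo Y) (Fo Z) (Fm Y Z g) (Fm X Y f))"

definition full_functor ::
  "('o, 'm, 'y) cat_scheme \<Rightarrow> ('p, 'n, 'z) cat_scheme \<Rightarrow> ('o \<Rightarrow> 'p) \<Rightarrow> ('o \<Rightarrow> 'o \<Rightarrow> 'm \<Rightarrow> 'n) \<Rightarrow> bool"
  where "full_functor \<S> \<T> Fo Fm \<longleftrightarrow>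
    (\<forall>X\<in>Obj \<S>. \<forall>Y\<in>Obj \<S>. Fm X Y ` mor \<S> X Y = mor \<T> (Fo X) (Fo Y))"

definition faithful_functor ::
  "('o, 'm, 'z) cat_scheme \<Rightarrow> ('o \<Rightarrow> 'o \<Rightarrow> 'm \<Rightarrow> 'n) \<Rightarrow> bool"
  where "faithful_functor \<S> Fm \<longleftrightarrow> (\<forall>X\<in>Obj \<S>. \<forall>Y\<in>Obj \<S>. inj_on (Fm X Y) (mor \<S> X Y))"

text \<open>\<open>\<theta>\<close> is the natural isomorphism \<open>F \<Sigma> \<rightarrow> \<Sigma> F\<close> that is part of a triangle functor.\<close>

definition triangle_functor ::
  "('o, 'm, 'y) tricat_scheme \<Rightarrow> ('p, 'n, 'z) tricat_scheme \<Rightarrow>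
    ('o \<Rightarrow> 'p) \<Rightarrow> ('o \<Rightarrow> 'o \<Rightarrow> 'm \<Rightarrow> 'n) \<Rightarrow> ('o \<Rightarrow> 'n) \<Rightarrow> bool"
  where "triangle_functor \<S> \<T> Fo Fm \<theta> \<longleftrightarrow>
    additive_functor \<S> \<T> Fo Fm \<and>
    (\<forall>X\<in>Obj \<S>. iso_mor \<T> (Fo (SuspO \<S> X)) (SuspO \<T> (Fo X)) (\<theta> X)) \<and>
    (\<forall>X\<in>Obj \<S>. \<forall>Y\<in>Obj \<S>. \<forall>f\<in>mor \<S> X Y.
      Cmp \<T> (Fo (SuspO \<S> X)) (Fo (SuspO \<S> Y)) (SuspO \<T> (Fo Y))
        (\<theta> Y) (Fm (SuspO \<S> X) (SuspO \<S> Y) (SuspM \<S> X Y f)) =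
      Cmp \<T> (Fo (SuspO \<S> X)) (SuspO \<T> (Fo X)) (SuspO \<T> (Fo Y))
        (SuspM \<T> (Fo X) (Fo Y) (Fm X Y f)) (\<theta> X)) \<and>
    (\<forall>X Y Z u v w. (X, Y, Z, u, v, w) \<in> Dist \<S> \<longrightarrow>
      (Fo X, Fo Y, Fo Z, Fm X Y u, Fm Y Z v,
        Cmp \<T> (Fo Z) (Fo (SuspO \<S> X)) (SuspO \<T> (Fo X)) (\<theta> X) (Fm Z (SuspO \<S> X) w)) \<in> Dist \<T>)"


section \<open>The Verdier quotient\<close>

text \<open>
  For a triangulated category \<open>\<T>\<close> and the set \<open>N\<close> of objects of a triangulated subcategory,
  \<open>\<T>/N\<close> is the localisation at the morphisms with cone in \<open>N\<close>, described by the calculus of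
  fractions: a morphism \<open>X \<rightarrow> Y\<close> is an equivalence class of roofs \<open>(Z, s, f)\<close>, that is, of
  diagrams \<open>X \<leftarrow> Z \<rightarrow> Y\<close> with \<open>s : Z \<rightarrow> X\<close> having its cone in \<open>N\<close>. Operations on classes are
  defined as the union of the classes obtained from all choices of representatives.
\<close>

definition has_cone_in :: "('o, 'm, 'z) tricat_scheme \<Rightarrow> 'o set \<Rightarrow> 'o \<Rightarrow> 'o \<Rightarrow> 'm set"
  where "has_cone_in \<T> N X Y = {s \<in> mor \<T> X Y. \<exists>Z v w. Z \<in> N \<and> (X, Y, Z, s, v, w) \<in> Dist \<T>}"

type_synonym ('o, 'm) roof = "'o \<times> 'm \<times> 'm"

definition roofs :: "('o, 'm, 'z) tricat_scheme \<Rightarrow> 'o set \<Rightarrow> 'o \<Rightarrow> 'o \<Rightarrow> ('o, 'm) roof set"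
  where "roofs \<T> N X Y = {(Z, s, f). Z \<in> Obj \<T> \<and> s \<in> has_cone_in \<T> N Z X \<and> f \<in> mor \<T> Z Y}"

definition roof_rel ::
  "('o, 'm, 'z) tricat_scheme \<Rightarrow> 'o set \<Rightarrow> 'o \<Rightarrow> 'o \<Rightarrow> (('o, 'm) roof \<times> ('o, 'm) roof) set"
  where "roof_rel \<T> N X Y = {((Z, s, f), (Z', s', f')).
    (Z, s, f) \<in> roofs \<T> N X Y \<and> (Z', s', f') \<in> roofs \<T> N X Y \<and>
    (\<exists>W\<in>Obj \<T>. \<exists>a\<in>mor \<T> W Z. \<exists>b\<in>mor \<T> W Z'.
      Cmp \<T> W Z X s a \<in> has_cone_in \<T> N W X \<and>
      Cmp \<T> W Z X s a = Cmp \<T> W Z' X s' b \<and>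
      Cmp \<T> W Z Y f a = Cmp \<T> W Z' Y f' b)}"

definition roof_class ::
  "('o, 'm, 'z) tricat_scheme \<Rightarrow> 'o set \<Rightarrow> 'o \<Rightarrow> 'o \<Rightarrow> ('o, 'm) roof \<Rightarrow> ('o, 'm) roof set"
  where "roof_class \<T> N X Y r = roof_rel \<T> N X Y `` {r}"

definition quot_mor ::
  "('o, 'm, 'z) tricat_scheme \<Rightarrow> 'o set \<Rightarrow> 'o \<Rightarrow> 'o \<Rightarrow> 'm \<Rightarrow> ('o, 'm) roof set"
  where "quot_mor \<T> N X Y f = roof_class \<T> N X Y (X, Idn \<T> X, f)"

text \<open>
  Two fractions are added over a common denominator, and composed by completing the middle
  cospan \<open>U \<rightarrow> Y \<leftarrow> V\<close> to a commutative square.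
\<close>

definition quot_add ::
  "('o, 'm, 'z) tricat_scheme \<Rightarrow> 'o set \<Rightarrow> 'o \<Rightarrow> 'o \<Rightarrow>
    ('o, 'm) roof set \<Rightarrow> ('o, 'm) roof set \<Rightarrow> ('o, 'm) roof set"
  where "quot_add \<T> N X Y \<phi> \<psi> =
    \<Union>{roof_class \<T> N X Y (Z, s, f \<otimes>\<^bsub>Hom \<T> Z Y\<^esub> g) | Z s f g. (Z, s, f) \<in> \<phi> \<and> (Z, s, g) \<in> \<psi>}"

definition quot_comp ::
  "('o, 'm, 'z) tricat_scheme \<Rightarrow> 'o set \<Rightarrow> 'o \<Rightarrow> 'o \<Rightarrow> 'o \<Rightarrow>
    ('o, 'm) roof set \<Rightarrow> ('o, 'm) roof set \<Rightarrow> ('o, 'm) roof set"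
  where "quot_comp \<T> N X Y Z \<psi> \<phi> =
    \<Union>{roof_class \<T> N X Z (W, Cmp \<T> W U X s a, Cmp \<T> W V Z g b) | U s f V t g W a b.
      (U, s, f) \<in> \<phi> \<and> (V, t, g) \<in> \<psi> \<and> W \<in> Obj \<T> \<and> a \<in> has_cone_in \<T> N W U \<and> b \<in> mor \<T> W V \<and>
      Cmp \<T> W U Y f a = Cmp \<T> W V Y t b}"

definition quot_susp ::
  "('o, 'm, 'z) tricat_scheme \<Rightarrow> 'o set \<Rightarrow> 'o \<Rightarrow> 'o \<Rightarrow> ('o, 'm) roof set \<Rightarrow> ('o, 'm) roof set"
  where "quot_susp \<T> N X Y \<phi> =
    \<Union>{roof_class \<T> N (SuspO \<T> X) (SuspO \<T> Y) (SuspO \<T> Z, SuspM \<T> Z X s, SuspM \<T> Z Y f) | Z s f.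
      (Z, s, f) \<in> \<phi>}"

definition verdier_quotient ::
  "('o, 'm) tricat \<Rightarrow> 'o set \<Rightarrow> ('o, ('o, 'm) roof set) tricat"
  where "verdier_quotient \<T> N = saturate_triangles
    \<lparr>Obj = Obj \<T>,
     Hom = (\<lambda>X Y. \<lparr>carrier = roofs \<T> N X Y // roof_rel \<T> N X Y,
                   monoid.mult = quot_add \<T> N X Y,
                   one = quot_mor \<T> N X Y (zero_mor \<T> X Y)\<rparr>),
     Idn = (\<lambda>X. quot_mor \<T> N X X (Idn \<T> X)),
     Cmp = quot_comp \<T> N,
     SuspO = SuspO \<T>,
     SuspM = quot_susp \<T> N,
     Dist = {(X, Y, Z, quot_mor \<T> N X Y u, quot_mor \<T> N Y Z v, quot_mor \<T> N Z (SuspO \<T> X) w)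
              | X Y Z u v w. (X, Y, Z, u, v, w) \<in> Dist \<T>}\<rparr>"


section \<open>Complexes and the homotopy category\<close>

record ('o, 'm) cplx =
  ob :: "int \<Rightarrow> 'o"
  df :: "int \<Rightarrow> 'm"

definition complexes :: "('o, 'm, 'z) cat_scheme \<Rightarrow> ('o, 'm) cplx set"
  where "complexes \<P> = {C. \<forall>n. ob C n \<in> Obj \<P> \<and> df C n \<in> mor \<P> (ob C n) (ob C (n - 1)) \<and>
    Cmp \<P> (ob C (n + 1)) (ob C n) (ob C (n - 1)) (df C n) (df C (n + 1))
      = zero_mor \<P> (ob C (n + 1)) (ob C (n - 1))}"

definition chain_maps ::
  "('o, 'm, 'z) cat_scheme \<Rightarrow> ('o, 'm) cplx \<Rightarrow> ('o, 'm) cplx \<Rightarrow> (int \<Rightarrow> 'm) set"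
  where "chain_maps \<P> C D = {f. \<forall>n. f n \<in> mor \<P> (ob C n) (ob D n) \<and>
    Cmp \<P> (ob C n) (ob D n) (ob D (n - 1)) (df D n) (f n) =
    Cmp \<P> (ob C n) (ob C (n - 1)) (ob D (n - 1)) (f (n - 1)) (df C n)}"

definition chain_group ::
  "('o, 'm, 'z) cat_scheme \<Rightarrow> ('o, 'm) cplx \<Rightarrow> ('o, 'm) cplx \<Rightarrow> (int \<Rightarrow> 'm) monoid"
  where "chain_group \<P> C D = \<lparr>carrier = chain_maps \<P> C D,
    monoid.mult = (\<lambda>f g n. f n \<otimes>\<^bsub>Hom \<P> (ob C n) (ob D n)\<^esub> g n),
    one = (\<lambda>n. zero_mor \<P> (ob C n) (ob D n))\<rparr>"

text \<open>
  The chain homotopy classes are the cosets of the subgroup of null-homotopic maps; composition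
  and suspension of classes below are again unions over all representatives.
\<close>

definition null_homotopic ::
  "('o, 'm, 'z) cat_scheme \<Rightarrow> ('o, 'm) cplx \<Rightarrow> ('o, 'm) cplx \<Rightarrow> (int \<Rightarrow> 'm) set"
  where "null_homotopic \<P> C D = {f \<in> chain_maps \<P> C D.
    \<exists>h. \<forall>n. h n \<in> mor \<P> (ob C n) (ob D (n + 1)) \<and>
      f n = Cmp \<P> (ob C n) (ob D (n + 1)) (ob D n) (df D (n + 1)) (h n)
        \<otimes>\<^bsub>Hom \<P> (ob C n) (ob D n)\<^esub> Cmp \<P> (ob C n) (ob C (n - 1)) (ob D n) (h (n - 1)) (df C n)}"

definition hclass ::
  "('o, 'm, 'z) cat_scheme \<Rightarrow> ('o, 'm) cplx \<Rightarrow> ('o, 'm) cplx \<Rightarrow> (int \<Rightarrow> 'm) \<Rightarrow> (int \<Rightarrow> 'm) set"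
  where "hclass \<P> C D f = null_homotopic \<P> C D #>\<^bsub>chain_group \<P> C D\<^esub> f"

definition chain_comp ::
  "('o, 'm, 'z) cat_scheme \<Rightarrow> ('o, 'm) cplx \<Rightarrow> ('o, 'm) cplx \<Rightarrow> ('o, 'm) cplx \<Rightarrow>
    (int \<Rightarrow> 'm) \<Rightarrow> (int \<Rightarrow> 'm) \<Rightarrow> int \<Rightarrow> 'm"
  where "chain_comp \<P> C D E g f = (\<lambda>n. Cmp \<P> (ob C n) (ob D n) (ob E n) (g n) (f n))"

definition susp :: "('o, 'm, 'z) cat_scheme \<Rightarrow> ('o, 'm) cplx \<Rightarrow> ('o, 'm) cplx"
  where "susp \<P> C = \<lparr>ob = (\<lambda>n. ob C (n - 1)),
    df = (\<lambda>n. inv\<^bsub>Hom \<P> (ob C (n - 1)) (ob C (n - 1 - 1))\<^esub> (df C (n - 1)))\<rparr>"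

definition susp_map :: "(int \<Rightarrow> 'm) \<Rightarrow> int \<Rightarrow> 'm"
  where "susp_map f = (\<lambda>n. f (n - 1))"

text \<open>
  The cone of \<open>f : C \<rightarrow> D\<close> has \<open>D\<^sub>n \<oplus> C\<^sub>n\<^sub>-\<^sub>1\<close> in degree \<open>n\<close>, and its differential is the matrix
  with rows \<open>(d\<^sup>D, f)\<close> and \<open>(0, d\<^sup>\<Sigma>\<^sup>C)\<close>, where \<open>d\<^sup>\<Sigma>\<^sup>C = - d\<^sup>C\<close>.
\<close>

abbreviation cone_sum ::
  "('o, 'm, 'z) cat_scheme \<Rightarrow> ('o, 'm) cplx \<Rightarrow> ('o, 'm) cplx \<Rightarrow> int \<Rightarrow> ('o, 'm) biprod"
  where "cone_sum \<P> C D n \<equiv> the_biprod \<P> (ob D n) (ob (susp \<P> C) n)"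

definition mapping_cone ::
  "('o, 'm, 'z) cat_scheme \<Rightarrow> ('o, 'm) cplx \<Rightarrow> ('o, 'm) cplx \<Rightarrow> (int \<Rightarrow> 'm) \<Rightarrow> ('o, 'm) cplx"
  where "mapping_cone \<P> C D f = \<lparr>ob = (\<lambda>n. bsum (cone_sum \<P> C D n)),
    df = (\<lambda>n.
      let b = cone_sum \<P> C D n;
          b' = cone_sum \<P> C D (n - 1);
          S = susp \<P> C;
          comp3 = (\<lambda>A B i d p. Cmp \<P> (bsum b) B (bsum b') i (Cmp \<P> (bsum b) A B d p))
      in comp3 (ob D n) (ob D (n - 1)) (in1 b') (df D n) (pr1 b)
         \<otimes>\<^bsub>Hom \<P> (bsum b) (bsum b')\<^esub> comp3 (ob S n) (ob D (n - 1)) (in1 b') (f (n - 1)) (pr2 b)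
         \<otimes>\<^bsub>Hom \<P> (bsum b) (bsum b')\<^esub> comp3 (ob S n) (ob S (n - 1)) (in2 b') (df S n) (pr2 b))\<rparr>"

definition cone_incl ::
  "('o, 'm, 'z) cat_scheme \<Rightarrow> ('o, 'm) cplx \<Rightarrow> ('o, 'm) cplx \<Rightarrow> int \<Rightarrow> 'm"
  where "cone_incl \<P> C D = (\<lambda>n. in1 (cone_sum \<P> C D n))"

definition cone_proj ::
  "('o, 'm, 'z) cat_scheme \<Rightarrow> ('o, 'm) cplx \<Rightarrow> ('o, 'm) cplx \<Rightarrow> int \<Rightarrow> 'm"
  where "cone_proj \<P> C D = (\<lambda>n. pr2 (cone_sum \<P> C D n))"

definition homotopy_category ::
  "('o, 'm, 'z) cat_scheme \<Rightarrow> (('o, 'm) cplx, (int \<Rightarrow> 'm) set) tricat"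
  where "homotopy_category \<P> = saturate_triangles
    \<lparr>Obj = complexes \<P>,
     Hom = (\<lambda>C D. chain_group \<P> C D Mod null_homotopic \<P> C D),
     Idn = (\<lambda>C. hclass \<P> C C (\<lambda>n. Idn \<P> (ob C n))),
     Cmp = (\<lambda>C D E \<psi> \<phi>. \<Union>{hclass \<P> C E (chain_comp \<P> C D E g f) | f g. f \<in> \<phi> \<and> g \<in> \<psi>}),
     SuspO = susp \<P>,
     SuspM = (\<lambda>C D \<phi>. \<Union>{hclass \<P> (susp \<P> C) (susp \<P> D) (susp_map f) | f. f \<in> \<phi>}),
     Dist = {(C, D, mapping_cone \<P> C D f, hclass \<P> C D f,
               hclass \<P> D (mapping_cone \<P> C D f) (cone_incl \<P> C D),
               hclass \<P> (mapping_cone \<P> C D f) (susp \<P> C) (cone_proj \<P> C D))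
              | C D f. C \<in> complexes \<P> \<and> D \<in> complexes \<P> \<and> f \<in> chain_maps \<P> C D}\<rparr>"


section \<open>Acyclicity conditions and subcategories of the homotopy category\<close>

definition homology :: "'a monoid \<Rightarrow> 'b monoid \<Rightarrow> 'c monoid \<Rightarrow> ('a \<Rightarrow> 'b) \<Rightarrow> ('b \<Rightarrow> 'c) \<Rightarrow> 'b set monoid"
  where "homology A B C f g = (B\<lparr>carrier := kernel B C g\<rparr>) Mod (f ` carrier A)"

definition homology_hom_from ::
  "('o, 'm, 'z) cat_scheme \<Rightarrow> 'o \<Rightarrow> ('o, 'm) cplx \<Rightarrow> int \<Rightarrow> 'm set monoid"
  where "homology_hom_from \<P> P C n =
    homology (Hom \<P> P (ob C (n + 1))) (Hom \<P> P (ob C n)) (Hom \<P> P (ob C (n - 1)))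
      (Cmp \<P> P (ob C (n + 1)) (ob C n) (df C (n + 1)))
      (Cmp \<P> P (ob C n) (ob C (n - 1)) (df C n))"

text \<open>
  \<open>Hom(C, P)\<close> is contravariant in \<open>C\<close>; the group below is its homology at the term \<open>Hom(C\<^sub>n, P)\<close>,
  which has homological degree \<open>-n\<close>.
\<close>

definition homology_hom_to ::
  "('o, 'm, 'z) cat_scheme \<Rightarrow> ('o, 'm) cplx \<Rightarrow> 'o \<Rightarrow> int \<Rightarrow> 'm set monoid"
  where "homology_hom_to \<P> C P n =
    homology (Hom \<P> (ob C (n - 1)) P) (Hom \<P> (ob C n) P) (Hom \<P> (ob C (n + 1)) P)
      (\<lambda>f. Cmp \<P> (ob C n) (ob C (n - 1)) P f (df C n))
      (\<lambda>f. Cmp \<P> (ob C (n + 1)) (ob C n) P f (df C (n + 1)))"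

definition acyclic_complex :: "('o, 'm, 'z) cat_scheme \<Rightarrow> ('o, 'm) cplx \<Rightarrow> bool"
  where "acyclic_complex \<P> C \<longleftrightarrow> (\<forall>P\<in>Obj \<P>. \<forall>n. trivial_group (homology_hom_from \<P> P C n))"

definition totally_acyclic :: "('o, 'm, 'z) cat_scheme \<Rightarrow> ('o, 'm) cplx \<Rightarrow> bool"
  where "totally_acyclic \<P> C \<longleftrightarrow> acyclic_complex \<P> C \<and>
    (\<forall>P\<in>Obj \<P>. \<forall>n. trivial_group (homology_hom_to \<P> C P n))"

definition eventually_acyclic :: "('o, 'm, 'z) cat_scheme \<Rightarrow> ('o, 'm) cplx \<Rightarrow> bool"
  where "eventually_acyclic \<P> C \<longleftrightarrow>
    (\<forall>P\<in>Obj \<P>. \<exists>N. \<forall>n. \<bar>n\<bar> > N \<longrightarrow> trivial_group (homology_hom_from \<P> P C n))"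

definition bounded_below :: "('o, 'm, 'z) cat_scheme \<Rightarrow> ('o, 'm) cplx \<Rightarrow> bool"
  where "bounded_below \<P> C \<longleftrightarrow> (\<exists>N. \<forall>n<N. zero_object \<P> (ob C n))"

definition bounded_complex :: "('o, 'm, 'z) cat_scheme \<Rightarrow> ('o, 'm) cplx \<Rightarrow> bool"
  where "bounded_complex \<P> C \<longleftrightarrow> (\<exists>N. \<forall>n. \<bar>n\<bar> > N \<longrightarrow> zero_object \<P> (ob C n))"

text \<open>
  The following subcategories consist of all complexes isomorphic in the homotopy category to one
  with the stated property.
\<close>

definition Ktac :: "('o, 'm, 'z) cat_scheme \<Rightarrow> (('o, 'm) cplx, (int \<Rightarrow> 'm) set) tricat"
  where "Ktac \<P> = full_sub (homotopy_category \<P>)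
    (iso_closure (homotopy_category \<P>) {C \<in> complexes \<P>. totally_acyclic \<P> C})"

definition Kmb :: "('o, 'm, 'z) cat_scheme \<Rightarrow> (('o, 'm) cplx, (int \<Rightarrow> 'm) set) tricat"
  where "Kmb \<P> = full_sub (homotopy_category \<P>)
    (iso_closure (homotopy_category \<P>)
      {C \<in> complexes \<P>. eventually_acyclic \<P> C \<and> bounded_below \<P> C})"

definition Kb :: "('o, 'm, 'z) cat_scheme \<Rightarrow> (('o, 'm) cplx, (int \<Rightarrow> 'm) set) tricat"
  where "Kb \<P> = full_sub (homotopy_category \<P>)
    (iso_closure (homotopy_category \<P>) {C \<in> complexes \<P>. bounded_complex \<P> C})"


section \<open>Brutal truncation\<close>

definition brutal :: "('o, 'm, 'z) cat_scheme \<Rightarrow> int \<Rightarrow> ('o, 'm) cplx \<Rightarrow> ('o, 'm) cplx"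
  where "brutal \<P> m C =
    (let t = (\<lambda>n. if n \<ge> m then ob C n else the_zero \<P>)
     in \<lparr>ob = t, df = (\<lambda>n. if n > m then df C n else zero_mor \<P> (t n) (t (n - 1)))\<rparr>)"

definition brutal_map :: "('o, 'm, 'z) cat_scheme \<Rightarrow> int \<Rightarrow> (int \<Rightarrow> 'm) \<Rightarrow> int \<Rightarrow> 'm"
  where "brutal_map \<P> m f =
    (\<lambda>n. if n \<ge> m then f n else zero_mor \<P> (the_zero \<P>) (the_zero \<P>))"

end

theory Submission
  imports Defs
begin

text \<open>
  Morphisms in \<open>K\<^sup>-\<^sup>,\<^sup>b/K\<^sup>b\<close> between bounded below complexes are germs at \<open>+\<infinity>\<close> of chain maps, up to germs
  of homotopies. Indeed, a map with bounded cone is invertible as a germ, so that a roof \<open>(s, f)\<close> has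
  a well-defined germ \<open>f s\<^sup>-\<^sup>1\<close>. Conversely, a chain map that is an isomorphism in high degrees has a
  cone that is homotopy equivalent to a bounded complex; a germ \<open>X \<rightarrow> Y\<close> is a map from \<open>X\<close> to a
  brutal truncation of \<open>Y\<close> and hence a fraction; and a map with zero germ factors through a bounded
  complex, so that roofs with equal germs are equivalent.

  Brutal truncation does not affect germs, so the functor sends the homotopy class of a chain map to
  its germ, and the comparison maps for suspensions and cones are germs of identities. If
  \<open>Hom(C, P)\<close> is acyclic for all \<open>P\<close>, then germs of chain maps out of \<open>C\<close>, and germs of null homotopies
  of such maps, extend downwards degree by degree; this gives fullness and faithfulness.
\<close>

section \<open>Arithmetic in preadditive categories\<close>

text \<open>Truncating a null homotopy loses its component from degree -1 to degree 0, so the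
  homotopy equation fails in degree 0; germs forget that degree.

  Objects of the subcategories are closed under homotopy equivalence, so the apex of a roof need not
  be bounded below. Ends of roofs are therefore taken in \<open>strict_mb\<close>, while apexes may
  be arbitrary. A given roof is only evaluated, by inverting the germ of its denominator. A roof
  that has to be constructed gets a strict apex and a denominator that is invertible in high degrees
  (\<open>ev_iso\<close>); such denominators compose degree by degree.

  Idempotents need not split in an additive category. Cutting off a complex that is contractible in
  high degrees leaves an idempotent at the cut, and for the cone of an \<open>ev_iso\<close> an
  explicit splitting of it is found.

  Operations of the quotient are unions over all representatives. Composition and suspension are
  computed in two halves: every set in the union lies in the class of the expected germ, and one of
  them equals that class.\<close>

context preadditive_category
begin

abbreviation comp_in ("(_ \<bullet>\<^bsub>_,_,_\<^esub> _)" [70, 0, 0, 0, 71] 70)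
  where "g \<bullet>\<^bsub>X,Y,Z\<^esub> f \<equiv> Cmp \<C> X Y Z g f"

abbreviation add_in ("(_ \<boxplus>\<^bsub>_,_\<^esub> _)" [65, 0, 0, 66] 65)
  where "f \<boxplus>\<^bsub>X,Y\<^esub> g \<equiv> f \<otimes>\<^bsub>Hom \<C> X Y\<^esub> g"

abbreviation neg_in ("(\<boxminus>\<^bsub>_,_\<^esub> _)" [0, 0, 81] 80)
  where "\<boxminus>\<^bsub>X,Y\<^esub> f \<equiv> inv\<^bsub>Hom \<C> X Y\<^esub> f"

lemma Hom_group: "\<lbrakk>X \<in> Obj \<C>; Y \<in> Obj \<C>\<rbrakk> \<Longrightarrow> group (Hom \<C> X Y)"
  using Hom_comm_group by (simp add: comm_group_def)

lemma Hom_comm_monoid: "\<lbrakk>X \<in> Obj \<C>; Y \<in> Obj \<C>\<rbrakk> \<Longrightarrow> comm_monoid (Hom \<C> X Y)"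
  using Hom_comm_group by (simp add: comm_group_def)

lemma add_mor: "\<lbrakk>X \<in> Obj \<C>; Y \<in> Obj \<C>; f \<in> mor \<C> X Y; g \<in> mor \<C> X Y\<rbrakk> \<Longrightarrow> f \<boxplus>\<^bsub>X,Y\<^esub> g \<in> mor \<C> X Y"
  by (rule monoid.m_closed[OF group.is_monoid[OF Hom_group]])

lemma neg_mor: "\<lbrakk>X \<in> Obj \<C>; Y \<in> Obj \<C>; f \<in> mor \<C> X Y\<rbrakk> \<Longrightarrow> \<boxminus>\<^bsub>X,Y\<^esub> f \<in> mor \<C> X Y"
  by (rule group.inv_closed[OF Hom_group])

lemma zero_mor: "\<lbrakk>X \<in> Obj \<C>; Y \<in> Obj \<C>\<rbrakk> \<Longrightarrow> zero_mor \<C> X Y \<in> mor \<C> X Y"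
  by (rule monoid.one_closed[OF group.is_monoid[OF Hom_group]])

lemmas mor_intros = Idn_mor Cmp_mor add_mor neg_mor zero_mor

lemma Hom_hom_mult:
  assumes "h \<in> hom G H" "x \<in> carrier G" "y \<in> carrier G"
  shows "h (x \<otimes>\<^bsub>G\<^esub> y) = h x \<otimes>\<^bsub>H\<^esub> h y"
  using assms by (simp add: hom_def)

lemma cmp_add_right:
  "\<lbrakk>X \<in> Obj \<C>; Y \<in> Obj \<C>; Z \<in> Obj \<C>; g \<in> mor \<C> Y Z; a \<in> mor \<C> X Y; b \<in> mor \<C> X Y\<rbrakk>
    \<Longrightarrow> g \<bullet>\<^bsub>X,Y,Z\<^esub> (a \<boxplus>\<^bsub>X,Y\<^esub> b) = g \<bullet>\<^bsub>X,Y,Z\<^esub> a \<boxplus>\<^bsub>X,Z\<^esub> g \<bullet>\<^bsub>X,Y,Z\<^esub> b"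
  by (rule Hom_hom_mult[OF Cmp_add_right])

lemma cmp_add_left:
  "\<lbrakk>X \<in> Obj \<C>; Y \<in> Obj \<C>; Z \<in> Obj \<C>; f \<in> mor \<C> X Y; a \<in> mor \<C> Y Z; b \<in> mor \<C> Y Z\<rbrakk>
    \<Longrightarrow> (a \<boxplus>\<^bsub>Y,Z\<^esub> b) \<bullet>\<^bsub>X,Y,Z\<^esub> f = a \<bullet>\<^bsub>X,Y,Z\<^esub> f \<boxplus>\<^bsub>X,Z\<^esub> b \<bullet>\<^bsub>X,Y,Z\<^esub> f"
  by (rule Hom_hom_mult[OF Cmp_add_left])

lemma cmp_zero_right:
  "\<lbrakk>X \<in> Obj \<C>; Y \<in> Obj \<C>; Z \<in> Obj \<C>; g \<in> mor \<C> Y Z\<rbrakk> \<Longrightarrow> g \<bullet>\<^bsub>X,Y,Z\<^esub> zero_mor \<C> X Y = zero_mor \<C> X Z"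
  by (rule group_hom.hom_one[OF group_hom.intro[OF Hom_group Hom_group group_hom_axioms.intro[OF Cmp_add_right]]])

lemma cmp_zero_left:
  "\<lbrakk>X \<in> Obj \<C>; Y \<in> Obj \<C>; Z \<in> Obj \<C>; f \<in> mor \<C> X Y\<rbrakk> \<Longrightarrow> zero_mor \<C> Y Z \<bullet>\<^bsub>X,Y,Z\<^esub> f = zero_mor \<C> X Z"
  by (rule group_hom.hom_one[OF group_hom.intro[OF Hom_group Hom_group group_hom_axioms.intro[OF Cmp_add_left]]])

lemma cmp_neg_right:
  "\<lbrakk>X \<in> Obj \<C>; Y \<in> Obj \<C>; Z \<in> Obj \<C>; g \<in> mor \<C> Y Z; a \<in> mor \<C> X Y\<rbrakk>
    \<Longrightarrow> g \<bullet>\<^bsub>X,Y,Z\<^esub> (\<boxminus>\<^bsub>X,Y\<^esub> a) = \<boxminus>\<^bsub>X,Z\<^esub> (g \<bullet>\<^bsub>X,Y,Z\<^esub> a)"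
  by (rule group_hom.hom_inv[OF group_hom.intro[OF Hom_group Hom_group group_hom_axioms.intro[OF Cmp_add_right]]])

lemma cmp_neg_left:
  "\<lbrakk>X \<in> Obj \<C>; Y \<in> Obj \<C>; Z \<in> Obj \<C>; f \<in> mor \<C> X Y; a \<in> mor \<C> Y Z\<rbrakk>
    \<Longrightarrow> (\<boxminus>\<^bsub>Y,Z\<^esub> a) \<bullet>\<^bsub>X,Y,Z\<^esub> f = \<boxminus>\<^bsub>X,Z\<^esub> (a \<bullet>\<^bsub>X,Y,Z\<^esub> f)"
  by (rule group_hom.hom_inv[OF group_hom.intro[OF Hom_group Hom_group group_hom_axioms.intro[OF Cmp_add_left]]])

lemmas cmp_distrib = cmp_add_right cmp_add_left cmp_zero_right cmp_zero_left cmp_neg_right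
  cmp_neg_left

lemma add_assoc: "\<lbrakk>X \<in> Obj \<C>; Y \<in> Obj \<C>; a \<in> mor \<C> X Y; b \<in> mor \<C> X Y; c \<in> mor \<C> X Y\<rbrakk>
    \<Longrightarrow> (a \<boxplus>\<^bsub>X,Y\<^esub> b) \<boxplus>\<^bsub>X,Y\<^esub> c = a \<boxplus>\<^bsub>X,Y\<^esub> (b \<boxplus>\<^bsub>X,Y\<^esub> c)"
  by (rule monoid.m_assoc[OF group.is_monoid[OF Hom_group]])

lemma add_comm: "\<lbrakk>X \<in> Obj \<C>; Y \<in> Obj \<C>; a \<in> mor \<C> X Y; b \<in> mor \<C> X Y\<rbrakk>
    \<Longrightarrow> a \<boxplus>\<^bsub>X,Y\<^esub> b = b \<boxplus>\<^bsub>X,Y\<^esub> a"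
  by (rule comm_monoid.m_comm[OF Hom_comm_monoid])

lemma add_lcomm: "\<lbrakk>X \<in> Obj \<C>; Y \<in> Obj \<C>; a \<in> mor \<C> X Y; b \<in> mor \<C> X Y; c \<in> mor \<C> X Y\<rbrakk>
    \<Longrightarrow> a \<boxplus>\<^bsub>X,Y\<^esub> (b \<boxplus>\<^bsub>X,Y\<^esub> c) = b \<boxplus>\<^bsub>X,Y\<^esub> (a \<boxplus>\<^bsub>X,Y\<^esub> c)"
  by (rule comm_monoid.m_lcomm[OF Hom_comm_monoid])

lemma add_zero_left: "\<lbrakk>X \<in> Obj \<C>; Y \<in> Obj \<C>; a \<in> mor \<C> X Y\<rbrakk> \<Longrightarrow> zero_mor \<C> X Y \<boxplus>\<^bsub>X,Y\<^esub> a = a"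
  by (rule monoid.l_one[OF group.is_monoid[OF Hom_group]])

lemma add_zero_right: "\<lbrakk>X \<in> Obj \<C>; Y \<in> Obj \<C>; a \<in> mor \<C> X Y\<rbrakk> \<Longrightarrow> a \<boxplus>\<^bsub>X,Y\<^esub> zero_mor \<C> X Y = a"
  by (rule monoid.r_one[OF group.is_monoid[OF Hom_group]])

lemma neg_add: "\<lbrakk>X \<in> Obj \<C>; Y \<in> Obj \<C>; a \<in> mor \<C> X Y; b \<in> mor \<C> X Y\<rbrakk>
    \<Longrightarrow> \<boxminus>\<^bsub>X,Y\<^esub> (a \<boxplus>\<^bsub>X,Y\<^esub> b) = \<boxminus>\<^bsub>X,Y\<^esub> a \<boxplus>\<^bsub>X,Y\<^esub> \<boxminus>\<^bsub>X,Y\<^esub> b"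
  by (rule comm_group.inv_mult[OF Hom_comm_group])

lemma neg_neg: "\<lbrakk>X \<in> Obj \<C>; Y \<in> Obj \<C>; a \<in> mor \<C> X Y\<rbrakk> \<Longrightarrow> \<boxminus>\<^bsub>X,Y\<^esub> (\<boxminus>\<^bsub>X,Y\<^esub> a) = a"
  by (rule group.inv_inv[OF Hom_group])

lemma neg_zero: "\<lbrakk>X \<in> Obj \<C>; Y \<in> Obj \<C>\<rbrakk> \<Longrightarrow> \<boxminus>\<^bsub>X,Y\<^esub> zero_mor \<C> X Y = zero_mor \<C> X Y"
  using group.inv_equality[OF Hom_group, of X Y] zero_mor add_zero_left by blast

lemma add_neg: "\<lbrakk>X \<in> Obj \<C>; Y \<in> Obj \<C>; a \<in> mor \<C> X Y\<rbrakk> \<Longrightarrow> a \<boxplus>\<^bsub>X,Y\<^esub> \<boxminus>\<^bsub>X,Y\<^esub> a = zero_mor \<C> X Y"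
  by (rule group.r_inv[OF Hom_group])

lemma neg_add_self: "\<lbrakk>X \<in> Obj \<C>; Y \<in> Obj \<C>; a \<in> mor \<C> X Y\<rbrakk> \<Longrightarrow> \<boxminus>\<^bsub>X,Y\<^esub> a \<boxplus>\<^bsub>X,Y\<^esub> a = zero_mor \<C> X Y"
  by (rule group.l_inv[OF Hom_group])

lemma add_neg_cancel:
  "\<lbrakk>X \<in> Obj \<C>; Y \<in> Obj \<C>; a \<in> mor \<C> X Y; b \<in> mor \<C> X Y\<rbrakk> \<Longrightarrow> a \<boxplus>\<^bsub>X,Y\<^esub> (\<boxminus>\<^bsub>X,Y\<^esub> a \<boxplus>\<^bsub>X,Y\<^esub> b) = b"
  "\<lbrakk>X \<in> Obj \<C>; Y \<in> Obj \<C>; a \<in> mor \<C> X Y; b \<in> mor \<C> X Y\<rbrakk> \<Longrightarrow> \<boxminus>\<^bsub>X,Y\<^esub> a \<boxplus>\<^bsub>X,Y\<^esub> (a \<boxplus>\<^bsub>X,Y\<^esub> b) = b"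
  using add_assoc[of X Y a "\<boxminus>\<^bsub>X,Y\<^esub> a" b] add_assoc[of X Y "\<boxminus>\<^bsub>X,Y\<^esub> a" a b]
  by (simp_all add: neg_mor add_neg neg_add_self add_zero_left)

text \<open>Sorting sums with \<open>add_comm\<close> and \<open>add_lcomm\<close> can leave one
  summand between \<open>a\<close> and its negative; these rules cancel across it.\<close>

lemma add_neg_cancel2:
  assumes "X \<in> Obj \<C>" "Y \<in> Obj \<C>" "a \<in> mor \<C> X Y" "b \<in> mor \<C> X Y"
  shows "c \<in> mor \<C> X Y \<Longrightarrow> a \<boxplus>\<^bsub>X,Y\<^esub> (b \<boxplus>\<^bsub>X,Y\<^esub> (\<boxminus>\<^bsub>X,Y\<^esub> a \<boxplus>\<^bsub>X,Y\<^esub> c)) = b \<boxplus>\<^bsub>X,Y\<^esub> c"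
    and "c \<in> mor \<C> X Y \<Longrightarrow> \<boxminus>\<^bsub>X,Y\<^esub> a \<boxplus>\<^bsub>X,Y\<^esub> (b \<boxplus>\<^bsub>X,Y\<^esub> (a \<boxplus>\<^bsub>X,Y\<^esub> c)) = b \<boxplus>\<^bsub>X,Y\<^esub> c"
    and "a \<boxplus>\<^bsub>X,Y\<^esub> (b \<boxplus>\<^bsub>X,Y\<^esub> \<boxminus>\<^bsub>X,Y\<^esub> a) = b"
    and "\<boxminus>\<^bsub>X,Y\<^esub> a \<boxplus>\<^bsub>X,Y\<^esub> (b \<boxplus>\<^bsub>X,Y\<^esub> a) = b"
proof -
  show "a \<boxplus>\<^bsub>X,Y\<^esub> (b \<boxplus>\<^bsub>X,Y\<^esub> (\<boxminus>\<^bsub>X,Y\<^esub> a \<boxplus>\<^bsub>X,Y\<^esub> c)) = b \<boxplus>\<^bsub>X,Y\<^esub> c" if "c \<in> mor \<C> X Y"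
    using assms that by (subst add_lcomm) (simp_all add: mor_intros add_neg_cancel)
  show "\<boxminus>\<^bsub>X,Y\<^esub> a \<boxplus>\<^bsub>X,Y\<^esub> (b \<boxplus>\<^bsub>X,Y\<^esub> (a \<boxplus>\<^bsub>X,Y\<^esub> c)) = b \<boxplus>\<^bsub>X,Y\<^esub> c" if "c \<in> mor \<C> X Y"
    using assms that by (subst add_lcomm) (simp_all add: mor_intros add_neg_cancel)
  show "a \<boxplus>\<^bsub>X,Y\<^esub> (b \<boxplus>\<^bsub>X,Y\<^esub> \<boxminus>\<^bsub>X,Y\<^esub> a) = b"
    using assms by (subst add_lcomm) (simp_all add: mor_intros add_neg add_zero_right)
  show "\<boxminus>\<^bsub>X,Y\<^esub> a \<boxplus>\<^bsub>X,Y\<^esub> (b \<boxplus>\<^bsub>X,Y\<^esub> a) = b"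
    using assms by (subst add_lcomm) (simp_all add: mor_intros neg_add_self add_zero_right)
qed

lemmas add_simps = add_assoc add_comm add_lcomm add_zero_left add_zero_right neg_add neg_neg
  neg_zero add_neg neg_add_self add_neg_cancel add_neg_cancel2

lemma add_left_imp_eq:
  assumes "X \<in> Obj \<C>" "Y \<in> Obj \<C>" "a \<in> mor \<C> X Y" "b \<in> mor \<C> X Y" "c \<in> mor \<C> X Y"
    and "a \<boxplus>\<^bsub>X,Y\<^esub> b = a \<boxplus>\<^bsub>X,Y\<^esub> c"
  shows "b = c"
proof -
  have "b = \<boxminus>\<^bsub>X,Y\<^esub> a \<boxplus>\<^bsub>X,Y\<^esub> (a \<boxplus>\<^bsub>X,Y\<^esub> b)"
    by (rule add_neg_cancel(2)[OF assms(1-4), symmetric])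
  also have "\<dots> = c"
    unfolding assms(6) by (rule add_neg_cancel(2)[OF assms(1-3,5)])
  finally show ?thesis .
qed

end

section \<open>Chain maps and homotopies in all degrees and as germs\<close>

text \<open>For the top filter, \<open>eventually\<close> means in every degree.\<close>

abbreviation all_deg :: "int filter"
  where "all_deg \<equiv> top_class.top"

context preadditive_category
begin

lemma ob_Obj: "C \<in> complexes \<C> \<Longrightarrow> ob C n \<in> Obj \<C>"
  by (simp add: complexes_def)

text \<open>The target degree is a variable with an equation as premise, so that simp can match
  degrees that agree only by arithmetic, such as \<open>n\<close> and
  \<open>n + 1 - 1\<close>.\<close>

lemma df_mor: "\<lbrakk>C \<in> complexes \<C>; k = n - 1\<rbrakk> \<Longrightarrow> df C n \<in> mor \<C> (ob C n) (ob C k)"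
  by (simp add: complexes_def)

lemma df_df:
  "\<lbrakk>C \<in> complexes \<C>; m = n + 1; k = n - 1\<rbrakk>
    \<Longrightarrow> df C n \<bullet>\<^bsub>ob C m,ob C n,ob C k\<^esub> df C m = zero_mor \<C> (ob C m) (ob C k)"
  by (simp add: complexes_def)

text \<open>Rewriting with \<open>Cmp_assoc\<close> associates to the left, so two consecutive
  differentials occur as \<open>(x d) d\<close>; this is \<open>df_df\<close> for that
  shape.\<close>

lemma comp_df_df:
  "\<lbrakk>C \<in> complexes \<C>; Z \<in> Obj \<C>; m = n + 1; k = n - 1; x \<in> mor \<C> (ob C k) Z\<rbrakk>
    \<Longrightarrow> x \<bullet>\<^bsub>ob C n,ob C k,Z\<^esub> df C n \<bullet>\<^bsub>ob C m,ob C n,Z\<^esub> df C m = zero_mor \<C> (ob C m) Z"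
  using Cmp_assoc[of "ob C m" "ob C n" "ob C k" Z "df C m" "df C n" x]
  by (simp add: ob_Obj df_mor df_df cmp_zero_right)

lemmas cplx_simps = ob_Obj df_mor df_df comp_df_df

text \<open>
  Chain maps and homotopies are needed both in all degrees and as germs at \<open>+\<infinity>\<close>; the filter
  \<open>F\<close> below is \<open>all_deg\<close> in the first case and \<open>at_top\<close> in the second.
\<close>

definition bd :: "('a, 'b) cplx \<Rightarrow> ('a, 'b) cplx \<Rightarrow> (int \<Rightarrow> 'b) \<Rightarrow> int \<Rightarrow> 'b"
  where "bd C D h n = df D (n + 1) \<bullet>\<^bsub>ob C n,ob D (n + 1),ob D n\<^esub> h n \<boxplus>\<^bsub>ob C n,ob D n\<^esub>
    h (n - 1) \<bullet>\<^bsub>ob C n,ob C (n - 1),ob D n\<^esub> df C n"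

text \<open>Values in degrees that the filter ignores are arbitrary and need not be morphisms. A
  germ is thus represented by a function on all integers, without passing to equivalence
  classes.\<close>

definition chmap :: "int filter \<Rightarrow> ('a, 'b) cplx \<Rightarrow> ('a, 'b) cplx \<Rightarrow> (int \<Rightarrow> 'b) \<Rightarrow> bool"
  where "chmap F C D f \<longleftrightarrow> (\<forall>\<^sub>F n in F. f n \<in> mor \<C> (ob C n) (ob D n) \<and>
    df D n \<bullet>\<^bsub>ob C n,ob D n,ob D (n - 1)\<^esub> f n = f (n - 1) \<bullet>\<^bsub>ob C n,ob C (n - 1),ob D (n - 1)\<^esub> df C n)"

text \<open>Neither \<open>f\<close> nor \<open>g\<close> is required to be a chain map here. The
  lemmas on \<open>htpy\<close> assume \<open>chmap\<close> for one side; that the values of the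
  other side are morphisms then follows from the equation.\<close>

definition htpy :: "int filter \<Rightarrow> ('a, 'b) cplx \<Rightarrow> ('a, 'b) cplx \<Rightarrow> (int \<Rightarrow> 'b) \<Rightarrow> (int \<Rightarrow> 'b) \<Rightarrow> bool"
  where "htpy F C D f g \<longleftrightarrow> (\<exists>h. \<forall>\<^sub>F n in F. h n \<in> mor \<C> (ob C n) (ob D (n + 1)) \<and>
    f n = g n \<boxplus>\<^bsub>ob C n,ob D n\<^esub> bd C D h n)"

definition chain_add :: "('a, 'b) cplx \<Rightarrow> ('a, 'b) cplx \<Rightarrow> (int \<Rightarrow> 'b) \<Rightarrow> (int \<Rightarrow> 'b) \<Rightarrow> int \<Rightarrow> 'b"
  where "chain_add C D f g n = f n \<boxplus>\<^bsub>ob C n,ob D n\<^esub> g n"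

definition chain_neg :: "('a, 'b) cplx \<Rightarrow> ('a, 'b) cplx \<Rightarrow> (int \<Rightarrow> 'b) \<Rightarrow> int \<Rightarrow> 'b"
  where "chain_neg C D f n = \<boxminus>\<^bsub>ob C n,ob D n\<^esub> f n"

definition chain_zero :: "('a, 'b) cplx \<Rightarrow> ('a, 'b) cplx \<Rightarrow> int \<Rightarrow> 'b"
  where "chain_zero C D n = zero_mor \<C> (ob C n) (ob D n)"

definition chain_id :: "('a, 'b) cplx \<Rightarrow> int \<Rightarrow> 'b"
  where "chain_id C n = Idn \<C> (ob C n)"

lemma bd_mor:
  "\<lbrakk>C \<in> complexes \<C>; D \<in> complexes \<C>; h n \<in> mor \<C> (ob C n) (ob D (n + 1));
    h (n - 1) \<in> mor \<C> (ob C (n - 1)) (ob D n)\<rbrakk> \<Longrightarrow> bd C D h n \<in> mor \<C> (ob C n) (ob D n)"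
  by (simp add: bd_def mor_intros cplx_simps)

lemma chmap_top: "chmap all_deg C D f \<longleftrightarrow> f \<in> chain_maps \<C> C D"
  by (simp add: chmap_def chain_maps_def)

lemma htpy_top:
  "htpy all_deg C D f g \<longleftrightarrow> (\<exists>h. \<forall>n. h n \<in> mor \<C> (ob C n) (ob D (n + 1)) \<and>
    f n = g n \<boxplus>\<^bsub>ob C n,ob D n\<^esub> bd C D h n)"
  by (simp add: htpy_def)

lemma eventually_topI: "(\<forall>\<^sub>F n in all_deg. Q n) \<Longrightarrow> (\<forall>\<^sub>F n in F. Q n)"
  by (simp add: eventually_mono)

lemma chmap_of_top: "chmap all_deg C D f \<Longrightarrow> chmap F C D f"
  unfolding chmap_def by (rule eventually_topI)

lemma htpy_of_top: "htpy all_deg C D f g \<Longrightarrow> htpy F C D f g"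
  unfolding htpy_def using eventually_topI by blast

lemma chain_comp_assoc:
  assumes "B \<in> complexes \<C>" "C \<in> complexes \<C>" "D \<in> complexes \<C>" "E \<in> complexes \<C>"
    and "chmap F B C f" "chmap F C D g" "chmap F D E h"
  shows "\<forall>\<^sub>F n in F. chain_comp \<C> B D E h (chain_comp \<C> B C D g f) n
    = chain_comp \<C> B C E (chain_comp \<C> C D E h g) f n"
  using assms(5-7) unfolding chmap_def
  by eventually_elim (use assms(1-4) in \<open>simp add: chain_comp_def Cmp_assoc cplx_simps\<close>)

context
  fixes F :: "int filter"
  assumes F: "F = all_deg \<or> F = at_top"
begin

text \<open>Conditions in degree \<open>n\<close> also involve the neighbouring degrees, so
  degreewise arguments need a filter that is stable under shifts in both directions.\<close>

lemma eventually_pred: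
  assumes "\<forall>\<^sub>F n in F. Q n"
  shows "\<forall>\<^sub>F n in F. Q (n - 1)"
proof (cases "F = all_deg")
  case False
  then obtain N where N: "\<And>n. n \<ge> N \<Longrightarrow> Q n"
    using assms F by (auto simp: eventually_at_top_linorder)
  have "\<forall>n\<ge>N+1. Q (n - 1)" using N by simp
  with False F show ?thesis by (auto simp: eventually_at_top_linorder)
qed (use assms in simp)

lemma eventually_succ:
  assumes "\<forall>\<^sub>F n in F. Q n"
  shows "\<forall>\<^sub>F n in F. Q (n + 1)"
proof (cases "F = all_deg")
  case False
  then obtain N where N: "\<And>n. n \<ge> N \<Longrightarrow> Q n"
    using assms F by (auto simp: eventually_at_top_linorder)
  have "\<forall>n\<ge>N. Q (n + 1)" using N by simp
  with False F show ?thesis by (auto simp: eventually_at_top_linorder)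
qed (use assms in simp)

lemma chmap_cong:
  assumes f: "chmap F C D f" and eq: "\<forall>\<^sub>F n in F. f n = g n"
  shows "chmap F C D g"
  using f eq eventually_pred[OF eq] unfolding chmap_def by eventually_elim simp

lemma chmap_id: "C \<in> complexes \<C> \<Longrightarrow> chmap F C C (chain_id C)"
  by (simp add: chmap_def chain_id_def mor_intros cplx_simps Cmp_Idn_left Cmp_Idn_right)

lemma chmap_zero: "C \<in> complexes \<C> \<Longrightarrow> D \<in> complexes \<C> \<Longrightarrow> chmap F C D (chain_zero C D)"
  by (simp add: chmap_def chain_zero_def mor_intros cplx_simps cmp_distrib)

lemma chmap_add:
  assumes C: "C \<in> complexes \<C>" and D: "D \<in> complexes \<C>" and f: "chmap F C D f" and g: "chmap F C D g"
  shows "chmap F C D (chain_add C D f g)"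
  using f g eventually_pred[OF f[unfolded chmap_def]] eventually_pred[OF g[unfolded chmap_def]]
  unfolding chmap_def
  by eventually_elim (use C D in \<open>simp add: chain_add_def mor_intros cplx_simps cmp_distrib\<close>)

lemma chmap_neg:
  assumes C: "C \<in> complexes \<C>" and D: "D \<in> complexes \<C>" and f: "chmap F C D f"
  shows "chmap F C D (chain_neg C D f)"
  using f eventually_pred[OF f[unfolded chmap_def]]
  unfolding chmap_def
  by eventually_elim (use C D in \<open>simp add: chain_neg_def mor_intros cplx_simps cmp_distrib\<close>)

lemma chmap_comp:
  assumes C: "C \<in> complexes \<C>" and D: "D \<in> complexes \<C>" and E: "E \<in> complexes \<C>"
    and f: "chmap F C D f" and g: "chmap F D E g"
  shows "chmap F C E (chain_comp \<C> C D E g f)"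
  using f g eventually_pred[OF f[unfolded chmap_def]] eventually_pred[OF g[unfolded chmap_def]]
  unfolding chmap_def
proof eventually_elim
  case (elim n)
  have "df E n \<bullet>\<^bsub>ob C n,ob E n,ob E (n - 1)\<^esub> (g n \<bullet>\<^bsub>ob C n,ob D n,ob E n\<^esub> f n)
      = g (n - 1) \<bullet>\<^bsub>ob D n,ob D (n - 1),ob E (n - 1)\<^esub> df D n \<bullet>\<^bsub>ob C n,ob D n,ob E (n - 1)\<^esub> f n"
    using elim C D E by (simp add: Cmp_assoc cplx_simps)
  also have "\<dots> = g (n - 1) \<bullet>\<^bsub>ob C n,ob D (n - 1),ob E (n - 1)\<^esub> (df D n \<bullet>\<^bsub>ob C n,ob D n,ob D (n - 1)\<^esub> f n)"
    by (rule Cmp_assoc[symmetric]) (use elim C D E in \<open>simp_all add: cplx_simps\<close>)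
  also have "\<dots> = g (n - 1) \<bullet>\<^bsub>ob C n,ob D (n - 1),ob E (n - 1)\<^esub> (f (n - 1) \<bullet>\<^bsub>ob C n,ob C (n - 1),ob D (n - 1)\<^esub> df C n)"
    using elim by simp
  finally show ?case
    using elim C D E by (simp add: chain_comp_def mor_intros cplx_simps Cmp_assoc)
qed

lemma htpy_eq:
  assumes C: "C \<in> complexes \<C>" and D: "D \<in> complexes \<C>" and f: "chmap F C D f"
    and eq: "\<forall>\<^sub>F n in F. f n = g n"
  shows "htpy F C D f g"
proof -
  define h where "h n = zero_mor \<C> (ob C n) (ob D (n + 1))" for n
  have "\<forall>\<^sub>F n in F. h n \<in> mor \<C> (ob C n) (ob D (n + 1)) \<and> f n = g n \<boxplus>\<^bsub>ob C n,ob D n\<^esub> bd C D h n"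
    using f eq unfolding chmap_def
    by eventually_elim (use C D in \<open>simp add: h_def bd_def mor_intros cplx_simps cmp_distrib add_simps\<close>)
  then show ?thesis unfolding htpy_def by blast
qed

lemma htpy_refl:
  "\<lbrakk>C \<in> complexes \<C>; D \<in> complexes \<C>; chmap F C D f\<rbrakk> \<Longrightarrow> htpy F C D f f"
  by (rule htpy_eq) auto

lemma htpy_sym:
  assumes C: "C \<in> complexes \<C>" and D: "D \<in> complexes \<C>" and g: "chmap F C D g" and h: "htpy F C D f g"
  shows "htpy F C D g f"
proof -
  from h obtain h where h: "\<forall>\<^sub>F n in F. h n \<in> mor \<C> (ob C n) (ob D (n + 1)) \<and>
      f n = g n \<boxplus>\<^bsub>ob C n,ob D n\<^esub> bd C D h n"
    unfolding htpy_def by blast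
  define k where "k n = \<boxminus>\<^bsub>ob C n,ob D (n + 1)\<^esub> h n" for n
  have "\<forall>\<^sub>F n in F. k n \<in> mor \<C> (ob C n) (ob D (n + 1)) \<and> g n = f n \<boxplus>\<^bsub>ob C n,ob D n\<^esub> bd C D k n"
    using g h eventually_pred[OF h] unfolding chmap_def
    by eventually_elim
      (use C D in \<open>simp add: k_def bd_def mor_intros cplx_simps cmp_distrib add_simps\<close>)
  then show ?thesis unfolding htpy_def by blast
qed

lemma htpy_trans:
  assumes C: "C \<in> complexes \<C>" and D: "D \<in> complexes \<C>" and e: "chmap F C D e"
    and "htpy F C D f g" "htpy F C D g e"
  shows "htpy F C D f e"
proof -
  from assms obtain h k where h: "\<forall>\<^sub>F n in F. h n \<in> mor \<C> (ob C n) (ob D (n + 1)) \<and>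
      f n = g n \<boxplus>\<^bsub>ob C n,ob D n\<^esub> bd C D h n"
    and k: "\<forall>\<^sub>F n in F. k n \<in> mor \<C> (ob C n) (ob D (n + 1)) \<and>
      g n = e n \<boxplus>\<^bsub>ob C n,ob D n\<^esub> bd C D k n"
    unfolding htpy_def by blast
  define l where "l n = h n \<boxplus>\<^bsub>ob C n,ob D (n + 1)\<^esub> k n" for n
  have "\<forall>\<^sub>F n in F. l n \<in> mor \<C> (ob C n) (ob D (n + 1)) \<and> f n = e n \<boxplus>\<^bsub>ob C n,ob D n\<^esub> bd C D l n"
    using e h k eventually_pred[OF h] eventually_pred[OF k] unfolding chmap_def
    by eventually_elim
      (use C D in \<open>simp add: l_def bd_def mor_intros cplx_simps cmp_distrib add_simps\<close>)
  then show ?thesis unfolding htpy_def by blast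
qed

lemma htpy_add:
  assumes C: "C \<in> complexes \<C>" and D: "D \<in> complexes \<C>" and "chmap F C D f'" "chmap F C D g'"
    and "htpy F C D f f'" "htpy F C D g g'"
  shows "htpy F C D (chain_add C D f g) (chain_add C D f' g')"
proof -
  from assms obtain h k where h: "\<forall>\<^sub>F n in F. h n \<in> mor \<C> (ob C n) (ob D (n + 1)) \<and>
      f n = f' n \<boxplus>\<^bsub>ob C n,ob D n\<^esub> bd C D h n"
    and k: "\<forall>\<^sub>F n in F. k n \<in> mor \<C> (ob C n) (ob D (n + 1)) \<and>
      g n = g' n \<boxplus>\<^bsub>ob C n,ob D n\<^esub> bd C D k n"
    unfolding htpy_def by blast
  define l where "l n = h n \<boxplus>\<^bsub>ob C n,ob D (n + 1)\<^esub> k n" for n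
  have "\<forall>\<^sub>F n in F. l n \<in> mor \<C> (ob C n) (ob D (n + 1)) \<and>
      chain_add C D f g n = chain_add C D f' g' n \<boxplus>\<^bsub>ob C n,ob D n\<^esub> bd C D l n"
    using assms(3,4) h k eventually_pred[OF h] eventually_pred[OF k] unfolding chmap_def
    by eventually_elim
      (use C D in \<open>simp add: l_def bd_def chain_add_def mor_intros cplx_simps cmp_distrib add_simps\<close>)
  then show ?thesis unfolding htpy_def by blast
qed

lemma htpy_neg:
  assumes C: "C \<in> complexes \<C>" and D: "D \<in> complexes \<C>" and "chmap F C D f'" 
    and "htpy F C D f f'"
  shows "htpy F C D (chain_neg C D f) (chain_neg C D f')"
proof -
  from assms obtain h where h: "\<forall>\<^sub>F n in F. h n \<in> mor \<C> (ob C n) (ob D (n + 1)) \<and>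
      f n = f' n \<boxplus>\<^bsub>ob C n,ob D n\<^esub> bd C D h n"
    unfolding htpy_def by blast
  define l where "l n = \<boxminus>\<^bsub>ob C n,ob D (n + 1)\<^esub> h n" for n
  have "\<forall>\<^sub>F n in F. l n \<in> mor \<C> (ob C n) (ob D (n + 1)) \<and>
      chain_neg C D f n = chain_neg C D f' n \<boxplus>\<^bsub>ob C n,ob D n\<^esub> bd C D l n"
    using assms(3) h eventually_pred[OF h] unfolding chmap_def
    by eventually_elim
      (use C D in \<open>simp add: l_def bd_def chain_neg_def mor_intros cplx_simps cmp_distrib add_simps\<close>)
  then show ?thesis unfolding htpy_def by blast
qed

lemma htpy_comp_left:
  assumes C: "C \<in> complexes \<C>" and D: "D \<in> complexes \<C>" and E: "E \<in> complexes \<C>"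
    and f': "chmap F C D f'" and f: "htpy F C D f f'" and g: "chmap F D E g"
  shows "htpy F C E (chain_comp \<C> C D E g f) (chain_comp \<C> C D E g f')"
proof -
  from f obtain h where h: "\<forall>\<^sub>F n in F. h n \<in> mor \<C> (ob C n) (ob D (n + 1)) \<and>
      f n = f' n \<boxplus>\<^bsub>ob C n,ob D n\<^esub> bd C D h n"
    unfolding htpy_def by blast
  define l where "l n = g (n + 1) \<bullet>\<^bsub>ob C n,ob D (n + 1),ob E (n + 1)\<^esub> h n" for n
  note g' = g[unfolded chmap_def]
  have "\<forall>\<^sub>F n in F. l n \<in> mor \<C> (ob C n) (ob E (n + 1)) \<and>
      chain_comp \<C> C D E g f n = chain_comp \<C> C D E g f' n \<boxplus>\<^bsub>ob C n,ob E n\<^esub> bd C E l n"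
    \<comment> \<open>Moving \<open>g\<close> past \<open>df D (n + 1)\<close> uses the chain map
      condition in degree \<open>n + 1\<close>.\<close>
    using f'[unfolded chmap_def] g' eventually_succ[OF g'] h eventually_pred[OF h]
    by eventually_elim
      (use C D E in \<open>simp add: l_def bd_def chain_comp_def mor_intros cplx_simps cmp_distrib Cmp_assoc\<close>)
  then show ?thesis unfolding htpy_def by blast
qed

lemma htpy_comp_right:
  assumes C: "C \<in> complexes \<C>" and D: "D \<in> complexes \<C>" and E: "E \<in> complexes \<C>"
    and f: "chmap F C D f" and g': "chmap F D E g'" and g: "htpy F D E g g'"
  shows "htpy F C E (chain_comp \<C> C D E g f) (chain_comp \<C> C D E g' f)"
proof -
  from g obtain h where h: "\<forall>\<^sub>F n in F. h n \<in> mor \<C> (ob D n) (ob E (n + 1)) \<and>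
      g n = g' n \<boxplus>\<^bsub>ob D n,ob E n\<^esub> bd D E h n"
    unfolding htpy_def by blast
  define l where "l n = h n \<bullet>\<^bsub>ob C n,ob D n,ob E (n + 1)\<^esub> f n" for n
  have "\<forall>\<^sub>F n in F. l n \<in> mor \<C> (ob C n) (ob E (n + 1)) \<and>
      chain_comp \<C> C D E g f n = chain_comp \<C> C D E g' f n \<boxplus>\<^bsub>ob C n,ob E n\<^esub> bd C E l n"
    using f[unfolded chmap_def] eventually_pred[OF f[unfolded chmap_def]] g'[unfolded chmap_def]
      h eventually_pred[OF h]
    by eventually_elim
      (use C D E in \<open>simp add: l_def bd_def chain_comp_def mor_intros cplx_simps cmp_distrib
        Cmp_assoc[symmetric]\<close>)
  then show ?thesis unfolding htpy_def by blast
qed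

end

end

section \<open>The homotopy category\<close>

context preadditive_category
begin

abbreviation K where "K \<equiv> homotopy_category \<C>"

abbreviation homotopic :: "('a, 'b) cplx \<Rightarrow> ('a, 'b) cplx \<Rightarrow> (int \<Rightarrow> 'b) \<Rightarrow> (int \<Rightarrow> 'b) \<Rightarrow> bool"
  where "homotopic \<equiv> htpy all_deg"

lemma all_deg: "all_deg = all_deg \<or> all_deg = at_top" by simp

lemma chain_group_simps:
  "carrier (chain_group \<C> C D) = chain_maps \<C> C D"
  "f \<otimes>\<^bsub>chain_group \<C> C D\<^esub> g = chain_add C D f g"
  "\<one>\<^bsub>chain_group \<C> C D\<^esub> = chain_zero C D"
  by (auto simp: chain_group_def chain_add_def chain_zero_def)

lemmas chain_maps_id = chmap_id[OF all_deg, unfolded chmap_top]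
lemmas chain_maps_zero = chmap_zero[OF all_deg, unfolded chmap_top]
lemmas chain_maps_add = chmap_add[OF all_deg, unfolded chmap_top]
lemmas chain_maps_neg = chmap_neg[OF all_deg, unfolded chmap_top]
lemmas chain_maps_comp = chmap_comp[OF all_deg, unfolded chmap_top]
lemmas chain_maps_closed = chain_maps_id chain_maps_zero chain_maps_add chain_maps_neg chain_maps_comp

lemmas homotopic_refl = htpy_refl[OF all_deg, unfolded chmap_top]
lemmas homotopic_sym = htpy_sym[OF all_deg, unfolded chmap_top]
lemmas homotopic_trans = htpy_trans[OF all_deg, unfolded chmap_top]
lemmas homotopic_add = htpy_add[OF all_deg, unfolded chmap_top]
lemmas homotopic_neg = htpy_neg[OF all_deg, unfolded chmap_top]
lemmas homotopic_comp_left = htpy_comp_left[OF all_deg, unfolded chmap_top]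
lemmas homotopic_comp_right = htpy_comp_right[OF all_deg, unfolded chmap_top]

lemma chain_maps_mor: "f \<in> chain_maps \<C> C D \<Longrightarrow> f n \<in> mor \<C> (ob C n) (ob D n)"
  by (simp add: chain_maps_def)

lemma chain_maps_df:
  "\<lbrakk>f \<in> chain_maps \<C> C D; k = n - 1\<rbrakk> \<Longrightarrow>
    f k \<bullet>\<^bsub>ob C n,ob C k,ob D k\<^esub> df C n = df D n \<bullet>\<^bsub>ob C n,ob D n,ob D k\<^esub> f n"
  by (simp add: chain_maps_def)

lemma chain_add_zero:
  assumes "C \<in> complexes \<C>" "D \<in> complexes \<C>" "f \<in> chain_maps \<C> C D"
  shows "chain_add C D (chain_zero C D) f = f" "chain_add C D f (chain_zero C D) = f"
    and "chain_add C D (chain_neg C D f) f = chain_zero C D"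
    and "chain_add C D f (chain_neg C D f) = chain_zero C D"
  using assms
  by (auto simp: fun_eq_iff chain_add_def chain_zero_def chain_neg_def ob_Obj chain_maps_mor add_zero_left
      add_zero_right neg_add_self add_neg)

lemma chain_add_assoc:
  assumes "C \<in> complexes \<C>" "D \<in> complexes \<C>"
    "f \<in> chain_maps \<C> C D" "g \<in> chain_maps \<C> C D" "h \<in> chain_maps \<C> C D"
  shows "chain_add C D (chain_add C D f g) h = chain_add C D f (chain_add C D g h)"
  using assms by (auto simp: fun_eq_iff chain_add_def ob_Obj chain_maps_mor add_assoc)

lemma chain_add_comm:
  assumes "C \<in> complexes \<C>" "D \<in> complexes \<C>" "f \<in> chain_maps \<C> C D" "g \<in> chain_maps \<C> C D"
  shows "chain_add C D f g = chain_add C D g f"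
  unfolding chain_add_def using assms by (intro ext add_comm ob_Obj chain_maps_mor)

lemma chain_group_comm_group:
  assumes C: "C \<in> complexes \<C>" and D: "D \<in> complexes \<C>"
  shows "comm_group (chain_group \<C> C D)"
proof (rule comm_groupI)
  fix f g assume "f \<in> carrier (chain_group \<C> C D)" "g \<in> carrier (chain_group \<C> C D)"
  then show "f \<otimes>\<^bsub>chain_group \<C> C D\<^esub> g = g \<otimes>\<^bsub>chain_group \<C> C D\<^esub> f"
    unfolding chain_group_simps by (rule chain_add_comm[OF C D])
next
  fix f assume f: "f \<in> carrier (chain_group \<C> C D)"
  show "\<exists>g\<in>carrier (chain_group \<C> C D). g \<otimes>\<^bsub>chain_group \<C> C D\<^esub> f = \<one>\<^bsub>chain_group \<C> C D\<^esub>"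
    using f chain_add_zero(3)[OF C D, of f] chain_maps_neg[OF C D, of f] unfolding chain_group_simps by blast
qed (use C D in \<open>auto simp: chain_group_simps chain_maps_closed chain_add_zero chain_add_assoc\<close>)

lemma homotopic_iff_diff:
  assumes C: "C \<in> complexes \<C>" and D: "D \<in> complexes \<C>"
    and f: "f \<in> chain_maps \<C> C D" and g: "g \<in> chain_maps \<C> C D"
  shows "homotopic C D f g \<longleftrightarrow> homotopic C D (chain_add C D f (chain_neg C D g)) (chain_zero C D)"
proof
  assume "homotopic C D f g"
  then have "homotopic C D (chain_add C D f (chain_neg C D g)) (chain_add C D g (chain_neg C D g))"
    using C D f g by (intro homotopic_add homotopic_refl chain_maps_closed)
  then show "homotopic C D (chain_add C D f (chain_neg C D g)) (chain_zero C D)"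
    using C D g by (simp add: chain_add_zero)
next
  assume "homotopic C D (chain_add C D f (chain_neg C D g)) (chain_zero C D)"
  then have "homotopic C D (chain_add C D (chain_add C D f (chain_neg C D g)) g) (chain_add C D (chain_zero C D) g)"
    using C D f g by (intro homotopic_add homotopic_refl chain_maps_closed)
  then show "homotopic C D f g"
    using C D f g by (simp add: chain_add_assoc chain_add_zero chain_maps_closed)
qed

lemma null_homotopic_iff:
  assumes C: "C \<in> complexes \<C>" and D: "D \<in> complexes \<C>"
  shows "f \<in> null_homotopic \<C> C D \<longleftrightarrow> f \<in> chain_maps \<C> C D \<and> homotopic C D f (chain_zero C D)"
proof -
  have eq: "chain_zero C D n \<boxplus>\<^bsub>ob C n,ob D n\<^esub> bd C D h n = bd C D h n"
    if "\<forall>n. h n \<in> mor \<C> (ob C n) (ob D (n + 1))" for h n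
    using C D bd_mor[OF C D, of h n] spec[OF that, of n] spec[OF that, of "n - 1"]
    by (simp add: chain_zero_def add_zero_left ob_Obj)
  have "(\<forall>n. h n \<in> mor \<C> (ob C n) (ob D (n + 1)) \<and> f n = bd C D h n) \<longleftrightarrow>
      (\<forall>n. h n \<in> mor \<C> (ob C n) (ob D (n + 1)) \<and> f n = chain_zero C D n \<boxplus>\<^bsub>ob C n,ob D n\<^esub> bd C D h n)" for h
    using eq[of h] by metis
  then show ?thesis
    unfolding null_homotopic_def htpy_top by (simp add: bd_def)
qed

lemma null_homotopic_normal:
  assumes C: "C \<in> complexes \<C>" and D: "D \<in> complexes \<C>"
  shows "null_homotopic \<C> C D \<lhd> chain_group \<C> C D"
proof -
  interpret G: comm_group "chain_group \<C> C D" by (rule chain_group_comm_group[OF C D])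
  have "subgroup (null_homotopic \<C> C D) (chain_group \<C> C D)"
  proof (rule G.subgroupI)
    show "null_homotopic \<C> C D \<subseteq> carrier (chain_group \<C> C D)"
      by (auto simp: null_homotopic_iff C D chain_group_simps)
    show "null_homotopic \<C> C D \<noteq> {}"
      using null_homotopic_iff[OF C D, of "chain_zero C D"] C D by (auto intro: chain_maps_closed homotopic_refl)
  next
    fix f assume "f \<in> null_homotopic \<C> C D"
    then have f: "f \<in> chain_maps \<C> C D" "homotopic C D f (chain_zero C D)"
      by (simp_all add: null_homotopic_iff C D)
    have inv: "inv\<^bsub>chain_group \<C> C D\<^esub> f = chain_neg C D f"
      using C D f(1) chain_maps_neg[OF C D f(1)]
      by (intro G.inv_equality) (simp_all add: chain_group_simps chain_add_zero)
    have z: "chain_neg C D (chain_zero C D) = chain_zero C D"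
      using C D by (auto simp: fun_eq_iff chain_neg_def chain_zero_def neg_zero ob_Obj)
    show "inv\<^bsub>chain_group \<C> C D\<^esub> f \<in> null_homotopic \<C> C D"
      using homotopic_neg[OF C D chain_maps_zero[OF C D] f(2)] C D f(1)
      by (simp add: inv null_homotopic_iff chain_maps_closed z)
  next
    fix f g assume "f \<in> null_homotopic \<C> C D" "g \<in> null_homotopic \<C> C D"
    then have f: "f \<in> chain_maps \<C> C D" "homotopic C D f (chain_zero C D)"
      and g: "g \<in> chain_maps \<C> C D" "homotopic C D g (chain_zero C D)"
      by (simp_all add: null_homotopic_iff C D)
    have "homotopic C D (chain_add C D f g) (chain_add C D (chain_zero C D) (chain_zero C D))"
      using C D f g by (intro homotopic_add chain_maps_closed)
    then show "f \<otimes>\<^bsub>chain_group \<C> C D\<^esub> g \<in> null_homotopic \<C> C D"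
      using C D f g by (simp add: chain_group_simps null_homotopic_iff chain_maps_closed chain_add_zero)
  qed
  then show ?thesis by (simp add: G.normal_iff_subgroup)
qed

text \<open>Membership of \<open>g\<close> in the coset of \<open>f\<close> means that
  \<open>g - f\<close> is null-homotopic, so the cosets are the homotopy classes.\<close>

lemma hclass_eq:
  assumes C: "C \<in> complexes \<C>" and D: "D \<in> complexes \<C>" and f: "f \<in> chain_maps \<C> C D"
  shows "hclass \<C> C D f = {g \<in> chain_maps \<C> C D. homotopic C D g f}"
proof (rule Set.set_eqI, rule iffI)
  fix g assume "g \<in> hclass \<C> C D f"
  then obtain u where u: "u \<in> chain_maps \<C> C D" "homotopic C D u (chain_zero C D)"
    and g: "g = chain_add C D u f"
    by (auto simp: hclass_def r_coset_def null_homotopic_iff C D chain_group_simps)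
  have "homotopic C D (chain_add C D u f) (chain_add C D (chain_zero C D) f)"
    using C D f u by (intro homotopic_add homotopic_refl chain_maps_closed)
  then show "g \<in> {g \<in> chain_maps \<C> C D. homotopic C D g f}"
    using C D f u by (simp add: g chain_maps_closed chain_add_zero)
next
  fix g assume "g \<in> {g \<in> chain_maps \<C> C D. homotopic C D g f}"
  then have g: "g \<in> chain_maps \<C> C D" "homotopic C D g f" by auto
  define u where "u = chain_add C D g (chain_neg C D f)"
  have "u \<in> null_homotopic \<C> C D"
    using C D f g homotopic_iff_diff[OF C D g(1) f] by (simp add: u_def null_homotopic_iff chain_maps_closed)
  moreover have "g = chain_add C D u f"
    using C D f g by (simp add: u_def chain_add_assoc chain_add_zero chain_maps_closed)
  ultimately show "g \<in> hclass \<C> C D f"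
    unfolding hclass_def r_coset_def chain_group_simps by blast
qed

lemma mem_hclass: "\<lbrakk>C \<in> complexes \<C>; D \<in> complexes \<C>; f \<in> chain_maps \<C> C D\<rbrakk> \<Longrightarrow> f \<in> hclass \<C> C D f"
  by (simp add: hclass_eq homotopic_refl)

lemma hclass_eq_iff:
  assumes C: "C \<in> complexes \<C>" and D: "D \<in> complexes \<C>"
    and f: "f \<in> chain_maps \<C> C D" and g: "g \<in> chain_maps \<C> C D"
  shows "hclass \<C> C D f = hclass \<C> C D g \<longleftrightarrow> homotopic C D f g"
proof
  assume "hclass \<C> C D f = hclass \<C> C D g"
  with mem_hclass[OF C D f] show "homotopic C D f g" by (simp add: hclass_eq[OF C D g])
next
  assume fg: "homotopic C D f g"
  then have gf: "homotopic C D g f" using homotopic_sym[OF C D g] by blast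
  show "hclass \<C> C D f = hclass \<C> C D g"
    unfolding hclass_eq[OF C D f] hclass_eq[OF C D g]
    using homotopic_trans[OF C D f _ gf] homotopic_trans[OF C D g _ fg] by blast
qed

lemma K_simps:
  "Obj K = complexes \<C>"
  "Hom K C D = chain_group \<C> C D Mod null_homotopic \<C> C D"
  "Idn K C = hclass \<C> C C (chain_id C)"
  "Cmp K C D E \<psi> \<phi> = \<Union>{hclass \<C> C E (chain_comp \<C> C D E g f) | f g. f \<in> \<phi> \<and> g \<in> \<psi>}"
  "SuspO K = susp \<C>"
  "SuspM K C D \<phi> = \<Union>{hclass \<C> (susp \<C> C) (susp \<C> D) (susp_map f) | f. f \<in> \<phi>}"
  by (simp_all add: homotopy_category_def saturate_triangles_def chain_id_def[abs_def])

lemma mor_K: "mor K C D = hclass \<C> C D ` chain_maps \<C> C D"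
  by (auto simp: K_simps FactGroup_def RCOSETS_def hclass_def chain_group_simps)

lemma hclass_mor: "f \<in> chain_maps \<C> C D \<Longrightarrow> hclass \<C> C D f \<in> mor K C D"
  by (auto simp: mor_K)

lemma K_add:
  assumes C: "C \<in> complexes \<C>" and D: "D \<in> complexes \<C>"
    and f: "f \<in> chain_maps \<C> C D" and g: "g \<in> chain_maps \<C> C D"
  shows "hclass \<C> C D f \<otimes>\<^bsub>Hom K C D\<^esub> hclass \<C> C D g = hclass \<C> C D (chain_add C D f g)"
  using normal.rcos_sum[OF null_homotopic_normal[OF C D], of f g] f g
  by (simp add: K_simps FactGroup_def hclass_def chain_group_simps)

text \<open>All representatives give the same class and at least one pair exists, so the union that
  defines composition runs over a single class.\<close>

lemma K_comp:
  assumes C: "C \<in> complexes \<C>" and D: "D \<in> complexes \<C>" and E: "E \<in> complexes \<C>"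
    and f: "f \<in> chain_maps \<C> C D" and g: "g \<in> chain_maps \<C> D E"
  shows "Cmp K C D E (hclass \<C> D E g) (hclass \<C> C D f) = hclass \<C> C E (chain_comp \<C> C D E g f)"
proof -
  have "hclass \<C> C E (chain_comp \<C> C D E g' f') = hclass \<C> C E (chain_comp \<C> C D E g f)"
    if "f' \<in> hclass \<C> C D f" "g' \<in> hclass \<C> D E g" for f' g'
  proof -
    from that have f': "f' \<in> chain_maps \<C> C D" "homotopic C D f' f"
      and g': "g' \<in> chain_maps \<C> D E" "homotopic D E g' g"
      using C D E f g by (auto simp: hclass_eq)
    have "homotopic C E (chain_comp \<C> C D E g' f') (chain_comp \<C> C D E g f')"
      using homotopic_comp_right[OF C D E f'(1) g g'(2)] .
    moreover have "homotopic C E (chain_comp \<C> C D E g f') (chain_comp \<C> C D E g f)"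
      using homotopic_comp_left[OF C D E f f'(2) g] .
    ultimately have "homotopic C E (chain_comp \<C> C D E g' f') (chain_comp \<C> C D E g f)"
      using C D E f g by (blast intro: homotopic_trans chain_maps_closed)
    then show ?thesis
      using C D E f f' g g' by (simp add: hclass_eq_iff chain_maps_closed)
  qed
  moreover have "f \<in> hclass \<C> C D f" "g \<in> hclass \<C> D E g"
    using C D E f g by (simp_all add: mem_hclass)
  ultimately have "{hclass \<C> C E (chain_comp \<C> C D E g' f') | f' g'. f' \<in> hclass \<C> C D f \<and> g' \<in> hclass \<C> D E g}
     = {hclass \<C> C E (chain_comp \<C> C D E g f)}" by blast
  then show ?thesis by (simp add: K_simps)
qed

lemma susp_simps:
  "ob (susp \<C> C) n = ob C (n - 1)"
  "df (susp \<C> C) n = \<boxminus>\<^bsub>ob C (n - 1),ob C (n - 1 - 1)\<^esub> df C (n - 1)"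
  by (simp_all add: susp_def)

lemma susp_complexes:
  assumes "C \<in> complexes \<C>"
  shows "susp \<C> C \<in> complexes \<C>"
  unfolding complexes_def
  using assms by (auto simp: susp_simps ob_Obj df_mor mor_intros cmp_distrib neg_neg df_df)

lemma chmap_susp:
  assumes F: "F = all_deg \<or> F = at_top" and C: "C \<in> complexes \<C>" and D: "D \<in> complexes \<C>"
    and f: "chmap F C D f"
  shows "chmap F (susp \<C> C) (susp \<C> D) (susp_map f)"
  using eventually_pred[OF F f[unfolded chmap_def]] eventually_pred[OF F eventually_pred[OF F f[unfolded chmap_def]]]
  unfolding chmap_def
  by eventually_elim (use C D in \<open>simp add: susp_simps susp_map_def cplx_simps mor_intros cmp_distrib\<close>)

lemma htpy_susp:
  assumes F: "F = all_deg \<or> F = at_top" and C: "C \<in> complexes \<C>" and D: "D \<in> complexes \<C>"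
    and f: "htpy F C D f g"
  shows "htpy F (susp \<C> C) (susp \<C> D) (susp_map f) (susp_map g)"
proof -
  from f obtain h where h: "\<forall>\<^sub>F n in F. h n \<in> mor \<C> (ob C n) (ob D (n + 1)) \<and>
      f n = g n \<boxplus>\<^bsub>ob C n,ob D n\<^esub> bd C D h n"
    unfolding htpy_def by blast
  \<comment> \<open>The sign compensates for the differential \<open>- d\<close> of the
    suspension.\<close>
  define k where "k n = \<boxminus>\<^bsub>ob C (n - 1),ob D n\<^esub> h (n - 1)" for n
  have "\<forall>\<^sub>F n in F. k n \<in> mor \<C> (ob (susp \<C> C) n) (ob (susp \<C> D) (n + 1)) \<and>
      susp_map f n = susp_map g n \<boxplus>\<^bsub>ob (susp \<C> C) n,ob (susp \<C> D) n\<^esub> bd (susp \<C> C) (susp \<C> D) k n"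
    using eventually_pred[OF F h] eventually_pred[OF F eventually_pred[OF F h]]
    by eventually_elim
      (use C D in \<open>simp add: susp_simps susp_map_def k_def bd_def cplx_simps mor_intros cmp_distrib neg_neg\<close>)
  then show ?thesis unfolding htpy_def by blast
qed

lemmas susp_map_chain_maps = chmap_susp[OF all_deg, unfolded chmap_top]

lemma K_susp:
  assumes C: "C \<in> complexes \<C>" and D: "D \<in> complexes \<C>" and f: "f \<in> chain_maps \<C> C D"
  shows "SuspM K C D (hclass \<C> C D f) = hclass \<C> (susp \<C> C) (susp \<C> D) (susp_map f)"
proof -
  have "hclass \<C> (susp \<C> C) (susp \<C> D) (susp_map f') = hclass \<C> (susp \<C> C) (susp \<C> D) (susp_map f)"
    if "f' \<in> hclass \<C> C D f" for f'
  proof -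
    have f': "f' \<in> chain_maps \<C> C D" "homotopic C D f' f"
      using that C D f by (simp_all add: hclass_eq)
    show ?thesis
      by (rule hclass_eq_iff[THEN iffD2, OF _ _ _ _ htpy_susp[OF all_deg C D f'(2)]])
        (use C D f f'(1) in \<open>simp_all add: susp_complexes susp_map_chain_maps\<close>)
  qed
  then have "{hclass \<C> (susp \<C> C) (susp \<C> D) (susp_map f') | f'. f' \<in> hclass \<C> C D f}
     = {hclass \<C> (susp \<C> C) (susp \<C> D) (susp_map f)}"
    using mem_hclass[OF C D f] by blast
  then show ?thesis by (simp add: K_simps)
qed

definition hequiv :: "('a, 'b) cplx \<Rightarrow> ('a, 'b) cplx \<Rightarrow> (int \<Rightarrow> 'b) \<Rightarrow> (int \<Rightarrow> 'b) \<Rightarrow> bool"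
  where "hequiv C D f g \<longleftrightarrow> C \<in> complexes \<C> \<and> D \<in> complexes \<C> \<and>
    f \<in> chain_maps \<C> C D \<and> g \<in> chain_maps \<C> D C \<and>
    homotopic C C (chain_comp \<C> C D C g f) (chain_id C) \<and>
    homotopic D D (chain_comp \<C> D C D f g) (chain_id D)"

lemma hequiv_sym: "hequiv C D f g \<Longrightarrow> hequiv D C g f"
  by (auto simp: hequiv_def)

lemma hequiv_id: "C \<in> complexes \<C> \<Longrightarrow> hequiv C C (chain_id C) (chain_id C)"
proof -
  assume C: "C \<in> complexes \<C>"
  have "chain_comp \<C> C C C (chain_id C) (chain_id C) = chain_id C"
    using C by (auto simp: chain_comp_def chain_id_def Cmp_Idn_left Idn_mor ob_Obj)
  then show ?thesis using C by (simp add: hequiv_def chain_maps_closed homotopic_refl)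
qed

lemma iso_mor_K_iff:
  assumes C: "C \<in> complexes \<C>" and D: "D \<in> complexes \<C>"
  shows "iso_mor K C D \<phi> \<longleftrightarrow> (\<exists>f g. \<phi> = hclass \<C> C D f \<and> hequiv C D f g)"
proof
  assume "iso_mor K C D \<phi>"
  then obtain f g where f: "f \<in> chain_maps \<C> C D" and phi: "\<phi> = hclass \<C> C D f" and g: "g \<in> chain_maps \<C> D C"
    and 1: "Cmp K C D C (hclass \<C> D C g) (hclass \<C> C D f) = Idn K C"
    and 2: "Cmp K D C D (hclass \<C> C D f) (hclass \<C> D C g) = Idn K D"
    unfolding iso_mor_def mor_K by blast
  have "hequiv C D f g"
    using 1 2 C D f g by (simp add: K_comp K_simps(3) hclass_eq_iff chain_maps_closed hequiv_def)
  with phi show "\<exists>f g. \<phi> = hclass \<C> C D f \<and> hequiv C D f g" by blast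
next
  assume "\<exists>f g. \<phi> = hclass \<C> C D f \<and> hequiv C D f g"
  then obtain f g where phi: "\<phi> = hclass \<C> C D f" and fg: "hequiv C D f g" by blast
  then have "Cmp K C D C (hclass \<C> D C g) (hclass \<C> C D f) = Idn K C"
    "Cmp K D C D (hclass \<C> C D f) (hclass \<C> D C g) = Idn K D"
    "hclass \<C> D C g \<in> mor K D C" "hclass \<C> C D f \<in> mor K C D"
    by (simp_all add: hequiv_def K_comp K_simps(3) hclass_eq_iff chain_maps_closed hclass_mor)
  then show "iso_mor K C D \<phi>" unfolding iso_mor_def phi by blast
qed

lemma isomorphic_K_iff:
  assumes "C \<in> complexes \<C>" "D \<in> complexes \<C>"
  shows "isomorphic K C D \<longleftrightarrow> (\<exists>f g. hequiv C D f g)"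
  unfolding isomorphic_def using iso_mor_K_iff[OF assms] by blast

lemma mem_iso_closure_K:
  assumes "S \<subseteq> complexes \<C>"
  shows "C \<in> iso_closure K S \<longleftrightarrow> (\<exists>D\<in>S. \<exists>f g. hequiv C D f g)"
proof -
  have "C \<in> iso_closure K S \<longleftrightarrow> (\<exists>D\<in>S. C \<in> complexes \<C> \<and> isomorphic K C D)"
    by (auto simp: iso_closure_def K_simps)
  also have "\<dots> \<longleftrightarrow> (\<exists>D\<in>S. \<exists>f g. hequiv C D f g)"
    using isomorphic_K_iff[of C] assms unfolding hequiv_def by blast
  finally show ?thesis .
qed

lemma iso_closure_K_superset: "S \<subseteq> complexes \<C> \<Longrightarrow> S \<subseteq> iso_closure K S"
  using mem_iso_closure_K hequiv_id by blast

end

section \<open>Mapping cones\<close>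

context additive_category
begin

lemma zero_object_the_zero: "zero_object \<C> (the_zero \<C>)"
  unfolding the_zero_def using ex_zero_object by (rule someI_ex)

lemma the_zero_Obj: "the_zero \<C> \<in> Obj \<C>"
  using zero_object_the_zero by (simp add: zero_object_def)

lemma mor_to_zero: "\<lbrakk>zero_object \<C> Z; X \<in> Obj \<C>; f \<in> mor \<C> X Z\<rbrakk> \<Longrightarrow> f = zero_mor \<C> X Z"
  by (auto simp: zero_object_def)

lemma mor_from_zero: "\<lbrakk>zero_object \<C> Z; X \<in> Obj \<C>; f \<in> mor \<C> Z X\<rbrakk> \<Longrightarrow> f = zero_mor \<C> Z X"
  by (auto simp: zero_object_def)

lemma biproduct_the_biprod: "\<lbrakk>A \<in> Obj \<C>; B \<in> Obj \<C>\<rbrakk> \<Longrightarrow> biproduct \<C> A B (the_biprod \<C> A B)"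
  unfolding the_biprod_def using ex_biproduct by (rule someI_ex)

text \<open>Both injections start at zero objects and vanish, so the identity of the sum is zero and
  every morphism into or out of it is zero.\<close>

lemma zero_object_bsum:
  assumes A: "zero_object \<C> A" and B: "zero_object \<C> B"
  shows "zero_object \<C> (bsum (the_biprod \<C> A B))"
proof -
  let ?b = "the_biprod \<C> A B"
  have AB: "A \<in> Obj \<C>" "B \<in> Obj \<C>" using A B by (auto simp: zero_object_def)
  note b = biproduct_the_biprod[OF AB, unfolded biproduct_def]
  have S: "bsum ?b \<in> Obj \<C>" using b by blast
  have zero: "in1 ?b = zero_mor \<C> A (bsum ?b)" "in2 ?b = zero_mor \<C> B (bsum ?b)"
    using mor_from_zero[OF A S] mor_from_zero[OF B S] b by blast+
  have pr: "pr1 ?b \<in> mor \<C> (bsum ?b) A" "pr2 ?b \<in> mor \<C> (bsum ?b) B"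
    and sum: "in1 ?b \<bullet>\<^bsub>bsum ?b,A,bsum ?b\<^esub> pr1 ?b \<boxplus>\<^bsub>bsum ?b,bsum ?b\<^esub>
      in2 ?b \<bullet>\<^bsub>bsum ?b,B,bsum ?b\<^esub> pr2 ?b = Idn \<C> (bsum ?b)"
    using b by blast+
  from sum have id: "Idn \<C> (bsum ?b) = zero_mor \<C> (bsum ?b) (bsum ?b)"
    using AB S pr by (simp add: zero cmp_zero_left add_zero_left zero_mor)
  show ?thesis
    unfolding zero_object_def
  proof (intro conjI ballI)
    fix X assume X: "X \<in> Obj \<C>"
    have "f = zero_mor \<C> X (bsum ?b)" if "f \<in> mor \<C> X (bsum ?b)" for f
      using Cmp_Idn_left[OF X S that] X S that by (simp add: id cmp_zero_left)
    then show "mor \<C> X (bsum ?b) = {zero_mor \<C> X (bsum ?b)}" using X S zero_mor by blast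
    have "f = zero_mor \<C> (bsum ?b) X" if "f \<in> mor \<C> (bsum ?b) X" for f
      using Cmp_Idn_right[OF S X that] X S that by (simp add: id cmp_zero_right)
    then show "mor \<C> (bsum ?b) X = {zero_mor \<C> (bsum ?b) X}" using X S zero_mor by blast
  qed (rule S)
qed

definition cone_in2 :: "('a, 'b) cplx \<Rightarrow> ('a, 'b) cplx \<Rightarrow> int \<Rightarrow> 'b"
  where "cone_in2 C D n = in2 (cone_sum \<C> C D n)"

definition cone_pr1 :: "('a, 'b) cplx \<Rightarrow> ('a, 'b) cplx \<Rightarrow> int \<Rightarrow> 'b"
  where "cone_pr1 C D n = pr1 (cone_sum \<C> C D n)"

text \<open>A rule for \<open>a b\<close> does not match inside the left-associated term
  \<open>(y a) b\<close>. This lifts such a rule under a left factor \<open>y\<close>.\<close>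

lemma comp_eq_comp:
  assumes "W \<in> Obj \<C>" "X \<in> Obj \<C>" "Y \<in> Obj \<C>" "Z \<in> Obj \<C>" "b \<in> mor \<C> W X" "a \<in> mor \<C> X Y" "y \<in> mor \<C> Y Z"
    and "a \<bullet>\<^bsub>W,X,Y\<^esub> b = c"
  shows "y \<bullet>\<^bsub>X,Y,Z\<^esub> a \<bullet>\<^bsub>W,X,Z\<^esub> b = y \<bullet>\<^bsub>W,Y,Z\<^esub> c"
  using Cmp_assoc[OF assms(1-7)] assms(8) by simp

context
  fixes C D :: "('a, 'b) cplx" and f :: "int \<Rightarrow> 'b"
  assumes C: "C \<in> complexes \<C>" and D: "D \<in> complexes \<C>" and f: "f \<in> chain_maps \<C> C D"
begin

abbreviation cE where "cE \<equiv> mapping_cone \<C> C D f"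
abbreviation "ci1 \<equiv> cone_incl \<C> C D"
abbreviation "ci2 \<equiv> cone_in2 C D"
abbreviation "cp1 \<equiv> cone_pr1 C D"
abbreviation "cp2 \<equiv> cone_proj \<C> C D"

lemma ob_cone: "ob cE n = bsum (cone_sum \<C> C D n)"
  by (simp add: mapping_cone_def)

lemma cone_biproduct: "biproduct \<C> (ob D n) (ob C (n - 1)) (cone_sum \<C> C D n)"
  using biproduct_the_biprod[of "ob D n" "ob C (n - 1)"] C D by (simp add: susp_simps ob_Obj)

lemmas cone_biproduct' = cone_biproduct[unfolded biproduct_def, folded ob_cone cone_incl_def[THEN fun_cong]
    cone_proj_def[THEN fun_cong] cone_in2_def cone_pr1_def]

lemma cone_mor:
  "ob cE n \<in> Obj \<C>"
  "ci1 n \<in> mor \<C> (ob D n) (ob cE n)"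
  "k = n - 1 \<Longrightarrow> ci2 n \<in> mor \<C> (ob C k) (ob cE n)"
  "cp1 n \<in> mor \<C> (ob cE n) (ob D n)"
  "k = n - 1 \<Longrightarrow> cp2 n \<in> mor \<C> (ob cE n) (ob C k)"
  using cone_biproduct'[of n] by (simp_all add: cone_incl_def cone_proj_def)

lemma cone_bp:
  "cp1 n \<bullet>\<^bsub>ob D n,ob cE n,ob D n\<^esub> ci1 n = Idn \<C> (ob D n)"
  "k = n - 1 \<Longrightarrow> cp2 n \<bullet>\<^bsub>ob C k,ob cE n,ob C k\<^esub> ci2 n = Idn \<C> (ob C k)"
  "k = n - 1 \<Longrightarrow> cp1 n \<bullet>\<^bsub>ob C k,ob cE n,ob D n\<^esub> ci2 n = zero_mor \<C> (ob C k) (ob D n)"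
  "k = n - 1 \<Longrightarrow> cp2 n \<bullet>\<^bsub>ob D n,ob cE n,ob C k\<^esub> ci1 n = zero_mor \<C> (ob D n) (ob C k)"
  and cone_bp_sum:
  "k = n - 1 \<Longrightarrow> ci1 n \<bullet>\<^bsub>ob cE n,ob D n,ob cE n\<^esub> cp1 n \<boxplus>\<^bsub>ob cE n,ob cE n\<^esub> ci2 n \<bullet>\<^bsub>ob cE n,ob C k,ob cE n\<^esub> cp2 n = Idn \<C> (ob cE n)"
  using cone_biproduct'[of n] by (simp_all add: cone_incl_def cone_proj_def)

lemmas cone_ty = cone_mor cplx_simps[OF C] cplx_simps[OF D] chain_maps_mor[OF f] mor_intros

lemma df_cone:
  "df cE n = ci1 (n - 1) \<bullet>\<^bsub>ob cE n,ob D (n - 1),ob cE (n - 1)\<^esub> (df D n \<bullet>\<^bsub>ob cE n,ob D n,ob D (n - 1)\<^esub> cp1 n)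
     \<boxplus>\<^bsub>ob cE n,ob cE (n - 1)\<^esub> ci1 (n - 1) \<bullet>\<^bsub>ob cE n,ob D (n - 1),ob cE (n - 1)\<^esub> (f (n - 1) \<bullet>\<^bsub>ob cE n,ob C (n - 1),ob D (n - 1)\<^esub> cp2 n)
     \<boxplus>\<^bsub>ob cE n,ob cE (n - 1)\<^esub> ci2 (n - 1) \<bullet>\<^bsub>ob cE n,ob C (n - 2),ob cE (n - 1)\<^esub>
        (\<boxminus>\<^bsub>ob C (n - 1),ob C (n - 2)\<^esub> df C (n - 1) \<bullet>\<^bsub>ob cE n,ob C (n - 1),ob C (n - 2)\<^esub> cp2 n)"
  by (simp add: mapping_cone_def Let_def susp_simps cone_incl_def cone_proj_def cone_in2_def cone_pr1_def)

lemma df_cone_mor: "k = n - 1 \<Longrightarrow> df cE n \<in> mor \<C> (ob cE n) (ob cE k)"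
  by (simp add: df_cone cone_ty)

text \<open>Multiplying \<open>x\<close> and \<open>y\<close> by the decomposition
  \<open>i1 p1 + i2 p2\<close> of the identity expresses both through their projections.\<close>

lemma cone_pr_eqI:
  assumes W: "W \<in> Obj \<C>" and x: "x \<in> mor \<C> W (ob cE n)" and y: "y \<in> mor \<C> W (ob cE n)"
    and 1: "cp1 n \<bullet>\<^bsub>W,ob cE n,ob D n\<^esub> x = cp1 n \<bullet>\<^bsub>W,ob cE n,ob D n\<^esub> y"
    and 2: "cp2 n \<bullet>\<^bsub>W,ob cE n,ob C (n - 1)\<^esub> x = cp2 n \<bullet>\<^bsub>W,ob cE n,ob C (n - 1)\<^esub> y"
  shows "x = y"
proof -
  have "z = ci1 n \<bullet>\<^bsub>W,ob D n,ob cE n\<^esub> (cp1 n \<bullet>\<^bsub>W,ob cE n,ob D n\<^esub> z) \<boxplus>\<^bsub>W,ob cE n\<^esub>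
      ci2 n \<bullet>\<^bsub>W,ob C (n - 1),ob cE n\<^esub> (cp2 n \<bullet>\<^bsub>W,ob cE n,ob C (n - 1)\<^esub> z)" if "z \<in> mor \<C> W (ob cE n)" for z
  proof -
    have "z = Idn \<C> (ob cE n) \<bullet>\<^bsub>W,ob cE n,ob cE n\<^esub> z"
      using W that by (simp add: Cmp_Idn_left cone_ty)
    also have "\<dots> = ci1 n \<bullet>\<^bsub>W,ob D n,ob cE n\<^esub> (cp1 n \<bullet>\<^bsub>W,ob cE n,ob D n\<^esub> z) \<boxplus>\<^bsub>W,ob cE n\<^esub>
      ci2 n \<bullet>\<^bsub>W,ob C (n - 1),ob cE n\<^esub> (cp2 n \<bullet>\<^bsub>W,ob cE n,ob C (n - 1)\<^esub> z)"
      unfolding cone_bp_sum[OF refl, symmetric] using W that by (simp add: cmp_distrib cone_ty Cmp_assoc)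
    finally show ?thesis .
  qed
  from this[OF x] this[OF y] 1 2 show ?thesis by simp
qed

text \<open>This and the next three lemmas read the matrix of the cone differential, with rows
  \<open>(d, f)\<close> and \<open>(0, - d)\<close>, by rows and by columns.\<close>

lemma cone_pr1_df: "k = n - 1 \<Longrightarrow> cp1 k \<bullet>\<^bsub>ob cE n,ob cE k,ob D k\<^esub> df cE n =
    df D n \<bullet>\<^bsub>ob cE n,ob D n,ob D k\<^esub> cp1 n \<boxplus>\<^bsub>ob cE n,ob D k\<^esub> f k \<bullet>\<^bsub>ob cE n,ob C k,ob D k\<^esub> cp2 n"
  by (simp add: df_cone cmp_distrib cone_ty Cmp_assoc cone_bp add_simps Cmp_Idn_left)

lemma cone_pr2_df: "\<lbrakk>k = n - 1; l = n - 2\<rbrakk> \<Longrightarrow> cp2 k \<bullet>\<^bsub>ob cE n,ob cE k,ob C l\<^esub> df cE n =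
    \<boxminus>\<^bsub>ob cE n,ob C l\<^esub> (df C k \<bullet>\<^bsub>ob cE n,ob C k,ob C l\<^esub> cp2 n)"
  by (simp add: df_cone cmp_distrib cone_ty Cmp_assoc cone_bp add_simps Cmp_Idn_left)

lemma cone_df_in1: "k = n - 1 \<Longrightarrow> df cE n \<bullet>\<^bsub>ob D n,ob cE n,ob cE k\<^esub> ci1 n = ci1 k \<bullet>\<^bsub>ob D n,ob D k,ob cE k\<^esub> df D n"
  by (simp add: df_cone cmp_distrib cone_ty Cmp_assoc[symmetric] cone_bp add_simps Cmp_Idn_right)

lemma cone_df_in2: "\<lbrakk>k = n - 1; l = n - 2\<rbrakk> \<Longrightarrow> df cE n \<bullet>\<^bsub>ob C k,ob cE n,ob cE k\<^esub> ci2 n =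
    ci1 k \<bullet>\<^bsub>ob C k,ob D k,ob cE k\<^esub> f k \<boxplus>\<^bsub>ob C k,ob cE k\<^esub>
    \<boxminus>\<^bsub>ob C k,ob cE k\<^esub> (ci2 k \<bullet>\<^bsub>ob C k,ob C l,ob cE k\<^esub> df C k)"
  by (simp add: df_cone cmp_distrib cone_ty Cmp_assoc[symmetric] cone_bp add_simps Cmp_Idn_right)

lemmas cone_ty' = cone_ty df_cone_mor

lemmas cone_rules = cone_bp cone_pr1_df cone_pr2_df cone_df_in1 cone_df_in2

lemma cone_rules_comp:
  assumes Z: "Z \<in> Obj \<C>"
  shows "y \<in> mor \<C> (ob D n) Z \<Longrightarrow> y \<bullet>\<^bsub>ob cE n,ob D n,Z\<^esub> cp1 n \<bullet>\<^bsub>ob D n,ob cE n,Z\<^esub> ci1 n = y"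
  and "\<lbrakk>k = n - 1; y \<in> mor \<C> (ob C k) Z\<rbrakk> \<Longrightarrow> y \<bullet>\<^bsub>ob cE n,ob C k,Z\<^esub> cp2 n \<bullet>\<^bsub>ob C k,ob cE n,Z\<^esub> ci2 n = y"
  and "\<lbrakk>k = n - 1; y \<in> mor \<C> (ob D n) Z\<rbrakk> \<Longrightarrow> y \<bullet>\<^bsub>ob cE n,ob D n,Z\<^esub> cp1 n \<bullet>\<^bsub>ob C k,ob cE n,Z\<^esub> ci2 n = zero_mor \<C> (ob C k) Z"
  and "\<lbrakk>k = n - 1; y \<in> mor \<C> (ob C k) Z\<rbrakk> \<Longrightarrow> y \<bullet>\<^bsub>ob cE n,ob C k,Z\<^esub> cp2 n \<bullet>\<^bsub>ob D n,ob cE n,Z\<^esub> ci1 n = zero_mor \<C> (ob D n) Z"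
  and "\<lbrakk>k = n - 1; y \<in> mor \<C> (ob D k) Z\<rbrakk> \<Longrightarrow> y \<bullet>\<^bsub>ob cE k,ob D k,Z\<^esub> cp1 k \<bullet>\<^bsub>ob cE n,ob cE k,Z\<^esub> df cE n =
    y \<bullet>\<^bsub>ob D n,ob D k,Z\<^esub> df D n \<bullet>\<^bsub>ob cE n,ob D n,Z\<^esub> cp1 n \<boxplus>\<^bsub>ob cE n,Z\<^esub> y \<bullet>\<^bsub>ob C k,ob D k,Z\<^esub> f k \<bullet>\<^bsub>ob cE n,ob C k,Z\<^esub> cp2 n"
  and "\<lbrakk>k = n - 1; l = n - 2; y \<in> mor \<C> (ob C l) Z\<rbrakk> \<Longrightarrow> y \<bullet>\<^bsub>ob cE k,ob C l,Z\<^esub> cp2 k \<bullet>\<^bsub>ob cE n,ob cE k,Z\<^esub> df cE n =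
    \<boxminus>\<^bsub>ob cE n,Z\<^esub> (y \<bullet>\<^bsub>ob C k,ob C l,Z\<^esub> df C k \<bullet>\<^bsub>ob cE n,ob C k,Z\<^esub> cp2 n)"
  and "\<lbrakk>k = n - 1; y \<in> mor \<C> (ob cE k) Z\<rbrakk> \<Longrightarrow> y \<bullet>\<^bsub>ob cE n,ob cE k,Z\<^esub> df cE n \<bullet>\<^bsub>ob D n,ob cE n,Z\<^esub> ci1 n =
    y \<bullet>\<^bsub>ob D k,ob cE k,Z\<^esub> ci1 k \<bullet>\<^bsub>ob D n,ob D k,Z\<^esub> df D n"
  and "\<lbrakk>k = n - 1; l = n - 2; y \<in> mor \<C> (ob cE k) Z\<rbrakk> \<Longrightarrow> y \<bullet>\<^bsub>ob cE n,ob cE k,Z\<^esub> df cE n \<bullet>\<^bsub>ob C k,ob cE n,Z\<^esub> ci2 n =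
    y \<bullet>\<^bsub>ob D k,ob cE k,Z\<^esub> ci1 k \<bullet>\<^bsub>ob C k,ob D k,Z\<^esub> f k \<boxplus>\<^bsub>ob C k,Z\<^esub>
    \<boxminus>\<^bsub>ob C k,Z\<^esub> (y \<bullet>\<^bsub>ob C l,ob cE k,Z\<^esub> ci2 k \<bullet>\<^bsub>ob C k,ob C l,Z\<^esub> df C k)"
         apply (subst comp_eq_comp[OF _ _ _ Z _ _ _ cone_bp(1)]; use Z in \<open>simp add: cone_ty' Cmp_Idn_right\<close>)
        apply (subst comp_eq_comp[OF _ _ _ Z _ _ _ cone_bp(2)]; use Z in \<open>simp add: cone_ty' Cmp_Idn_right\<close>)
       apply (subst comp_eq_comp[OF _ _ _ Z _ _ _ cone_bp(3)]; use Z in \<open>simp add: cone_ty' cmp_zero_right\<close>)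
      apply (subst comp_eq_comp[OF _ _ _ Z _ _ _ cone_bp(4)]; use Z in \<open>simp add: cone_ty' cmp_zero_right\<close>)
     apply (subst comp_eq_comp[OF _ _ _ Z _ _ _ cone_pr1_df]; use Z in \<open>simp add: cone_ty' cmp_distrib Cmp_assoc\<close>)
    apply (subst comp_eq_comp[OF _ _ _ Z _ _ _ cone_pr2_df]; use Z in \<open>simp add: cone_ty' cmp_distrib Cmp_assoc\<close>)
   apply (subst comp_eq_comp[OF _ _ _ Z _ _ _ cone_df_in1]; use Z in \<open>simp add: cone_ty' cmp_distrib Cmp_assoc\<close>)
  apply (subst comp_eq_comp[OF _ _ _ Z _ _ _ cone_df_in2[where l = l]]; use Z in \<open>simp add: cone_ty' cmp_distrib Cmp_assoc\<close>)
  done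

text \<open>Checked on the two projections. The entry of \<open>d d\<close> from \<open>C\<close> to
  \<open>D\<close> is \<open>d f - f d\<close>, which vanishes because \<open>f\<close> is a chain
  map.\<close>

lemma cone_complexes: "cE \<in> complexes \<C>"
proof -
  have "df cE n \<bullet>\<^bsub>ob cE (n + 1),ob cE n,ob cE (n - 1)\<^esub> df cE (n + 1) = zero_mor \<C> (ob cE (n + 1)) (ob cE (n - 1))" for n
    by (rule cone_pr_eqI[where W = "ob cE (n + 1)" and n = "n - 1"])
      (simp_all add: cone_ty' Cmp_assoc cone_rules cone_rules_comp cmp_distrib add_simps chain_maps_df[OF f])
  then show ?thesis
    unfolding complexes_def by (auto simp: cone_ty')
qed

lemma cone_incl_chain_maps: "ci1 \<in> chain_maps \<C> D cE"
  unfolding chain_maps_def by (simp add: cone_ty' cone_rules)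

lemma cone_proj_chain_maps: "cp2 \<in> chain_maps \<C> cE (susp \<C> C)"
  unfolding chain_maps_def by (simp add: cone_ty' cone_rules susp_simps cmp_distrib)

end

end

section \<open>Null homotopies into a mapping cone and contractions of it\<close>

context additive_category
begin

text \<open>Projecting an equation to a component in which its left side vanishes leaves a
  commutation relation in this form.\<close>

lemma eq_if_zero_eq_diff:
  assumes "X \<in> Obj \<C>" "Y \<in> Obj \<C>" "a \<in> mor \<C> X Y" "b \<in> mor \<C> X Y"
    and "zero_mor \<C> X Y = b \<boxplus>\<^bsub>X,Y\<^esub> \<boxminus>\<^bsub>X,Y\<^esub> a"
  shows "a = b"
proof -
  have "a = a \<boxplus>\<^bsub>X,Y\<^esub> (b \<boxplus>\<^bsub>X,Y\<^esub> \<boxminus>\<^bsub>X,Y\<^esub> a)"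
    using assms(1-4) by (simp add: assms(5)[symmetric] add_zero_right)
  also have "\<dots> = b" using assms(1-4) by (rule add_neg_cancel2(3))
  finally show ?thesis .
qed

text \<open>Split the null homotopy \<open>h\<close> into its components \<open>y = p2 h\<close> and
  \<open>k = p1 h\<close>. The \<open>p2\<close> component of \<open>i1 x = d h + h d\<close> says
  that \<open>y\<close> commutes with the differentials, and the \<open>p1\<close> component says
  \<open>x = f y + d k + k d\<close>.\<close>

lemma cone_lift:
  assumes C: "C \<in> complexes \<C>" and D: "D \<in> complexes \<C>" and f: "f \<in> chain_maps \<C> C D"
    and W: "W \<in> complexes \<C>" and x: "x \<in> chain_maps \<C> W D"
    and null: "homotopic W (mapping_cone \<C> C D f) (chain_comp \<C> W D (mapping_cone \<C> C D f) (cone_incl \<C> C D) x)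
      (chain_zero W (mapping_cone \<C> C D f))"
  shows "\<exists>y \<in> chain_maps \<C> W C. homotopic W D (chain_comp \<C> W C D f y) x"
proof -
  let ?E = "mapping_cone \<C> C D f" and ?i1 = "cone_incl \<C> C D" and ?p1 = "cone_pr1 C D" and ?p2 = "cone_proj \<C> C D"
  note ty = cone_ty'[OF C D f] cplx_simps[OF W] chain_maps_mor[OF x]
  note ru = cone_rules[OF C D f] cone_rules_comp[OF C D f]
  obtain h where h: "\<And>n. h n \<in> mor \<C> (ob W n) (ob ?E (n + 1))"
    and eq: "\<And>n. ?i1 n \<bullet>\<^bsub>ob W n,ob D n,ob ?E n\<^esub> x n = bd W ?E h n"
  proof -
    from null obtain h where h: "\<And>n. h n \<in> mor \<C> (ob W n) (ob ?E (n + 1))"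
      and eq: "\<And>n. ?i1 n \<bullet>\<^bsub>ob W n,ob D n,ob ?E n\<^esub> x n = zero_mor \<C> (ob W n) (ob ?E n) \<boxplus>\<^bsub>ob W n,ob ?E n\<^esub> bd W ?E h n"
      unfolding htpy_top chain_comp_def chain_zero_def by blast
    have "bd W ?E h n \<in> mor \<C> (ob W n) (ob ?E n)" for n
      using bd_mor[OF W cone_complexes[OF C D f], of h n] h[of n] h[of "n - 1"] by simp
    then show ?thesis using that[OF h] eq by (simp add: add_zero_left ty)
  qed
  have h': "h (n - 1) \<in> mor \<C> (ob W (n - 1)) (ob ?E n)" for n using h[of "n - 1"] by simp
  define y where "y n = ?p2 (n + 1) \<bullet>\<^bsub>ob W n,ob ?E (n + 1),ob C n\<^esub> h n" for n
  have y: "y \<in> chain_maps \<C> W C"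
  proof -
    have "df C n \<bullet>\<^bsub>ob W n,ob C n,ob C (n - 1)\<^esub> y n = y (n - 1) \<bullet>\<^bsub>ob W n,ob W (n - 1),ob C (n - 1)\<^esub> df W n" for n
    proof (rule eq_if_zero_eq_diff)
      have "?p2 n \<bullet>\<^bsub>ob W n,ob ?E n,ob C (n - 1)\<^esub> (?i1 n \<bullet>\<^bsub>ob W n,ob D n,ob ?E n\<^esub> x n)
          = ?p2 n \<bullet>\<^bsub>ob W n,ob ?E n,ob C (n - 1)\<^esub> bd W ?E h n"
        by (simp only: eq)
      then show "zero_mor \<C> (ob W n) (ob C (n - 1)) = y (n - 1) \<bullet>\<^bsub>ob W n,ob W (n - 1),ob C (n - 1)\<^esub> df W n
          \<boxplus>\<^bsub>ob W n,ob C (n - 1)\<^esub> \<boxminus>\<^bsub>ob W n,ob C (n - 1)\<^esub> (df C n \<bullet>\<^bsub>ob W n,ob C n,ob C (n - 1)\<^esub> y n)"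
        using h[of n] h'[of n] by (simp add: bd_def y_def ty ru cmp_distrib Cmp_assoc add_comm)
    qed (use h h' in \<open>auto simp: y_def ty\<close>)
    then show ?thesis unfolding chain_maps_def using h by (auto simp: y_def ty)
  qed
  define k where "k n = ?p1 (n + 1) \<bullet>\<^bsub>ob W n,ob ?E (n + 1),ob D (n + 1)\<^esub> h n" for n
  have "x n = chain_comp \<C> W C D f y n \<boxplus>\<^bsub>ob W n,ob D n\<^esub> bd W D k n" for n
  proof -
    have "?p1 n \<bullet>\<^bsub>ob W n,ob ?E n,ob D n\<^esub> (?i1 n \<bullet>\<^bsub>ob W n,ob D n,ob ?E n\<^esub> x n)
        = ?p1 n \<bullet>\<^bsub>ob W n,ob ?E n,ob D n\<^esub> bd W ?E h n"
      by (simp only: eq)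
    then show ?thesis
      using h[of n] h'[of n]
      by (simp add: bd_def y_def k_def chain_comp_def ty ru cmp_distrib Cmp_assoc add_simps Cmp_Idn_left)
  qed
  moreover have "k n \<in> mor \<C> (ob W n) (ob D (n + 1))" for n
    using h by (simp add: k_def ty)
  ultimately have "homotopic W D x (chain_comp \<C> W C D f y)"
    unfolding htpy_top by blast
  then show ?thesis
    using y homotopic_sym[OF W D chain_maps_comp[OF W C D y f]] by blast
qed

text \<open>The matrix entries of the equation \<open>1 = d h + h d\<close> contain everything: the
  entry from \<open>D\<close> to \<open>C\<close> makes \<open>c = p2 h i1\<close> a chain map, the
  entry from \<open>D\<close> to \<open>D\<close> gives \<open>f c = 1\<close> up to the homotopy
  \<open>a\<close>, and the entry from \<open>C\<close> to \<open>C\<close> gives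
  \<open>c f = 1\<close> up to the homotopy \<open>e\<close>.\<close>

lemma cone_contractible_germ:
  assumes C: "C \<in> complexes \<C>" and D: "D \<in> complexes \<C>" and f: "f \<in> chain_maps \<C> C D"
    and null: "htpy at_top (mapping_cone \<C> C D f) (mapping_cone \<C> C D f) (chain_id (mapping_cone \<C> C D f))
      (chain_zero (mapping_cone \<C> C D f) (mapping_cone \<C> C D f))"
  shows "\<exists>c. chmap at_top D C c \<and> htpy at_top D D (chain_comp \<C> D C D f c) (chain_id D) \<and>
    htpy at_top C C (chain_comp \<C> C D C c f) (chain_id C)"
proof -
  let ?E = "mapping_cone \<C> C D f" and ?i1 = "cone_incl \<C> C D" and ?p1 = "cone_pr1 C D" and ?p2 = "cone_proj \<C> C D"
    and ?i2 = "cone_in2 C D"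
  have at_top: "at_top = all_deg \<or> at_top = (at_top :: int filter)" by simp
  note ty = cone_ty'[OF C D f]
  note ru = cone_rules[OF C D f] cone_rules_comp[OF C D f]
  obtain h where h0: "\<forall>\<^sub>F n in at_top. h n \<in> mor \<C> (ob ?E n) (ob ?E (n + 1)) \<and>
      Idn \<C> (ob ?E n) = zero_mor \<C> (ob ?E n) (ob ?E n) \<boxplus>\<^bsub>ob ?E n,ob ?E n\<^esub> bd ?E ?E h n"
    using null unfolding htpy_def chain_id_def chain_zero_def by blast
  have h: "\<forall>\<^sub>F n in at_top. h n \<in> mor \<C> (ob ?E n) (ob ?E (n + 1)) \<and> h (n - 1) \<in> mor \<C> (ob ?E (n - 1)) (ob ?E n) \<and>
      Idn \<C> (ob ?E n) = bd ?E ?E h n"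
    using h0 eventually_pred[OF at_top h0]
  proof eventually_elim
    case (elim n)
    then have "bd ?E ?E h n \<in> mor \<C> (ob ?E n) (ob ?E n)"
      using cone_complexes[OF C D f] by (intro bd_mor) simp_all
    with elim show ?case by (simp add: add_zero_left ty)
  qed
  define c where "c n = ?p2 (n + 1) \<bullet>\<^bsub>ob ?E n,ob ?E (n + 1),ob C n\<^esub> h n \<bullet>\<^bsub>ob D n,ob ?E n,ob C n\<^esub> ?i1 n" for n
  define a where "a n = ?p1 (n + 1) \<bullet>\<^bsub>ob ?E n,ob ?E (n + 1),ob D (n + 1)\<^esub> h n \<bullet>\<^bsub>ob D n,ob ?E n,ob D (n + 1)\<^esub> ?i1 n" for n
  \<comment> \<open>\<open>C\<close> sits in the cone one degree higher, which shifts the index of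
    \<open>h\<close>. The sign turns the differential \<open>- d\<close> of that summand back into
    \<open>d\<close>.\<close>
  define e where "e n = \<boxminus>\<^bsub>ob C n,ob C (n + 1)\<^esub> (?p2 (n + 1 + 1) \<bullet>\<^bsub>ob ?E (n + 1),ob ?E (n + 1 + 1),ob C (n + 1)\<^esub> h (n + 1)
      \<bullet>\<^bsub>ob C n,ob ?E (n + 1),ob C (n + 1)\<^esub> ?i2 (n + 1))" for n
  have e1: "e (n - 1) = \<boxminus>\<^bsub>ob C (n - 1),ob C n\<^esub> (?p2 (n + 1) \<bullet>\<^bsub>ob ?E n,ob ?E (n + 1),ob C n\<^esub> h n
      \<bullet>\<^bsub>ob C (n - 1),ob ?E n,ob C n\<^esub> ?i2 n)" for n
    by (simp add: e_def add.commute)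
  have c: "chmap at_top D C c"
    unfolding chmap_def using h
  proof eventually_elim
    case (elim n)
    have "df C n \<bullet>\<^bsub>ob D n,ob C n,ob C (n - 1)\<^esub> c n = c (n - 1) \<bullet>\<^bsub>ob D n,ob D (n - 1),ob C (n - 1)\<^esub> df D n"
    proof (rule eq_if_zero_eq_diff)
      have "?p2 n \<bullet>\<^bsub>ob ?E n,ob ?E n,ob C (n - 1)\<^esub> Idn \<C> (ob ?E n) \<bullet>\<^bsub>ob D n,ob ?E n,ob C (n - 1)\<^esub> ?i1 n
          = ?p2 n \<bullet>\<^bsub>ob ?E n,ob ?E n,ob C (n - 1)\<^esub> bd ?E ?E h n \<bullet>\<^bsub>ob D n,ob ?E n,ob C (n - 1)\<^esub> ?i1 n"
        using elim by simp
      then show "zero_mor \<C> (ob D n) (ob C (n - 1)) = c (n - 1) \<bullet>\<^bsub>ob D n,ob D (n - 1),ob C (n - 1)\<^esub> df D n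
          \<boxplus>\<^bsub>ob D n,ob C (n - 1)\<^esub> \<boxminus>\<^bsub>ob D n,ob C (n - 1)\<^esub> (df C n \<bullet>\<^bsub>ob D n,ob C n,ob C (n - 1)\<^esub> c n)"
        using conjunct1[OF elim] conjunct1[OF conjunct2[OF elim]]
        by (simp add: bd_def c_def ty ru cmp_distrib Cmp_assoc Cmp_Idn_right add_comm)
    qed (use elim in \<open>simp_all add: c_def ty\<close>)
    then show ?case using elim by (simp add: c_def ty)
  qed
  have fc: "\<forall>\<^sub>F n in at_top. a n \<in> mor \<C> (ob D n) (ob D (n + 1)) \<and>
      chain_id D n = chain_comp \<C> D C D f c n \<boxplus>\<^bsub>ob D n,ob D n\<^esub> bd D D a n"
    using h
  proof eventually_elim
    case (elim n)
    have "?p1 n \<bullet>\<^bsub>ob ?E n,ob ?E n,ob D n\<^esub> Idn \<C> (ob ?E n) \<bullet>\<^bsub>ob D n,ob ?E n,ob D n\<^esub> ?i1 n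
        = ?p1 n \<bullet>\<^bsub>ob ?E n,ob ?E n,ob D n\<^esub> bd ?E ?E h n \<bullet>\<^bsub>ob D n,ob ?E n,ob D n\<^esub> ?i1 n"
      using elim by simp
    then have "chain_id D n = chain_comp \<C> D C D f c n \<boxplus>\<^bsub>ob D n,ob D n\<^esub> bd D D a n"
      using conjunct1[OF elim] conjunct1[OF conjunct2[OF elim]]
      by (simp add: bd_def c_def a_def chain_id_def chain_comp_def ty ru cmp_distrib Cmp_assoc Cmp_Idn_right add_simps)
    then show ?case using elim by (simp add: a_def ty)
  qed
  have cf: "\<forall>\<^sub>F n in at_top. e n \<in> mor \<C> (ob C n) (ob C (n + 1)) \<and>
      chain_id C n = chain_comp \<C> C D C c f n \<boxplus>\<^bsub>ob C n,ob C n\<^esub> bd C C e n"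
    using eventually_succ[OF at_top h]
  proof eventually_elim
    case (elim n)
    have "?p2 (n + 1) \<bullet>\<^bsub>ob ?E (n + 1),ob ?E (n + 1),ob C n\<^esub> Idn \<C> (ob ?E (n + 1)) \<bullet>\<^bsub>ob C n,ob ?E (n + 1),ob C n\<^esub> ?i2 (n + 1)
        = ?p2 (n + 1) \<bullet>\<^bsub>ob ?E (n + 1),ob ?E (n + 1),ob C n\<^esub> bd ?E ?E h (n + 1) \<bullet>\<^bsub>ob C n,ob ?E (n + 1),ob C n\<^esub> ?i2 (n + 1)"
      using elim by simp
    then have "chain_id C n = chain_comp \<C> C D C c f n \<boxplus>\<^bsub>ob C n,ob C n\<^esub> bd C C e n"
      using conjunct1[OF elim] conjunct1[OF conjunct2[OF elim]]
      by (simp add: bd_def c_def e_def[of n] e1 chain_id_def chain_comp_def ty ru cmp_distrib Cmp_assoc Cmp_Idn_right add_simps)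
    then show ?case using elim by (simp add: e_def ty)
  qed
  have "htpy at_top D D (chain_id D) (chain_comp \<C> D C D f c)" "htpy at_top C C (chain_id C) (chain_comp \<C> C D C c f)"
    unfolding htpy_def using fc cf by blast+
  moreover have fg: "chmap at_top C D f" using f by (simp add: chmap_of_top chmap_top)
  ultimately have "htpy at_top D D (chain_comp \<C> D C D f c) (chain_id D)" "htpy at_top C C (chain_comp \<C> C D C c f) (chain_id C)"
    using C D c by (simp_all add: htpy_sym[OF at_top] chmap_comp[OF at_top])
  with c show ?thesis by blast
qed

end

section \<open>Bounded models for cones of maps invertible in high degrees\<close>

context additive_category
begin

text \<open>
  A contraction of \<open>X\<close> in degrees above \<open>N\<close> leaves an idempotent in degree \<open>N\<close>; if it splits then
  \<open>X\<close> can be cut off there.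
\<close>

lemma truncate_contractible:
  assumes X: "X \<in> complexes \<C>"
    and h: "\<And>n. n \<ge> N \<Longrightarrow> h n \<in> mor \<C> (ob X n) (ob X (n + 1))"
    and contr: "\<And>n. n > N \<Longrightarrow> Idn \<C> (ob X n) = bd X X h n"
    and A: "A \<in> Obj \<C>" and i: "i \<in> mor \<C> A (ob X N)" and r: "r \<in> mor \<C> (ob X N) A"
    and ri: "r \<bullet>\<^bsub>A,ob X N,A\<^esub> i = Idn \<C> A"
    and ir: "Idn \<C> (ob X N) = i \<bullet>\<^bsub>ob X N,A,ob X N\<^esub> r \<boxplus>\<^bsub>ob X N,ob X N\<^esub> df X (N + 1) \<bullet>\<^bsub>ob X N,ob X (N + 1),ob X N\<^esub> h N"
  shows "\<exists>Y f g. hequiv X Y f g \<and> (\<forall>n<N. ob Y n = ob X n) \<and> (\<forall>n>N. zero_object \<C> (ob Y n))"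
proof -
  let ?Z = "the_zero \<C>"
  note ty = cplx_simps[OF X] A i r mor_intros the_zero_Obj
  have hN: "h N \<in> mor \<C> (ob X N) (ob X (N + 1))" "h (N + 1) \<in> mor \<C> (ob X (N + 1)) (ob X (N + 1 + 1))"
    using h[of N] h[of "N + 1"] by auto
  \<comment> \<open>The other summand of the identity in degree \<open>N\<close> is
    \<open>d h\<close>, which \<open>df X N\<close> kills.\<close>
  have dir: "df X N \<bullet>\<^bsub>A,ob X N,ob X (N - 1)\<^esub> i \<bullet>\<^bsub>ob X N,A,ob X (N - 1)\<^esub> r = df X N"
  proof -
    have "df X N = df X N \<bullet>\<^bsub>ob X N,ob X N,ob X (N - 1)\<^esub> Idn \<C> (ob X N)" by (simp add: ty Cmp_Idn_right)
    also have "\<dots> = df X N \<bullet>\<^bsub>A,ob X N,ob X (N - 1)\<^esub> i \<bullet>\<^bsub>ob X N,A,ob X (N - 1)\<^esub> r"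
      unfolding ir using hN by (simp add: ty cmp_distrib Cmp_assoc add_simps)
    finally show ?thesis by simp
  qed
  \<comment> \<open>The contraction in degree \<open>N + 1\<close> gives \<open>d = d h d\<close>.
    Inserting \<open>1 = i r + d h\<close> between \<open>r\<close> and \<open>d\<close> then yields
    \<open>r d = r d + r d\<close>.\<close>
  have rd: "r \<bullet>\<^bsub>ob X (N + 1),ob X N,A\<^esub> df X (N + 1) = zero_mor \<C> (ob X (N + 1)) A"
  proof -
    let ?d = "df X (N + 1)"
    have 1: "?d = ?d \<bullet>\<^bsub>ob X (N + 1),ob X (N + 1),ob X N\<^esub> Idn \<C> (ob X (N + 1))" by (simp add: ty Cmp_Idn_right)
    have d: "?d = ?d \<bullet>\<^bsub>ob X N,ob X (N + 1),ob X N\<^esub> h N \<bullet>\<^bsub>ob X (N + 1),ob X N,ob X N\<^esub> ?d"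
      using 1 contr[of "N + 1"] hN by (simp add: bd_def ty cmp_distrib Cmp_assoc add_simps)
    have "r \<bullet>\<^bsub>ob X (N + 1),ob X N,A\<^esub> ?d = r \<bullet>\<^bsub>ob X (N + 1),ob X N,A\<^esub> (Idn \<C> (ob X N) \<bullet>\<^bsub>ob X (N + 1),ob X N,ob X N\<^esub> ?d)"
      by (simp add: ty Cmp_Idn_left)
    also have "\<dots> = r \<bullet>\<^bsub>ob X (N + 1),ob X N,A\<^esub> ?d \<boxplus>\<^bsub>ob X (N + 1),A\<^esub> r \<bullet>\<^bsub>ob X (N + 1),ob X N,A\<^esub>
        (?d \<bullet>\<^bsub>ob X N,ob X (N + 1),ob X N\<^esub> h N \<bullet>\<^bsub>ob X (N + 1),ob X N,ob X N\<^esub> ?d)"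
      unfolding ir using hN by (simp add: ty cmp_distrib Cmp_assoc ri Cmp_Idn_left)
    also have "\<dots> = r \<bullet>\<^bsub>ob X (N + 1),ob X N,A\<^esub> ?d \<boxplus>\<^bsub>ob X (N + 1),A\<^esub> r \<bullet>\<^bsub>ob X (N + 1),ob X N,A\<^esub> ?d"
      by (simp only: d[symmetric])
    finally have "r \<bullet>\<^bsub>ob X (N + 1),ob X N,A\<^esub> ?d \<boxplus>\<^bsub>ob X (N + 1),A\<^esub> zero_mor \<C> (ob X (N + 1)) A =
        r \<bullet>\<^bsub>ob X (N + 1),ob X N,A\<^esub> ?d \<boxplus>\<^bsub>ob X (N + 1),A\<^esub> r \<bullet>\<^bsub>ob X (N + 1),ob X N,A\<^esub> ?d"
      by (simp add: ty add_zero_right)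
    from add_left_imp_eq[OF _ _ _ _ _ this] show ?thesis by (simp add: ty)
  qed
  \<comment> \<open>\<open>Y\<close> is \<open>X\<close> below \<open>N\<close>, the image
    \<open>A\<close> of the idempotent \<open>i r\<close> in degree \<open>N\<close>, and zero
    above.\<close>
  define Y where "Y = \<lparr>ob = \<lambda>n. if n < N then ob X n else if n = N then A else ?Z,
    df = \<lambda>n. if n < N then df X n else if n = N then df X N \<bullet>\<^bsub>A,ob X N,ob X (N - 1)\<^esub> i
      else zero_mor \<C> ?Z (if n = N + 1 then A else ?Z)\<rparr>"
  have Ylow: "ob Y n = ob X n" "df Y n = df X n" if "n < N" for n using that by (simp_all add: Y_def)
  have YN: "ob Y N = A" "df Y N = df X N \<bullet>\<^bsub>A,ob X N,ob X (N - 1)\<^esub> i" by (simp_all add: Y_def)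
  have YN1: "df Y (N + 1) = zero_mor \<C> ?Z A" by (simp add: Y_def)
  have Yhigh: "ob Y n = ?Z" if "n > N" for n using that by (simp add: Y_def)
  have Yhigh': "df Y n = zero_mor \<C> ?Z ?Z" if "n > N + 1" for n using that by (simp add: Y_def)
  note Y = Ylow YN YN1 Yhigh Yhigh'
  have cases: "n < N \<or> n = N \<or> n = N + 1 \<or> n > N + 1" for n :: int by linarith
  have Yc: "Y \<in> complexes \<C>"
    unfolding complexes_def mem_Collect_eq
  proof
    fix n
    have *: "n + 1 < N \<or> n = N - 1 \<or> n = N \<or> n = N + 1 \<or> n > N + 1" by linarith
    show "ob Y n \<in> Obj \<C> \<and> df Y n \<in> mor \<C> (ob Y n) (ob Y (n - 1)) \<and>
      df Y n \<bullet>\<^bsub>ob Y (n + 1),ob Y n,ob Y (n - 1)\<^esub> df Y (n + 1) = zero_mor \<C> (ob Y (n + 1)) (ob Y (n - 1))"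
      using * by (elim disjE) (auto simp: Y ty Cmp_assoc cmp_distrib)
  qed
  define f where "f n = (if n < N then Idn \<C> (ob X n) else if n = N then r else zero_mor \<C> (ob X n) ?Z)" for n
  define g where "g n = (if n < N then Idn \<C> (ob X n) else if n = N then i else zero_mor \<C> ?Z (ob X n))" for n
  have f: "f \<in> chain_maps \<C> X Y"
    unfolding chain_maps_def mem_Collect_eq
  proof
    fix n show "f n \<in> mor \<C> (ob X n) (ob Y n) \<and>
      df Y n \<bullet>\<^bsub>ob X n,ob Y n,ob Y (n - 1)\<^esub> f n = f (n - 1) \<bullet>\<^bsub>ob X n,ob X (n - 1),ob Y (n - 1)\<^esub> df X n"
      using cases[of n] by (elim disjE) (auto simp: f_def Y ty cmp_distrib Cmp_Idn_left Cmp_Idn_right dir rd)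
  qed
  have g: "g \<in> chain_maps \<C> Y X"
    unfolding chain_maps_def mem_Collect_eq
  proof
    fix n show "g n \<in> mor \<C> (ob Y n) (ob X n) \<and>
      df X n \<bullet>\<^bsub>ob Y n,ob X n,ob X (n - 1)\<^esub> g n = g (n - 1) \<bullet>\<^bsub>ob Y n,ob Y (n - 1),ob X (n - 1)\<^esub> df Y n"
      using cases[of n] by (elim disjE) (auto simp: g_def Y ty cmp_distrib Cmp_Idn_left Cmp_Idn_right)
  qed
  have "f n \<bullet>\<^bsub>ob Y n,ob X n,ob Y n\<^esub> g n = Idn \<C> (ob Y n)" for n
  proof -
    have "zero_mor \<C> ?Z ?Z = Idn \<C> ?Z"
      by (rule mor_to_zero[OF zero_object_the_zero, symmetric]) (simp_all add: the_zero_Obj Idn_mor)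
    then show ?thesis
      using cases[of n] by (elim disjE) (auto simp: f_def g_def Y ty cmp_distrib Cmp_Idn_left ri)
  qed
  then have fg: "homotopic Y Y (chain_comp \<C> Y X Y f g) (chain_id Y)"
    using homotopic_refl[OF Yc Yc chain_maps_id[OF Yc]] by (simp add: chain_comp_def chain_id_def[abs_def])
  define k where "k n = (if n < N then zero_mor \<C> (ob X n) (ob X (n + 1)) else h n)" for n
  have k: "k n \<in> mor \<C> (ob X n) (ob X (n + 1))" for n using h[of n] by (simp add: k_def ty)
  have id: "chain_id X n = chain_comp \<C> X Y X g f n \<boxplus>\<^bsub>ob X n,ob X n\<^esub> bd X X k n" for n
  proof -
    consider "n < N" | "n = N" | "n > N" by linarith
    then show ?thesis
    proof cases
      case 3
      have "bd X X k n = bd X X h n" using 3 by (simp add: bd_def k_def)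
      then show ?thesis
        using 3 contr[OF 3] k[of n] k[of "n - 1"] bd_mor[OF X X, of k n]
        by (simp add: chain_id_def chain_comp_def f_def g_def Y ty cmp_distrib add_zero_left)
    qed (use hN in \<open>auto simp: chain_id_def chain_comp_def f_def g_def k_def bd_def Y ty cmp_distrib add_simps
          Cmp_Idn_left ir\<close>)
  qed
  have "homotopic X X (chain_id X) (chain_comp \<C> X Y X g f)"
    unfolding htpy_top using k id by blast
  then have "homotopic X X (chain_comp \<C> X Y X g f) (chain_id X)"
    using homotopic_sym[OF X X] f g X Yc by (simp add: chain_maps_comp)
  with f g fg X Yc have "hequiv X Y f g" by (simp add: hequiv_def)
  moreover have "\<forall>n>N. zero_object \<C> (ob Y n)" by (simp add: Y zero_object_the_zero)
  ultimately show ?thesis using Ylow(1) by blast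
qed

text \<open>These are the denominators that the proof constructs. Invertibility is required degree
  by degree in the category itself, not merely up to homotopy.\<close>

definition ev_iso :: "('a, 'b) cplx \<Rightarrow> ('a, 'b) cplx \<Rightarrow> (int \<Rightarrow> 'b) \<Rightarrow> bool"
  where "ev_iso C D s \<longleftrightarrow> s \<in> chain_maps \<C> C D \<and> (\<forall>\<^sub>F n in at_top. iso_mor \<C> (ob C n) (ob D n) (s n))"

lemma bounded_belowD: "bounded_below \<C> C \<Longrightarrow> \<exists>N. \<forall>n<N. zero_object \<C> (ob C n)"
  by (simp add: bounded_below_def)

text \<open>Above the degree \<open>M\<close> from which \<open>s\<close> is invertible, the
  homotopy whose single entry is the inverse \<open>t\<close> contracts the cone. The idempotent
  left over in degree \<open>M\<close> splits through \<open>ob C (M - 1)\<close>, so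
  \<open>truncate_contractible\<close> applies; the lower bounds of \<open>C\<close> and
  \<open>D\<close> bound the result on the other side.\<close>

lemma cone_ev_iso_bounded:
  assumes C: "C \<in> complexes \<C>" and D: "D \<in> complexes \<C>" and s: "ev_iso C D s"
    and bC: "bounded_below \<C> C" and bD: "bounded_below \<C> D"
  shows "\<exists>Y f g. hequiv (mapping_cone \<C> C D s) Y f g \<and> bounded_complex \<C> Y"
proof -
  have sc: "s \<in> chain_maps \<C> C D" using s by (simp add: ev_iso_def)
  let ?E = "mapping_cone \<C> C D s" and ?i1 = "cone_incl \<C> C D" and ?p1 = "cone_pr1 C D" and ?p2 = "cone_proj \<C> C D"
    and ?i2 = "cone_in2 C D"
  note ty = cone_ty'[OF C D sc]
  note ru = cone_rules[OF C D sc] cone_rules_comp[OF C D sc]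
  from s obtain M where "\<forall>n\<ge>M. iso_mor \<C> (ob C n) (ob D n) (s n)"
    by (auto simp: ev_iso_def eventually_at_top_linorder)
  then have "\<forall>n. \<exists>t. n \<ge> M \<longrightarrow> t \<in> mor \<C> (ob D n) (ob C n) \<and>
      t \<bullet>\<^bsub>ob C n,ob D n,ob C n\<^esub> s n = Idn \<C> (ob C n) \<and> s n \<bullet>\<^bsub>ob D n,ob C n,ob D n\<^esub> t = Idn \<C> (ob D n)"
    unfolding iso_mor_def by blast
  then obtain t where "\<forall>n. n \<ge> M \<longrightarrow> t n \<in> mor \<C> (ob D n) (ob C n) \<and>
      t n \<bullet>\<^bsub>ob C n,ob D n,ob C n\<^esub> s n = Idn \<C> (ob C n) \<and> s n \<bullet>\<^bsub>ob D n,ob C n,ob D n\<^esub> t n = Idn \<C> (ob D n)"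
    by metis
  then have t: "\<And>n. n \<ge> M \<Longrightarrow> t n \<in> mor \<C> (ob D n) (ob C n)"
    and ts: "\<And>n. n \<ge> M \<Longrightarrow> t n \<bullet>\<^bsub>ob C n,ob D n,ob C n\<^esub> s n = Idn \<C> (ob C n)"
    and st: "\<And>n. n \<ge> M \<Longrightarrow> s n \<bullet>\<^bsub>ob D n,ob C n,ob D n\<^esub> t n = Idn \<C> (ob D n)" by blast+
  \<comment> \<open>\<open>n > M\<close> makes both inverses \<open>t n\<close> and
    \<open>t (n - 1)\<close> available.\<close>
  have td: "df C n \<bullet>\<^bsub>ob D n,ob C n,ob C (n - 1)\<^esub> t n = t (n - 1) \<bullet>\<^bsub>ob D n,ob D (n - 1),ob C (n - 1)\<^esub> df D n" if n: "n > M" for n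
  proof -
    have tn: "t n \<in> mor \<C> (ob D n) (ob C n)" "t (n - 1) \<in> mor \<C> (ob D (n - 1)) (ob C (n - 1))" using t n by auto
    have "df C n \<bullet>\<^bsub>ob D n,ob C n,ob C (n - 1)\<^esub> t n
        = t (n - 1) \<bullet>\<^bsub>ob C (n - 1),ob D (n - 1),ob C (n - 1)\<^esub> s (n - 1) \<bullet>\<^bsub>ob C n,ob C (n - 1),ob C (n - 1)\<^esub> df C n
          \<bullet>\<^bsub>ob D n,ob C n,ob C (n - 1)\<^esub> t n"
      using tn n by (simp add: ts ty Cmp_Idn_left)
    also have "\<dots> = t (n - 1) \<bullet>\<^bsub>ob D n,ob D (n - 1),ob C (n - 1)\<^esub> (s (n - 1) \<bullet>\<^bsub>ob C n,ob C (n - 1),ob D (n - 1)\<^esub> df C n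
          \<bullet>\<^bsub>ob D n,ob C n,ob D (n - 1)\<^esub> t n)"
      using tn by (simp add: ty Cmp_assoc)
    also have "\<dots> = t (n - 1) \<bullet>\<^bsub>ob D n,ob D (n - 1),ob C (n - 1)\<^esub> (df D n \<bullet>\<^bsub>ob D n,ob D n,ob D (n - 1)\<^esub> (s n
          \<bullet>\<^bsub>ob D n,ob C n,ob D n\<^esub> t n))"
      using tn by (simp add: ty Cmp_assoc chain_maps_df[OF sc])
    also have "\<dots> = t (n - 1) \<bullet>\<^bsub>ob D n,ob D (n - 1),ob C (n - 1)\<^esub> df D n"
      using n by (simp add: st ty Cmp_Idn_right)
    finally show ?thesis .
  qed
  have st': "y \<bullet>\<^bsub>ob C n,ob D n,Z\<^esub> s n \<bullet>\<^bsub>ob D n,ob C n,Z\<^esub> t n = y" 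
    if "n \<ge> M" "Z \<in> Obj \<C>" "y \<in> mor \<C> (ob D n) Z" for n Z y
    using comp_eq_comp[OF _ _ _ _ _ _ _ st[OF that(1)], of Z y] that t[of n] by (simp add: ty Cmp_Idn_right)
  have ts': "y \<bullet>\<^bsub>ob D n,ob C n,Z\<^esub> t n \<bullet>\<^bsub>ob C n,ob D n,Z\<^esub> s n = y" 
    if "n \<ge> M" "Z \<in> Obj \<C>" "y \<in> mor \<C> (ob C n) Z" for n Z y
    using comp_eq_comp[OF _ _ _ _ _ _ _ ts[OF that(1)], of Z y] that t[of n] by (simp add: ty Cmp_Idn_right)
  have td': "y \<bullet>\<^bsub>ob D (n - 1),ob C (n - 1),Z\<^esub> t (n - 1) \<bullet>\<^bsub>ob D n,ob D (n - 1),Z\<^esub> df D n =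
      y \<bullet>\<^bsub>ob C n,ob C (n - 1),Z\<^esub> df C n \<bullet>\<^bsub>ob D n,ob C n,Z\<^esub> t n" 
    if "n > M" "Z \<in> Obj \<C>" "y \<in> mor \<C> (ob C (n - 1)) Z" for n Z y
    using comp_eq_comp[OF _ _ _ _ _ _ _ td[OF that(1), symmetric], of Z y] that t[of n] t[of "n - 1"] 
    by (simp add: ty Cmp_assoc)
  define h where "h n = ?i2 (n + 1) \<bullet>\<^bsub>ob D n,ob C n,ob ?E (n + 1)\<^esub> t n \<bullet>\<^bsub>ob ?E n,ob D n,ob ?E (n + 1)\<^esub> ?p1 n" for n
  \<comment> \<open>In degree \<open>M\<close>, \<open>s t = 1\<close> turns
    \<open>d h = d i2 t p1\<close> into \<open>i1 p1 - i2 d t p1\<close>. Subtracting this from the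
    identity leaves exactly \<open>i2 r\<close>.\<close>
  define r where "r = ?p2 M \<boxplus>\<^bsub>ob ?E M,ob C (M - 1)\<^esub> df C M \<bullet>\<^bsub>ob D M,ob C M,ob C (M - 1)\<^esub> t M \<bullet>\<^bsub>ob ?E M,ob D M,ob C (M - 1)\<^esub> ?p1 M"
  have sum: "Idn \<C> (ob ?E n) = ?i1 n \<bullet>\<^bsub>ob ?E n,ob D n,ob ?E n\<^esub> ?p1 n \<boxplus>\<^bsub>ob ?E n,ob ?E n\<^esub>
      ?i2 n \<bullet>\<^bsub>ob ?E n,ob C (n - 1),ob ?E n\<^esub> ?p2 n" for n
    by (rule cone_bp_sum[OF C D sc refl, symmetric])
  have "\<exists>Y f g. hequiv ?E Y f g \<and> (\<forall>n<M. ob Y n = ob ?E n) \<and> (\<forall>n>M. zero_object \<C> (ob Y n))"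
  proof (rule truncate_contractible)
    show "?E \<in> complexes \<C>" by (rule cone_complexes[OF C D sc])
    show "h n \<in> mor \<C> (ob ?E n) (ob ?E (n + 1))" if "n \<ge> M" for n
      using t[OF that] by (simp add: h_def ty)
    show "Idn \<C> (ob ?E n) = bd ?E ?E h n" if "n > M" for n
      using that t[of n] t[of "n - 1"] unfolding sum
      by (simp add: bd_def h_def ty ru cmp_distrib Cmp_assoc st' ts' td' add_simps)
    show "?i2 M \<in> mor \<C> (ob C (M - 1)) (ob ?E M)" "ob C (M - 1) \<in> Obj \<C>" by (simp_all add: ty)
    show "r \<in> mor \<C> (ob ?E M) (ob C (M - 1))" using t[of M] by (simp add: ty r_def)
    show "r \<bullet>\<^bsub>ob C (M - 1),ob ?E M,ob C (M - 1)\<^esub> ?i2 M = Idn \<C> (ob C (M - 1))"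
      using t[of M] by (simp add: r_def ty ru cmp_distrib add_simps)
    show "Idn \<C> (ob ?E M) = ?i2 M \<bullet>\<^bsub>ob ?E M,ob C (M - 1),ob ?E M\<^esub> r \<boxplus>\<^bsub>ob ?E M,ob ?E M\<^esub>
        df ?E (M + 1) \<bullet>\<^bsub>ob ?E M,ob ?E (M + 1),ob ?E M\<^esub> h M"
      using t[of M] unfolding sum by (simp add: r_def h_def ty ru cmp_distrib Cmp_assoc st' add_simps)
  qed
  then obtain Y f g where Y: "hequiv ?E Y f g" "\<And>n. n < M \<Longrightarrow> ob Y n = ob ?E n" "\<And>n. n > M \<Longrightarrow> zero_object \<C> (ob Y n)"
    by blast
  obtain N1 N2 where N: "\<And>n. n < N1 \<Longrightarrow> zero_object \<C> (ob C n)" "\<And>n. n < N2 \<Longrightarrow> zero_object \<C> (ob D n)"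
    using bounded_belowD[OF bC] bounded_belowD[OF bD] by blast
  \<comment> \<open>Above \<open>M\<close> the truncated model is zero. Far below, its object is
    that of the cone, a biproduct of two zero objects.\<close>
  have "zero_object \<C> (ob Y n)" if "\<bar>n\<bar> > \<bar>M\<bar> + \<bar>N1\<bar> + \<bar>N2\<bar>" for n
  proof (cases "n > M")
    case False
    with that have "n < M" "n - 1 < N1" "n < N2" by linarith+
    then show ?thesis
      using Y(2) N zero_object_bsum[of "ob D n" "ob C (n - 1)"] by (simp add: ob_cone[OF C D sc] susp_simps)
  qed (use Y(3) in blast)
  then have "bounded_complex \<C> Y" unfolding bounded_complex_def by blast
  with Y(1) show ?thesis by blast
qed

end

section \<open>Exactness\<close>

text \<open>A factor group is trivial exactly when the subgroup divided out is everything. The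
  assumption \<open>gf\<close> makes the image a subgroup of the kernel, so that this
  applies.\<close>

lemma trivial_homology_iff:
  fixes A :: "'a monoid" and G :: "'b monoid" and C :: "'c monoid"
  assumes A: "comm_group A" and G: "comm_group G" and C: "comm_group C" and f: "f \<in> hom A G" and g: "g \<in> hom G C"
    and gf: "\<And>a. a \<in> carrier A \<Longrightarrow> g (f a) = \<one>\<^bsub>C\<^esub>"
  shows "trivial_group (homology A G C f g) \<longleftrightarrow>
    (\<forall>x\<in>carrier G. g x = \<one>\<^bsub>C\<^esub> \<longrightarrow> (\<exists>a\<in>carrier A. x = f a))"
proof -
  interpret comm_group G by (rule G)
  interpret f: group_hom A G f using A f by (simp add: group_hom_def group_hom_axioms_def comm_group_def G)
  interpret g: group_hom G C g using C g by (simp add: group_hom_def group_hom_axioms_def comm_group_def G)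
  define k where "k = kernel G C g"
  define Z where "Z = G\<lparr>carrier := k\<rparr>"
  define B where "B = f ` carrier A"
  have k: "subgroup k G" unfolding k_def by (rule g.subgroup_kernel)
  have Zs: "carrier Z = k" "x \<otimes>\<^bsub>Z\<^esub> y = x \<otimes>\<^bsub>G\<^esub> y" "\<one>\<^bsub>Z\<^esub> = \<one>\<^bsub>G\<^esub>" for x y by (simp_all add: Z_def)
  have Z: "comm_group Z"
    using subgroup.subgroup_is_group[OF k] k by (auto intro!: group.group_comm_groupI simp: Z_def subgroup.mem_carrier m_comm)
  then interpret Z: comm_group Z .
  have Bk: "B \<subseteq> k" using gf by (auto simp: B_def k_def kernel_def)
  have B: "subgroup B G" unfolding B_def by (rule f.img_is_subgroup)
  then have "subgroup B Z" unfolding Z_def using subgroup_incl[OF B k Bk] by simp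
  then have nB: "normal B Z" by (simp add: Z.normal_iff_subgroup)
  have grp: "group (Z Mod B)" by (rule normal.factorgroup_is_group[OF nB])
  have BZ: "subgroup B Z" by fact
  have one: "\<one>\<^bsub>Z Mod B\<^esub> = B" by (simp add: FactGroup_def)
  have "trivial_group (Z Mod B) \<longleftrightarrow> k \<subseteq> B"
  proof
    assume t: "trivial_group (Z Mod B)"
    show "k \<subseteq> B"
    proof
      fix x assume x: "x \<in> k"
      then have "B #>\<^bsub>Z\<^esub> x \<in> carrier (Z Mod B)"
        by (auto simp: FactGroup_def RCOSETS_def Zs)
      then have "B #>\<^bsub>Z\<^esub> x = B" using t by (simp add: trivial_group_def one)
      moreover have "x \<in> B #>\<^bsub>Z\<^esub> x"
        by (rule Z.rcos_self[OF _ BZ]) (use x in \<open>simp add: Zs\<close>)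
      ultimately show "x \<in> B" by simp
    qed
  next
    assume kB: "k \<subseteq> B"
    have "B #>\<^bsub>Z\<^esub> x = B" if "x \<in> k" for x
      by (rule Z.coset_join2[OF _ BZ]) (use that kB in \<open>auto simp: Zs\<close>)
    moreover have "\<one>\<^bsub>G\<^esub> \<in> k" using k by (rule subgroup.one_closed)
    ultimately have "carrier (Z Mod B) = {B}"
      by (auto simp: FactGroup_def RCOSETS_def Zs)
    then show "trivial_group (Z Mod B)" using grp by (simp add: trivial_group_def one)
  qed
  moreover have "homology A G C f g = Z Mod B" by (simp add: homology_def Z_def B_def k_def)
  ultimately show ?thesis by (auto simp: k_def B_def kernel_def)
qed

context additive_category
begin

definition exact_from :: "'a \<Rightarrow> ('a, 'b) cplx \<Rightarrow> int \<Rightarrow> bool"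
  where "exact_from P C n \<longleftrightarrow> (\<forall>x\<in>mor \<C> P (ob C n).
    df C n \<bullet>\<^bsub>P,ob C n,ob C (n - 1)\<^esub> x = zero_mor \<C> P (ob C (n - 1)) \<longrightarrow>
    (\<exists>y\<in>mor \<C> P (ob C (n + 1)). x = df C (n + 1) \<bullet>\<^bsub>P,ob C (n + 1),ob C n\<^esub> y))"

definition exact_to :: "('a, 'b) cplx \<Rightarrow> 'a \<Rightarrow> int \<Rightarrow> bool"
  where "exact_to C P n \<longleftrightarrow> (\<forall>x\<in>mor \<C> (ob C n) P.
    x \<bullet>\<^bsub>ob C (n + 1),ob C n,P\<^esub> df C (n + 1) = zero_mor \<C> (ob C (n + 1)) P \<longrightarrow>
    (\<exists>y\<in>mor \<C> (ob C (n - 1)) P. x = y \<bullet>\<^bsub>ob C n,ob C (n - 1),P\<^esub> df C n))"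

lemma trivial_homology_hom_from:
  assumes C: "C \<in> complexes \<C>" and P: "P \<in> Obj \<C>"
  shows "trivial_group (homology_hom_from \<C> P C n) \<longleftrightarrow> exact_from P C n"
  unfolding homology_hom_from_def exact_from_def
proof (rule trivial_homology_iff)
  show "Cmp \<C> P (ob C n) (ob C (n - 1)) (df C n) (Cmp \<C> P (ob C (n + 1)) (ob C n) (df C (n + 1)) a) = \<one>\<^bsub>Hom \<C> P (ob C (n - 1))\<^esub>"
    if "a \<in> mor \<C> P (ob C (n + 1))" for a
    using that C P by (simp add: Cmp_assoc cplx_simps cmp_zero_left)
qed (use C P in \<open>auto intro!: Hom_comm_group Cmp_add_right simp: cplx_simps\<close>)

lemma trivial_homology_hom_to:
  assumes C: "C \<in> complexes \<C>" and P: "P \<in> Obj \<C>"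
  shows "trivial_group (homology_hom_to \<C> C P n) \<longleftrightarrow> exact_to C P n"
  unfolding homology_hom_to_def exact_to_def
proof (rule trivial_homology_iff)
  show "Cmp \<C> (ob C (n + 1)) (ob C n) P (Cmp \<C> (ob C n) (ob C (n - 1)) P a (df C n)) (df C (n + 1)) = \<one>\<^bsub>Hom \<C> (ob C (n + 1)) P\<^esub>"
    if "a \<in> mor \<C> (ob C (n - 1)) P" for a
    using that C P by (simp add: cplx_simps cmp_zero_left)
qed (use C P in \<open>auto intro!: Hom_comm_group Cmp_add_left simp: cplx_simps\<close>)

lemma totally_acyclic_iff:
  "C \<in> complexes \<C> \<Longrightarrow> totally_acyclic \<C> C \<longleftrightarrow> (\<forall>P\<in>Obj \<C>. \<forall>n. exact_from P C n \<and> exact_to C P n)"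
  by (auto simp: totally_acyclic_def acyclic_complex_def trivial_homology_hom_from trivial_homology_hom_to)

lemma eventually_acyclic_iff:
  "C \<in> complexes \<C> \<Longrightarrow> eventually_acyclic \<C> C \<longleftrightarrow>
    (\<forall>P\<in>Obj \<C>. \<exists>N. \<forall>n. \<bar>n\<bar> > N \<longrightarrow> exact_from P C n)"
  by (simp add: eventually_acyclic_def trivial_homology_hom_from)

lemma exact_from_zero:
  assumes C: "C \<in> complexes \<C>" and P: "P \<in> Obj \<C>" and z: "zero_object \<C> (ob C n)"
  shows "exact_from P C n"
  unfolding exact_from_def
proof (intro ballI impI)
  fix x assume x: "x \<in> mor \<C> P (ob C n)"
  have "x = df C (n + 1) \<bullet>\<^bsub>P,ob C (n + 1),ob C n\<^esub> zero_mor \<C> P (ob C (n + 1))"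
    using mor_to_zero[OF z P x] C P by (simp add: cplx_simps cmp_zero_right)
  then show "\<exists>y\<in>mor \<C> P (ob C (n + 1)). x = df C (n + 1) \<bullet>\<^bsub>P,ob C (n + 1),ob C n\<^esub> y"
    using C P by (blast intro: zero_mor ob_Obj)
qed

text \<open>For a cycle \<open>x\<close>, the homotopy gives \<open>x = g f x + d h x\<close>. As
  \<open>f x\<close> is a cycle in \<open>D\<close> it is \<open>d y\<close>, and
  \<open>x = d (g y + h x)\<close>.\<close>

lemma exact_from_hequiv:
  assumes fg: "hequiv C D f g" and P: "P \<in> Obj \<C>" and ex: "exact_from P D n"
  shows "exact_from P C n"
  unfolding exact_from_def
proof (intro ballI impI)
  have C: "C \<in> complexes \<C>" and D: "D \<in> complexes \<C>" and f: "f \<in> chain_maps \<C> C D" and g: "g \<in> chain_maps \<C> D C"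
    using fg by (auto simp: hequiv_def)
  have "homotopic C C (chain_id C) (chain_comp \<C> C D C g f)"
    using fg homotopic_sym[OF C C chain_maps_id[OF C]] by (simp add: hequiv_def)
  then obtain h where h: "\<And>n. h n \<in> mor \<C> (ob C n) (ob C (n + 1))"
    and id: "\<And>n. Idn \<C> (ob C n) = g n \<bullet>\<^bsub>ob C n,ob D n,ob C n\<^esub> f n \<boxplus>\<^bsub>ob C n,ob C n\<^esub> bd C C h n"
    unfolding htpy_top chain_id_def chain_comp_def by blast
  note ty = cplx_simps[OF C] cplx_simps[OF D] chain_maps_mor[OF f] chain_maps_mor[OF g] P h h[of "n - 1", simplified] mor_intros
  fix x assume x: "x \<in> mor \<C> P (ob C n)"
    and dx: "df C n \<bullet>\<^bsub>P,ob C n,ob C (n - 1)\<^esub> x = zero_mor \<C> P (ob C (n - 1))"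
  have hdx: "h (n - 1) \<bullet>\<^bsub>ob C n,ob C (n - 1),ob C n\<^esub> df C n \<bullet>\<^bsub>P,ob C n,ob C n\<^esub> x = zero_mor \<C> P (ob C n)"
    using comp_eq_comp[OF _ _ _ _ _ _ _ dx, of "ob C n" "h (n - 1)"] x by (simp add: ty cmp_zero_right)
  have "df D n \<bullet>\<^bsub>P,ob D n,ob D (n - 1)\<^esub> (f n \<bullet>\<^bsub>P,ob C n,ob D n\<^esub> x)
      = f (n - 1) \<bullet>\<^bsub>P,ob C (n - 1),ob D (n - 1)\<^esub> (df C n \<bullet>\<^bsub>P,ob C n,ob C (n - 1)\<^esub> x)"
    by (subst (1 2) Cmp_assoc) (use x in \<open>simp_all add: ty chain_maps_df[OF f]\<close>)
  then have "df D n \<bullet>\<^bsub>P,ob D n,ob D (n - 1)\<^esub> (f n \<bullet>\<^bsub>P,ob C n,ob D n\<^esub> x) = zero_mor \<C> P (ob D (n - 1))"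
    using x by (simp add: dx ty cmp_zero_right)
  then obtain y where y: "y \<in> mor \<C> P (ob D (n + 1))"
    and fx: "f n \<bullet>\<^bsub>P,ob C n,ob D n\<^esub> x = df D (n + 1) \<bullet>\<^bsub>P,ob D (n + 1),ob D n\<^esub> y"
    using ex x unfolding exact_from_def by (blast intro: Cmp_mor P ob_Obj C D chain_maps_mor[OF f])
  have gfx: "g n \<bullet>\<^bsub>ob C n,ob D n,ob C n\<^esub> f n \<bullet>\<^bsub>P,ob C n,ob C n\<^esub> x
      = df C (n + 1) \<bullet>\<^bsub>ob D (n + 1),ob C (n + 1),ob C n\<^esub> g (n + 1) \<bullet>\<^bsub>P,ob D (n + 1),ob C n\<^esub> y"
    using comp_eq_comp[OF _ _ _ _ _ _ _ fx, of "ob C n" "g n"] x y chain_maps_df[OF g, of n "n + 1"]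
    by (simp add: ty Cmp_assoc)
  have "x = Idn \<C> (ob C n) \<bullet>\<^bsub>P,ob C n,ob C n\<^esub> x" using x by (simp add: ty Cmp_Idn_left)
  also have "\<dots> = df C (n + 1) \<bullet>\<^bsub>P,ob C (n + 1),ob C n\<^esub> (g (n + 1) \<bullet>\<^bsub>P,ob D (n + 1),ob C (n + 1)\<^esub> y
      \<boxplus>\<^bsub>P,ob C (n + 1)\<^esub> h n \<bullet>\<^bsub>P,ob C n,ob C (n + 1)\<^esub> x)"
    unfolding id using x y by (simp add: bd_def ty cmp_distrib Cmp_assoc hdx gfx add_simps)
  finally show "\<exists>y\<in>mor \<C> P (ob C (n + 1)). x = df C (n + 1) \<bullet>\<^bsub>P,ob C (n + 1),ob C n\<^esub> y"
    using x y by (blast intro: Cmp_mor add_mor P ob_Obj C D chain_maps_mor[OF g] h)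
qed

text \<open>Dually, \<open>x d = 0\<close> leaves \<open>x = x g f + x h d\<close>; with
  \<open>x g = y d\<close> this is \<open>(y f + x h) d\<close>.\<close>

lemma exact_to_hequiv:
  assumes fg: "hequiv C D f g" and P: "P \<in> Obj \<C>" and ex: "exact_to D P n"
  shows "exact_to C P n"
  unfolding exact_to_def
proof (intro ballI impI)
  have C: "C \<in> complexes \<C>" and D: "D \<in> complexes \<C>" and f: "f \<in> chain_maps \<C> C D" and g: "g \<in> chain_maps \<C> D C"
    using fg by (auto simp: hequiv_def)
  have "homotopic C C (chain_id C) (chain_comp \<C> C D C g f)"
    using fg homotopic_sym[OF C C chain_maps_id[OF C]] by (simp add: hequiv_def)
  then obtain h where h: "\<And>n. h n \<in> mor \<C> (ob C n) (ob C (n + 1))"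
    and id: "\<And>n. Idn \<C> (ob C n) = g n \<bullet>\<^bsub>ob C n,ob D n,ob C n\<^esub> f n \<boxplus>\<^bsub>ob C n,ob C n\<^esub> bd C C h n"
    unfolding htpy_top chain_id_def chain_comp_def by blast
  note ty = cplx_simps[OF C] cplx_simps[OF D] chain_maps_mor[OF f] chain_maps_mor[OF g] P h h[of "n - 1", simplified] mor_intros
  fix x assume x: "x \<in> mor \<C> (ob C n) P"
    and xd: "x \<bullet>\<^bsub>ob C (n + 1),ob C n,P\<^esub> df C (n + 1) = zero_mor \<C> (ob C (n + 1)) P"
  have "x \<bullet>\<^bsub>ob D n,ob C n,P\<^esub> g n \<bullet>\<^bsub>ob D (n + 1),ob D n,P\<^esub> df D (n + 1)
      = x \<bullet>\<^bsub>ob C (n + 1),ob C n,P\<^esub> df C (n + 1) \<bullet>\<^bsub>ob D (n + 1),ob C (n + 1),P\<^esub> g (n + 1)"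
    by (subst (1 2) Cmp_assoc[symmetric]) (use x chain_maps_df[OF g, of n "n + 1"] in \<open>simp_all add: ty\<close>)
  then have "x \<bullet>\<^bsub>ob D n,ob C n,P\<^esub> g n \<bullet>\<^bsub>ob D (n + 1),ob D n,P\<^esub> df D (n + 1) = zero_mor \<C> (ob D (n + 1)) P"
    using x by (simp add: xd ty cmp_zero_left)
  then obtain y where y: "y \<in> mor \<C> (ob D (n - 1)) P"
    and xg: "x \<bullet>\<^bsub>ob D n,ob C n,P\<^esub> g n = y \<bullet>\<^bsub>ob D n,ob D (n - 1),P\<^esub> df D n"
    using ex x unfolding exact_to_def by (blast intro: Cmp_mor P ob_Obj C D chain_maps_mor[OF g])
  have "x = x \<bullet>\<^bsub>ob C n,ob C n,P\<^esub> Idn \<C> (ob C n)" using x by (simp add: ty Cmp_Idn_right)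
  also have "\<dots> = y \<bullet>\<^bsub>ob D n,ob D (n - 1),P\<^esub> df D n \<bullet>\<^bsub>ob C n,ob D n,P\<^esub> f n \<boxplus>\<^bsub>ob C n,P\<^esub>
      x \<bullet>\<^bsub>ob C (n - 1),ob C n,P\<^esub> h (n - 1) \<bullet>\<^bsub>ob C n,ob C (n - 1),P\<^esub> df C n"
    unfolding id using x y by (simp add: bd_def ty cmp_distrib Cmp_assoc xg xd add_simps)
  also have "y \<bullet>\<^bsub>ob D n,ob D (n - 1),P\<^esub> df D n \<bullet>\<^bsub>ob C n,ob D n,P\<^esub> f n
      = y \<bullet>\<^bsub>ob C (n - 1),ob D (n - 1),P\<^esub> f (n - 1) \<bullet>\<^bsub>ob C n,ob C (n - 1),P\<^esub> df C n"
    by (subst (1 2) Cmp_assoc[symmetric]) (use y in \<open>simp_all add: ty chain_maps_df[OF f]\<close>)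
  also have "y \<bullet>\<^bsub>ob C (n - 1),ob D (n - 1),P\<^esub> f (n - 1) \<bullet>\<^bsub>ob C n,ob C (n - 1),P\<^esub> df C n \<boxplus>\<^bsub>ob C n,P\<^esub>
      x \<bullet>\<^bsub>ob C (n - 1),ob C n,P\<^esub> h (n - 1) \<bullet>\<^bsub>ob C n,ob C (n - 1),P\<^esub> df C n
      = (y \<bullet>\<^bsub>ob C (n - 1),ob D (n - 1),P\<^esub> f (n - 1) \<boxplus>\<^bsub>ob C (n - 1),P\<^esub>
        x \<bullet>\<^bsub>ob C (n - 1),ob C n,P\<^esub> h (n - 1)) \<bullet>\<^bsub>ob C n,ob C (n - 1),P\<^esub> df C n"
    using x y by (simp add: ty cmp_distrib)
  finally show "\<exists>y\<in>mor \<C> (ob C (n - 1)) P. x = y \<bullet>\<^bsub>ob C n,ob C (n - 1),P\<^esub> df C n"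
    using x y by (auto intro!: bexI[rotated] simp: ty)
qed

text \<open>Exactness in degree \<open>n\<close> involves three consecutive degrees, and composition
  with \<open>s\<close> is bijective on \<open>mor \<C> P\<close> in each of them.\<close>

lemma exact_from_iso:
  assumes C: "C \<in> complexes \<C>" and D: "D \<in> complexes \<C>" and s: "s \<in> chain_maps \<C> C D" and P: "P \<in> Obj \<C>"
    and iso: "\<And>m. m \<in> {n - 1, n, n + 1} \<Longrightarrow> iso_mor \<C> (ob C m) (ob D m) (s m)"
  shows "exact_from P C n \<longleftrightarrow> exact_from P D n"
proof -
  note ty = cplx_simps[OF C] cplx_simps[OF D] chain_maps_mor[OF s] P mor_intros
  have ds: "df D m \<bullet>\<^bsub>P,ob D m,ob D (m - 1)\<^esub> (s m \<bullet>\<^bsub>P,ob C m,ob D m\<^esub> x) 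
      = s (m - 1) \<bullet>\<^bsub>P,ob C (m - 1),ob D (m - 1)\<^esub> (df C m \<bullet>\<^bsub>P,ob C m,ob C (m - 1)\<^esub> x)"
    if "x \<in> mor \<C> P (ob C m)" for m x
    by (subst (1 2) Cmp_assoc) (use that in \<open>simp_all add: ty chain_maps_df[OF s]\<close>)
  have surj: "\<exists>x'\<in>mor \<C> P (ob C m). x = s m \<bullet>\<^bsub>P,ob C m,ob D m\<^esub> x'"
    if m: "m \<in> {n - 1, n, n + 1}" and x: "x \<in> mor \<C> P (ob D m)" for m x
  proof -
    obtain t where t: "t \<in> mor \<C> (ob D m) (ob C m)" "s m \<bullet>\<^bsub>ob D m,ob C m,ob D m\<^esub> t = Idn \<C> (ob D m)"
      using iso[OF m] unfolding iso_mor_def by blast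
    have "x = s m \<bullet>\<^bsub>P,ob C m,ob D m\<^esub> (t \<bullet>\<^bsub>P,ob D m,ob C m\<^esub> x)"
      using t x by (simp add: ty Cmp_assoc Cmp_Idn_left)
    with t x show ?thesis by (blast intro: Cmp_mor P ob_Obj C D)
  qed
  have inj: "x = y" if m: "m \<in> {n - 1, n, n + 1}" and x: "x \<in> mor \<C> P (ob C m)" and y: "y \<in> mor \<C> P (ob C m)"
    and eq: "s m \<bullet>\<^bsub>P,ob C m,ob D m\<^esub> x = s m \<bullet>\<^bsub>P,ob C m,ob D m\<^esub> y" for m x y
  proof -
    obtain t where t: "t \<in> mor \<C> (ob D m) (ob C m)" "t \<bullet>\<^bsub>ob C m,ob D m,ob C m\<^esub> s m = Idn \<C> (ob C m)"
      using iso[OF m] unfolding iso_mor_def by blast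
    have "t \<bullet>\<^bsub>P,ob D m,ob C m\<^esub> (s m \<bullet>\<^bsub>P,ob C m,ob D m\<^esub> x) = t \<bullet>\<^bsub>P,ob D m,ob C m\<^esub> (s m \<bullet>\<^bsub>P,ob C m,ob D m\<^esub> y)"
      by (simp only: eq)
    then show ?thesis using t x y by (simp add: ty Cmp_assoc Cmp_Idn_left)
  qed
  show ?thesis
  proof
    assume ex: "exact_from P C n"
    show "exact_from P D n" unfolding exact_from_def
    proof (intro ballI impI)
      fix x assume x: "x \<in> mor \<C> P (ob D n)"
        and dx: "df D n \<bullet>\<^bsub>P,ob D n,ob D (n - 1)\<^esub> x = zero_mor \<C> P (ob D (n - 1))"
      obtain x' where x': "x' \<in> mor \<C> P (ob C n)" "x = s n \<bullet>\<^bsub>P,ob C n,ob D n\<^esub> x'" using surj[OF _ x] by auto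
      have "df C n \<bullet>\<^bsub>P,ob C n,ob C (n - 1)\<^esub> x' = zero_mor \<C> P (ob C (n - 1))"
        by (rule inj[of "n - 1"]) (use x' dx ds[of x' n] in \<open>simp_all add: ty cmp_zero_right\<close>)
      then obtain y where y: "y \<in> mor \<C> P (ob C (n + 1))" "x' = df C (n + 1) \<bullet>\<^bsub>P,ob C (n + 1),ob C n\<^esub> y"
        using ex x' unfolding exact_from_def by blast
      have "x = df D (n + 1) \<bullet>\<^bsub>P,ob D (n + 1),ob D n\<^esub> (s (n + 1) \<bullet>\<^bsub>P,ob C (n + 1),ob D (n + 1)\<^esub> y)"
        using ds[of y "n + 1"] y x' by simp
      then show "\<exists>y\<in>mor \<C> P (ob D (n + 1)). x = df D (n + 1) \<bullet>\<^bsub>P,ob D (n + 1),ob D n\<^esub> y"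
        using y by (blast intro: Cmp_mor P ob_Obj C D chain_maps_mor[OF s])
    qed
  next
    assume ex: "exact_from P D n"
    show "exact_from P C n" unfolding exact_from_def
    proof (intro ballI impI)
      fix x assume x: "x \<in> mor \<C> P (ob C n)"
        and dx: "df C n \<bullet>\<^bsub>P,ob C n,ob C (n - 1)\<^esub> x = zero_mor \<C> P (ob C (n - 1))"
      have "df D n \<bullet>\<^bsub>P,ob D n,ob D (n - 1)\<^esub> (s n \<bullet>\<^bsub>P,ob C n,ob D n\<^esub> x) = zero_mor \<C> P (ob D (n - 1))"
        using ds[OF x] by (simp add: dx ty cmp_zero_right)
      then obtain y where y: "y \<in> mor \<C> P (ob D (n + 1))" "s n \<bullet>\<^bsub>P,ob C n,ob D n\<^esub> x = df D (n + 1) \<bullet>\<^bsub>P,ob D (n + 1),ob D n\<^esub> y"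
        using ex x unfolding exact_from_def by (blast intro: Cmp_mor P ob_Obj C D chain_maps_mor[OF s])
      obtain z where z: "z \<in> mor \<C> P (ob C (n + 1))" "y = s (n + 1) \<bullet>\<^bsub>P,ob C (n + 1),ob D (n + 1)\<^esub> z"
        using surj[OF _ y(1)] by auto
      have "x = df C (n + 1) \<bullet>\<^bsub>P,ob C (n + 1),ob C n\<^esub> z"
        by (rule inj[of n]) (use x y z ds[of z "n + 1"] in \<open>simp_all add: ty\<close>)
      with z show "\<exists>y\<in>mor \<C> P (ob C (n + 1)). x = df C (n + 1) \<bullet>\<^bsub>P,ob C (n + 1),ob C n\<^esub> y" by blast
    qed
  qed
qed

lemma eventually_acyclic_ev_iso:
  assumes C: "C \<in> complexes \<C>" and D: "D \<in> complexes \<C>" and s: "ev_iso C D s"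
    and bC: "bounded_below \<C> C" and bD: "bounded_below \<C> D"
  shows "eventually_acyclic \<C> C \<longleftrightarrow> eventually_acyclic \<C> D"
proof -
  from s obtain M where M: "\<And>n. n \<ge> M \<Longrightarrow> iso_mor \<C> (ob C n) (ob D n) (s n)" and sc: "s \<in> chain_maps \<C> C D"
    by (auto simp: ev_iso_def eventually_at_top_linorder)
  obtain N1 N2 where N: "\<And>n. n < N1 \<Longrightarrow> zero_object \<C> (ob C n)" "\<And>n. n < N2 \<Longrightarrow> zero_object \<C> (ob D n)"
    using bounded_belowD[OF bC] bounded_belowD[OF bD] by blast
  \<comment> \<open>The summand 1 leaves room for degree \<open>n - 1\<close>, which exactness in
    degree \<open>n\<close> involves.\<close>
  define R where "R = \<bar>M\<bar> + \<bar>N1\<bar> + \<bar>N2\<bar> + 1"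
  have eq: "exact_from P C n \<longleftrightarrow> exact_from P D n" if "\<bar>n\<bar> > R" "P \<in> Obj \<C>" for n P
  proof (cases "n > 0")
    case True
    then have "n - 1 \<ge> M" using that by (simp add: R_def)
    then show ?thesis by (intro exact_from_iso[OF C D sc that(2)] M) auto
  next
    case False
    then have "n < N1" "n < N2" using that by (simp_all add: R_def)
    then show ?thesis using exact_from_zero C D N that(2) by blast
  qed
  have "(\<exists>N. \<forall>n. \<bar>n\<bar> > N \<longrightarrow> exact_from P C n) \<longleftrightarrow> (\<exists>N. \<forall>n. \<bar>n\<bar> > N \<longrightarrow> exact_from P D n)" if P: "P \<in> Obj \<C>" for P
  proof
    assume "\<exists>N. \<forall>n. \<bar>n\<bar> > N \<longrightarrow> exact_from P C n"
    then obtain N where "\<forall>n. \<bar>n\<bar> > N \<longrightarrow> exact_from P C n" by blast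
    then have "\<forall>n. \<bar>n\<bar> > max N R \<longrightarrow> exact_from P D n" using eq[OF _ P] by auto
    then show "\<exists>N. \<forall>n. \<bar>n\<bar> > N \<longrightarrow> exact_from P D n" by blast
  next
    assume "\<exists>N. \<forall>n. \<bar>n\<bar> > N \<longrightarrow> exact_from P D n"
    then obtain N where "\<forall>n. \<bar>n\<bar> > N \<longrightarrow> exact_from P D n" by blast
    then have "\<forall>n. \<bar>n\<bar> > max N R \<longrightarrow> exact_from P C n" using eq[OF _ P] by auto
    then show "\<exists>N. \<forall>n. \<bar>n\<bar> > N \<longrightarrow> exact_from P C n" by blast
  qed
  then show ?thesis by (simp add: eventually_acyclic_iff C D)
qed

end

section \<open>Distinguished triangles and calculation up to homotopy\<close>

lemma saturate_triangles_simps: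
  "Obj (saturate_triangles T) = Obj T" "Hom (saturate_triangles T) = Hom T" "Idn (saturate_triangles T) = Idn T"
  "Cmp (saturate_triangles T) = Cmp T" "SuspO (saturate_triangles T) = SuspO T" "SuspM (saturate_triangles T) = SuspM T"
  by (simp_all add: saturate_triangles_def)

lemma full_sub_simps:
  "Obj (full_sub T S) = S" "Hom (full_sub T S) = Hom T" "Idn (full_sub T S) = Idn T"
  "Cmp (full_sub T S) = Cmp T" "SuspO (full_sub T S) = SuspO T" "SuspM (full_sub T S) = SuspM T"
  "(X, Y, Z, u, v, w) \<in> Dist (full_sub T S) \<longleftrightarrow> (X, Y, Z, u, v, w) \<in> Dist T \<and> X \<in> S \<and> Y \<in> S \<and> Z \<in> S"
  by (simp_all add: full_sub_def)

text \<open>\<open>triangles\<close> and \<open>triangle_iso\<close> do not look at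
  \<open>Dist\<close>, so both may be taken in the saturated category.\<close>

lemma Dist_saturate_triangles:
  "t \<in> Dist (saturate_triangles T) \<longleftrightarrow>
    t \<in> triangles (saturate_triangles T) \<and> (\<exists>t'\<in>Dist T. triangle_iso (saturate_triangles T) t t')"
proof -
  have "triangles (saturate_triangles T) = triangles T"
    by (simp add: triangles_def saturate_triangles_simps)
  moreover have "triangle_iso (saturate_triangles T) t t' \<longleftrightarrow> triangle_iso T t t'" for t t'
    by (cases t; cases t') (simp add: iso_mor_def saturate_triangles_simps)
  ultimately show ?thesis by (auto simp: saturate_triangles_def)
qed

context additive_category
begin

lemma Dist_K:
  "t \<in> Dist K \<longleftrightarrow> t \<in> triangles K \<and> (\<exists>C D f. C \<in> complexes \<C> \<and> D \<in> complexes \<C> \<and> f \<in> chain_maps \<C> C D \<and>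
    triangle_iso K t (C, D, mapping_cone \<C> C D f, hclass \<C> C D f,
      hclass \<C> D (mapping_cone \<C> C D f) (cone_incl \<C> C D),
      hclass \<C> (mapping_cone \<C> C D f) (susp \<C> C) (cone_proj \<C> C D)))"
  unfolding homotopy_category_def Dist_saturate_triangles tricat.select_convs by blast

text \<open>All typing conditions are bundled with the homotopy, so that calculations chain without
  side conditions; the reflexive instance \<open>heq F C D f f\<close> serves as the typing
  judgement for \<open>f\<close>.\<close>

definition heq :: "int filter \<Rightarrow> ('a, 'b) cplx \<Rightarrow> ('a, 'b) cplx \<Rightarrow> (int \<Rightarrow> 'b) \<Rightarrow> (int \<Rightarrow> 'b) \<Rightarrow> bool"
  where "heq F C D f g \<longleftrightarrow> C \<in> complexes \<C> \<and> D \<in> complexes \<C> \<and> chmap F C D f \<and> chmap F C D g \<and> htpy F C D f g"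

abbreviation "cc \<equiv> chain_comp \<C>"

context
  fixes F :: "int filter"
  assumes F: "F = all_deg \<or> F = at_top"
begin

lemma heq_refl: "\<lbrakk>C \<in> complexes \<C>; D \<in> complexes \<C>; chmap F C D f\<rbrakk> \<Longrightarrow> heq F C D f f"
  by (simp add: heq_def htpy_refl[OF F])

lemma heq_refl_left: "heq F C D f g \<Longrightarrow> heq F C D f f"
  by (simp add: heq_def htpy_refl[OF F])

lemma heq_refl_right: "heq F C D f g \<Longrightarrow> heq F C D g g"
  by (simp add: heq_def htpy_refl[OF F])

lemma heq_sym: "heq F C D f g \<Longrightarrow> heq F C D g f"
  using htpy_sym[OF F] by (simp add: heq_def)

lemma heq_trans [trans]: "heq F C D f g \<Longrightarrow> heq F C D g h \<Longrightarrow> heq F C D f h"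
  using htpy_trans[OF F] unfolding heq_def by blast

lemma heq_eq: "\<lbrakk>heq F C D f f; \<forall>\<^sub>F n in F. f n = g n\<rbrakk> \<Longrightarrow> heq F C D f g"
  unfolding heq_def using htpy_eq[OF F] chmap_cong[OF F] by blast

lemma heq_comp:
  assumes g: "heq F D E g g'" and f: "heq F C D f f'"
  shows "heq F C E (cc C D E g f) (cc C D E g' f')"
proof -
  have 1: "htpy F C E (cc C D E g f) (cc C D E g f')"
    using f g unfolding heq_def by (intro htpy_comp_left[OF F]) auto
  have 2: "htpy F C E (cc C D E g f') (cc C D E g' f')"
    using f g unfolding heq_def by (intro htpy_comp_right[OF F]) auto
  have "chmap F C E (cc C D E g f)" "chmap F C E (cc C D E g' f')"
    using f g unfolding heq_def by (auto intro: chmap_comp[OF F])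
  then show ?thesis using f g 1 2 htpy_trans[OF F, of C E "cc C D E g' f'"] unfolding heq_def by blast
qed

lemma heq_assoc:
  assumes "heq F B C f f" "heq F C D g g" "heq F D E h h"
  shows "heq F B E (cc B D E h (cc B C D g f)) (cc B C E (cc C D E h g) f)"
  by (rule heq_eq, intro heq_comp assms)
    (use assms in \<open>auto simp: heq_def intro: chain_comp_assoc\<close>)

lemma heq_id: "C \<in> complexes \<C> \<Longrightarrow> heq F C C (chain_id C) (chain_id C)"
  by (simp add: heq_refl chmap_id[OF F])

lemma heq_id_left: assumes f: "heq F C D f f" shows "heq F C D (cc C D D (chain_id D) f) f"
proof (rule heq_eq)
  show "heq F C D (cc C D D (chain_id D) f) (cc C D D (chain_id D) f)"
    by (intro heq_comp heq_id f) (use f in \<open>simp_all add: heq_def\<close>)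
  have "chmap F C D f" "C \<in> complexes \<C>" "D \<in> complexes \<C>" using f by (auto simp: heq_def)
  then show "\<forall>\<^sub>F n in F. cc C D D (chain_id D) f n = f n"
    unfolding chmap_def by (auto elim!: eventually_mono simp: chain_comp_def chain_id_def Cmp_Idn_left ob_Obj)
qed

lemma heq_id_right: assumes f: "heq F C D f f" shows "heq F C D (cc C C D f (chain_id C)) f"
proof (rule heq_eq)
  show "heq F C D (cc C C D f (chain_id C)) (cc C C D f (chain_id C))"
    by (intro heq_comp heq_id f) (use f in \<open>simp_all add: heq_def\<close>)
  have "chmap F C D f" "C \<in> complexes \<C>" "D \<in> complexes \<C>" using f by (auto simp: heq_def)
  then show "\<forall>\<^sub>F n in F. cc C C D f (chain_id C) n = f n"
    unfolding chmap_def by (auto elim!: eventually_mono simp: chain_comp_def chain_id_def Cmp_Idn_right ob_Obj)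
qed

lemma heq_add:
  assumes "heq F C D f f'" "heq F C D g g'"
  shows "heq F C D (chain_add C D f g) (chain_add C D f' g')"
  using assms unfolding heq_def by (auto intro!: htpy_add[OF F] chmap_add[OF F])

lemma heq_susp: "heq F C D f g \<Longrightarrow> heq F (susp \<C> C) (susp \<C> D) (susp_map f) (susp_map g)"
  using htpy_susp[OF F] chmap_susp[OF F] by (simp add: heq_def susp_complexes)

lemma heq_add_comp:
  assumes f: "heq F C D f f" and g: "heq F D E g g" and g': "heq F D E g' g'"
  shows "heq F C E (cc C D E (chain_add D E g g') f) (chain_add C E (cc C D E g f) (cc C D E g' f))"
proof (rule heq_eq)
  show "heq F C E (cc C D E (chain_add D E g g') f) (cc C D E (chain_add D E g g') f)"
    by (intro heq_comp heq_add assms)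
  have ch: "chmap F C D f" "chmap F D E g" "chmap F D E g'" and ob: "C \<in> complexes \<C>" "D \<in> complexes \<C>" "E \<in> complexes \<C>"
    using assms by (auto simp: heq_def)
  show "\<forall>\<^sub>F n in F. cc C D E (chain_add D E g g') f n = chain_add C E (cc C D E g f) (cc C D E g' f) n"
    using ch unfolding chmap_def
    by eventually_elim (use ob in \<open>simp add: chain_comp_def chain_add_def cmp_add_left ob_Obj\<close>)
qed

end

abbreviation "keq \<equiv> heq all_deg"
abbreviation "geq \<equiv> heq at_top"

lemma at_top: "at_top = all_deg \<or> at_top = (at_top :: int filter)" by simp

lemmas keq_sym = heq_sym[OF all_deg]
lemmas keq_trans [trans] = heq_trans[OF all_deg]
lemmas keq_comp = heq_comp[OF all_deg]
lemmas keq_assoc = heq_assoc[OF all_deg]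
lemmas keq_id = heq_id[OF all_deg]
lemmas keq_id_left = heq_id_left[OF all_deg]
lemmas keq_id_right = heq_id_right[OF all_deg]
lemmas keq_add = heq_add[OF all_deg]

lemmas geq_sym = heq_sym[OF at_top]
lemmas geq_trans [trans] = heq_trans[OF at_top]
lemmas geq_comp = heq_comp[OF at_top]
lemmas geq_assoc = heq_assoc[OF at_top]
lemmas geq_id = heq_id[OF at_top]
lemmas geq_id_right = heq_id_right[OF at_top]
lemmas geq_eq = heq_eq[OF at_top]
lemmas geq_refl_left = heq_refl_left[OF at_top]
lemmas geq_refl_right = heq_refl_right[OF at_top]

lemma geq_if_keq: "keq C D f g \<Longrightarrow> geq C D f g"
  by (auto simp: heq_def intro: chmap_of_top htpy_of_top)

lemma keq_iff: "keq C D f g \<longleftrightarrow> C \<in> complexes \<C> \<and> D \<in> complexes \<C> \<and> f \<in> chain_maps \<C> C D \<and> g \<in> chain_maps \<C> C D \<and>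
    hclass \<C> C D f = hclass \<C> C D g"
  unfolding heq_def chmap_top using hclass_eq_iff by blast

lemma keq_self: "keq C D f f \<longleftrightarrow> C \<in> complexes \<C> \<and> D \<in> complexes \<C> \<and> f \<in> chain_maps \<C> C D"
  by (simp add: keq_iff)

lemma hequiv_keq: "hequiv C D f g \<longleftrightarrow> keq C D f f \<and> keq D C g g \<and> keq C C (cc C D C g f) (chain_id C) \<and>
    keq D D (cc D C D f g) (chain_id D)"
  unfolding hequiv_def heq_def chmap_top by (auto simp: homotopic_refl chain_maps_comp chain_maps_id)

text \<open>Cancellation is stated for either filter, because it serves chain homotopy equivalences
  as well as inverses of germs.\<close>

lemma hequiv_inv_left:
  assumes F: "F = all_deg \<or> F = at_top"
    and "heq F D C g g" "heq F C D f f" "heq F C C (cc C D C g f) (chain_id C)" "heq F B C x x"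
  shows "heq F B C (cc B D C g (cc B C D f x)) x"
proof -
  note [trans] = heq_trans[OF F]
  have "heq F B C (cc B D C g (cc B C D f x)) (cc B C C (cc C D C g f) x)"
    by (intro heq_assoc[OF F] assms)
  also have "heq F B C \<dots> (cc B C C (chain_id C) x)" by (intro heq_comp[OF F] assms)
  also have "heq F B C \<dots> x" by (intro heq_id_left[OF F] assms)
  finally show ?thesis .
qed

lemma hequiv_inv_right:
  assumes F: "F = all_deg \<or> F = at_top"
    and "heq F D C g g" "heq F C D f f" "heq F C C (cc C D C g f) (chain_id C)" "heq F C B x x"
  shows "heq F C B (cc C D B (cc D C B x g) f) x"
proof -
  note [trans] = heq_trans[OF F]
  have "heq F C B (cc C D B (cc D C B x g) f) (cc C C B x (cc C D C g f))"
    by (rule heq_sym[OF F], intro heq_assoc[OF F] assms)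
  also have "heq F C B \<dots> (cc C C B x (chain_id C))" by (intro heq_comp[OF F] assms)
  also have "heq F C B \<dots> x" by (intro heq_id_right[OF F] assms)
  finally show ?thesis .
qed

lemma K_comp_keq:
  assumes f: "keq C D f f" and g: "keq D E g g"
  shows "Cmp K C D E (hclass \<C> D E g) (hclass \<C> C D f) = hclass \<C> C E (cc C D E g f)"
  using assms by (intro K_comp) (auto simp: keq_self)

text \<open>The arguments about triangles are carried out with chain maps. This provides
  representatives, explicit homotopy equivalences to a standard triangle, and its three squares up
  to homotopy.\<close>

lemma Dist_K_D:
  assumes "(X, Y, Z, u, v, w) \<in> Dist K"
  obtains s p q C D f a a' b b' c c'
  where "u = hclass \<C> X Y s" "v = hclass \<C> Y Z p" "w = hclass \<C> Z (susp \<C> X) q"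
    and "keq X Y s s" "keq Y Z p p" "keq Z (susp \<C> X) q q"
    and "keq C D f f" "hequiv X C a a'" "hequiv Y D b b'" "hequiv Z (mapping_cone \<C> C D f) c c'"
    and "keq X D (cc X Y D b s) (cc X C D f a)"
    and "keq Y (mapping_cone \<C> C D f) (cc Y Z (mapping_cone \<C> C D f) c p)
      (cc Y D (mapping_cone \<C> C D f) (cone_incl \<C> C D) b)"
    and "keq Z (susp \<C> C) (cc Z (susp \<C> X) (susp \<C> C) (susp_map a) q)
      (cc Z (mapping_cone \<C> C D f) (susp \<C> C) (cone_proj \<C> C D) c)"
proof -
  from assms have t: "(X, Y, Z, u, v, w) \<in> triangles K" by (simp add: Dist_K)
  then have XYZ: "X \<in> complexes \<C>" "Y \<in> complexes \<C>" "Z \<in> complexes \<C>"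
    and "u \<in> mor K X Y" "v \<in> mor K Y Z" "w \<in> mor K Z (susp \<C> X)"
    by (auto simp: triangles_def K_simps(1,5))
  then obtain s p q where spq: "u = hclass \<C> X Y s" "v = hclass \<C> Y Z p" "w = hclass \<C> Z (susp \<C> X) q"
    "s \<in> chain_maps \<C> X Y" "p \<in> chain_maps \<C> Y Z" "q \<in> chain_maps \<C> Z (susp \<C> X)"
    unfolding mor_K by blast
  from assms[unfolded Dist_K] obtain C D f where C: "C \<in> complexes \<C>" and D: "D \<in> complexes \<C>" and f: "f \<in> chain_maps \<C> C D"
    and ti: "triangle_iso K (X, Y, Z, u, v, w) (C, D, mapping_cone \<C> C D f, hclass \<C> C D f,
      hclass \<C> D (mapping_cone \<C> C D f) (cone_incl \<C> C D),
      hclass \<C> (mapping_cone \<C> C D f) (susp \<C> C) (cone_proj \<C> C D))" by blast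
  let ?E = "mapping_cone \<C> C D f"
  have E: "?E \<in> complexes \<C>" by (rule cone_complexes[OF C D f])
  from ti obtain \<alpha> \<beta> \<gamma> where i: "iso_mor K X C \<alpha>" "iso_mor K Y D \<beta>" "iso_mor K Z ?E \<gamma>"
    and sq: "Cmp K X Y D \<beta> u = Cmp K X C D (hclass \<C> C D f) \<alpha>"
      "Cmp K Y Z ?E \<gamma> v = Cmp K Y D ?E (hclass \<C> D ?E (cone_incl \<C> C D)) \<beta>"
      "Cmp K Z (susp \<C> X) (susp \<C> C) (SuspM K X C \<alpha>) w = Cmp K Z ?E (susp \<C> C) (hclass \<C> ?E (susp \<C> C) (cone_proj \<C> C D)) \<gamma>"
    by (auto simp: K_simps(5))
  from i obtain a a' b b' c c' where abc: "\<alpha> = hclass \<C> X C a" "hequiv X C a a'" "\<beta> = hclass \<C> Y D b" "hequiv Y D b b'"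
    "\<gamma> = hclass \<C> Z ?E c" "hequiv Z ?E c c'"
    using iso_mor_K_iff XYZ C D E by metis
  have k: "keq X Y s s" "keq Y Z p p" "keq Z (susp \<C> X) q q" "keq C D f f" "keq X C a a" "keq Y D b b" "keq Z ?E c c"
    "keq D ?E (cone_incl \<C> C D) (cone_incl \<C> C D)" "keq ?E (susp \<C> C) (cone_proj \<C> C D) (cone_proj \<C> C D)"
    using XYZ C D f E spq abc by (auto simp: keq_self susp_complexes hequiv_def cone_incl_chain_maps cone_proj_chain_maps)
  have sa: "keq (susp \<C> X) (susp \<C> C) (susp_map a) (susp_map a)" by (rule heq_susp[OF all_deg k(5)])
  have sM: "SuspM K X C \<alpha> = hclass \<C> (susp \<C> X) (susp \<C> C) (susp_map a)"
    using k(5) abc(1) by (simp add: K_susp keq_self)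
  note cl = keq_comp[OF k(6) k(1)] keq_comp[OF k(4) k(5)] keq_comp[OF k(7) k(2)] keq_comp[OF k(8) k(6)]
    keq_comp[OF sa k(3)] keq_comp[OF k(9) k(7)]
  show thesis
  proof (rule that[OF spq(1-3) k(1-4) abc(2,4,6)])
    show "keq X D (cc X Y D b s) (cc X C D f a)"
      using sq(1) cl by (simp add: spq abc K_comp_keq k) (simp add: keq_iff)
    show "keq Y ?E (cc Y Z ?E c p) (cc Y D ?E (cone_incl \<C> C D) b)"
      using sq(2) cl by (simp add: spq abc K_comp_keq k) (simp add: keq_iff)
    show "keq Z (susp \<C> C) (cc Z (susp \<C> X) (susp \<C> C) (susp_map a) q) (cc Z ?E (susp \<C> C) (cone_proj \<C> C D) c)"
      using sq(3) cl by (simp add: spq(3) abc(5) sM K_comp_keq k sa) (simp add: keq_iff)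
  qed
qed

lemma iso_mor_K_id: "C \<in> complexes \<C> \<Longrightarrow> iso_mor K C C (hclass \<C> C C (chain_id C))"
  using iso_mor_K_iff hequiv_id by blast

text \<open>Distinguished triangles are those isomorphic to a standard one; the three identities
  provide such an isomorphism.\<close>

lemma cone_Dist_K:
  assumes C: "C \<in> complexes \<C>" and D: "D \<in> complexes \<C>" and f: "f \<in> chain_maps \<C> C D"
  shows "(C, D, mapping_cone \<C> C D f, hclass \<C> C D f,
      hclass \<C> D (mapping_cone \<C> C D f) (cone_incl \<C> C D),
      hclass \<C> (mapping_cone \<C> C D f) (susp \<C> C) (cone_proj \<C> C D)) \<in> Dist K"
proof -
  let ?E = "mapping_cone \<C> C D f"
  have E: "?E \<in> complexes \<C>" by (rule cone_complexes[OF C D f])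
  have k: "keq C D f f" "keq D ?E (cone_incl \<C> C D) (cone_incl \<C> C D)" "keq ?E (susp \<C> C) (cone_proj \<C> C D) (cone_proj \<C> C D)"
    using C D f E by (auto simp: keq_self susp_complexes cone_incl_chain_maps cone_proj_chain_maps)
  have id: "Cmp K X Y Y (hclass \<C> Y Y (chain_id Y)) (hclass \<C> X Y g) = Cmp K X X Y (hclass \<C> X Y g) (hclass \<C> X X (chain_id X))"
    if g: "keq X Y g g" for X Y g
  proof -
    have XY: "X \<in> complexes \<C>" "Y \<in> complexes \<C>" using g by (auto simp: keq_self)
    have "keq X Y (cc X Y Y (chain_id Y) g) (cc X X Y g (chain_id X))"
      using keq_trans[OF keq_id_left[OF g] keq_sym[OF keq_id_right[OF g]]] .
    then show ?thesis using XY by (simp add: K_comp_keq[OF g keq_id] K_comp_keq[OF keq_id g]) (simp add: keq_iff)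
  qed
  have "susp_map (chain_id C) = chain_id (susp \<C> C)"
    by (auto simp: susp_map_def chain_id_def susp_simps)
  then have sid: "SuspM K C C (hclass \<C> C C (chain_id C)) = hclass \<C> (susp \<C> C) (susp \<C> C) (chain_id (susp \<C> C))"
    using C by (simp add: K_susp chain_maps_id)
  have "triangle_iso K (C, D, ?E, hclass \<C> C D f, hclass \<C> D ?E (cone_incl \<C> C D), hclass \<C> ?E (susp \<C> C) (cone_proj \<C> C D))
    (C, D, ?E, hclass \<C> C D f, hclass \<C> D ?E (cone_incl \<C> C D), hclass \<C> ?E (susp \<C> C) (cone_proj \<C> C D))"
    unfolding triangle_iso.simps
    by (intro exI[of _ "hclass \<C> C C (chain_id C)"] exI[of _ "hclass \<C> D D (chain_id D)"] exI[of _ "hclass \<C> ?E ?E (chain_id ?E)"])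
      (use C D E k in \<open>simp add: iso_mor_K_id id[OF k(1)] id[OF k(2)] id[OF k(3)] K_simps(5) sid\<close>)
  moreover have "(C, D, ?E, hclass \<C> C D f, hclass \<C> D ?E (cone_incl \<C> C D), hclass \<C> ?E (susp \<C> C) (cone_proj \<C> C D)) \<in> triangles K"
    using C D E k by (auto simp: triangles_def K_simps(1,5) keq_self intro: hclass_mor)
  ultimately show ?thesis using C D f unfolding Dist_K by blast
qed

end

section \<open>Morphisms with bounded cone\<close>

context additive_category
begin

lemma chain_comp_zero_right:
  "keq D E g g \<Longrightarrow> C \<in> complexes \<C> \<Longrightarrow> cc C D E g (chain_zero C D) = chain_zero C E"
  by (auto simp: keq_self chain_comp_def chain_zero_def cmp_zero_right ob_Obj chain_maps_mor)

lemma hequivD: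
  assumes "hequiv C D f g"
  shows "keq C D f f" "keq D C g g" "keq C C (cc C D C g f) (chain_id C)" "keq D D (cc D C D f g) (chain_id D)"
  using assms unfolding hequiv_keq by auto

lemma hequiv_complexes:
  assumes "hequiv C D f g"
  shows "C \<in> complexes \<C>" "D \<in> complexes \<C>"
  using assms unfolding hequiv_def by auto

lemma hequiv_trans:
  assumes fg: "hequiv C D f g" and fg': "hequiv D E f' g'"
  shows "hequiv C E (cc C D E f' f) (cc E D C g g')"
proof -
  have *: "keq C C (cc C E C (cc E D C g g') (cc C D E f' f)) (chain_id C)"
    if fg: "hequiv C D f g" and fg': "hequiv D E f' g'" for C D E f g f' g'
  proof -
    note k = hequivD[OF fg] hequivD[OF fg']
    have "keq C C (cc C E C (cc E D C g g') (cc C D E f' f)) (cc C D C g (cc C E D g' (cc C D E f' f)))"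
      by (rule keq_sym, intro keq_assoc keq_comp k)
    also have "keq C C \<dots> (cc C D C g f)"
      by (intro keq_comp k hequiv_inv_left[OF all_deg])
    also note k(3)
    finally show ?thesis .
  qed
  show ?thesis
    using *[OF fg fg'] *[OF hequiv_sym[OF fg'] hequiv_sym[OF fg]] hequivD(1,2)[OF fg] hequivD(1,2)[OF fg']
    unfolding hequiv_keq by (blast intro: keq_comp)
qed

text \<open>The class before closing it under homotopy equivalence. Its members are themselves
  bounded below, which boundedness of cones and truncations requires.\<close>

definition strict_mb :: "('a, 'b) cplx set"
  where "strict_mb = {C \<in> complexes \<C>. eventually_acyclic \<C> C \<and> bounded_below \<C> C}"

abbreviation "Sys \<equiv> has_cone_in (Kmb \<C>) (Obj (Kb \<C>))"

lemma strict_mbD: "C \<in> strict_mb \<Longrightarrow> C \<in> complexes \<C>" "C \<in> strict_mb \<Longrightarrow> bounded_below \<C> C"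
  by (auto simp: strict_mb_def)

lemma Kmb_simps:
  "Obj (Kmb \<C>) = iso_closure K strict_mb" "Hom (Kmb \<C>) = Hom K" "Idn (Kmb \<C>) = Idn K"
  "Cmp (Kmb \<C>) = Cmp K" "SuspO (Kmb \<C>) = SuspO K" "SuspM (Kmb \<C>) = SuspM K"
  "(X, Y, Z, u, v, w) \<in> Dist (Kmb \<C>) \<longleftrightarrow> (X, Y, Z, u, v, w) \<in> Dist K \<and> X \<in> Obj (Kmb \<C>) \<and> Y \<in> Obj (Kmb \<C>) \<and> Z \<in> Obj (Kmb \<C>)"
  by (simp_all add: Kmb_def full_sub_simps strict_mb_def)

lemma strict_mb_Obj_Kmb: "strict_mb \<subseteq> Obj (Kmb \<C>)"
  unfolding Kmb_simps by (rule iso_closure_K_superset) (auto simp: strict_mb_def)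

lemma Obj_Kmb_complexes: "Obj (Kmb \<C>) \<subseteq> complexes \<C>"
  by (auto simp: Kmb_simps iso_closure_def K_simps(1))

lemma bounded_strict_mb:
  assumes C: "C \<in> complexes \<C>" and b: "bounded_complex \<C> C"
  shows "C \<in> strict_mb"
proof -
  from b obtain N where N: "\<And>n. \<bar>n\<bar> > N \<Longrightarrow> zero_object \<C> (ob C n)" unfolding bounded_complex_def by blast
  have "\<forall>n. \<bar>n\<bar> > N \<longrightarrow> exact_from P C n" if "P \<in> Obj \<C>" for P
    using exact_from_zero[OF C that] N by blast
  moreover have "\<forall>n<(-\<bar>N\<bar>). zero_object \<C> (ob C n)" using N by auto
  ultimately show ?thesis
    unfolding strict_mb_def bounded_below_def eventually_acyclic_iff[OF C, THEN eq_reflection] using C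
    by (auto simp: eventually_acyclic_iff)
qed

lemma mem_Kb: "C \<in> Obj (Kb \<C>) \<longleftrightarrow> (\<exists>B f g. bounded_complex \<C> B \<and> hequiv C B f g)"
proof -
  have "C \<in> Obj (Kb \<C>) \<longleftrightarrow> (\<exists>B\<in>{C \<in> complexes \<C>. bounded_complex \<C> C}. \<exists>f g. hequiv C B f g)"
    unfolding Kb_def full_sub_simps by (rule mem_iso_closure_K) auto
  then show ?thesis by (auto dest: hequiv_complexes)
qed

lemma hequiv_bounded_Obj_Kmb: "bounded_complex \<C> B \<Longrightarrow> hequiv C B f g \<Longrightarrow> C \<in> Obj (Kmb \<C>)"
  unfolding Kmb_simps using mem_iso_closure_K[of strict_mb C] bounded_strict_mb[of B] hequiv_complexes(2)[of C B f g]
  by (auto simp: strict_mb_def)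

lemma ev_iso_Sys:
  assumes C: "C \<in> strict_mb" and D: "D \<in> strict_mb" and s: "ev_iso C D s"
  shows "hclass \<C> C D s \<in> Sys C D"
proof -
  have CD: "C \<in> complexes \<C>" "D \<in> complexes \<C>" and sc: "s \<in> chain_maps \<C> C D"
    using C D s by (auto simp: strict_mb_def ev_iso_def)
  obtain Y f g where Y: "hequiv (mapping_cone \<C> C D s) Y f g" "bounded_complex \<C> Y"
    using cone_ev_iso_bounded[OF CD s strict_mbD(2)[OF C] strict_mbD(2)[OF D]] by blast
  then have "mapping_cone \<C> C D s \<in> Obj (Kb \<C>)" "mapping_cone \<C> C D s \<in> Obj (Kmb \<C>)"
    using mem_Kb hequiv_bounded_Obj_Kmb by blast+
  moreover have "hclass \<C> C D s \<in> mor (Kmb \<C>) C D" unfolding Kmb_simps by (rule hclass_mor[OF sc])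
  ultimately show ?thesis
    unfolding has_cone_in_def Kmb_simps(7)
    using cone_Dist_K[OF CD sc] strict_mb_Obj_Kmb C D by blast
qed

text \<open>The third object of the triangle is homotopy equivalent both to a bounded complex and to
  a standard cone. Composing the two equivalences gives a bounded model of the standard
  cone.\<close>

lemma Sys_cone:
  assumes "\<sigma> \<in> Sys X Y"
  obtains s C D f a a' b b' B e e' where "\<sigma> = hclass \<C> X Y s" "keq X Y s s" "keq C D f f"
    "hequiv X C a a'" "hequiv Y D b b'" "keq X D (cc X Y D b s) (cc X C D f a)"
    "bounded_complex \<C> B" "hequiv (mapping_cone \<C> C D f) B e e'"
proof -
  from assms obtain Z v w where Z: "Z \<in> Obj (Kb \<C>)" and D: "(X, Y, Z, \<sigma>, v, w) \<in> Dist K"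
    unfolding has_cone_in_def Kmb_simps(7) by blast
  from Z obtain B z z' where B: "bounded_complex \<C> B" "hequiv Z B z z'" unfolding mem_Kb by blast
  show thesis
    by (rule Dist_K_D[OF D], rule that[OF _ _ _ _ _ _ B(1) hequiv_trans[OF hequiv_sym B(2)]])
qed

text \<open>
  \<open>k\<close> is the map from \<open>Y\<close> to the cone of \<open>s\<close>, followed by a homotopy equivalence of the cone with \<open>B\<close>.
\<close>

lemma Sys_lift:
  assumes "\<sigma> \<in> Sys X Y"
  obtains s B k where "\<sigma> = hclass \<C> X Y s" "keq X Y s s" "bounded_complex \<C> B" "keq Y B k k"
    "\<And>W x. keq W Y x x \<Longrightarrow> keq W B (cc W Y B k x) (chain_zero W B) \<Longrightarrow>
      \<exists>y. keq W X y y \<and> keq W Y (cc W X Y s y) x"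
proof -
  obtain s C D f a a' b b' B e e' where s: "\<sigma> = hclass \<C> X Y s" "keq X Y s s" and f: "keq C D f f" and
    a: "hequiv X C a a'" and b: "hequiv Y D b b'" and sq: "keq X D (cc X Y D b s) (cc X C D f a)" and
    B: "bounded_complex \<C> B" and e: "hequiv (mapping_cone \<C> C D f) B e e'"
    using Sys_cone[OF assms] by metis
  let ?E = "mapping_cone \<C> C D f" and ?i = "cone_incl \<C> C D"
  have C: "C \<in> complexes \<C>" and D: "D \<in> complexes \<C>" and fc: "f \<in> chain_maps \<C> C D" using f by (auto simp: keq_self)
  have i: "keq D ?E ?i ?i" using cone_incl_chain_maps[OF C D fc] cone_complexes[OF C D fc] D by (simp add: keq_self)
  note k = s(2) f i hequivD[OF a] hequivD[OF b] hequivD[OF e]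
  define m where "m = cc Y D ?E ?i b"
  have m: "keq Y ?E m m" unfolding m_def by (intro keq_comp k)
  define u where "u = cc Y ?E B e m"
  have u: "keq Y B u u" unfolding u_def by (intro keq_comp k m)
  show thesis
  proof (rule that[OF s B u])
    fix W x assume x: "keq W Y x x" and null: "keq W B (cc W Y B u x) (chain_zero W B)"
    have W: "W \<in> complexes \<C>" using x by (simp add: keq_self)
    have bx: "keq W D (cc W Y D b x) (cc W Y D b x)" by (intro keq_comp k x)
    have "keq W ?E (cc W D ?E ?i (cc W Y D b x)) (cc W Y ?E m x)"
      unfolding m_def by (intro keq_assoc k x)
    also have "keq W ?E (cc W Y ?E m x) (cc W B ?E e' (cc W ?E B e (cc W Y ?E m x)))"
      by (rule keq_sym, intro hequiv_inv_left[OF all_deg] k keq_comp m x)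
    also have "keq W ?E \<dots> (cc W B ?E e' (cc W Y B u x))"
      unfolding u_def by (intro keq_comp[OF k(13)] keq_assoc k m x)
    also have "keq W ?E \<dots> (cc W B ?E e' (chain_zero W B))"
      by (intro keq_comp k null)
    also have "cc W B ?E e' (chain_zero W B) = chain_zero W ?E"
      by (rule chain_comp_zero_right[OF k(13) W])
    finally have "homotopic W ?E (cc W D ?E ?i (cc W Y D b x)) (chain_zero W ?E)"
      by (simp add: heq_def)
    \<comment> \<open>The map \<open>i b x\<close> is null-homotopic because its composite with the
      equivalence \<open>e\<close> is; hence \<open>b x\<close> lifts through
      \<open>f\<close>.\<close>
    then obtain y where "y \<in> chain_maps \<C> W C" and "homotopic W D (cc W C D f y) (cc W Y D b x)"
      using cone_lift[OF C D fc W _] bx by (auto simp: keq_self)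
    then have y: "keq W C y y" and fy: "keq W D (cc W C D f y) (cc W Y D b x)"
      using bx f W C D by (auto simp: keq_self heq_def chmap_top homotopic_refl intro: chain_maps_comp)
    define y' where "y' = cc W C X a' y"
    have y': "keq W X y' y'" unfolding y'_def by (intro keq_comp k y)
    \<comment> \<open>Up to homotopy, \<open>b s y' = f a a' y = f y = b x\<close>, and
      \<open>b'\<close> removes \<open>b\<close> on both sides.\<close>
    have "keq W Y (cc W X Y s y') (cc W D Y b' (cc W Y D b (cc W X Y s y')))"
      by (rule keq_sym, intro hequiv_inv_left[OF all_deg] k keq_comp y')
    also have "keq W Y \<dots> (cc W D Y b' (cc W Y D b x))"
    proof (rule keq_comp[OF k(9)])
      have "keq W D (cc W Y D b (cc W X Y s y')) (cc W X D (cc X Y D b s) y')"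
        by (intro keq_assoc k y')
      also have "keq W D \<dots> (cc W X D (cc X C D f a) y')" by (intro keq_comp sq y')
      also have "keq W D \<dots> (cc W C D f (cc W X C a y'))" by (rule keq_sym, intro keq_assoc k y')
      also have "keq W D \<dots> (cc W C D f y)"
        unfolding y'_def by (intro keq_comp[OF k(2)] hequiv_inv_left[OF all_deg] k y)
      also note fy
      finally show "keq W D (cc W Y D b (cc W X Y s y')) (cc W Y D b x)" .
    qed
    also have "keq W Y \<dots> x" by (intro hequiv_inv_left[OF all_deg] k x)
    finally have "keq W Y (cc W X Y s y') x" .
    with y' show "\<exists>y. keq W X y y \<and> keq W Y (cc W X Y s y) x" by blast
  qed
qed

lemma ev_zero_if_bounded:
  assumes B: "bounded_complex \<C> B" and e: "keq C B e e"
  shows "\<forall>\<^sub>F n in at_top. e n = chain_zero C B n"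
proof -
  from B obtain N where N: "\<And>n. \<bar>n\<bar> > N \<Longrightarrow> zero_object \<C> (ob B n)" unfolding bounded_complex_def by blast
  have "\<forall>n\<ge>\<bar>N\<bar>+1. e n = chain_zero C B n"
    using mor_to_zero[OF N] e by (auto simp: chain_zero_def keq_self ob_Obj chain_maps_mor)
  then show ?thesis by (auto simp: eventually_at_top_linorder)
qed

text \<open>The cone is equivalent to a bounded complex, so its identity has zero germ and
  \<open>cone_contractible_germ\<close> inverts \<open>f\<close>. The equivalences \<open>a\<close>
  and \<open>b\<close> carry this inverse over to \<open>s\<close>. The complexes \<open>X\<close>
  and \<open>Y\<close> are arbitrary, as apexes of roofs require.\<close>

lemma Sys_germ_inverse:
  assumes s: "keq X Y s s" and S: "hclass \<C> X Y s \<in> Sys X Y"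
  obtains c where "geq Y X c c" "geq Y Y (cc Y X Y s c) (chain_id Y)" "geq X X (cc X Y X c s) (chain_id X)"
proof -
  obtain s' C D f a a' b b' B e e' where s': "hclass \<C> X Y s = hclass \<C> X Y s'" "keq X Y s' s'" and f: "keq C D f f" and
    a: "hequiv X C a a'" and b: "hequiv Y D b b'" and sq': "keq X D (cc X Y D b s') (cc X C D f a)" and
    B: "bounded_complex \<C> B" and e: "hequiv (mapping_cone \<C> C D f) B e e'"
    using Sys_cone[OF S] by metis
  let ?E = "mapping_cone \<C> C D f"
  have C: "C \<in> complexes \<C>" and D: "D \<in> complexes \<C>" and fc: "f \<in> chain_maps \<C> C D" using f by (auto simp: keq_self)
  have E: "?E \<in> complexes \<C>" by (rule cone_complexes[OF C D fc])
  have "keq X Y s s'" using s s' by (simp add: keq_iff)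
  then have "keq X D (cc X Y D b s) (cc X Y D b s')" by (intro keq_comp hequivD[OF b])
  from keq_trans[OF this sq'] have sq: "keq X D (cc X Y D b s) (cc X C D f a)" .
  note k = hequivD[OF e] hequivD[OF a] hequivD[OF b]
  note g = k[THEN geq_if_keq] s[THEN geq_if_keq] f[THEN geq_if_keq]
  \<comment> \<open>The identity factors through \<open>B\<close> up to homotopy, and
    \<open>e\<close> vanishes in high degrees.\<close>
  have "geq ?E ?E (chain_id ?E) (cc ?E B ?E e' e)" by (rule geq_sym[OF g(3)])
  also have "geq ?E ?E \<dots> (cc ?E B ?E e' (chain_zero ?E B))"
    by (intro geq_comp g geq_eq ev_zero_if_bounded[OF B] k)
  also have "cc ?E B ?E e' (chain_zero ?E B) = chain_zero ?E ?E"
    by (rule chain_comp_zero_right[OF k(2) E])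
  finally have "htpy at_top ?E ?E (chain_id ?E) (chain_zero ?E ?E)" by (simp add: heq_def)
  then obtain r where "chmap at_top D C r" "htpy at_top D D (cc D C D f r) (chain_id D)" "htpy at_top C C (cc C D C r f) (chain_id C)"
    using cone_contractible_germ[OF C D fc] by blast
  then have r: "geq D C r r" and fr: "geq D D (cc D C D f r) (chain_id D)" and rf: "geq C C (cc C D C r f) (chain_id C)"
    using C D f chmap_of_top[of C D f] by (auto simp: heq_def htpy_refl[OF at_top] chmap_comp[OF at_top] chmap_id[OF at_top])
  define c where "c = cc Y C X a' (cc Y D C r b)"
  have c: "geq Y X c c" unfolding c_def by (intro geq_comp g r)
  have "geq Y Y (cc Y X Y s c) (cc Y D Y b' (cc Y Y D b (cc Y X Y s c)))"
    by (rule geq_sym, intro hequiv_inv_left[OF at_top] g geq_comp c)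
  also have "geq Y Y \<dots> (cc Y D Y b' b)"
  proof (rule geq_comp[OF g(10)])
    have "geq Y D (cc Y Y D b (cc Y X Y s c)) (cc Y X D (cc X Y D b s) c)"
      by (intro geq_assoc g c)
    also have "geq Y D \<dots> (cc Y X D (cc X C D f a) c)" by (intro geq_comp geq_if_keq[OF sq] c)
    also have "geq Y D \<dots> (cc Y C D f (cc Y X C a c))" by (rule geq_sym, intro geq_assoc g c)
    also have "geq Y D \<dots> (cc Y C D f (cc Y D C r b))"
      unfolding c_def by (intro geq_comp[OF g(14)] hequiv_inv_left[OF at_top] g r geq_comp)
    also have "geq Y D \<dots> b" by (intro hequiv_inv_left[OF at_top] fr r g)
    finally show "geq Y D (cc Y Y D b (cc Y X Y s c)) b" .
  qed
  also note g(11)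
  finally have 1: "geq Y Y (cc Y X Y s c) (chain_id Y)" .
  have "geq X X (cc X Y X c s) (cc X C X a' (cc X Y C (cc Y D C r b) s))"
    unfolding c_def by (rule geq_sym, intro geq_assoc geq_comp g r)
  also have "geq X X \<dots> (cc X C X a' a)"
  proof (rule geq_comp[OF g(6)])
    have "geq X C (cc X Y C (cc Y D C r b) s) (cc X D C r (cc X Y D b s))"
      by (rule geq_sym, intro geq_assoc g r)
    also have "geq X C \<dots> (cc X D C r (cc X C D f a))" by (intro geq_comp r geq_if_keq[OF sq])
    also have "geq X C \<dots> a" by (intro hequiv_inv_left[OF at_top] rf r g)
    finally show "geq X C (cc X Y C (cc Y D C r b) s) a" .
  qed
  also note g(7)
  finally have 2: "geq X X (cc X Y X c s) (chain_id X)" .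
  show thesis by (rule that[OF c 1 2])
qed

end

section \<open>Homotopy fibres, Ore squares and fractions representing germs\<close>

context additive_category
begin

text \<open>The desuspension of the mapping cone, that is, the homotopy fibre of \<open>k\<close>;
  \<open>fibre_pr\<close> below is the desuspended projection of the cone.\<close>

definition fibre :: "('a, 'b) cplx \<Rightarrow> ('a, 'b) cplx \<Rightarrow> (int \<Rightarrow> 'b) \<Rightarrow> ('a, 'b) cplx"
  where "fibre X B k = \<lparr>ob = \<lambda>n. ob (mapping_cone \<C> X B k) (n + 1),
    df = \<lambda>n. \<boxminus>\<^bsub>ob (mapping_cone \<C> X B k) (n + 1),ob (mapping_cone \<C> X B k) n\<^esub> df (mapping_cone \<C> X B k) (n + 1)\<rparr>"

definition fibre_pr :: "('a, 'b) cplx \<Rightarrow> ('a, 'b) cplx \<Rightarrow> int \<Rightarrow> 'b"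
  where "fibre_pr X B n = cone_proj \<C> X B (n + 1)"

lemma fibre:
  assumes k: "keq X B k k"
  shows fibre_complexes: "fibre X B k \<in> complexes \<C>"
    and fibre_pr_keq: "keq (fibre X B k) X (fibre_pr X B) (fibre_pr X B)"
    and fibre_null: "keq (fibre X B k) B (cc (fibre X B k) X B k (fibre_pr X B)) (chain_zero (fibre X B k) B)"
proof -
  have X: "X \<in> complexes \<C>" and B: "B \<in> complexes \<C>" and kc: "k \<in> chain_maps \<C> X B"
    using k by (auto simp: keq_self)
  note ty = cone_ty'[OF X B kc] cplx_simps[OF cone_complexes[OF X B kc]]
  note ru = cone_rules[OF X B kc] cone_rules_comp[OF X B kc]
  show W: "fibre X B k \<in> complexes \<C>"
    unfolding complexes_def by (auto simp: fibre_def ty cmp_distrib add_simps)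
  have p: "fibre_pr X B \<in> chain_maps \<C> (fibre X B k) X"
    unfolding chain_maps_def by (auto simp: fibre_def fibre_pr_def ty ru cmp_distrib add_simps)
  then show p': "keq (fibre X B k) X (fibre_pr X B) (fibre_pr X B)" using W X by (simp add: keq_self)
  \<comment> \<open>The component \<open>- p1\<close> is the universal null homotopy: its boundary
    is \<open>- d p1 + p1 d\<close>, where the second \<open>d\<close> is that of the cone, and
    \<open>p1 d = d p1 + k p2\<close>.\<close>
  define h where "h n = \<boxminus>\<^bsub>ob (fibre X B k) n,ob B (n + 1)\<^esub> cone_pr1 X B (n + 1)" for n
  have h': "h (n - 1) = \<boxminus>\<^bsub>ob (mapping_cone \<C> X B k) n,ob B n\<^esub> cone_pr1 X B n" for n
    by (simp add: h_def fibre_def)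
  have hm: "h n \<in> mor \<C> (ob (fibre X B k) n) (ob B (n + 1))" for n by (simp add: h_def fibre_def ty)
  have "cc (fibre X B k) X B k (fibre_pr X B) n =
      chain_zero (fibre X B k) B n \<boxplus>\<^bsub>ob (fibre X B k) n,ob B n\<^esub> bd (fibre X B k) B h n" for n
    by (simp add: bd_def h' h_def[of n] chain_comp_def chain_zero_def fibre_def fibre_pr_def ty ru cmp_distrib add_simps)
  with hm have "homotopic (fibre X B k) B (cc (fibre X B k) X B k (fibre_pr X B)) (chain_zero (fibre X B k) B)"
    unfolding htpy_top by blast
  then show "keq (fibre X B k) B (cc (fibre X B k) X B k (fibre_pr X B)) (chain_zero (fibre X B k) B)"
    using W B kc p by (simp add: heq_def chmap_top chain_maps_comp X chain_maps_zero)
qed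

text \<open>Where \<open>B\<close> is zero, the cone has only the summand from \<open>X\<close>, and
  \<open>cone_in2\<close> inverts the projection. In low degrees both summands vanish, and eventual
  acyclicity passes along the resulting \<open>ev_iso\<close>.\<close>

lemma fibre_strict_mb:
  assumes k: "keq X B k k" and B: "bounded_complex \<C> B" and X: "X \<in> strict_mb"
  shows "fibre X B k \<in> strict_mb" "ev_iso (fibre X B k) X (fibre_pr X B)"
proof -
  let ?W = "fibre X B k"
  have Xc: "X \<in> complexes \<C>" and Bc: "B \<in> complexes \<C>" and kc: "k \<in> chain_maps \<C> X B"
    using k by (auto simp: keq_self)
  note ty = cone_ty'[OF Xc Bc kc]
  from B obtain N where N: "\<And>n. \<bar>n\<bar> > N \<Longrightarrow> zero_object \<C> (ob B n)" unfolding bounded_complex_def by blast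
  have "iso_mor \<C> (ob ?W n) (ob X n) (fibre_pr X B n)" if n: "n \<ge> \<bar>N\<bar>" for n
  proof -
    have "zero_object \<C> (ob B (n + 1))" using n N by simp
    then have z: "cone_incl \<C> X B (n + 1) = zero_mor \<C> (ob B (n + 1)) (ob (mapping_cone \<C> X B k) (n + 1))"
      by (rule mor_from_zero) (simp_all add: ty)
    have "cone_in2 X B (n + 1) \<bullet>\<^bsub>ob ?W n,ob X n,ob ?W n\<^esub> fibre_pr X B n = Idn \<C> (ob ?W n)"
      using cone_bp_sum[OF Xc Bc kc, of n "n + 1"]
      by (simp add: z fibre_def fibre_pr_def ty cmp_zero_left add_zero_left)
    moreover have "fibre_pr X B n \<bullet>\<^bsub>ob X n,ob ?W n,ob X n\<^esub> cone_in2 X B (n + 1) = Idn \<C> (ob X n)"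
      using cone_bp(2)[OF Xc Bc kc, of n "n + 1"] by (simp add: fibre_def fibre_pr_def)
    ultimately show ?thesis
      unfolding iso_mor_def by (auto simp: fibre_def fibre_pr_def ty intro!: bexI[of _ "cone_in2 X B (n + 1)"])
  qed
  then show ev: "ev_iso ?W X (fibre_pr X B)"
    using fibre_pr_keq[OF k] by (auto simp: ev_iso_def keq_self eventually_at_top_linorder)
  obtain M where M: "\<And>n. n < M \<Longrightarrow> zero_object \<C> (ob X n)" using bounded_belowD[OF strict_mbD(2)[OF X]] by blast
  have "zero_object \<C> (ob ?W n)" if "n < - \<bar>M\<bar> - \<bar>N\<bar> - 1" for n
    using zero_object_bsum[of "ob B (n + 1)" "ob X n"] M[of n] N[of "n + 1"] that
    by (simp add: fibre_def ob_cone[OF Xc Bc kc] susp_simps)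
  then have bW: "bounded_below \<C> ?W" unfolding bounded_below_def by blast
  with X show "?W \<in> strict_mb"
    using eventually_acyclic_ev_iso[OF fibre_complexes[OF k] Xc ev bW strict_mbD(2)[OF X]] fibre_complexes[OF k]
    by (simp add: strict_mb_def)
qed

lemma ev_iso_keq: "ev_iso C D s \<Longrightarrow> C \<in> complexes \<C> \<Longrightarrow> D \<in> complexes \<C> \<Longrightarrow> keq C D s s"
  by (simp add: ev_iso_def keq_self)

lemma ev_iso_comp:
  assumes "B \<in> complexes \<C>" "C \<in> complexes \<C>" "D \<in> complexes \<C>" "ev_iso B C s" "ev_iso C D t"
  shows "ev_iso B D (cc B C D t s)"
proof -
  have "iso_mor \<C> X Z (g \<bullet>\<^bsub>X,Y,Z\<^esub> f)"
    if f: "iso_mor \<C> X Y f" and g: "iso_mor \<C> Y Z g" and ob: "X \<in> Obj \<C>" "Y \<in> Obj \<C>" "Z \<in> Obj \<C>" for X Y Z f g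
  proof -
    obtain f' where f': "f' \<in> mor \<C> Y X" "f' \<bullet>\<^bsub>X,Y,X\<^esub> f = Idn \<C> X" "f \<bullet>\<^bsub>Y,X,Y\<^esub> f' = Idn \<C> Y" and fm: "f \<in> mor \<C> X Y"
      using f unfolding iso_mor_def by blast
    obtain g' where g': "g' \<in> mor \<C> Z Y" "g' \<bullet>\<^bsub>Y,Z,Y\<^esub> g = Idn \<C> Y" "g \<bullet>\<^bsub>Z,Y,Z\<^esub> g' = Idn \<C> Z" and gm: "g \<in> mor \<C> Y Z"
      using g unfolding iso_mor_def by blast
    have 1: "f' \<bullet>\<^bsub>Z,Y,X\<^esub> g' \<bullet>\<^bsub>Y,Z,X\<^esub> g = f'"
      using comp_eq_comp[OF _ _ _ _ _ _ _ g'(2), of X f'] gm g' f' ob by (simp add: Cmp_Idn_right)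
    have 2: "g \<bullet>\<^bsub>X,Y,Z\<^esub> f \<bullet>\<^bsub>Y,X,Z\<^esub> f' = g"
      using comp_eq_comp[OF _ _ _ _ _ _ _ f'(3), of Z g] gm fm f' ob by (simp add: Cmp_Idn_right)
    have "(f' \<bullet>\<^bsub>Z,Y,X\<^esub> g') \<bullet>\<^bsub>X,Z,X\<^esub> (g \<bullet>\<^bsub>X,Y,Z\<^esub> f) = Idn \<C> X"
      using 1 f' g' fm gm ob by (simp add: Cmp_assoc mor_intros)
    moreover have "(g \<bullet>\<^bsub>X,Y,Z\<^esub> f) \<bullet>\<^bsub>Z,X,Z\<^esub> (f' \<bullet>\<^bsub>Z,Y,X\<^esub> g') = Idn \<C> Z"
      using 2 f' g' fm gm ob by (simp add: Cmp_assoc mor_intros)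
    ultimately show ?thesis unfolding iso_mor_def using f' g' fm gm ob by (blast intro: Cmp_mor)
  qed
  note iso = this
  have "\<forall>\<^sub>F n in at_top. iso_mor \<C> (ob B n) (ob C n) (s n)" "\<forall>\<^sub>F n in at_top. iso_mor \<C> (ob C n) (ob D n) (t n)"
    using assms by (auto simp: ev_iso_def)
  then have "\<forall>\<^sub>F n in at_top. iso_mor \<C> (ob B n) (ob D n) (cc B C D t s n)"
    by eventually_elim (unfold chain_comp_def, intro iso ob_Obj assms(1-3))
  then show ?thesis using assms by (auto simp: ev_iso_def intro: chain_maps_comp)
qed

lemma ev_iso_if_ev_id:
  assumes "s \<in> chain_maps \<C> C D" "C \<in> complexes \<C>"
    and "\<forall>\<^sub>F n in at_top. ob C n = ob D n \<and> s n = Idn \<C> (ob C n)"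
  shows "ev_iso C D s"
proof -
  have "iso_mor \<C> X X (Idn \<C> X)" if "X \<in> Obj \<C>" for X
    using that unfolding iso_mor_def by (auto intro!: bexI[of _ "Idn \<C> X"] simp: Idn_mor Cmp_Idn_left)
  note iso = this
  have "\<forall>\<^sub>F n in at_top. iso_mor \<C> (ob C n) (ob D n) (s n)"
    using assms(3)
  proof eventually_elim
    case (elim n)
    then show ?case using iso[OF ob_Obj[OF assms(2), of n]] by simp
  qed
  then show ?thesis using assms(1) by (simp add: ev_iso_def)
qed

lemma ev_iso_id: "C \<in> complexes \<C> \<Longrightarrow> ev_iso C C (chain_id C)"
  by (rule ev_iso_if_ev_id) (auto simp: chain_id_def[abs_def] intro: chain_maps_id[unfolded chain_id_def[abs_def]])

text \<open>By \<open>Sys_lift\<close>, \<open>x q\<close> lifts through \<open>s\<close> as soon as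
  \<open>k x q\<close> is null-homotopic, and the projection \<open>q\<close> from the fibre of
  \<open>k x\<close> has this property. It is an \<open>ev_iso\<close> whatever \<open>s\<close>
  was.\<close>

lemma Ore_square:
  assumes S: "hclass \<C> Z X s \<in> Sys Z X" and s: "keq Z X s s" and V: "V \<in> strict_mb" and x: "keq V X x x"
  obtains W q y where "W \<in> strict_mb" "ev_iso W V q" "keq W Z y y" "keq W X (cc W Z X s y) (cc W V X x q)"
proof -
  obtain s' B k where s': "hclass \<C> Z X s = hclass \<C> Z X s'" "keq Z X s' s'" and B: "bounded_complex \<C> B" and k: "keq X B k k"
    and lift: "\<And>W x. keq W X x x \<Longrightarrow> keq W B (cc W X B k x) (chain_zero W B) \<Longrightarrow>
      \<exists>y. keq W Z y y \<and> keq W X (cc W Z X s' y) x"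
    using Sys_lift[OF S] by metis
  define u where "u = cc V X B k x"
  have u: "keq V B u u" unfolding u_def by (intro keq_comp k x)
  let ?W = "fibre V B u" and ?q = "fibre_pr V B"
  have q: "keq ?W V ?q ?q" by (rule fibre_pr_keq[OF u])
  have "keq ?W B (cc ?W X B k (cc ?W V X x ?q)) (cc ?W V B u ?q)" unfolding u_def by (intro keq_assoc k x q[unfolded u_def])
  also note fibre_null[OF u]
  finally obtain y where y: "keq ?W Z y y" "keq ?W X (cc ?W Z X s' y) (cc ?W V X x ?q)"
    using lift[OF keq_comp[OF x q]] by blast
  have "keq Z X s s'" using s s' by (simp add: keq_iff)
  then have "keq ?W X (cc ?W Z X s y) (cc ?W Z X s' y)" by (intro keq_comp y(1))
  from keq_trans[OF this y(2)] show thesis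
    using that fibre_strict_mb[OF u B V] y(1) by blast
qed

lemma brutal_simps:
  "ob (brutal \<C> m C) n = (if n \<ge> m then ob C n else the_zero \<C>)"
  "df (brutal \<C> m C) n = (if n > m then df C n else zero_mor \<C> (ob (brutal \<C> m C) n) (ob (brutal \<C> m C) (n - 1)))"
  by (simp_all add: brutal_def Let_def)

lemma brutal_complexes:
  assumes C: "C \<in> complexes \<C>"
  shows "brutal \<C> m C \<in> complexes \<C>"
  unfolding complexes_def mem_Collect_eq
proof
  fix n
  consider "n > m" | "n \<le> m" by linarith
  then show "ob (brutal \<C> m C) n \<in> Obj \<C> \<and> df (brutal \<C> m C) n \<in> mor \<C> (ob (brutal \<C> m C) n) (ob (brutal \<C> m C) (n - 1)) \<and>
    df (brutal \<C> m C) n \<bullet>\<^bsub>ob (brutal \<C> m C) (n + 1),ob (brutal \<C> m C) n,ob (brutal \<C> m C) (n - 1)\<^esub> df (brutal \<C> m C) (n + 1)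
    = zero_mor \<C> (ob (brutal \<C> m C) (n + 1)) (ob (brutal \<C> m C) (n - 1))"
    by cases (use C in \<open>simp_all add: brutal_simps cplx_simps the_zero_Obj mor_intros cmp_distrib\<close>)
qed

lemma brutal_bounded_below: "bounded_below \<C> (brutal \<C> m C)"
  unfolding bounded_below_def by (rule exI[of _ m]) (simp add: brutal_simps zero_object_the_zero)

text \<open>Differentials lower degrees, so the truncation is the quotient of \<open>C\<close> by
  its part below \<open>m\<close>; this is the quotient map.\<close>

definition brutal_pr :: "int \<Rightarrow> ('a, 'b) cplx \<Rightarrow> int \<Rightarrow> 'b"
  where "brutal_pr m C n = (if n \<ge> m then Idn \<C> (ob C n) else zero_mor \<C> (ob C n) (the_zero \<C>))"

text \<open>For \<open>n\<close> at most \<open>m\<close> the square ends in a zero object and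
  commutes automatically.\<close>

lemma chain_map_to_brutal:
  assumes C: "C \<in> complexes \<C>" and D: "D \<in> complexes \<C>"
    and mor: "\<And>n. f n \<in> mor \<C> (ob C n) (ob (brutal \<C> m D) n)"
    and comm: "\<And>n. n > m \<Longrightarrow> df D n \<bullet>\<^bsub>ob C n,ob D n,ob D (n - 1)\<^esub> f n = f (n - 1) \<bullet>\<^bsub>ob C n,ob C (n - 1),ob D (n - 1)\<^esub> df C n"
  shows "f \<in> chain_maps \<C> C (brutal \<C> m D)"
  unfolding chain_maps_def mem_Collect_eq
proof (intro allI conjI mor)
  fix n
  show "df (brutal \<C> m D) n \<bullet>\<^bsub>ob C n,ob (brutal \<C> m D) n,ob (brutal \<C> m D) (n - 1)\<^esub> f n =
    f (n - 1) \<bullet>\<^bsub>ob C n,ob C (n - 1),ob (brutal \<C> m D) (n - 1)\<^esub> df C n" (is "?l = ?r")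
  proof (cases "n > m")
    case True then show ?thesis using comm by (simp add: brutal_simps)
  next
    case False
    then have z: "zero_object \<C> (ob (brutal \<C> m D) (n - 1))" by (simp add: brutal_simps zero_object_the_zero)
    have "?l \<in> mor \<C> (ob C n) (ob (brutal \<C> m D) (n - 1))" "?r \<in> mor \<C> (ob C n) (ob (brutal \<C> m D) (n - 1))"
      using mor[of n] mor[of "n - 1"] C brutal_complexes[OF D] by (simp_all add: cplx_simps mor_intros)
    then show ?thesis using mor_to_zero[OF z ob_Obj[OF C]] by metis
  qed
qed

lemma brutal_pr:
  assumes C: "C \<in> complexes \<C>"
  shows "brutal_pr m C \<in> chain_maps \<C> C (brutal \<C> m C)" "ev_iso C (brutal \<C> m C) (brutal_pr m C)"
proof -
  show p: "brutal_pr m C \<in> chain_maps \<C> C (brutal \<C> m C)"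
    by (rule chain_map_to_brutal[OF C C])
      (use C in \<open>auto simp: brutal_pr_def brutal_simps cplx_simps the_zero_Obj mor_intros Cmp_Idn_left Cmp_Idn_right\<close>)
  have "\<forall>n\<ge>m. ob C n = ob (brutal \<C> m C) n \<and> brutal_pr m C n = Idn \<C> (ob C n)"
    by (simp add: brutal_simps brutal_pr_def)
  then show "ev_iso C (brutal \<C> m C) (brutal_pr m C)"
    using p C by (intro ev_iso_if_ev_id) (auto simp: eventually_at_top_linorder)
qed

lemma brutal_strict_mb:
  assumes C: "C \<in> strict_mb"
  shows "brutal \<C> m C \<in> strict_mb"
  using eventually_acyclic_ev_iso[OF strict_mbD(1)[OF C] brutal_complexes brutal_pr(2) strict_mbD(2)[OF C] brutal_bounded_below]
    C brutal_complexes brutal_bounded_below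
  by (auto simp: strict_mb_def)

text \<open>From some degree \<open>m\<close> on, \<open>g\<close> is an honest chain map, hence a
  map from \<open>X\<close> to the truncation of \<open>Y\<close> at \<open>m\<close>. The Ore
  square with the quotient map of \<open>Y\<close> turns it into a fraction, and the quotient map is
  the identity in high degrees, so the germ is unchanged.\<close>

lemma germ_fraction:
  assumes X: "X \<in> strict_mb" and Y: "Y \<in> strict_mb" and g: "geq X Y g g"
  obtains W q y where "W \<in> strict_mb" "ev_iso W X q" "keq W Y y y" "geq W Y y (cc W X Y g q)"
proof -
  have Xc: "X \<in> complexes \<C>" and Yc: "Y \<in> complexes \<C>" using X Y by (auto simp: strict_mb_def)
  from g obtain m where m: "\<And>n. n \<ge> m \<Longrightarrow> g n \<in> mor \<C> (ob X n) (ob Y n)"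
    "\<And>n. n \<ge> m \<Longrightarrow> df Y n \<bullet>\<^bsub>ob X n,ob Y n,ob Y (n - 1)\<^esub> g n = g (n - 1) \<bullet>\<^bsub>ob X n,ob X (n - 1),ob Y (n - 1)\<^esub> df X n"
    by (auto simp: heq_def chmap_def eventually_at_top_linorder)
  let ?B = "brutal \<C> m Y" and ?p = "brutal_pr m Y"
  define g' where "g' n = (if n \<ge> m then g n else zero_mor \<C> (ob X n) (the_zero \<C>))" for n
  have "g' \<in> chain_maps \<C> X ?B"
    by (rule chain_map_to_brutal[OF Xc Yc])
      (use m Xc in \<open>auto simp: g'_def brutal_simps ob_Obj the_zero_Obj mor_intros\<close>)
  then have g': "keq X ?B g' g'" using Xc Yc by (simp add: keq_self brutal_complexes)
  have p: "keq Y ?B ?p ?p" using Yc by (simp add: keq_self brutal_complexes brutal_pr)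
  have "hclass \<C> Y ?B ?p \<in> Sys Y ?B"
    by (rule ev_iso_Sys[OF Y brutal_strict_mb[OF Y] brutal_pr(2)[OF Yc]])
  then obtain W q y where W: "W \<in> strict_mb" "ev_iso W X q" "keq W Y y y"
    and eq: "keq W ?B (cc W Y ?B ?p y) (cc W X ?B g' q)"
    using Ore_square[OF _ p X g'] by blast
  have Wc: "W \<in> complexes \<C>" using W by (simp add: strict_mb_def)
  have q: "keq W X q q" using W Wc Xc by (simp add: ev_iso_keq)
  have yc: "y \<in> chain_maps \<C> W Y" using W by (simp add: keq_self)
  have "htpy at_top W ?B (cc W Y ?B ?p y) (cc W X ?B g' q)"
    using eq by (auto simp: heq_def intro: htpy_of_top)
  then obtain h where "\<forall>\<^sub>F n in at_top. h n \<in> mor \<C> (ob W n) (ob ?B (n + 1)) \<and>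
      cc W Y ?B ?p y n = cc W X ?B g' q n \<boxplus>\<^bsub>ob W n,ob ?B n\<^esub> bd W ?B h n"
    unfolding htpy_def by blast
  moreover have "\<forall>\<^sub>F n in at_top. n \<ge> m" by (rule eventually_ge_at_top)
  ultimately have "\<forall>\<^sub>F n in at_top. h n \<in> mor \<C> (ob W n) (ob Y (n + 1)) \<and>
      y n = cc W X Y g q n \<boxplus>\<^bsub>ob W n,ob Y n\<^esub> bd W Y h n"
  proof eventually_elim
    case (elim n)
    then show ?case
      using chain_maps_mor[OF yc, of n] Wc Yc
      by (simp add: brutal_simps bd_def chain_comp_def brutal_pr_def g'_def ob_Obj Cmp_Idn_left)
  qed
  then have "htpy at_top W Y y (cc W X Y g q)" unfolding htpy_def by blast
  moreover have "geq W Y (cc W X Y g q) (cc W X Y g q)" by (intro geq_comp g geq_if_keq[OF q])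
  moreover have "geq W Y y y" by (rule geq_if_keq[OF W(3)])
  ultimately have "geq W Y y (cc W X Y g q)" by (simp add: heq_def)
  with W that show thesis by blast
qed

text \<open>This is a subcomplex since differentials lower degrees; it is bounded if
  \<open>C\<close> is bounded below.\<close>

definition lower_trunc :: "int \<Rightarrow> ('a, 'b) cplx \<Rightarrow> ('a, 'b) cplx"
  where "lower_trunc N C = \<lparr>ob = \<lambda>n. if n \<le> N then ob C n else the_zero \<C>,
    df = \<lambda>n. if n \<le> N then df C n else zero_mor \<C> (the_zero \<C>) (if n - 1 \<le> N then ob C (n - 1) else the_zero \<C>)\<rparr>"

lemma lower_trunc_simps:
  "n \<le> N \<Longrightarrow> ob (lower_trunc N C) n = ob C n" "n \<le> N \<Longrightarrow> df (lower_trunc N C) n = df C n"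
  "n > N \<Longrightarrow> ob (lower_trunc N C) n = the_zero \<C>"
  "n > N \<Longrightarrow> df (lower_trunc N C) n = zero_mor \<C> (the_zero \<C>) (ob (lower_trunc N C) (n - 1))"
  by (simp_all add: lower_trunc_def)

lemma lower_trunc_complexes:
  assumes C: "C \<in> complexes \<C>"
  shows "lower_trunc N C \<in> complexes \<C>"
proof -
  have ob: "ob (lower_trunc N C) n \<in> Obj \<C>" for n
    using C by (cases "n \<le> N") (simp_all add: lower_trunc_simps ob_Obj the_zero_Obj)
  have d: "df (lower_trunc N C) n \<in> mor \<C> (ob (lower_trunc N C) n) (ob (lower_trunc N C) (n - 1))" for n
    using C ob[of "n - 1"] by (cases "n \<le> N") (simp_all add: lower_trunc_simps df_mor the_zero_Obj zero_mor)
  have "df (lower_trunc N C) n \<bullet>\<^bsub>ob (lower_trunc N C) (n + 1),ob (lower_trunc N C) n,ob (lower_trunc N C) (n - 1)\<^esub>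
      df (lower_trunc N C) (n + 1) = zero_mor \<C> (ob (lower_trunc N C) (n + 1)) (ob (lower_trunc N C) (n - 1))" for n
  proof (cases "n + 1 \<le> N")
    case True then show ?thesis using C by (simp add: lower_trunc_simps df_df)
  next
    case False
    then have "df (lower_trunc N C) (n + 1) = zero_mor \<C> (ob (lower_trunc N C) (n + 1)) (ob (lower_trunc N C) n)"
      by (simp add: lower_trunc_simps(3,4))
    then show ?thesis using ob d by (simp add: cmp_zero_right)
  qed
  then show ?thesis unfolding complexes_def using ob d by blast
qed

text \<open>
  A map with zero germ is homotopic to one that vanishes in high degrees, and this factors through
  the bounded complex \<open>lower_trunc N Y\<close>; so it dies on the fibre of the first factor.
\<close>

lemma germ_null_kill:
  assumes V: "V \<in> strict_mb" and Y: "Y \<in> strict_mb" and f: "keq V Y f f" and null: "geq V Y f (chain_zero V Y)"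
  obtains W q where "W \<in> strict_mb" "ev_iso W V q" "keq W Y (cc W V Y f q) (chain_zero W Y)"
proof -
  have Vc: "V \<in> complexes \<C>" and Yc: "Y \<in> complexes \<C>" and fc: "f \<in> chain_maps \<C> V Y"
    using f by (auto simp: keq_self)
  from null obtain h where "\<forall>\<^sub>F n in at_top. h n \<in> mor \<C> (ob V n) (ob Y (n + 1)) \<and>
      f n = chain_zero V Y n \<boxplus>\<^bsub>ob V n,ob Y n\<^esub> bd V Y h n"
    unfolding heq_def htpy_def by blast
  then obtain M where M: "\<And>n. n \<ge> M \<Longrightarrow> h n \<in> mor \<C> (ob V n) (ob Y (n + 1))"
    "\<And>n. n \<ge> M \<Longrightarrow> f n = chain_zero V Y n \<boxplus>\<^bsub>ob V n,ob Y n\<^esub> bd V Y h n"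
    by (auto simp: eventually_at_top_linorder)
  \<comment> \<open>Extended by zero, the germ of a homotopy becomes one in all degrees. Its
    boundary \<open>b\<close> is a null-homotopic chain map that agrees with \<open>f\<close> in
    high degrees.\<close>
  define k where "k n = (if n \<ge> M then h n else zero_mor \<C> (ob V n) (ob Y (n + 1)))" for n
  have k: "k n \<in> mor \<C> (ob V n) (ob Y (n + 1))" for n using M(1) Vc Yc by (simp add: k_def zero_mor ob_Obj)
  define b where "b n = bd V Y k n" for n
  have bm: "b n \<in> mor \<C> (ob V n) (ob Y n)" for n
    unfolding b_def using bd_mor[OF Vc Yc, of k n] k[of n] k[of "n - 1"] by simp
  have b: "b \<in> chain_maps \<C> V Y"
    unfolding chain_maps_def mem_Collect_eq
  proof (intro allI conjI bm)
    fix n show "df Y n \<bullet>\<^bsub>ob V n,ob Y n,ob Y (n - 1)\<^esub> b n = b (n - 1) \<bullet>\<^bsub>ob V n,ob V (n - 1),ob Y (n - 1)\<^esub> df V n"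
      using k[of n] k[of "n - 1"] k[of "n - 2"] Vc Yc
      by (simp add: b_def bd_def cplx_simps mor_intros cmp_distrib Cmp_assoc add_simps)
  qed
  have bz: "homotopic V Y b (chain_zero V Y)"
    unfolding htpy_top
  proof (intro exI[of _ k] allI conjI k)
    fix n show "b n = chain_zero V Y n \<boxplus>\<^bsub>ob V n,ob Y n\<^esub> bd V Y k n"
      unfolding b_def[symmetric] chain_zero_def by (rule add_zero_left[symmetric]) (use bm Vc Yc in \<open>simp_all add: ob_Obj\<close>)
  qed
  define f' where "f' = chain_add V Y f (chain_neg V Y b)"
  have f': "f' \<in> chain_maps \<C> V Y" unfolding f'_def using Vc Yc fc b by (intro chain_maps_closed)
  \<comment> \<open>The inequality is strict because \<open>bd\<close> in degree \<open>n\<close>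
    also involves \<open>k (n - 1)\<close>, which is known to be \<open>h (n - 1)\<close> only for
    \<open>n > M\<close>.\<close>
  have hi: "f' n = zero_mor \<C> (ob V n) (ob Y n)" if "n > M" for n
  proof -
    have "f n = b n"
      using that M(2)[of n] bm[of n] Vc Yc by (simp add: b_def bd_def k_def chain_zero_def add_zero_left ob_Obj)
    then show ?thesis using bm Vc Yc by (simp add: f'_def chain_add_def chain_neg_def add_neg ob_Obj)
  qed
  have ff': "keq V Y f f'"
  proof -
    have "homotopic V Y (chain_add V Y f (chain_neg V Y b)) (chain_add V Y f (chain_neg V Y (chain_zero V Y)))"
      using Vc Yc fc b bz by (intro homotopic_add homotopic_neg homotopic_refl chain_maps_closed)
    moreover have "chain_neg V Y (chain_zero V Y) = chain_zero V Y"
      using Vc Yc by (auto simp: fun_eq_iff chain_neg_def chain_zero_def neg_zero ob_Obj)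
    ultimately have "homotopic V Y f' f" using Vc Yc fc by (simp add: f'_def chain_add_zero)
    then have "keq V Y f' f" using Vc Yc fc f' by (simp add: heq_def chmap_top)
    then show ?thesis by (rule keq_sym)
  qed
  let ?B = "lower_trunc M Y"
  have B: "?B \<in> complexes \<C>" by (rule lower_trunc_complexes[OF Yc])
  define r where "r n = (if n \<le> M then f' n else zero_mor \<C> (ob V n) (the_zero \<C>))" for n
  define j where "j n = (if n \<le> M then Idn \<C> (ob Y n) else zero_mor \<C> (the_zero \<C>) (ob Y n))" for n
  have r: "r \<in> chain_maps \<C> V ?B"
    unfolding chain_maps_def mem_Collect_eq
  proof
    fix n
    \<comment> \<open>In degree \<open>M + 1\<close>, commutation requires that \<open>f' M\<close>
      composed with the differential of \<open>V\<close> vanish; it equals the differential of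
      \<open>Y\<close> composed with \<open>f' (M + 1)\<close>, which is zero.\<close>
    consider "n \<le> M" | "n = M + 1" | "n > M + 1" by linarith
    then show "r n \<in> mor \<C> (ob V n) (ob ?B n) \<and>
      df ?B n \<bullet>\<^bsub>ob V n,ob ?B n,ob ?B (n - 1)\<^esub> r n = r (n - 1) \<bullet>\<^bsub>ob V n,ob V (n - 1),ob ?B (n - 1)\<^esub> df V n"
      by cases (use f' Vc Yc hi[of n] in \<open>simp_all add: r_def lower_trunc_simps chain_maps_mor chain_maps_df cplx_simps
        the_zero_Obj mor_intros cmp_distrib\<close>)
  qed
  have j: "j \<in> chain_maps \<C> ?B Y"
    unfolding chain_maps_def mem_Collect_eq
  proof
    fix n
    consider "n \<le> M" | "n = M + 1" | "n > M + 1" by linarith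
    then show "j n \<in> mor \<C> (ob ?B n) (ob Y n) \<and>
      df Y n \<bullet>\<^bsub>ob ?B n,ob Y n,ob Y (n - 1)\<^esub> j n = j (n - 1) \<bullet>\<^bsub>ob ?B n,ob ?B (n - 1),ob Y (n - 1)\<^esub> df ?B n"
      by cases (use Yc in \<open>simp_all add: j_def lower_trunc_simps cplx_simps the_zero_Obj mor_intros cmp_distrib
          Cmp_Idn_left Cmp_Idn_right\<close>)
  qed
  have jr: "cc V ?B Y j r = f'"
  proof
    fix n show "cc V ?B Y j r n = f' n"
      using f' Vc Yc hi[of n] by (cases "n \<le> M")
        (simp_all add: chain_comp_def j_def r_def lower_trunc_simps chain_maps_mor Cmp_Idn_left cmp_zero_left ob_Obj the_zero_Obj zero_mor)
  qed
  obtain N where N: "\<And>n. n < N \<Longrightarrow> zero_object \<C> (ob Y n)" using bounded_belowD[OF strict_mbD(2)[OF Y]] by blast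
  have "zero_object \<C> (ob ?B n)" if "\<bar>n\<bar> > \<bar>M\<bar> + \<bar>N\<bar>" for n
    using that N[of n] by (cases "n \<le> M") (auto simp: lower_trunc_simps zero_object_the_zero)
  then have bB: "bounded_complex \<C> ?B" unfolding bounded_complex_def by blast
  have rk: "keq V ?B r r" and jk: "keq ?B Y j j" using r j Vc Yc B by (simp_all add: keq_self)
  let ?W = "fibre V ?B r" and ?q = "fibre_pr V ?B"
  have q: "keq ?W V ?q ?q" by (rule fibre_pr_keq[OF rk])
  have "keq ?W Y (cc ?W V Y f ?q) (cc ?W V Y f' ?q)" by (intro keq_comp ff' q)
  also have "keq ?W Y (cc ?W V Y f' ?q) (cc ?W ?B Y j (cc ?W V ?B r ?q))"
    unfolding jr[symmetric] by (rule keq_sym, intro keq_assoc q rk jk)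
  also have "keq ?W Y \<dots> (cc ?W ?B Y j (chain_zero ?W ?B))" by (intro keq_comp jk fibre_null[OF rk])
  also have "cc ?W ?B Y j (chain_zero ?W ?B) = chain_zero ?W Y"
    by (rule chain_comp_zero_right[OF jk fibre_complexes[OF rk]])
  finally show thesis using that fibre_strict_mb[OF rk bB V] by blast
qed

end

section \<open>The Verdier quotient as a category of germs\<close>

context additive_category
begin

lemma mor_K_keq: "\<lbrakk>C \<in> complexes \<C>; D \<in> complexes \<C>; \<phi> \<in> mor K C D\<rbrakk> \<Longrightarrow> \<exists>f. \<phi> = hclass \<C> C D f \<and> keq C D f f"
  by (auto simp: mor_K keq_self)

lemma keq_mor_K: "keq C D f f \<Longrightarrow> hclass \<C> C D f \<in> mor K C D"
  by (simp add: keq_self hclass_mor)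

lemma hclass_keq: "keq C D f g \<Longrightarrow> hclass \<C> C D f = hclass \<C> C D g"
  by (simp add: keq_iff)

lemma keq_if_hclass_eq: "\<lbrakk>keq C D f f; keq C D g g; hclass \<C> C D f = hclass \<C> C D g\<rbrakk> \<Longrightarrow> keq C D f g"
  by (simp add: keq_iff)

lemma Sys_keq: "\<lbrakk>\<sigma> \<in> Sys X Y\<rbrakk> \<Longrightarrow> \<exists>s. \<sigma> = hclass \<C> X Y s \<and> keq X Y s s"
  by (rule Sys_cone[of \<sigma> X Y]) blast+

text \<open>The germ inverse of \<open>p\<close> cancels it from the right.\<close>

lemma geq_cancel_Sys:
  assumes S: "hclass \<C> W X p \<in> Sys W X" and p: "keq W X p p" and g: "geq X Y g g" and g': "geq X Y g' g'"
    and eq: "geq W Y (cc W X Y g p) (cc W X Y g' p)"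
  shows "geq X Y g g'"
proof -
  obtain c where c: "geq X W c c" and pc: "geq X X (cc X W X p c) (chain_id X)"
    using Sys_germ_inverse[OF p S] by blast
  have "geq X Y g (cc X W Y (cc W X Y g p) c)"
    by (rule geq_sym, intro hequiv_inv_right[OF at_top] c geq_if_keq[OF p] pc g)
  also have "geq X Y \<dots> (cc X W Y (cc W X Y g' p) c)" by (intro geq_comp eq c)
  also have "geq X Y \<dots> g'" by (intro hequiv_inv_right[OF at_top] c geq_if_keq[OF p] pc g')
  finally show ?thesis .
qed

text \<open>Apply \<open>germ_null_kill\<close> to the difference \<open>f - g\<close>, then add
  \<open>g q\<close> back.\<close>

lemma germ_eq_equalise:
  assumes V: "V \<in> strict_mb" and Y: "Y \<in> strict_mb" and f: "keq V Y f f" and g: "keq V Y g g" and fg: "geq V Y f g"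
  obtains W q where "W \<in> strict_mb" "ev_iso W V q" "keq W Y (cc W V Y f q) (cc W V Y g q)"
proof -
  have Vc: "V \<in> complexes \<C>" and Yc: "Y \<in> complexes \<C>" and fc: "f \<in> chain_maps \<C> V Y" and gc: "g \<in> chain_maps \<C> V Y"
    using f g by (auto simp: keq_self)
  define e where "e = chain_add V Y f (chain_neg V Y g)"
  have n: "keq V Y (chain_neg V Y g) (chain_neg V Y g)" using Vc Yc gc by (simp add: keq_self chain_maps_neg)
  have e: "keq V Y e e" unfolding e_def by (intro keq_add f n)
  have "geq V Y e (chain_add V Y g (chain_neg V Y g))"
    unfolding e_def by (intro heq_add[OF at_top] fg geq_if_keq[OF n])
  also have "chain_add V Y g (chain_neg V Y g) = chain_zero V Y" by (rule chain_add_zero(4)[OF Vc Yc gc])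
  finally obtain W q where W: "W \<in> strict_mb" "ev_iso W V q" and null: "keq W Y (cc W V Y e q) (chain_zero W Y)"
    using germ_null_kill[OF V Y e] by blast
  have Wc: "W \<in> complexes \<C>" using W by (simp add: strict_mb_def)
  have q: "keq W V q q" by (rule ev_iso_keq[OF W(2) Wc Vc])
  have gq: "keq W Y (cc W V Y g q) (cc W V Y g q)" by (intro keq_comp g q)
  have "f = chain_add V Y e g"
    unfolding e_def using Vc Yc fc gc by (simp add: chain_add_assoc chain_maps_neg chain_add_zero)
  then have "keq W Y (cc W V Y f q) (cc W V Y (chain_add V Y e g) q)" using keq_comp[OF f q] by simp
  also have "keq W Y \<dots> (chain_add W Y (cc W V Y e q) (cc W V Y g q))" by (intro heq_add_comp[OF all_deg] q e g)
  also have "keq W Y \<dots> (chain_add W Y (chain_zero W Y) (cc W V Y g q))" by (intro keq_add null gq)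
  also have "chain_add W Y (chain_zero W Y) (cc W V Y g q) = cc W V Y g q"
    using gq by (intro chain_add_zero(1)) (auto simp: keq_self)
  finally show thesis using that W by blast
qed

abbreviation "Roofs \<equiv> roofs (Kmb \<C>) (Obj (Kb \<C>))"

lemma mem_roofs: "(Z, \<sigma>, \<phi>) \<in> Roofs X Y \<longleftrightarrow> Z \<in> Obj (Kmb \<C>) \<and> \<sigma> \<in> Sys Z X \<and> \<phi> \<in> mor K Z Y"
  by (auto simp: roofs_def Kmb_simps)

text \<open>
  \<open>roof_val X Y (Z, [s], [f]) g\<close> expresses that \<open>f s\<^sup>-\<^sup>1\<close> is the germ \<open>g\<close>, and \<open>germ_class X Y g\<close> is the
  morphism of the Verdier quotient corresponding to the germ \<open>g\<close>.
\<close>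

definition roof_val :: "('a, 'b) cplx \<Rightarrow> ('a, 'b) cplx \<Rightarrow> (('a, 'b) cplx, (int \<Rightarrow> 'b) set) roof \<Rightarrow> (int \<Rightarrow> 'b) \<Rightarrow> bool"
  where "roof_val X Y = (\<lambda>(Z, \<sigma>, \<phi>) g. \<exists>s f. \<sigma> = hclass \<C> Z X s \<and> \<phi> = hclass \<C> Z Y f \<and>
    keq Z X s s \<and> keq Z Y f f \<and> geq Z Y f (cc Z X Y g s))"

definition germ_class :: "('a, 'b) cplx \<Rightarrow> ('a, 'b) cplx \<Rightarrow> (int \<Rightarrow> 'b) \<Rightarrow> (('a, 'b) cplx, (int \<Rightarrow> 'b) set) roof set"
  where "germ_class X Y g = {r \<in> Roofs X Y. roof_val X Y r g}"

lemma roof_reps: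
  assumes "(Z, \<sigma>, \<phi>) \<in> Roofs X Y" "Y \<in> complexes \<C>"
  obtains s f where "\<sigma> = hclass \<C> Z X s" "\<phi> = hclass \<C> Z Y f" "keq Z X s s" "keq Z Y f f" "Z \<in> complexes \<C>"
proof -
  have "Z \<in> complexes \<C>" "\<phi> \<in> mor K Z Y" using assms Obj_Kmb_complexes by (auto simp: mem_roofs)
  with assms Sys_keq[of \<sigma> Z X] mor_K_keq[of Z Y \<phi>] that show thesis by (auto simp: mem_roofs)
qed

text \<open>\<open>roof_val\<close> is existential in the representatives. Homotopic representatives
  have homotopic germs, so any one choice decides the condition.\<close>

lemma roof_val_hclass:
  assumes s: "keq Z X s s" and f: "keq Z Y f f" and g: "geq X Y g g"
  shows "roof_val X Y (Z, hclass \<C> Z X s, hclass \<C> Z Y f) g \<longleftrightarrow> geq Z Y f (cc Z X Y g s)"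
proof
  assume "roof_val X Y (Z, hclass \<C> Z X s, hclass \<C> Z Y f) g"
  then obtain s' f' where eq: "hclass \<C> Z X s = hclass \<C> Z X s'" "hclass \<C> Z Y f = hclass \<C> Z Y f'"
    and k: "keq Z X s' s'" "keq Z Y f' f'" and v: "geq Z Y f' (cc Z X Y g s')"
    unfolding roof_val_def by auto
  have "geq Z Y f f'" by (rule geq_if_keq[OF keq_if_hclass_eq[OF f k(2) eq(2)]])
  also note v
  also have "geq Z Y (cc Z X Y g s') (cc Z X Y g s)"
    by (rule geq_comp[OF g geq_if_keq[OF keq_if_hclass_eq[OF k(1) s eq(1)[symmetric]]]])
  finally show "geq Z Y f (cc Z X Y g s)" .
qed (use s f in \<open>auto simp: roof_val_def\<close>)

lemma roof_val_cong:
  assumes "geq X Y g g'" "roof_val X Y r g"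
  shows "roof_val X Y r g'"
proof -
  obtain Z \<sigma> \<phi> where r: "r = (Z, \<sigma>, \<phi>)" by (cases r)
  from assms(2) obtain s f where k: "\<sigma> = hclass \<C> Z X s" "\<phi> = hclass \<C> Z Y f" "keq Z X s s" "keq Z Y f f" 
    and v: "geq Z Y f (cc Z X Y g s)" unfolding r roof_val_def by auto
  have "geq Z Y (cc Z X Y g s) (cc Z X Y g' s)" by (rule geq_comp[OF assms(1) geq_if_keq[OF k(3)]])
  from geq_trans[OF v this] k show ?thesis unfolding r roof_val_def by auto
qed

text \<open>With \<open>c\<close> the germ inverse of the denominator, the value is
  \<open>f c\<close>.\<close>

lemma roof_val_exists:
  assumes r: "r \<in> Roofs X Y" and Y: "Y \<in> complexes \<C>"
  obtains g where "geq X Y g g" "roof_val X Y r g"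
proof -
  obtain Z \<sigma> \<phi> where r': "r = (Z, \<sigma>, \<phi>)" by (cases r)
  obtain s f where sf: "\<sigma> = hclass \<C> Z X s" "\<phi> = hclass \<C> Z Y f" "keq Z X s s" "keq Z Y f f"
    using roof_reps[OF r[unfolded r'] Y] by blast
  have "hclass \<C> Z X s \<in> Sys Z X" using r unfolding r' sf mem_roofs by blast
  then obtain c where c: "geq X Z c c" and cs: "geq Z Z (cc Z X Z c s) (chain_id Z)"
    using Sys_germ_inverse[OF sf(3)] by blast
  have g: "geq X Y (cc X Z Y f c) (cc X Z Y f c)" by (intro geq_comp c geq_if_keq[OF sf(4)])
  have "geq Z Y f (cc Z X Y (cc X Z Y f c) s)"
    by (rule geq_sym, intro hequiv_inv_right[OF at_top] geq_if_keq[OF sf(3)] geq_if_keq[OF sf(4)] c cs)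
  with sf have "roof_val X Y r (cc X Z Y f c)" unfolding r' roof_val_def by auto
  with g that show thesis by blast
qed

text \<open>Both values become the germ of \<open>f\<close> after composition with the denominator,
  which can be cancelled.\<close>

lemma roof_val_unique:
  assumes r: "r \<in> Roofs X Y" and g: "geq X Y g g" "roof_val X Y r g" and g': "geq X Y g' g'" "roof_val X Y r g'"
  shows "geq X Y g g'"
proof -
  obtain Z \<sigma> \<phi> where r': "r = (Z, \<sigma>, \<phi>)" by (cases r)
  have Y: "Y \<in> complexes \<C>" using g by (simp add: heq_def)
  obtain s f where sf: "\<sigma> = hclass \<C> Z X s" "\<phi> = hclass \<C> Z Y f" "keq Z X s s" "keq Z Y f f"
    using roof_reps[OF r[unfolded r'] Y] by blast
  have v: "geq Z Y f (cc Z X Y g s)" "geq Z Y f (cc Z X Y g' s)"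
    using g(2) g'(2) roof_val_hclass[OF sf(3,4) g(1)] roof_val_hclass[OF sf(3,4) g'(1)] unfolding r' sf by blast+
  have "geq Z Y (cc Z X Y g s) (cc Z X Y g' s)" by (rule geq_trans[OF geq_sym[OF v(1)] v(2)])
  moreover have "hclass \<C> Z X s \<in> Sys Z X" using r unfolding r' sf mem_roofs by blast
  ultimately show ?thesis using geq_cancel_Sys[OF _ sf(3) g(1) g'(1)] by blast
qed

text \<open>Pull both roofs back to one strict apex on which the denominators agree. There both
  numerators have the germ \<open>g\<close> composed with this denominator, so one further
  denominator makes them homotopic.\<close>

lemma roof_rel_common_val:
  assumes X: "X \<in> strict_mb" and Y: "Y \<in> strict_mb" and r: "r \<in> Roofs X Y" and r': "r' \<in> Roofs X Y"
    and g: "geq X Y g g" and v: "roof_val X Y r g" and v': "roof_val X Y r' g"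
  shows "(r, r') \<in> roof_rel (Kmb \<C>) (Obj (Kb \<C>)) X Y"
proof -
  have Xc: "X \<in> complexes \<C>" and Yc: "Y \<in> complexes \<C>" using X Y by (auto simp: strict_mb_def)
  obtain Z \<sigma> \<phi> where rZ: "r = (Z, \<sigma>, \<phi>)" by (cases r)
  obtain s f where sf: "\<sigma> = hclass \<C> Z X s" "\<phi> = hclass \<C> Z Y f" "keq Z X s s" "keq Z Y f f"
    using roof_reps[OF r[unfolded rZ] Yc] by blast
  obtain Z' \<sigma>' \<phi>' where rZ': "r' = (Z', \<sigma>', \<phi>')" by (cases r')
  obtain s' f' where sf': "\<sigma>' = hclass \<C> Z' X s'" "\<phi>' = hclass \<C> Z' Y f'" "keq Z' X s' s'" "keq Z' Y f' f'"
    using roof_reps[OF r'[unfolded rZ'] Yc] by blast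
  have S: "hclass \<C> Z X s \<in> Sys Z X" and S': "hclass \<C> Z' X s' \<in> Sys Z' X"
    using r r' unfolding rZ rZ' sf sf' mem_roofs by auto
  have fg: "geq Z Y f (cc Z X Y g s)" using v roof_val_hclass[OF sf(3,4) g] unfolding rZ sf by blast
  have fg': "geq Z' Y f' (cc Z' X Y g s')" using v' roof_val_hclass[OF sf'(3,4) g] unfolding rZ' sf' by blast
  \<comment> \<open>The square with the identity of \<open>X\<close> replaces the apex
    \<open>Z\<close>, which need not lie in \<open>strict_mb\<close>, by a strict one that maps to
    \<open>X\<close> by an \<open>ev_iso\<close>.\<close>
  obtain W1 q1 y1 where W1: "W1 \<in> strict_mb" "ev_iso W1 X q1" "keq W1 Z y1 y1"
    "keq W1 X (cc W1 Z X s y1) (cc W1 X X (chain_id X) q1)"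
    using Ore_square[OF S sf(3) X keq_id[OF Xc]] .
  have W1c: "W1 \<in> complexes \<C>" using W1 by (simp add: strict_mb_def)
  have q1: "keq W1 X q1 q1" by (rule ev_iso_keq[OF W1(2) W1c Xc])
  have sy1: "keq W1 X (cc W1 Z X s y1) q1" using keq_trans[OF W1(4) keq_id_left[OF q1]] .
  \<comment> \<open>The second square brings in \<open>Z'\<close>; on \<open>W2\<close> both
    denominators become \<open>q1 q2\<close>.\<close>
  obtain W2 q2 y2 where W2: "W2 \<in> strict_mb" "ev_iso W2 W1 q2" "keq W2 Z' y2 y2"
    and sy2: "keq W2 X (cc W2 Z' X s' y2) (cc W2 W1 X q1 q2)"
    using Ore_square[OF S' sf'(3) W1(1) q1] .
  have W2c: "W2 \<in> complexes \<C>" using W2 by (simp add: strict_mb_def)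
  have q2: "keq W2 W1 q2 q2" by (rule ev_iso_keq[OF W2(2) W2c W1c])
  define a2 where "a2 = cc W2 W1 Z y1 q2"
  have a2: "keq W2 Z a2 a2" unfolding a2_def by (intro keq_comp W1 q2)
  have sa2: "keq W2 X (cc W2 Z X s a2) (cc W2 W1 X q1 q2)"
  proof -
    have "keq W2 X (cc W2 Z X s a2) (cc W2 W1 X (cc W1 Z X s y1) q2)"
      unfolding a2_def by (intro keq_assoc sf W1 q2)
    also have "keq W2 X \<dots> (cc W2 W1 X q1 q2)" by (intro keq_comp sy1 q2)
    finally show ?thesis .
  qed
  note G = geq_if_keq
  have "geq W2 Y (cc W2 Z Y f a2) (cc W2 Z Y (cc Z X Y g s) a2)" by (intro geq_comp fg G[OF a2])
  also have "geq W2 Y \<dots> (cc W2 X Y g (cc W2 Z X s a2))"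
    by (rule geq_sym, intro geq_assoc G[OF a2] G[OF sf(3)] g)
  also have "geq W2 Y \<dots> (cc W2 X Y g (cc W2 Z' X s' y2))"
    by (intro geq_comp g geq_trans[OF G[OF sa2] geq_sym[OF G[OF sy2]]])
  also have "geq W2 Y \<dots> (cc W2 Z' Y (cc Z' X Y g s') y2)"
    by (intro geq_assoc G[OF W2(3)] G[OF sf'(3)] g)
  also have "geq W2 Y \<dots> (cc W2 Z' Y f' y2)" by (intro geq_comp geq_sym[OF fg'] G[OF W2(3)])
  finally have ff: "geq W2 Y (cc W2 Z Y f a2) (cc W2 Z' Y f' y2)" .
  \<comment> \<open>On \<open>W2\<close> the numerators agree only as germs; on \<open>W\<close>
    they agree up to homotopy.\<close>
  obtain W q where W: "W \<in> strict_mb" "ev_iso W W2 q" and eq: "keq W Y (cc W W2 Y (cc W2 Z Y f a2) q) (cc W W2 Y (cc W2 Z' Y f' y2) q)"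
    using germ_eq_equalise[OF W2(1) Y keq_comp[OF sf(4) a2] keq_comp[OF sf'(4) W2(3)] ff] .
  have Wc: "W \<in> complexes \<C>" using W by (simp add: strict_mb_def)
  have q: "keq W W2 q q" by (rule ev_iso_keq[OF W(2) Wc W2c])
  define a where "a = cc W W2 Z a2 q"
  define b where "b = cc W W2 Z' y2 q"
  define p where "p = cc W W2 X (cc W2 W1 X q1 q2) q"
  have a: "keq W Z a a" unfolding a_def by (intro keq_comp a2 q)
  have b: "keq W Z' b b" unfolding b_def by (intro keq_comp W2 q)
  have sa: "keq W X (cc W Z X s a) p"
  proof -
    have "keq W X (cc W Z X s a) (cc W W2 X (cc W2 Z X s a2) q)" unfolding a_def by (intro keq_assoc sf a2 q)
    also have "keq W X \<dots> p" unfolding p_def by (intro keq_comp sa2 q)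
    finally show ?thesis .
  qed
  have sb: "keq W X (cc W Z' X s' b) p"
  proof -
    have "keq W X (cc W Z' X s' b) (cc W W2 X (cc W2 Z' X s' y2) q)" unfolding b_def by (intro keq_assoc sf' W2 q)
    also have "keq W X \<dots> p" unfolding p_def by (intro keq_comp sy2 q)
    finally show ?thesis .
  qed
  have fafb: "keq W Y (cc W Z Y f a) (cc W Z' Y f' b)"
  proof -
    have "keq W Y (cc W Z Y f a) (cc W W2 Y (cc W2 Z Y f a2) q)" unfolding a_def by (intro keq_assoc sf a2 q)
    also note eq
    also have "keq W Y (cc W W2 Y (cc W2 Z' Y f' y2) q) (cc W Z' Y f' b)"
      unfolding b_def by (rule keq_sym, intro keq_assoc sf' W2 q)
    finally show ?thesis .
  qed
  \<comment> \<open>The common denominator is a composite of three maps invertible in high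
    degrees.\<close>
  have "ev_iso W X p" unfolding p_def by (intro ev_iso_comp W W2 W1 Wc W2c W1c Xc)
  then have pS: "hclass \<C> W X p \<in> Sys W X" by (rule ev_iso_Sys[OF W(1) X])
  have "\<exists>W\<in>Obj (Kmb \<C>). \<exists>a\<in>mor (Kmb \<C>) W Z. \<exists>b\<in>mor (Kmb \<C>) W Z'.
      Cmp (Kmb \<C>) W Z X \<sigma> a \<in> Sys W X \<and> Cmp (Kmb \<C>) W Z X \<sigma> a = Cmp (Kmb \<C>) W Z' X \<sigma>' b \<and>
      Cmp (Kmb \<C>) W Z Y \<phi> a = Cmp (Kmb \<C>) W Z' Y \<phi>' b"
      unfolding Kmb_simps(2-6)
    proof (intro bexI conjI)
      show "W \<in> Obj (Kmb \<C>)" using W strict_mb_Obj_Kmb by blast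
      show "hclass \<C> W Z a \<in> mor K W Z" "hclass \<C> W Z' b \<in> mor K W Z'" by (intro keq_mor_K a b)+
      show "Cmp K W Z X \<sigma> (hclass \<C> W Z a) \<in> Sys W X"
        using pS by (simp add: sf K_comp_keq[OF a sf(3)] hclass_keq[OF sa])
      show "Cmp K W Z X \<sigma> (hclass \<C> W Z a) = Cmp K W Z' X \<sigma>' (hclass \<C> W Z' b)"
        by (simp add: sf(1) sf'(1) K_comp_keq[OF a sf(3)] K_comp_keq[OF b sf'(3)] hclass_keq[OF sa] hclass_keq[OF sb])
      show "Cmp K W Z Y \<phi> (hclass \<C> W Z a) = Cmp K W Z' Y \<phi>' (hclass \<C> W Z' b)"
        by (simp add: sf(2) sf'(2) K_comp_keq[OF a sf(4)] K_comp_keq[OF b sf'(4)] hclass_keq[OF fafb])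
    qed
  then show ?thesis
    using r r' unfolding rZ rZ' roof_rel_def by simp
qed

text \<open>Let \<open>g'\<close> be the germ of \<open>r'\<close>. Over the common refinement
  \<open>W\<close>, both \<open>g\<close> and \<open>g'\<close> composed with the map to
  \<open>X\<close> give the germ of the common numerator. That map lies in \<open>Sys\<close>, so it
  can be cancelled.\<close>

lemma roof_rel_val:
  assumes X: "X \<in> strict_mb" and Y: "Y \<in> strict_mb" and rel: "(r, r') \<in> roof_rel (Kmb \<C>) (Obj (Kb \<C>)) X Y"
    and g: "geq X Y g g" and v: "roof_val X Y r g"
  shows "roof_val X Y r' g"
proof -
  have Xc: "X \<in> complexes \<C>" and Yc: "Y \<in> complexes \<C>" using X Y by (auto simp: strict_mb_def)
  obtain Z \<sigma> \<phi> Z' \<sigma>' \<phi>' where rZ: "r = (Z, \<sigma>, \<phi>)" and rZ': "r' = (Z', \<sigma>', \<phi>')" by (cases r; cases r')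
  from rel have r: "r \<in> Roofs X Y" and r': "r' \<in> Roofs X Y" by (auto simp: roof_rel_def)
  obtain W \<alpha> \<beta> where W: "W \<in> Obj (Kmb \<C>)" and ab: "\<alpha> \<in> mor K W Z" "\<beta> \<in> mor K W Z'"
    and S: "Cmp K W Z X \<sigma> \<alpha> \<in> Sys W X" and e1: "Cmp K W Z X \<sigma> \<alpha> = Cmp K W Z' X \<sigma>' \<beta>"
    and e2: "Cmp K W Z Y \<phi> \<alpha> = Cmp K W Z' Y \<phi>' \<beta>"
    using rel unfolding rZ rZ' roof_rel_def Kmb_simps(2-6) by auto
  obtain s f where sf: "\<sigma> = hclass \<C> Z X s" "\<phi> = hclass \<C> Z Y f" "keq Z X s s" "keq Z Y f f" "Z \<in> complexes \<C>"
    using roof_reps[OF r[unfolded rZ] Yc] by blast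
  obtain s' f' where sf': "\<sigma>' = hclass \<C> Z' X s'" "\<phi>' = hclass \<C> Z' Y f'" "keq Z' X s' s'" "keq Z' Y f' f'" "Z' \<in> complexes \<C>"
    using roof_reps[OF r'[unfolded rZ'] Yc] by blast
  have Wc: "W \<in> complexes \<C>" using W Obj_Kmb_complexes by blast
  obtain a where a: "\<alpha> = hclass \<C> W Z a" "keq W Z a a" using mor_K_keq[OF Wc sf(5) ab(1)] by blast
  obtain b where b: "\<beta> = hclass \<C> W Z' b" "keq W Z' b b" using mor_K_keq[OF Wc sf'(5) ab(2)] by blast
  have sa: "keq W X (cc W Z X s a) (cc W Z X s a)" "keq W X (cc W Z' X s' b) (cc W Z' X s' b)"
    "keq W Y (cc W Z Y f a) (cc W Z Y f a)" "keq W Y (cc W Z' Y f' b) (cc W Z' Y f' b)"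
    by (intro keq_comp a b sf sf')+
  have eq1: "keq W X (cc W Z X s a) (cc W Z' X s' b)"
    by (rule keq_if_hclass_eq[OF sa(1,2)]) (use e1 in \<open>simp add: sf sf' a b K_comp_keq\<close>)
  have eq2: "keq W Y (cc W Z Y f a) (cc W Z' Y f' b)"
    by (rule keq_if_hclass_eq[OF sa(3,4)]) (use e2 in \<open>simp add: sf sf' a b K_comp_keq\<close>)
  have S': "hclass \<C> W X (cc W Z X s a) \<in> Sys W X" using S by (simp add: sf a K_comp_keq)
  have fg: "geq Z Y f (cc Z X Y g s)" using v roof_val_hclass[OF sf(3,4) g] unfolding rZ sf by blast
  obtain g' where g': "geq X Y g' g'" and v': "roof_val X Y r' g'" using roof_val_exists[OF r' Yc] .
  have fg': "geq Z' Y f' (cc Z' X Y g' s')" using v' roof_val_hclass[OF sf'(3,4) g'] unfolding rZ' sf' by blast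
  note G = geq_if_keq
  have "geq W Y (cc W X Y g' (cc W Z X s a)) (cc W X Y g' (cc W Z' X s' b))" by (intro geq_comp g' G[OF eq1])
  also have "geq W Y \<dots> (cc W Z' Y (cc Z' X Y g' s') b)" by (intro geq_assoc G[OF b(2)] G[OF sf'(3)] g')
  also have "geq W Y \<dots> (cc W Z' Y f' b)" by (intro geq_comp geq_sym[OF fg'] G[OF b(2)])
  also have "geq W Y \<dots> (cc W Z Y f a)" by (rule geq_sym[OF G[OF eq2]])
  also have "geq W Y \<dots> (cc W Z Y (cc Z X Y g s) a)" by (intro geq_comp fg G[OF a(2)])
  also have "geq W Y \<dots> (cc W X Y g (cc W Z X s a))"
    by (rule geq_sym, intro geq_assoc G[OF a(2)] G[OF sf(3)] g)
  finally have "geq X Y g' g" using geq_cancel_Sys[OF S' sa(1) g' g] by blast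
  from roof_val_cong[OF this v'] show ?thesis .
qed

abbreviation "Q \<equiv> verdier_quotient (Kmb \<C>) (Obj (Kb \<C>))"

text \<open>By the two preceding lemmas, roofs are related exactly when they have the same
  germ.\<close>

lemma roof_class_eq:
  assumes X: "X \<in> strict_mb" and Y: "Y \<in> strict_mb" and g: "geq X Y g g" and r: "r \<in> germ_class X Y g"
  shows "roof_class (Kmb \<C>) (Obj (Kb \<C>)) X Y r = germ_class X Y g"
proof -
  have "(r, r') \<in> roof_rel (Kmb \<C>) (Obj (Kb \<C>)) X Y \<longleftrightarrow> r' \<in> germ_class X Y g" for r'
  proof
    assume rel: "(r, r') \<in> roof_rel (Kmb \<C>) (Obj (Kb \<C>)) X Y"
    then have "r' \<in> Roofs X Y" by (auto simp: roof_rel_def)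
    with roof_rel_val[OF X Y rel g] r show "r' \<in> germ_class X Y g" by (simp add: germ_class_def)
  qed (use roof_rel_common_val[OF X Y _ _ g] r in \<open>simp add: germ_class_def\<close>)
  then show ?thesis by (auto simp: roof_class_def)
qed

text \<open>The unions in \<open>quot_comp\<close> and \<open>quot_susp\<close> also range over
  triples that are not known to be roofs; those that are not contribute nothing.\<close>

lemma roof_class_invalid: "r \<notin> Roofs X Y \<Longrightarrow> roof_class (Kmb \<C>) (Obj (Kb \<C>)) X Y r = {}"
  by (auto simp: roof_class_def roof_rel_def)

lemma germ_class_nonempty:
  assumes X: "X \<in> strict_mb" and Y: "Y \<in> strict_mb" and g: "geq X Y g g"
  obtains W q y where "W \<in> strict_mb" "ev_iso W X q" "keq W X q q" "keq W Y y y"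
    "(W, hclass \<C> W X q, hclass \<C> W Y y) \<in> germ_class X Y g"
proof -
  obtain W q y where W: "W \<in> strict_mb" "ev_iso W X q" "keq W Y y y" "geq W Y y (cc W X Y g q)"
    using germ_fraction[OF X Y g] .
  then have q: "keq W X q q" using X by (auto simp: strict_mb_def ev_iso_keq)
  have "(W, hclass \<C> W X q, hclass \<C> W Y y) \<in> Roofs X Y"
    using W strict_mb_Obj_Kmb ev_iso_Sys[OF W(1) X W(2)] keq_mor_K[OF W(3)] by (auto simp: mem_roofs)
  then have "(W, hclass \<C> W X q, hclass \<C> W Y y) \<in> germ_class X Y g"
    using roof_val_hclass[OF q W(3) g] W(4) by (simp add: germ_class_def)
  with that W q show thesis by blast
qed

text \<open>A roof in the common class has both germs as values, and values are unique;
  \<open>germ_class_nonempty\<close> supplies the roof.\<close>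

lemma germ_class_eq_iff:
  assumes X: "X \<in> strict_mb" and Y: "Y \<in> strict_mb" and g: "geq X Y g g" and g': "geq X Y g' g'"
  shows "germ_class X Y g = germ_class X Y g' \<longleftrightarrow> geq X Y g g'"
proof
  assume eq: "germ_class X Y g = germ_class X Y g'"
  obtain r where "r \<in> germ_class X Y g" using germ_class_nonempty[OF X Y g] by blast
  with eq have "r \<in> Roofs X Y" "roof_val X Y r g" "roof_val X Y r g'" by (auto simp: germ_class_def)
  then show "geq X Y g g'" using roof_val_unique g g' by blast
next
  assume "geq X Y g g'"
  then show "germ_class X Y g = germ_class X Y g'"
    using roof_val_cong[of X Y g g'] roof_val_cong[of X Y g' g] geq_sym[of X Y g g'] unfolding germ_class_def by blast
qed

lemma germ_class_cong:
  assumes "X \<in> strict_mb" "Y \<in> strict_mb" "geq X Y g g'"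
  shows "germ_class X Y g = germ_class X Y g'"
  using germ_class_eq_iff[OF assms(1,2) geq_refl_left[OF assms(3)] geq_refl_right[OF assms(3)]] assms(3) by blast

lemma quot_mor_germ_class:
  assumes X: "X \<in> strict_mb" and Y: "Y \<in> strict_mb" and f: "keq X Y f f"
  shows "quot_mor (Kmb \<C>) (Obj (Kb \<C>)) X Y (hclass \<C> X Y f) = germ_class X Y f"
proof -
  have Xc: "X \<in> complexes \<C>" using X by (simp add: strict_mb_def)
  have "hclass \<C> X X (chain_id X) \<in> Sys X X" by (rule ev_iso_Sys[OF X X ev_iso_id[OF Xc]])
  then have "(X, hclass \<C> X X (chain_id X), hclass \<C> X Y f) \<in> Roofs X Y"
    using X strict_mb_Obj_Kmb keq_mor_K[OF f] by (auto simp: mem_roofs)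
  moreover have "roof_val X Y (X, hclass \<C> X X (chain_id X), hclass \<C> X Y f) f"
    using roof_val_hclass[OF keq_id[OF Xc] f geq_if_keq[OF f]] geq_sym[OF geq_id_right[OF geq_if_keq[OF f]]] by blast
  ultimately show ?thesis
    unfolding quot_mor_def Kmb_simps K_simps(3) by (intro roof_class_eq[OF X Y geq_if_keq[OF f]]) (simp add: germ_class_def)
qed

lemma Q_simps:
  "Obj Q = Obj (Kmb \<C>)"
  "carrier (Hom Q X Y) = Roofs X Y // roof_rel (Kmb \<C>) (Obj (Kb \<C>)) X Y"
  "x \<otimes>\<^bsub>Hom Q X Y\<^esub> y = quot_add (Kmb \<C>) (Obj (Kb \<C>)) X Y x y"
  "Idn Q X = quot_mor (Kmb \<C>) (Obj (Kb \<C>)) X X (Idn K X)"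
  "Cmp Q = quot_comp (Kmb \<C>) (Obj (Kb \<C>))"
  "SuspO Q = susp \<C>"
  "SuspM Q = quot_susp (Kmb \<C>) (Obj (Kb \<C>))"
  by (simp_all add: verdier_quotient_def saturate_triangles_simps Kmb_simps(3,5) K_simps(5))

lemma mor_Q:
  assumes X: "X \<in> strict_mb" and Y: "Y \<in> strict_mb"
  shows "mor Q X Y = germ_class X Y ` {g. geq X Y g g}"
proof (intro subset_antisym subsetI)
  have Yc: "Y \<in> complexes \<C>" using Y by (simp add: strict_mb_def)
  fix \<phi> assume "\<phi> \<in> mor Q X Y"
  then obtain r where r: "r \<in> Roofs X Y" and \<phi>: "\<phi> = roof_class (Kmb \<C>) (Obj (Kb \<C>)) X Y r"
    by (auto simp: Q_simps quotient_def roof_class_def)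
  obtain g where g: "geq X Y g g" "roof_val X Y r g" using roof_val_exists[OF r Yc] .
  then have "r \<in> germ_class X Y g" using r by (simp add: germ_class_def)
  then show "\<phi> \<in> germ_class X Y ` {g. geq X Y g g}" using roof_class_eq[OF X Y g(1)] \<phi> g by blast
next
  fix \<phi> assume "\<phi> \<in> germ_class X Y ` {g. geq X Y g g}"
  then obtain g where g: "geq X Y g g" "\<phi> = germ_class X Y g" by blast
  obtain r where r: "r \<in> germ_class X Y g" using germ_class_nonempty[OF X Y g(1)] by blast
  have "\<phi> = roof_class (Kmb \<C>) (Obj (Kb \<C>)) X Y r" using roof_class_eq[OF X Y g(1) r] g by simp
  then show "\<phi> \<in> mor Q X Y"
    using r by (auto simp: Q_simps quotient_def roof_class_def germ_class_def)
qed

lemma Idn_Q: "X \<in> strict_mb \<Longrightarrow> Idn Q X = germ_class X X (chain_id X)"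
  unfolding Q_simps K_simps(3) by (intro quot_mor_germ_class keq_id) (auto simp: strict_mb_def)

text \<open>In every admissible square, cancelling the denominators as germs gives the composite
  triple the value \<open>h g\<close> (\<open>val\<close>). So each set in the union lies in the
  class of \<open>h g\<close> (\<open>sub\<close>), and one of them is the whole class
  (\<open>ex\<close>).\<close>

lemma Cmp_Q:
  assumes X: "X \<in> strict_mb" and Y: "Y \<in> strict_mb" and Z: "Z \<in> strict_mb" and g: "geq X Y g g" and h: "geq Y Z h h"
  shows "Cmp Q X Y Z (germ_class Y Z h) (germ_class X Y g) = germ_class X Z (cc X Y Z h g)"
proof -
  let ?M = "{roof_class (Kmb \<C>) (Obj (Kb \<C>)) X Z (W, Cmp K W U X s a, Cmp K W V Z u b) | U s f V t u W a b.
      (U, s, f) \<in> germ_class X Y g \<and> (V, t, u) \<in> germ_class Y Z h \<and> W \<in> Obj (Kmb \<C>) \<and> a \<in> Sys W U \<and> b \<in> mor K W V \<and>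
      Cmp K W U Y f a = Cmp K W V Y t b}"
  have Yc: "Y \<in> complexes \<C>" and Zc: "Z \<in> complexes \<C>" and Xc: "X \<in> complexes \<C>" using X Y Z by (auto simp: strict_mb_def)
  have hg: "geq X Z (cc X Y Z h g) (cc X Y Z h g)" by (intro geq_comp g h)
  note G = geq_if_keq
  have val: "roof_val X Z (W, Cmp K W U X \<sigma> \<alpha>, Cmp K W V Z \<psi> \<beta>) (cc X Y Z h g)"
    if 1: "(U, \<sigma>, \<phi>) \<in> germ_class X Y g" and 2: "(V, \<tau>, \<psi>) \<in> germ_class Y Z h" and W: "W \<in> Obj (Kmb \<C>)"
      and \<alpha>: "\<alpha> \<in> Sys W U" and \<beta>: "\<beta> \<in> mor K W V" and eq: "Cmp K W U Y \<phi> \<alpha> = Cmp K W V Y \<tau> \<beta>" for U \<sigma> \<phi> V \<tau> \<psi> W \<alpha> \<beta>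
  proof -
    obtain s f where sf: "\<sigma> = hclass \<C> U X s" "\<phi> = hclass \<C> U Y f" "keq U X s s" "keq U Y f f" "U \<in> complexes \<C>"
      using roof_reps[of U \<sigma> \<phi> X Y] 1 Yc by (auto simp: germ_class_def)
    obtain t u where tu: "\<tau> = hclass \<C> V Y t" "\<psi> = hclass \<C> V Z u" "keq V Y t t" "keq V Z u u" "V \<in> complexes \<C>"
      using roof_reps[of V \<tau> \<psi> Y Z] 2 Zc by (auto simp: germ_class_def)
    have Wc: "W \<in> complexes \<C>" using W Obj_Kmb_complexes by blast
    obtain a where a: "\<alpha> = hclass \<C> W U a" "keq W U a a" using Sys_keq[OF \<alpha>] by blast
    obtain b where b: "\<beta> = hclass \<C> W V b" "keq W V b b" using mor_K_keq[OF Wc tu(5) \<beta>] by blast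
    have fg: "geq U Y f (cc U X Y g s)"
      using 1 roof_val_hclass[OF sf(3,4) g] unfolding sf germ_class_def by blast
    have uh: "geq V Z u (cc V Y Z h t)"
      using 2 roof_val_hclass[OF tu(3,4) h] unfolding tu germ_class_def by blast
    have k: "keq W Y (cc W U Y f a) (cc W U Y f a)" "keq W Y (cc W V Y t b) (cc W V Y t b)"
      "keq W X (cc W U X s a) (cc W U X s a)" "keq W Z (cc W V Z u b) (cc W V Z u b)"
      by (intro keq_comp a b sf tu)+
    have fatb: "keq W Y (cc W U Y f a) (cc W V Y t b)"
      by (rule keq_if_hclass_eq[OF k(1,2)]) (use eq in \<open>simp add: sf tu a b K_comp_keq\<close>)
    have "geq W Z (cc W V Z u b) (cc W V Z (cc V Y Z h t) b)" by (intro geq_comp uh G[OF b(2)])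
    also have "geq W Z \<dots> (cc W Y Z h (cc W V Y t b))" by (rule geq_sym, intro geq_assoc h G[OF tu(3)] G[OF b(2)])
    also have "geq W Z \<dots> (cc W Y Z h (cc W X Y g (cc W U X s a)))"
    proof (rule geq_comp[OF h])
      have "geq W Y (cc W V Y t b) (cc W U Y f a)" by (rule geq_sym[OF G[OF fatb]])
      also have "geq W Y \<dots> (cc W U Y (cc U X Y g s) a)" by (intro geq_comp fg G[OF a(2)])
      also have "geq W Y \<dots> (cc W X Y g (cc W U X s a))" by (rule geq_sym, intro geq_assoc g G[OF sf(3)] G[OF a(2)])
      finally show "geq W Y (cc W V Y t b) (cc W X Y g (cc W U X s a))" .
    qed
    also have "geq W Z \<dots> (cc W X Z (cc X Y Z h g) (cc W U X s a))" by (intro geq_assoc h g G[OF k(3)])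
    finally have "geq W Z (cc W V Z u b) (cc W X Z (cc X Y Z h g) (cc W U X s a))" .
    then show ?thesis
      using roof_val_hclass[OF k(3,4) hg] by (simp add: sf tu a b K_comp_keq)
  qed
  have sub: "m \<subseteq> germ_class X Z (cc X Y Z h g)" if "m \<in> ?M" for m
  proof -
    from that obtain U \<sigma> \<phi> V \<tau> \<psi> W \<alpha> \<beta> where m: "m = roof_class (Kmb \<C>) (Obj (Kb \<C>)) X Z (W, Cmp K W U X \<sigma> \<alpha>, Cmp K W V Z \<psi> \<beta>)"
      and "(U, \<sigma>, \<phi>) \<in> germ_class X Y g" "(V, \<tau>, \<psi>) \<in> germ_class Y Z h" "W \<in> Obj (Kmb \<C>)"
      "\<alpha> \<in> Sys W U" "\<beta> \<in> mor K W V" "Cmp K W U Y \<phi> \<alpha> = Cmp K W V Y \<tau> \<beta>" by blast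
    note v = val[OF this(2-)]
    show ?thesis
    \<comment> \<open>The definition does not record that the composite denominator has its cone in
      \<open>Kb\<close>. Without this the class is empty and the inclusion trivial.\<close>
    proof (cases "(W, Cmp K W U X \<sigma> \<alpha>, Cmp K W V Z \<psi> \<beta>) \<in> Roofs X Z")
      case True
      with v have "(W, Cmp K W U X \<sigma> \<alpha>, Cmp K W V Z \<psi> \<beta>) \<in> germ_class X Z (cc X Y Z h g)" by (simp add: germ_class_def)
      then show ?thesis using roof_class_eq[OF X Z hg] m by blast
    qed (use m roof_class_invalid in blast)
  qed
  have ex: "germ_class X Z (cc X Y Z h g) \<in> ?M"
  proof -
    \<comment> \<open>Roofs with \<open>ev_iso\<close> denominators, joined by an Ore square, have a
      composite whose denominator is certainly admissible.\<close>
    obtain U q y where U: "U \<in> strict_mb" "ev_iso U X q" "keq U X q q" "keq U Y y y"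
      "(U, hclass \<C> U X q, hclass \<C> U Y y) \<in> germ_class X Y g"
      using germ_class_nonempty[OF X Y g] .
    obtain V t u where V: "V \<in> strict_mb" "ev_iso V Y t" "keq V Y t t" "keq V Z u u"
      "(V, hclass \<C> V Y t, hclass \<C> V Z u) \<in> germ_class Y Z h"
      using germ_class_nonempty[OF Y Z h] .
    obtain W a b where W: "W \<in> strict_mb" "ev_iso W U a" "keq W V b b" and sq: "keq W Y (cc W V Y t b) (cc W U Y y a)"
      using Ore_square[OF ev_iso_Sys[OF V(1) Y V(2)] V(3) U(1) U(4)] .
    have Wc: "W \<in> complexes \<C>" and Uc: "U \<in> complexes \<C>" using W U by (auto simp: strict_mb_def)
    have a: "keq W U a a" by (rule ev_iso_keq[OF W(2) Wc Uc])
    have WO: "W \<in> Obj (Kmb \<C>)" using W strict_mb_Obj_Kmb by blast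
    have aS: "hclass \<C> W U a \<in> Sys W U" by (rule ev_iso_Sys[OF W(1) U(1) W(2)])
    have eq: "Cmp K W U Y (hclass \<C> U Y y) (hclass \<C> W U a) = Cmp K W V Y (hclass \<C> V Y t) (hclass \<C> W V b)"
      by (simp add: K_comp_keq[OF a U(4)] K_comp_keq[OF W(3) V(3)] hclass_keq[OF sq])
    let ?r = "(W, Cmp K W U X (hclass \<C> U X q) (hclass \<C> W U a), Cmp K W V Z (hclass \<C> V Z u) (hclass \<C> W V b))"
    have "ev_iso W X (cc W U X q a)" by (rule ev_iso_comp[OF Wc Uc Xc W(2) U(2)])
    then have "hclass \<C> W X (cc W U X q a) \<in> Sys W X" by (rule ev_iso_Sys[OF W(1) X])
    then have "?r \<in> Roofs X Z"
      using WO keq_mor_K[OF keq_comp[OF V(4) W(3)]] by (simp add: mem_roofs K_comp_keq[OF a U(3)] K_comp_keq[OF W(3) V(4)])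
    then have "?r \<in> germ_class X Z (cc X Y Z h g)"
      using val[OF U(5) V(5) WO aS keq_mor_K[OF W(3)] eq] by (simp add: germ_class_def)
    then have "roof_class (Kmb \<C>) (Obj (Kb \<C>)) X Z ?r = germ_class X Z (cc X Y Z h g)" by (rule roof_class_eq[OF X Z hg])
    then show ?thesis using U(5) V(5) WO aS keq_mor_K[OF W(3)] eq by blast
  qed
  have "Cmp Q X Y Z (germ_class Y Z h) (germ_class X Y g) = \<Union>?M"
    unfolding Q_simps quot_comp_def Kmb_simps(2,4) ..
  also have "\<dots> = germ_class X Z (cc X Y Z h g)" using sub ex by blast
  finally show ?thesis .
qed

text \<open>Stated for honest chain maps: their roofs over the identity of \<open>X\<close> already
  share a denominator, so the union is nonempty. Any other common denominator leads to the same
  germ.\<close>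

lemma add_Q:
  assumes X: "X \<in> strict_mb" and Y: "Y \<in> strict_mb" and f: "keq X Y f f" and g: "keq X Y g g"
  shows "germ_class X Y f \<otimes>\<^bsub>Hom Q X Y\<^esub> germ_class X Y g = germ_class X Y (chain_add X Y f g)"
proof -
  let ?M = "{roof_class (Kmb \<C>) (Obj (Kb \<C>)) X Y (Z, s, u \<otimes>\<^bsub>Hom K Z Y\<^esub> v) | Z s u v.
    (Z, s, u) \<in> germ_class X Y f \<and> (Z, s, v) \<in> germ_class X Y g}"
  have Xc: "X \<in> complexes \<C>" and Yc: "Y \<in> complexes \<C>" using X Y by (auto simp: strict_mb_def)
  note G = geq_if_keq
  have fg: "keq X Y (chain_add X Y f g) (chain_add X Y f g)" by (intro keq_add f g)
  have mem: "(Z, \<sigma>, \<phi> \<otimes>\<^bsub>Hom K Z Y\<^esub> \<psi>) \<in> germ_class X Y (chain_add X Y f g)"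
    if 1: "(Z, \<sigma>, \<phi>) \<in> germ_class X Y f" and 2: "(Z, \<sigma>, \<psi>) \<in> germ_class X Y g" for Z \<sigma> \<phi> \<psi>
  proof -
    obtain s u where su: "\<sigma> = hclass \<C> Z X s" "\<phi> = hclass \<C> Z Y u" "keq Z X s s" "keq Z Y u u" "Z \<in> complexes \<C>"
      using roof_reps[of Z \<sigma> \<phi> X Y] 1 Yc by (auto simp: germ_class_def)
    obtain v where v: "\<psi> = hclass \<C> Z Y v" "keq Z Y v v"
      using roof_reps[of Z \<sigma> \<psi> X Y] 2 Yc by (auto simp: germ_class_def)
    have uv: "keq Z Y (chain_add Z Y u v) (chain_add Z Y u v)" by (intro keq_add su v)
    have eq: "\<phi> \<otimes>\<^bsub>Hom K Z Y\<^esub> \<psi> = hclass \<C> Z Y (chain_add Z Y u v)"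
      unfolding su v by (rule K_add) (use su v in \<open>auto simp: keq_self\<close>)
    have "geq Z Y u (cc Z X Y f s)" using 1 roof_val_hclass[OF su(3,4) G[OF f]] unfolding su germ_class_def by blast
    moreover have "geq Z Y v (cc Z X Y g s)" using 2 roof_val_hclass[OF su(3) v(2) G[OF g]] unfolding su v germ_class_def by blast
    ultimately have "geq Z Y (chain_add Z Y u v) (chain_add Z Y (cc Z X Y f s) (cc Z X Y g s))"
      by (rule heq_add[OF at_top])
    also have "geq Z Y \<dots> (cc Z X Y (chain_add X Y f g) s)"
      by (rule geq_sym, rule heq_add_comp[OF at_top]) (rule G[OF su(3)] G[OF f] G[OF g])+
    finally have "roof_val X Y (Z, \<sigma>, \<phi> \<otimes>\<^bsub>Hom K Z Y\<^esub> \<psi>) (chain_add X Y f g)"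
      using roof_val_hclass[OF su(3) uv G[OF fg]] unfolding eq su(1) by blast
    moreover have "(Z, \<sigma>, \<phi> \<otimes>\<^bsub>Hom K Z Y\<^esub> \<psi>) \<in> Roofs X Y"
      using 1 keq_mor_K[OF uv] unfolding eq by (auto simp: germ_class_def mem_roofs)
    ultimately show ?thesis by (simp add: germ_class_def)
  qed
  have all: "m = germ_class X Y (chain_add X Y f g)" if "m \<in> ?M" for m
    using that mem roof_class_eq[OF X Y G[OF fg]] by blast
  have "(X, Idn K X, hclass \<C> X Y k) \<in> germ_class X Y k" if k: "keq X Y k k" for k
  proof -
    have "hclass \<C> X X (chain_id X) \<in> Sys X X" by (rule ev_iso_Sys[OF X X ev_iso_id[OF Xc]])
    moreover have "roof_val X Y (X, hclass \<C> X X (chain_id X), hclass \<C> X Y k) k"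
      using roof_val_hclass[OF keq_id[OF Xc] k G[OF k]] geq_sym[OF geq_id_right[OF G[OF k]]] by blast
    ultimately show ?thesis
      using X strict_mb_Obj_Kmb keq_mor_K[OF k] by (auto simp: mem_roofs germ_class_def K_simps(3))
  qed
  from this[OF f] this[OF g] have "?M \<noteq> {}" by blast
  with all have "\<Union>?M = germ_class X Y (chain_add X Y f g)" by blast
  then show ?thesis unfolding Q_simps quot_add_def Kmb_simps(2) .
qed

section \<open>Suspension and isomorphisms in the quotient\<close>

lemma exact_from_susp:
  assumes C: "C \<in> complexes \<C>" and P: "P \<in> Obj \<C>" and ex: "exact_from P C (n - 1)"
  shows "exact_from P (susp \<C> C) n"
  unfolding exact_from_def
proof (intro ballI impI)
  note ty = cplx_simps[OF C] P mor_intros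
  fix x assume "x \<in> mor \<C> P (ob (susp \<C> C) n)"
    and d: "df (susp \<C> C) n \<bullet>\<^bsub>P,ob (susp \<C> C) n,ob (susp \<C> C) (n - 1)\<^esub> x = zero_mor \<C> P (ob (susp \<C> C) (n - 1))"
  then have x: "x \<in> mor \<C> P (ob C (n - 1))" by (simp add: susp_simps)
  have "\<boxminus>\<^bsub>P,ob C (n - 2)\<^esub> (df C (n - 1) \<bullet>\<^bsub>P,ob C (n - 1),ob C (n - 2)\<^esub> x) = zero_mor \<C> P (ob C (n - 2))"
    using d x by (simp add: susp_simps ty cmp_neg_left)
  then have "\<boxminus>\<^bsub>P,ob C (n - 2)\<^esub> (\<boxminus>\<^bsub>P,ob C (n - 2)\<^esub> (df C (n - 1) \<bullet>\<^bsub>P,ob C (n - 1),ob C (n - 2)\<^esub> x)) = zero_mor \<C> P (ob C (n - 2))"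
    by (simp add: neg_zero ty)
  then have "df C (n - 1) \<bullet>\<^bsub>P,ob C (n - 1),ob C (n - 2)\<^esub> x = zero_mor \<C> P (ob C (n - 2))"
    using x by (simp add: neg_neg ty)
  then obtain y where y: "y \<in> mor \<C> P (ob C n)" "x = df C n \<bullet>\<^bsub>P,ob C n,ob C (n - 1)\<^esub> y"
    using ex x unfolding exact_from_def by auto
  then have "x = df (susp \<C> C) (n + 1) \<bullet>\<^bsub>P,ob (susp \<C> C) (n + 1),ob (susp \<C> C) n\<^esub> (\<boxminus>\<^bsub>P,ob C n\<^esub> y)"
    by (simp add: susp_simps ty cmp_distrib neg_neg)
  with y show "\<exists>y\<in>mor \<C> P (ob (susp \<C> C) (n + 1)). x = df (susp \<C> C) (n + 1) \<bullet>\<^bsub>P,ob (susp \<C> C) (n + 1),ob (susp \<C> C) n\<^esub> y"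
    by (auto intro!: bexI[of _ "\<boxminus>\<^bsub>P,ob C n\<^esub> y"] simp: susp_simps ty)
qed

lemma susp_strict_mb:
  assumes C: "C \<in> strict_mb"
  shows "susp \<C> C \<in> strict_mb"
proof -
  have Cc: "C \<in> complexes \<C>" using C by (simp add: strict_mb_def)
  have "\<exists>N. \<forall>n. \<bar>n\<bar> > N \<longrightarrow> exact_from P (susp \<C> C) n" if P: "P \<in> Obj \<C>" for P
  proof -
    obtain N where N: "\<And>n. \<bar>n\<bar> > N \<Longrightarrow> exact_from P C n"
      using C P unfolding strict_mb_def by (auto simp: eventually_acyclic_iff[OF Cc])
    have "\<forall>n. \<bar>n\<bar> > N + 1 \<longrightarrow> exact_from P (susp \<C> C) n"
      using exact_from_susp[OF Cc P] N by auto
    then show ?thesis by blast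
  qed
  moreover obtain N where N: "\<And>n. n < N \<Longrightarrow> zero_object \<C> (ob C n)" using bounded_belowD[OF strict_mbD(2)[OF C]] by blast
  then have "\<forall>n<N. zero_object \<C> (ob (susp \<C> C) n)" by (simp add: susp_simps)
  ultimately show ?thesis
    using Cc by (auto simp: strict_mb_def eventually_acyclic_iff susp_complexes bounded_below_def)
qed

text \<open>As for composition, every suspended triple has the suspended germ as value. A shift
  preserves \<open>ev_iso\<close>, so a roof with such a denominator has a suspension that is again
  a roof.\<close>

lemma SuspM_Q:
  assumes X: "X \<in> strict_mb" and Y: "Y \<in> strict_mb" and g: "geq X Y g g"
  shows "SuspM Q X Y (germ_class X Y g) = germ_class (susp \<C> X) (susp \<C> Y) (susp_map g)"
proof -
  let ?M = "{roof_class (Kmb \<C>) (Obj (Kb \<C>)) (susp \<C> X) (susp \<C> Y) (susp \<C> Z, SuspM K Z X s, SuspM K Z Y f) | Z s f.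
    (Z, s, f) \<in> germ_class X Y g}"
  have Xc: "X \<in> complexes \<C>" and Yc: "Y \<in> complexes \<C>" using X Y by (auto simp: strict_mb_def)
  have SX: "susp \<C> X \<in> strict_mb" and SY: "susp \<C> Y \<in> strict_mb" using X Y by (auto intro: susp_strict_mb)
  have sg: "geq (susp \<C> X) (susp \<C> Y) (susp_map g) (susp_map g)" by (rule heq_susp[OF at_top g])
  have sM: "SuspM K C D (hclass \<C> C D f) = hclass \<C> (susp \<C> C) (susp \<C> D) (susp_map f)" if "keq C D f f" for C D f
    using that by (auto simp: keq_self K_susp)
  have val: "roof_val (susp \<C> X) (susp \<C> Y) (susp \<C> Z, SuspM K Z X \<sigma>, SuspM K Z Y \<phi>) (susp_map g)"
    if 1: "(Z, \<sigma>, \<phi>) \<in> germ_class X Y g" for Z \<sigma> \<phi>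
  proof -
    obtain s f where sf: "\<sigma> = hclass \<C> Z X s" "\<phi> = hclass \<C> Z Y f" "keq Z X s s" "keq Z Y f f" "Z \<in> complexes \<C>"
      using roof_reps[of Z \<sigma> \<phi> X Y] 1 Yc by (auto simp: germ_class_def)
    have fg: "geq Z Y f (cc Z X Y g s)" using 1 roof_val_hclass[OF sf(3,4) g] unfolding sf germ_class_def by blast
    have "susp_map (cc Z X Y g s) = cc (susp \<C> Z) (susp \<C> X) (susp \<C> Y) (susp_map g) (susp_map s)"
      by (auto simp: susp_map_def chain_comp_def susp_simps)
    then have "geq (susp \<C> Z) (susp \<C> Y) (susp_map f) (cc (susp \<C> Z) (susp \<C> X) (susp \<C> Y) (susp_map g) (susp_map s))"
      using heq_susp[OF at_top fg] by simp
    then show ?thesis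
      using roof_val_hclass[OF heq_susp[OF all_deg sf(3)] heq_susp[OF all_deg sf(4)] sg] by (simp add: sf sM)
  qed
  have sub: "m \<subseteq> germ_class (susp \<C> X) (susp \<C> Y) (susp_map g)" if "m \<in> ?M" for m
  proof -
    from that obtain Z \<sigma> \<phi> where m: "m = roof_class (Kmb \<C>) (Obj (Kb \<C>)) (susp \<C> X) (susp \<C> Y) (susp \<C> Z, SuspM K Z X \<sigma>, SuspM K Z Y \<phi>)"
      and "(Z, \<sigma>, \<phi>) \<in> germ_class X Y g" by blast
    note v = val[OF this(2)]
    show ?thesis
    proof (cases "(susp \<C> Z, SuspM K Z X \<sigma>, SuspM K Z Y \<phi>) \<in> Roofs (susp \<C> X) (susp \<C> Y)")
      case True
      with v have "(susp \<C> Z, SuspM K Z X \<sigma>, SuspM K Z Y \<phi>) \<in> germ_class (susp \<C> X) (susp \<C> Y) (susp_map g)" by (simp add: germ_class_def)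
      then show ?thesis using roof_class_eq[OF SX SY sg] m by blast
    qed (use m roof_class_invalid in blast)
  qed
  have ex: "germ_class (susp \<C> X) (susp \<C> Y) (susp_map g) \<in> ?M"
  proof -
    obtain W q y where W: "W \<in> strict_mb" "ev_iso W X q" "keq W X q q" "keq W Y y y"
      and r: "(W, hclass \<C> W X q, hclass \<C> W Y y) \<in> germ_class X Y g"
      using germ_class_nonempty[OF X Y g] .
    have SW: "susp \<C> W \<in> strict_mb" by (rule susp_strict_mb[OF W(1)])
    have "\<forall>\<^sub>F n in at_top. iso_mor \<C> (ob W (n - 1)) (ob X (n - 1)) (q (n - 1))"
      using W(2) eventually_pred[OF at_top] unfolding ev_iso_def by blast
    then have "ev_iso (susp \<C> W) (susp \<C> X) (susp_map q)"
      using heq_susp[OF all_deg W(3)] by (simp add: ev_iso_def keq_self susp_simps susp_map_def)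
    then have "hclass \<C> (susp \<C> W) (susp \<C> X) (susp_map q) \<in> Sys (susp \<C> W) (susp \<C> X)"
      by (rule ev_iso_Sys[OF SW SX])
    then have "(susp \<C> W, SuspM K W X (hclass \<C> W X q), SuspM K W Y (hclass \<C> W Y y)) \<in> germ_class (susp \<C> X) (susp \<C> Y) (susp_map g)"
      using val[OF r] SW strict_mb_Obj_Kmb keq_mor_K[OF heq_susp[OF all_deg W(4)]]
      by (auto simp: germ_class_def mem_roofs sM W)
    from roof_class_eq[OF SX SY sg this] r show ?thesis by blast
  qed
  have "SuspM Q X Y (germ_class X Y g) = \<Union>?M"
    unfolding Q_simps quot_susp_def Kmb_simps(5,6) K_simps(5) ..
  also have "\<dots> = germ_class (susp \<C> X) (susp \<C> Y) (susp_map g)" using sub ex by blast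
  finally show ?thesis .
qed

lemma iso_mor_Q:
  assumes X: "X \<in> strict_mb" and Y: "Y \<in> strict_mb" and g: "geq X Y g g" and h: "geq Y X h h"
    and hg: "geq X X (cc X Y X h g) (chain_id X)" and gh: "geq Y Y (cc Y X Y g h) (chain_id Y)"
  shows "iso_mor Q X Y (germ_class X Y g)"
  unfolding iso_mor_def mor_Q[OF X Y] mor_Q[OF Y X]
  using germ_class_cong[OF X X hg] germ_class_cong[OF Y Y gh] g h
  by (auto intro!: bexI[of _ h] simp: Cmp_Q X Y Idn_Q)

end

section \<open>Totally acyclic complexes\<close>

text \<open>Dependent choice towards lower degrees: \<open>I\<close> is the invariant that
  guarantees a next value, and \<open>R\<close> is the relation wanted between neighbouring
  values.\<close>

lemma extend_downwards:
  fixes I :: "int \<Rightarrow> 'c \<Rightarrow> bool" and R :: "int \<Rightarrow> 'c \<Rightarrow> 'c \<Rightarrow> bool"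
  assumes step: "\<And>n x. I n x \<Longrightarrow> \<exists>y. I (n - 1) y \<and> R n x y"
    and I: "\<And>n. n \<ge> N \<Longrightarrow> I n (g n)" and R: "\<And>n. n > N \<Longrightarrow> R n (g n) (g (n - 1))"
  shows "\<exists>f. (\<forall>n\<ge>N. f n = g n) \<and> (\<forall>n. I n (f n) \<and> R n (f n) (f (n - 1)))"
proof -
  define nx where "nx n x = (SOME y. I (n - 1) y \<and> R n x y)" for n x
  have nx: "I (n - 1) (nx n x) \<and> R n x (nx n x)" if "I n x" for n x
    unfolding nx_def using step[OF that] by (rule someI_ex)
  \<comment> \<open>\<open>r k\<close> is the value in degree \<open>N - k\<close>.\<close>
  define r where "r = rec_nat (g N) (\<lambda>k x. nx (N - int k) x)"
  have r: "r 0 = g N" "r (Suc k) = nx (N - int k) (r k)" for k by (simp_all add: r_def)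
  have Ir: "I (N - int k) (r k)" for k
  proof (induction k)
    case 0 then show ?case using I[of N] by (simp add: r)
  next
    case (Suc k) then show ?case using nx[OF Suc] by (simp add: r algebra_simps)
  qed
  define f where "f n = (if n \<ge> N then g n else r (nat (N - n)))" for n
  have fr: "f n = r (nat (N - n))" if "n \<le> N" for n using that by (auto simp: f_def r)
  have "I n (f n)" for n
    using I[of n] Ir[of "nat (N - n)"] by (cases "n \<ge> N") (auto simp: f_def)
  moreover have "R n (f n) (f (n - 1))" for n
  proof (cases "n > N")
    case True then show ?thesis using R by (simp add: f_def)
  next
    case False
    have "f (n - 1) = nx n (f n)"
    proof -
      have "nat (N - (n - 1)) = Suc (nat (N - n))" "N - int (nat (N - n)) = n" using False by simp_all
      then show ?thesis using False by (simp add: fr r)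
    qed
    moreover have "I n (f n)" using Ir[of "nat (N - n)"] False by (simp add: fr)
    ultimately show ?thesis using nx by simp
  qed
  moreover have "\<forall>n\<ge>N. f n = g n" by (simp add: f_def)
  ultimately show ?thesis by blast
qed

context additive_category
begin

text \<open>Given \<open>x\<close> in degree \<open>n\<close>, the next component has to be a
  \<open>y\<close> with \<open>y d = d x\<close>. It exists by \<open>exact_to\<close> because
  \<open>d x d = 0\<close>, and it inherits this condition since
  \<open>d y d = d d x = 0\<close>.\<close>

lemma extend_germ:
  assumes C: "C \<in> complexes \<C>" and D: "D \<in> complexes \<C>" and ex: "\<And>P n. P \<in> Obj \<C> \<Longrightarrow> exact_to C P n"
    and g: "geq C D g g"
  obtains f where "keq C D f f" "\<forall>\<^sub>F n in at_top. f n = g n"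
proof -
  note ty = cplx_simps[OF C] cplx_simps[OF D] mor_intros
  from g obtain m where gm: "\<And>n. n \<ge> m \<Longrightarrow> g n \<in> mor \<C> (ob C n) (ob D n)"
    and gd: "\<And>n. n \<ge> m \<Longrightarrow> df D n \<bullet>\<^bsub>ob C n,ob D n,ob D (n - 1)\<^esub> g n = g (n - 1) \<bullet>\<^bsub>ob C n,ob C (n - 1),ob D (n - 1)\<^esub> df C n"
    by (auto simp: heq_def chmap_def eventually_at_top_linorder)
  \<comment> \<open>The invariant says that \<open>d x\<close> vanishes on the image of the
    differential of \<open>C\<close>, the hypothesis under which exactness factors it.\<close>
  define I where "I n x \<longleftrightarrow> x \<in> mor \<C> (ob C n) (ob D n) \<and>
    df D n \<bullet>\<^bsub>ob C n,ob D n,ob D (n - 1)\<^esub> x \<bullet>\<^bsub>ob C (n + 1),ob C n,ob D (n - 1)\<^esub> df C (n + 1) = zero_mor \<C> (ob C (n + 1)) (ob D (n - 1))" for n x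
  define R where "R n x y \<longleftrightarrow> df D n \<bullet>\<^bsub>ob C n,ob D n,ob D (n - 1)\<^esub> x = y \<bullet>\<^bsub>ob C n,ob C (n - 1),ob D (n - 1)\<^esub> df C n" for n x y
  have "\<exists>f. (\<forall>n\<ge>m. f n = g n) \<and> (\<forall>n. I n (f n) \<and> R n (f n) (f (n - 1)))"
  proof (rule extend_downwards)
    fix n x assume x: "I n x"
    have "df D n \<bullet>\<^bsub>ob C n,ob D n,ob D (n - 1)\<^esub> x \<in> mor \<C> (ob C n) (ob D (n - 1))" using x by (simp add: I_def ty)
    then obtain y where y: "y \<in> mor \<C> (ob C (n - 1)) (ob D (n - 1))" "R n x y"
      using ex[OF ob_Obj[OF D, of "n - 1"], of n] x unfolding exact_to_def I_def R_def by blast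
    have "df D (n - 1) \<bullet>\<^bsub>ob C (n - 1),ob D (n - 1),ob D (n - 2)\<^esub> y \<bullet>\<^bsub>ob C n,ob C (n - 1),ob D (n - 2)\<^esub> df C n
        = df D (n - 1) \<bullet>\<^bsub>ob C n,ob D (n - 1),ob D (n - 2)\<^esub> (y \<bullet>\<^bsub>ob C n,ob C (n - 1),ob D (n - 1)\<^esub> df C n)"
      by (rule Cmp_assoc[symmetric]) (use y in \<open>simp_all add: ty\<close>)
    also have "\<dots> = df D (n - 1) \<bullet>\<^bsub>ob C n,ob D (n - 1),ob D (n - 2)\<^esub> (df D n \<bullet>\<^bsub>ob C n,ob D n,ob D (n - 1)\<^esub> x)"
      using y by (simp add: R_def)
    also have "\<dots> = zero_mor \<C> (ob C n) (ob D (n - 2))"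
      using x by (simp add: I_def ty Cmp_assoc cmp_zero_left)
    finally show "\<exists>y. I (n - 1) y \<and> R n x y" using y by (auto simp: I_def)
  next
    fix n assume n: "n \<ge> m"
    have "df D n \<bullet>\<^bsub>ob C n,ob D n,ob D (n - 1)\<^esub> g n \<bullet>\<^bsub>ob C (n + 1),ob C n,ob D (n - 1)\<^esub> df C (n + 1)
        = df D n \<bullet>\<^bsub>ob C (n + 1),ob D n,ob D (n - 1)\<^esub> (g n \<bullet>\<^bsub>ob C (n + 1),ob C n,ob D n\<^esub> df C (n + 1))"
      by (rule Cmp_assoc[symmetric]) (use gm[OF n] in \<open>simp_all add: ty\<close>)
    also have "\<dots> = df D n \<bullet>\<^bsub>ob C (n + 1),ob D n,ob D (n - 1)\<^esub> (df D (n + 1) \<bullet>\<^bsub>ob C (n + 1),ob D (n + 1),ob D n\<^esub> g (n + 1))"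
      using gd[of "n + 1"] n by simp
    also have "\<dots> = zero_mor \<C> (ob C (n + 1)) (ob D (n - 1))"
      using gm[of "n + 1"] n by (simp add: ty Cmp_assoc cmp_zero_left)
    finally show "I n (g n)" using gm[OF n] by (simp add: I_def)
  next
    fix n assume "n > m" then show "R n (g n) (g (n - 1))" using gd by (simp add: R_def)
  qed
  then obtain f where f: "\<And>n. n \<ge> m \<Longrightarrow> f n = g n" "\<And>n. I n (f n)" "\<And>n. R n (f n) (f (n - 1))" by blast
  then have "keq C D f f" using C D by (auto simp: keq_self chain_maps_def I_def R_def)
  moreover have "\<forall>\<^sub>F n in at_top. f n = g n" using f(1) by (auto simp: eventually_at_top_linorder)
  ultimately show thesis using that by blast
qed

text \<open>The same descent for homotopies. The next component \<open>y\<close> must satisfy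
  \<open>y d = u - d x\<close>, which is solvable when \<open>(u - d x) d = 0\<close>. The condition
  passes on to \<open>y\<close>, because \<open>d y d = d u = u d\<close>.\<close>

lemma extend_null_homotopy:
  assumes C: "C \<in> complexes \<C>" and D: "D \<in> complexes \<C>" and ex: "\<And>P n. P \<in> Obj \<C> \<Longrightarrow> exact_to C P n"
    and u: "u \<in> chain_maps \<C> C D" and null: "geq C D u (chain_zero C D)"
  shows "homotopic C D u (chain_zero C D)"
proof -
  note ty = cplx_simps[OF C] cplx_simps[OF D] mor_intros chain_maps_mor[OF u]
  from null obtain g where "\<forall>\<^sub>F n in at_top. g n \<in> mor \<C> (ob C n) (ob D (n + 1)) \<and>
      u n = chain_zero C D n \<boxplus>\<^bsub>ob C n,ob D n\<^esub> bd C D g n"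
    unfolding heq_def htpy_def by blast
  then obtain M where gm: "\<And>n. n \<ge> M \<Longrightarrow> g n \<in> mor \<C> (ob C n) (ob D (n + 1))"
    and ug: "\<And>n. n \<ge> M \<Longrightarrow> u n = chain_zero C D n \<boxplus>\<^bsub>ob C n,ob D n\<^esub> bd C D g n"
    by (auto simp: eventually_at_top_linorder)
  \<comment> \<open>The boundary in degree \<open>n\<close> involves \<open>g (n - 1)\<close> as
    well, so the descent starts at \<open>M + 1\<close>.\<close>
  have gm': "g n \<in> mor \<C> (ob C n) (ob D (n + 1))" "g (n - 1) \<in> mor \<C> (ob C (n - 1)) (ob D n)" if "n \<ge> M + 1" for n
    using gm[of n] gm[of "n - 1"] that by auto
  have ubd: "u n = df D (n + 1) \<bullet>\<^bsub>ob C n,ob D (n + 1),ob D n\<^esub> g n \<boxplus>\<^bsub>ob C n,ob D n\<^esub> g (n - 1) \<bullet>\<^bsub>ob C n,ob C (n - 1),ob D n\<^esub> df C n"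
    if n: "n \<ge> M + 1" for n
    using ug[of n] gm'[OF n] n by (simp add: bd_def chain_zero_def ty add_zero_left)
  define I where "I n x \<longleftrightarrow> x \<in> mor \<C> (ob C n) (ob D (n + 1)) \<and>
    (u n \<boxplus>\<^bsub>ob C n,ob D n\<^esub> \<boxminus>\<^bsub>ob C n,ob D n\<^esub> (df D (n + 1) \<bullet>\<^bsub>ob C n,ob D (n + 1),ob D n\<^esub> x))
      \<bullet>\<^bsub>ob C (n + 1),ob C n,ob D n\<^esub> df C (n + 1) = zero_mor \<C> (ob C (n + 1)) (ob D n)" for n x
  define R where "R n x y \<longleftrightarrow> u n = df D (n + 1) \<bullet>\<^bsub>ob C n,ob D (n + 1),ob D n\<^esub> x \<boxplus>\<^bsub>ob C n,ob D n\<^esub>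
    y \<bullet>\<^bsub>ob C n,ob C (n - 1),ob D n\<^esub> df C n" for n x y
  have "\<exists>h. (\<forall>n\<ge>M+1. h n = g n) \<and> (\<forall>n. I n (h n) \<and> R n (h n) (h (n - 1)))"
  proof (rule extend_downwards)
    fix n x assume "I n x"
    then have x: "x \<in> mor \<C> (ob C n) (ob D (n + 1))" by (simp add: I_def)
    define z where "z = u n \<boxplus>\<^bsub>ob C n,ob D n\<^esub> \<boxminus>\<^bsub>ob C n,ob D n\<^esub> (df D (n + 1) \<bullet>\<^bsub>ob C n,ob D (n + 1),ob D n\<^esub> x)"
    have z: "z \<in> mor \<C> (ob C n) (ob D n)" using x by (simp add: z_def ty)
    have "z \<bullet>\<^bsub>ob C (n + 1),ob C n,ob D n\<^esub> df C (n + 1) = zero_mor \<C> (ob C (n + 1)) (ob D n)"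
      using \<open>I n x\<close> by (simp add: I_def z_def)
    then obtain y where y: "y \<in> mor \<C> (ob C (n - 1)) (ob D n)" and zy: "z = y \<bullet>\<^bsub>ob C n,ob C (n - 1),ob D n\<^esub> df C n"
      using ex[OF ob_Obj[OF D, of n], of n] z unfolding exact_to_def by blast
    have "R n x y"
      unfolding R_def zy[symmetric] z_def using x by (simp add: ty add_simps)
    moreover have "I (n - 1) y"
    proof -
      have "df D n \<bullet>\<^bsub>ob C (n - 1),ob D n,ob D (n - 1)\<^esub> y \<bullet>\<^bsub>ob C n,ob C (n - 1),ob D (n - 1)\<^esub> df C n
          = df D n \<bullet>\<^bsub>ob C n,ob D n,ob D (n - 1)\<^esub> z"
        unfolding zy by (rule Cmp_assoc[symmetric]) (use y in \<open>simp_all add: ty\<close>)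
      also have "\<dots> = u (n - 1) \<bullet>\<^bsub>ob C n,ob C (n - 1),ob D (n - 1)\<^esub> df C n"
        unfolding z_def using x by (simp add: ty cmp_distrib Cmp_assoc add_simps chain_maps_df[OF u])
      finally show ?thesis using y by (simp add: I_def ty cmp_distrib add_neg)
    qed
    ultimately show "\<exists>y. I (n - 1) y \<and> R n x y" by blast
  next
    fix n assume n: "n \<ge> M + 1"
    show "I n (g n)"
      unfolding I_def ubd[OF n] using gm'[OF n] by (simp add: ty cmp_distrib add_simps Cmp_assoc)
  next
    fix n assume "n > M + 1" then show "R n (g n) (g (n - 1))" using ubd by (simp add: R_def)
  qed
  then obtain h where h: "\<And>n. I n (h n)" "\<And>n. R n (h n) (h (n - 1))" by blast
  have hm: "h n \<in> mor \<C> (ob C n) (ob D (n + 1))" for n using h(1) by (simp add: I_def)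
  have "u n = chain_zero C D n \<boxplus>\<^bsub>ob C n,ob D n\<^esub> bd C D h n" for n
  proof -
    have "u n = bd C D h n" using h(2)[of n] by (simp add: R_def bd_def)
    then show ?thesis using C D by (simp add: chain_zero_def add_zero_left ty bd_mor hm hm[of "n - 1", simplified])
  qed
  with hm show ?thesis unfolding htpy_top by blast
qed

lemma keq_if_geq:
  assumes f: "keq C D f f" and g: "keq C D g g" and ex: "\<And>P n. P \<in> Obj \<C> \<Longrightarrow> exact_to C P n"
    and fg: "geq C D f g"
  shows "keq C D f g"
proof -
  have C: "C \<in> complexes \<C>" and D: "D \<in> complexes \<C>" and fc: "f \<in> chain_maps \<C> C D" and gc: "g \<in> chain_maps \<C> C D"
    using f g by (auto simp: keq_self)
  have n: "keq C D (chain_neg C D g) (chain_neg C D g)" using C D gc by (simp add: keq_self chain_maps_neg)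
  have "geq C D (chain_add C D f (chain_neg C D g)) (chain_add C D g (chain_neg C D g))"
    by (intro heq_add[OF at_top] fg geq_if_keq[OF n])
  also have "chain_add C D g (chain_neg C D g) = chain_zero C D" by (rule chain_add_zero(4)[OF C D gc])
  finally have "homotopic C D (chain_add C D f (chain_neg C D g)) (chain_zero C D)"
    using C D fc gc by (intro extend_null_homotopy ex chain_maps_closed)
  then have "homotopic C D f g" using homotopic_iff_diff[OF C D fc gc] by blast
  then show ?thesis using C D fc gc by (simp add: heq_def chmap_top)
qed

definition tac :: "('a, 'b) cplx set"
  where "tac = {C \<in> complexes \<C>. \<forall>P\<in>Obj \<C>. \<forall>n. exact_from P C n \<and> exact_to C P n}"

lemma tacD: "C \<in> tac \<Longrightarrow> C \<in> complexes \<C>" "C \<in> tac \<Longrightarrow> P \<in> Obj \<C> \<Longrightarrow> exact_from P C n"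
  "C \<in> tac \<Longrightarrow> P \<in> Obj \<C> \<Longrightarrow> exact_to C P n"
  by (auto simp: tac_def)

lemma tac_hequiv: "D \<in> tac \<Longrightarrow> hequiv C D f g \<Longrightarrow> C \<in> tac"
  unfolding tac_def using exact_from_hequiv exact_to_hequiv hequiv_complexes by blast

text \<open>The isomorphism closure adds nothing, because exactness of both Hom complexes is
  invariant under homotopy equivalence.\<close>

lemma Ktac_simps:
  "Obj (Ktac \<C>) = tac" "Hom (Ktac \<C>) = Hom K" "Idn (Ktac \<C>) = Idn K"
  "Cmp (Ktac \<C>) = Cmp K" "SuspO (Ktac \<C>) = susp \<C>" "SuspM (Ktac \<C>) = SuspM K"
  "(X, Y, Z, u, v, w) \<in> Dist (Ktac \<C>) \<longleftrightarrow> (X, Y, Z, u, v, w) \<in> Dist K \<and> X \<in> tac \<and> Y \<in> tac \<and> Z \<in> tac"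
proof -
  have "{C \<in> complexes \<C>. totally_acyclic \<C> C} = tac"
    by (auto simp: tac_def totally_acyclic_iff)
  moreover have "iso_closure K tac = tac"
  proof -
    have sub: "tac \<subseteq> complexes \<C>" by (auto simp: tac_def)
    have "C \<in> iso_closure K tac \<longleftrightarrow> C \<in> tac" for C
      unfolding mem_iso_closure_K[OF sub] using tac_hequiv hequiv_id tacD(1) by blast
    then show ?thesis by blast
  qed
  ultimately have eq: "Ktac \<C> = full_sub K tac" by (simp add: Ktac_def)
  show "Obj (Ktac \<C>) = tac" "Hom (Ktac \<C>) = Hom K" "Idn (Ktac \<C>) = Idn K"
  "Cmp (Ktac \<C>) = Cmp K" "SuspO (Ktac \<C>) = susp \<C>" "SuspM (Ktac \<C>) = SuspM K"
  "(X, Y, Z, u, v, w) \<in> Dist (Ktac \<C>) \<longleftrightarrow> (X, Y, Z, u, v, w) \<in> Dist K \<and> X \<in> tac \<and> Y \<in> tac \<and> Z \<in> tac"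
    unfolding eq by (simp_all add: full_sub_simps K_simps(5))
qed

lemma exact_to_susp:
  assumes C: "C \<in> complexes \<C>" and P: "P \<in> Obj \<C>" and ex: "exact_to C P (n - 1)"
  shows "exact_to (susp \<C> C) P n"
  unfolding exact_to_def
proof (intro ballI impI)
  note ty = cplx_simps[OF C] P mor_intros
  fix x assume "x \<in> mor \<C> (ob (susp \<C> C) n) P"
    and d: "x \<bullet>\<^bsub>ob (susp \<C> C) (n + 1),ob (susp \<C> C) n,P\<^esub> df (susp \<C> C) (n + 1) = zero_mor \<C> (ob (susp \<C> C) (n + 1)) P"
  then have x: "x \<in> mor \<C> (ob C (n - 1)) P" by (simp add: susp_simps)
  have "\<boxminus>\<^bsub>ob C n,P\<^esub> (x \<bullet>\<^bsub>ob C n,ob C (n - 1),P\<^esub> df C n) = zero_mor \<C> (ob C n) P"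
    using d x by (simp add: susp_simps ty cmp_neg_right)
  then have "\<boxminus>\<^bsub>ob C n,P\<^esub> (\<boxminus>\<^bsub>ob C n,P\<^esub> (x \<bullet>\<^bsub>ob C n,ob C (n - 1),P\<^esub> df C n)) = zero_mor \<C> (ob C n) P"
    by (simp add: neg_zero ty)
  then have "x \<bullet>\<^bsub>ob C n,ob C (n - 1),P\<^esub> df C n = zero_mor \<C> (ob C n) P"
    using x by (simp add: neg_neg ty)
  then obtain y where y: "y \<in> mor \<C> (ob C (n - 2)) P" "x = y \<bullet>\<^bsub>ob C (n - 1),ob C (n - 2),P\<^esub> df C (n - 1)"
    using ex x unfolding exact_to_def by auto
  then have "x = (\<boxminus>\<^bsub>ob C (n - 2),P\<^esub> y) \<bullet>\<^bsub>ob (susp \<C> C) n,ob (susp \<C> C) (n - 1),P\<^esub> df (susp \<C> C) n"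
    by (simp add: susp_simps ty cmp_distrib neg_neg)
  with y show "\<exists>y\<in>mor \<C> (ob (susp \<C> C) (n - 1)) P. x = y \<bullet>\<^bsub>ob (susp \<C> C) n,ob (susp \<C> C) (n - 1),P\<^esub> df (susp \<C> C) n"
    by (auto intro!: bexI[of _ "\<boxminus>\<^bsub>ob C (n - 2),P\<^esub> y"] simp: susp_simps ty)
qed

lemma susp_tac: "C \<in> tac \<Longrightarrow> susp \<C> C \<in> tac"
  unfolding tac_def using exact_from_susp exact_to_susp susp_complexes by blast

text \<open>Literal equality in high degrees, rather than isomorphism: one function on the integers
  can then be read as a germ for either complex, without comparison maps.\<close>

definition ev_eq :: "('a, 'b) cplx \<Rightarrow> ('a, 'b) cplx \<Rightarrow> bool"
  where "ev_eq C C' \<longleftrightarrow> C \<in> complexes \<C> \<and> C' \<in> complexes \<C> \<and> (\<forall>\<^sub>F n in at_top. ob C' n = ob C n \<and> df C' n = df C n)"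

lemma ev_eq_shift:
  assumes "ev_eq C C'"
  shows "\<forall>\<^sub>F n in at_top. ob C' n = ob C n \<and> ob C' (n - 1) = ob C (n - 1) \<and> ob C' (n + 1) = ob C (n + 1) \<and>
    df C' n = df C n \<and> df C' (n + 1) = df C (n + 1)"
proof -
  have e: "\<forall>\<^sub>F n in at_top. ob C' n = ob C n \<and> df C' n = df C n" using assms by (simp add: ev_eq_def)
  show ?thesis using e eventually_pred[OF at_top e] eventually_succ[OF at_top e] by eventually_elim simp
qed

lemma geq_ev_eq:
  assumes C: "ev_eq C C'" and D: "ev_eq D D'" and fg: "geq C D f g"
  shows "geq C' D' f g"
proof -
  have ch: "chmap at_top C' D' k" if "chmap at_top C D k" for k
    using that ev_eq_shift[OF C] ev_eq_shift[OF D] unfolding chmap_def by eventually_elim simp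
  obtain h where h: "\<forall>\<^sub>F n in at_top. h n \<in> mor \<C> (ob C n) (ob D (n + 1)) \<and> f n = g n \<boxplus>\<^bsub>ob C n,ob D n\<^esub> bd C D h n"
    using fg unfolding heq_def htpy_def by blast
  have "\<forall>\<^sub>F n in at_top. h n \<in> mor \<C> (ob C' n) (ob D' (n + 1)) \<and> f n = g n \<boxplus>\<^bsub>ob C' n,ob D' n\<^esub> bd C' D' h n"
    using h ev_eq_shift[OF C] ev_eq_shift[OF D] by eventually_elim (simp add: bd_def)
  then have "htpy at_top C' D' f g" unfolding htpy_def by blast
  with C D fg ch show ?thesis by (simp add: heq_def ev_eq_def)
qed

lemma ev_eq_cc:
  assumes "ev_eq C C'" "ev_eq D D'" "ev_eq E E'"
  shows "\<forall>\<^sub>F n in at_top. cc C' D' E' g f n = cc C D E g f n"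
  using assms[THEN ev_eq_shift] by eventually_elim (simp add: chain_comp_def)

lemma ev_eq_id: "ev_eq C C' \<Longrightarrow> \<forall>\<^sub>F n in at_top. chain_id C' n = chain_id C n"
  by (drule ev_eq_shift, erule eventually_mono) (simp add: chain_id_def)

text \<open>Composites in the quotient can be computed between \<open>X'\<close>, \<open>Y'\<close>
  and \<open>Z'\<close>. In the application these are untruncated complexes, where homotopies
  between chain maps are at hand.\<close>

lemma germ_class_ev_eq_comp:
  assumes X: "X \<in> strict_mb" and Y: "Y \<in> strict_mb" and Z: "Z \<in> strict_mb"
    and XX: "ev_eq X' X" and YY: "ev_eq Y' Y" and ZZ: "ev_eq Z' Z"
    and g: "geq X' Y' g g" and h: "geq Y' Z' h h"
  shows "Cmp Q X Y Z (germ_class Y Z h) (germ_class X Y g) = germ_class X Z (cc X' Y' Z' h g)"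
proof -
  have g': "geq X Y g g" and h': "geq Y Z h h" using geq_ev_eq XX YY ZZ g h by blast+
  have "geq X Z (cc X Y Z h g) (cc X' Y' Z' h g)"
    by (rule geq_eq[OF geq_comp[OF h' g'] ev_eq_cc[OF XX YY ZZ]])
  from germ_class_cong[OF X Z this] Cmp_Q[OF X Y Z g' h'] show ?thesis by simp
qed

lemma iso_mor_Q_ev_eq:
  assumes X: "X \<in> strict_mb" and Y: "Y \<in> strict_mb" and XX: "ev_eq X' X" and YY: "ev_eq Y' Y" and fg: "hequiv X' Y' f g"
  shows "iso_mor Q X Y (germ_class X Y f)"
proof -
  note k = hequivD[OF fg, THEN geq_if_keq]
  have f: "geq X Y f f" and g: "geq Y X g g" using geq_ev_eq XX YY k(1,2) by blast+
  have "geq X X (cc X Y X g f) (cc X' Y' X' g f)" by (rule geq_eq[OF geq_comp[OF g f] ev_eq_cc[OF XX YY XX]])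
  also have "geq X X \<dots> (chain_id X')" by (rule geq_ev_eq[OF XX XX k(3)])
  also have "geq X X \<dots> (chain_id X)"
    using geq_sym[OF geq_eq[OF geq_id ev_eq_id[OF XX]]] XX by (simp add: ev_eq_def)
  finally have 1: "geq X X (cc X Y X g f) (chain_id X)" .
  have "geq Y Y (cc Y X Y f g) (cc Y' X' Y' f g)" by (rule geq_eq[OF geq_comp[OF f g] ev_eq_cc[OF YY XX YY]])
  also have "geq Y Y \<dots> (chain_id Y')" by (rule geq_ev_eq[OF YY YY k(4)])
  also have "geq Y Y \<dots> (chain_id Y)"
    using geq_sym[OF geq_eq[OF geq_id ev_eq_id[OF YY]]] YY by (simp add: ev_eq_def)
  finally have 2: "geq Y Y (cc Y X Y f g) (chain_id Y)" .
  show ?thesis by (rule iso_mor_Q[OF X Y f g 1 2])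
qed

text \<open>Exactness comes from \<open>C\<close> in high degrees and from vanishing in low ones.
  This covers truncations as well as the cone of a truncated map.\<close>

lemma strict_mb_ev_eq_tac:
  assumes C: "C \<in> tac" and CC: "ev_eq C C'" and b: "bounded_below \<C> C'"
  shows "C' \<in> strict_mb"
proof -
  have C': "C' \<in> complexes \<C>" using CC by (simp add: ev_eq_def)
  obtain M where M: "\<And>n. n \<ge> M \<Longrightarrow> ob C' n = ob C n \<and> ob C' (n - 1) = ob C (n - 1) \<and> ob C' (n + 1) = ob C (n + 1) \<and>
    df C' n = df C n \<and> df C' (n + 1) = df C (n + 1)"
    using ev_eq_shift[OF CC] by (auto simp: eventually_at_top_linorder)
  obtain N where N: "\<And>n. n < N \<Longrightarrow> zero_object \<C> (ob C' n)" using bounded_belowD[OF b] by blast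
  have "exact_from P C' n" if P: "P \<in> Obj \<C>" and n: "\<bar>n\<bar> > \<bar>M\<bar> + \<bar>N\<bar>" for P n
  proof (cases "n \<ge> M")
    case True then show ?thesis using tacD(2)[OF C P, of n] M[OF True] by (simp add: exact_from_def)
  next
    case False
    then have "n < N" using n by linarith
    then show ?thesis using exact_from_zero[OF C' P] N by blast
  qed
  then show ?thesis using C' b by (auto simp: strict_mb_def eventually_acyclic_iff)
qed

abbreviation "\<beta> \<equiv> brutal \<C> 0"

lemma ev_eq_brutal:
  assumes "C \<in> complexes \<C>"
  shows "ev_eq C (brutal \<C> m C)"
proof -
  \<comment> \<open>In degree \<open>m\<close> itself the differential of the truncation is already
    zero.\<close>
  have "\<forall>n\<ge>m+1. ob (brutal \<C> m C) n = ob C n \<and> df (brutal \<C> m C) n = df C n" by (simp add: brutal_simps)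
  then show ?thesis using assms brutal_complexes by (auto simp: ev_eq_def eventually_at_top_linorder)
qed

lemma ev_eq_susp:
  assumes "ev_eq C C'"
  shows "ev_eq (susp \<C> C) (susp \<C> C')"
proof -
  have "\<forall>\<^sub>F n in at_top. ob (susp \<C> C') n = ob (susp \<C> C) n \<and> df (susp \<C> C') n = df (susp \<C> C) n"
    using eventually_pred[OF at_top ev_eq_shift[OF assms]] by eventually_elim (simp add: susp_simps)
  then show ?thesis using assms by (simp add: ev_eq_def susp_complexes)
qed

lemma brutal_tac: "C \<in> tac \<Longrightarrow> brutal \<C> m C \<in> strict_mb"
  using strict_mb_ev_eq_tac ev_eq_brutal tacD(1) brutal_bounded_below by blast

lemma brutal_map_keq:
  assumes "keq C D f f"
  shows "keq (\<beta> C) (\<beta> D) (brutal_map \<C> 0 f) (brutal_map \<C> 0 f)"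
proof -
  have C: "C \<in> complexes \<C>" and D: "D \<in> complexes \<C>" and f: "f \<in> chain_maps \<C> C D" using assms by (auto simp: keq_self)
  have "brutal_map \<C> 0 f \<in> chain_maps \<C> (\<beta> C) (\<beta> D)"
    by (rule chain_map_to_brutal[OF brutal_complexes[OF C] D])
      (use f D in \<open>auto simp: brutal_simps brutal_map_def chain_maps_mor chain_maps_df[OF f] the_zero_Obj zero_mor\<close>)
  then show ?thesis using C D by (simp add: keq_self brutal_complexes)
qed

lemma brutal_map_ev: "\<forall>\<^sub>F n in at_top. f n = brutal_map \<C> m f n"
  using eventually_ge_at_top[of m] by eventually_elim (simp add: brutal_map_def)

text \<open>\<open>f\<close> and \<open>brutal_map \<C> 0 f\<close> coincide in nonnegative degrees,
  so they have the same germ.\<close>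

lemma quot_mor_brutal_map:
  assumes C: "C \<in> tac" and D: "D \<in> tac" and f: "keq C D f f"
  shows "quot_mor (Kmb \<C>) (Obj (Kb \<C>)) (\<beta> C) (\<beta> D) (hclass \<C> (\<beta> C) (\<beta> D) (brutal_map \<C> 0 f)) = germ_class (\<beta> C) (\<beta> D) f"
proof -
  have "geq (\<beta> C) (\<beta> D) f f"
    using geq_ev_eq[OF ev_eq_brutal ev_eq_brutal geq_if_keq[OF f]] C D tacD(1) by blast
  from geq_eq[OF this brutal_map_ev] have "geq (\<beta> C) (\<beta> D) f (brutal_map \<C> 0 f)" .
  then show ?thesis
    using quot_mor_germ_class[OF brutal_tac[OF C] brutal_tac[OF D] brutal_map_keq[OF f]]
      germ_class_cong[OF brutal_tac[OF C] brutal_tac[OF D]] by simp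
qed

end

section \<open>The truncation functor\<close>

context additive_category
begin

lemma cone_brutal:
  assumes f: "keq C D f f"
  shows ev_eq_cone_brutal: "ev_eq (mapping_cone \<C> C D f) (mapping_cone \<C> (\<beta> C) (\<beta> D) (brutal_map \<C> 0 f))"
    and cone_incl_brutal: "\<forall>\<^sub>F n in at_top. cone_incl \<C> (\<beta> C) (\<beta> D) n = cone_incl \<C> C D n"
    and cone_proj_brutal: "\<forall>\<^sub>F n in at_top. cone_proj \<C> (\<beta> C) (\<beta> D) n = cone_proj \<C> C D n"
    and bounded_below_cone_brutal: "bounded_below \<C> (mapping_cone \<C> (\<beta> C) (\<beta> D) (brutal_map \<C> 0 f))"
proof -
  have C: "C \<in> complexes \<C>" and D: "D \<in> complexes \<C>" and fc: "f \<in> chain_maps \<C> C D" using f by (auto simp: keq_self)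
  have bC: "\<beta> C \<in> complexes \<C>" and bD: "\<beta> D \<in> complexes \<C>" and bf: "brutal_map \<C> 0 f \<in> chain_maps \<C> (\<beta> C) (\<beta> D)"
    using brutal_map_keq[OF f] by (auto simp: keq_self)
  let ?E = "mapping_cone \<C> C D f" and ?E' = "mapping_cone \<C> (\<beta> C) (\<beta> D) (brutal_map \<C> 0 f)"
  \<comment> \<open>For \<open>n \<ge> 3\<close> the degrees \<open>n\<close>, \<open>n - 1\<close>
    and \<open>n - 2\<close> entering the cone are all positive, so truncation leaves them alone.
    The biproducts are literally equal since \<open>the_biprod\<close> is a fixed choice for each
    pair of summands.\<close>
  have "\<forall>n\<ge>3. ob ?E' n = ob ?E n \<and> df ?E' n = df ?E n"
    by (simp add: mapping_cone_def Let_def susp_simps brutal_simps brutal_map_def)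
  then have "\<forall>\<^sub>F n in at_top. ob ?E' n = ob ?E n \<and> df ?E' n = df ?E n"
    unfolding eventually_at_top_linorder by blast
  then show "ev_eq ?E ?E'"
    using cone_complexes[OF C D fc] cone_complexes[OF bC bD bf] by (simp add: ev_eq_def)
  show "\<forall>\<^sub>F n in at_top. cone_incl \<C> (\<beta> C) (\<beta> D) n = cone_incl \<C> C D n"
    using eventually_ge_at_top[of 3] by eventually_elim (simp add: cone_incl_def susp_simps brutal_simps)
  show "\<forall>\<^sub>F n in at_top. cone_proj \<C> (\<beta> C) (\<beta> D) n = cone_proj \<C> C D n"
    using eventually_ge_at_top[of 3] by eventually_elim (simp add: cone_proj_def susp_simps brutal_simps)
  have "\<forall>n<0. zero_object \<C> (ob ?E' n)"
    using zero_object_bsum[OF zero_object_the_zero zero_object_the_zero]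
    by (simp add: mapping_cone_def susp_simps brutal_simps)
  then show "bounded_below \<C> ?E'" unfolding bounded_below_def by blast
qed

lemma Dist_Q:
  "t \<in> Dist Q \<longleftrightarrow> t \<in> triangles Q \<and> (\<exists>X Y Z u v w. (X, Y, Z, u, v, w) \<in> Dist (Kmb \<C>) \<and>
    triangle_iso Q t (X, Y, Z, quot_mor (Kmb \<C>) (Obj (Kb \<C>)) X Y u, quot_mor (Kmb \<C>) (Obj (Kb \<C>)) Y Z v,
      quot_mor (Kmb \<C>) (Obj (Kb \<C>)) Z (susp \<C> X) w))"
proof -
  have [simp]: "SuspO (Kmb \<C>) = susp \<C>" by (simp add: Kmb_simps K_simps)
  show ?thesis
    unfolding verdier_quotient_def Dist_saturate_triangles tricat.select_convs by (simp only: \<open>SuspO (Kmb \<C>) = susp \<C>\<close>) blast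
qed

text \<open>By \<open>beta_mor_hclass\<close> the choice of representative is immaterial. It is used
  untruncated: only its germ between the truncations counts.\<close>

definition beta_mor :: "('a, 'b) cplx \<Rightarrow> ('a, 'b) cplx \<Rightarrow> (int \<Rightarrow> 'b) set \<Rightarrow> (('a, 'b) cplx, (int \<Rightarrow> 'b) set) roof set"
  where "beta_mor C D \<phi> = germ_class (\<beta> C) (\<beta> D) (SOME f. f \<in> \<phi>)"

text \<open>The objects of the two complexes differ in degree 0 only: the truncation of the
  suspension has \<open>ob X (-1)\<close> there, the suspension of the truncation a zero object. The
  identities therefore form a germ between them.\<close>

definition beta_susp :: "('a, 'b) cplx \<Rightarrow> (('a, 'b) cplx, (int \<Rightarrow> 'b) set) roof set"
  where "beta_susp X = germ_class (\<beta> (susp \<C> X)) (susp \<C> (\<beta> X)) (chain_id (susp \<C> X))"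

lemma ev_eq_tac: "C \<in> tac \<Longrightarrow> ev_eq C (\<beta> C)"
  using ev_eq_brutal tacD(1) by blast

lemma ev_eq_susp_tac: "C \<in> tac \<Longrightarrow> ev_eq (susp \<C> C) (susp \<C> (\<beta> C))"
  using ev_eq_susp ev_eq_tac by blast

lemma beta_mor_hclass:
  assumes C: "C \<in> tac" and D: "D \<in> tac" and f: "keq C D f f"
  shows "beta_mor C D (hclass \<C> C D f) = germ_class (\<beta> C) (\<beta> D) f"
proof -
  define f' where "f' = (SOME g. g \<in> hclass \<C> C D f)"
  have k: "C \<in> complexes \<C>" "D \<in> complexes \<C>" "f \<in> chain_maps \<C> C D" using f by (auto simp: keq_self)
  have "f' \<in> hclass \<C> C D f" unfolding f'_def by (rule someI[of _ f], rule mem_hclass[OF k])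
  then have "keq C D f' f" by (simp add: hclass_eq k heq_def chmap_top)
  then have "geq (\<beta> C) (\<beta> D) f' f" using geq_ev_eq[OF ev_eq_tac[OF C] ev_eq_tac[OF D] geq_if_keq] by blast
  then show ?thesis
    unfolding beta_mor_def f'_def[symmetric] by (rule germ_class_cong[OF brutal_tac[OF C] brutal_tac[OF D]])
qed

lemma mor_Ktac:
  assumes "C \<in> tac" "D \<in> tac" "\<phi> \<in> mor (Ktac \<C>) C D"
  obtains f where "\<phi> = hclass \<C> C D f" "keq C D f f"
  using mor_K_keq[OF tacD(1)[OF assms(1)] tacD(1)[OF assms(2)]] assms(3) unfolding Ktac_simps by blast

lemma germ_class_mor_Q:
  "\<lbrakk>X \<in> strict_mb; Y \<in> strict_mb; geq X Y g g\<rbrakk> \<Longrightarrow> germ_class X Y g \<in> mor Q X Y"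
  using mor_Q by blast

lemma additive_functor_beta: "additive_functor (Ktac \<C>) Q \<beta> beta_mor"
  unfolding additive_functor_def Ktac_simps(1)
proof (intro conjI ballI)
  fix X assume X: "X \<in> tac"
  show "\<beta> X \<in> Obj Q" using brutal_tac[OF X] strict_mb_Obj_Kmb unfolding Q_simps by blast
next
  fix X Y assume X: "X \<in> tac" and Y: "Y \<in> tac"
  show "beta_mor X Y \<in> hom (Hom (Ktac \<C>) X Y) (Hom Q (\<beta> X) (\<beta> Y))"
  proof (rule homI)
    fix \<phi> assume "\<phi> \<in> mor (Ktac \<C>) X Y"
    then obtain f where f: "\<phi> = hclass \<C> X Y f" "keq X Y f f" using mor_Ktac[OF X Y] by blast
    show "beta_mor X Y \<phi> \<in> mor Q (\<beta> X) (\<beta> Y)"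
      unfolding f(1) beta_mor_hclass[OF X Y f(2)]
      by (rule germ_class_mor_Q[OF brutal_tac[OF X] brutal_tac[OF Y] geq_ev_eq[OF ev_eq_tac[OF X] ev_eq_tac[OF Y] geq_if_keq[OF f(2)]]])
  next
    fix \<phi> \<psi> assume "\<phi> \<in> mor (Ktac \<C>) X Y" "\<psi> \<in> mor (Ktac \<C>) X Y"
    then obtain f g where f: "\<phi> = hclass \<C> X Y f" "keq X Y f f" and g: "\<psi> = hclass \<C> X Y g" "keq X Y g g"
      using mor_Ktac[OF X Y] by metis
    \<comment> \<open>\<open>add_Q\<close> takes honest chain maps. Between the truncations,
      \<open>f\<close> and \<open>g\<close> are only germs, so truncated maps with the same germs
      stand in for them.\<close>
    let ?f = "brutal_map \<C> 0 f" and ?g = "brutal_map \<C> 0 g"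
    have bf: "keq (\<beta> X) (\<beta> Y) ?f ?f" and bg: "keq (\<beta> X) (\<beta> Y) ?g ?g" using brutal_map_keq f(2) g(2) by blast+
    have gf: "geq (\<beta> X) (\<beta> Y) f f" and gg: "geq (\<beta> X) (\<beta> Y) g g"
      using geq_ev_eq[OF ev_eq_tac[OF X] ev_eq_tac[OF Y] geq_if_keq] f(2) g(2) by blast+
    have fg: "keq X Y (chain_add X Y f g) (chain_add X Y f g)" by (intro keq_add f g)
    have "\<forall>\<^sub>F n in at_top. chain_add X Y f g n = chain_add (\<beta> X) (\<beta> Y) f g n"
      using ev_eq_shift[OF ev_eq_tac[OF X]] ev_eq_shift[OF ev_eq_tac[OF Y]] by eventually_elim (simp add: chain_add_def)
    from geq_eq[OF geq_ev_eq[OF ev_eq_tac[OF X] ev_eq_tac[OF Y] geq_if_keq[OF fg]] this]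
    have "geq (\<beta> X) (\<beta> Y) (chain_add X Y f g) (chain_add (\<beta> X) (\<beta> Y) f g)" .
    also have "geq (\<beta> X) (\<beta> Y) \<dots> (chain_add (\<beta> X) (\<beta> Y) ?f ?g)"
      by (rule heq_add[OF at_top geq_eq[OF gf brutal_map_ev[where m = 0]] geq_eq[OF gg brutal_map_ev[where m = 0]]])
    finally have add: "geq (\<beta> X) (\<beta> Y) (chain_add X Y f g) (chain_add (\<beta> X) (\<beta> Y) ?f ?g)" .
    note S = brutal_tac[OF X, of 0] brutal_tac[OF Y, of 0]
    have "\<phi> \<otimes>\<^bsub>Hom (Ktac \<C>) X Y\<^esub> \<psi> = hclass \<C> X Y (chain_add X Y f g)"
      unfolding f(1) g(1) Ktac_simps(2) by (rule K_add) (use f(2) g(2) in \<open>auto simp: keq_self\<close>)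
    then have "beta_mor X Y (\<phi> \<otimes>\<^bsub>Hom (Ktac \<C>) X Y\<^esub> \<psi>) = germ_class (\<beta> X) (\<beta> Y) (chain_add X Y f g)"
      by (simp add: beta_mor_hclass[OF X Y fg])
    also have "\<dots> = germ_class (\<beta> X) (\<beta> Y) ?f \<otimes>\<^bsub>Hom Q (\<beta> X) (\<beta> Y)\<^esub> germ_class (\<beta> X) (\<beta> Y) ?g"
      unfolding add_Q[OF S bf bg] by (rule germ_class_cong[OF S add])
    also have "\<dots> = beta_mor X Y \<phi> \<otimes>\<^bsub>Hom Q (\<beta> X) (\<beta> Y)\<^esub> beta_mor X Y \<psi>"
      unfolding f(1) g(1) beta_mor_hclass[OF X Y f(2)] beta_mor_hclass[OF X Y g(2)]
      by (simp only: germ_class_cong[OF S geq_eq[OF gf brutal_map_ev[where m = 0]]] germ_class_cong[OF S geq_eq[OF gg brutal_map_ev[where m = 0]]])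
    finally show "beta_mor X Y (\<phi> \<otimes>\<^bsub>Hom (Ktac \<C>) X Y\<^esub> \<psi>) = beta_mor X Y \<phi> \<otimes>\<^bsub>Hom Q (\<beta> X) (\<beta> Y)\<^esub> beta_mor X Y \<psi>" .
  qed
next
  fix X assume X: "X \<in> tac"
  note S = brutal_tac[OF X, of 0]
  have id: "keq X X (chain_id X) (chain_id X)" using tacD(1)[OF X] by (rule keq_id)
  have "geq (\<beta> X) (\<beta> X) (chain_id (\<beta> X)) (chain_id X)"
    by (rule geq_eq[OF geq_id ev_eq_id[OF ev_eq_tac[OF X]]]) (use S in \<open>simp add: strict_mb_def\<close>)
  then show "beta_mor X X (Idn (Ktac \<C>) X) = Idn Q (\<beta> X)"
    unfolding Ktac_simps(3) K_simps(3) beta_mor_hclass[OF X X id] Idn_Q[OF S] using germ_class_cong[OF S S] by metis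
next
  fix X Y Z \<phi> \<psi> assume X: "X \<in> tac" and Y: "Y \<in> tac" and Z: "Z \<in> tac"
    and "\<phi> \<in> mor (Ktac \<C>) X Y" "\<psi> \<in> mor (Ktac \<C>) Y Z"
  then obtain f g where f: "\<phi> = hclass \<C> X Y f" "keq X Y f f" and g: "\<psi> = hclass \<C> Y Z g" "keq Y Z g g"
    using mor_Ktac[OF X Y] mor_Ktac[OF Y Z] by metis
  show "beta_mor X Z (Cmp (Ktac \<C>) X Y Z \<psi> \<phi>) = Cmp Q (\<beta> X) (\<beta> Y) (\<beta> Z) (beta_mor Y Z \<psi>) (beta_mor X Y \<phi>)"
    unfolding f(1) g(1) Ktac_simps(4) K_comp_keq[OF f(2) g(2)] beta_mor_hclass[OF X Y f(2)] beta_mor_hclass[OF Y Z g(2)]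
      beta_mor_hclass[OF X Z keq_comp[OF g(2) f(2)]]
    by (rule germ_class_ev_eq_comp[symmetric]) (use X Y Z f(2) g(2) in \<open>simp_all add: brutal_tac ev_eq_tac geq_if_keq\<close>)
qed

text \<open>The comparison is a germ of identities, so composing with it only changes the target in
  which the germ \<open>g\<close> is read.\<close>

lemma beta_susp_comp:
  assumes X: "X \<in> tac" and W: "W \<in> tac" and g: "keq W (susp \<C> X) g g"
  shows "Cmp Q (\<beta> W) (\<beta> (susp \<C> X)) (susp \<C> (\<beta> X)) (beta_susp X) (beta_mor W (susp \<C> X) (hclass \<C> W (susp \<C> X) g))
    = germ_class (\<beta> W) (susp \<C> (\<beta> X)) g"
proof -
  note SX = susp_tac[OF X]
  have S: "\<beta> W \<in> strict_mb" "\<beta> (susp \<C> X) \<in> strict_mb" "susp \<C> (\<beta> X) \<in> strict_mb"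
    using X W SX by (simp_all add: brutal_tac susp_strict_mb)
  have id: "keq (susp \<C> X) (susp \<C> X) (chain_id (susp \<C> X)) (chain_id (susp \<C> X))" by (rule keq_id[OF tacD(1)[OF SX]])
  have "Cmp Q (\<beta> W) (\<beta> (susp \<C> X)) (susp \<C> (\<beta> X)) (beta_susp X) (beta_mor W (susp \<C> X) (hclass \<C> W (susp \<C> X) g))
    = germ_class (\<beta> W) (susp \<C> (\<beta> X)) (cc W (susp \<C> X) (susp \<C> X) (chain_id (susp \<C> X)) g)"
    unfolding beta_mor_hclass[OF W SX g] beta_susp_def
    by (rule germ_class_ev_eq_comp[OF S ev_eq_tac[OF W] ev_eq_tac[OF SX] ev_eq_susp_tac[OF X] geq_if_keq[OF g] geq_if_keq[OF id]])
  also have "\<dots> = germ_class (\<beta> W) (susp \<C> (\<beta> X)) g"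
    by (intro germ_class_cong S geq_ev_eq[OF ev_eq_tac[OF W] ev_eq_susp_tac[OF X]] geq_if_keq keq_id_left g)
  finally show ?thesis .
qed

text \<open>Compare with the standard triangle of the truncated map from \<open>\<beta> C\<close> to
  \<open>\<beta> D\<close>. Its cone agrees in high degrees with the cone of \<open>f\<close>, so
  the germs of \<open>a\<close>, \<open>b\<close> and \<open>c\<close> form an isomorphism of
  triangles in the quotient, and its squares are the given ones read as germs.\<close>

lemma beta_Dist:
  assumes t: "(X, Y, Z, u, v, w) \<in> Dist (Ktac \<C>)"
  shows "(\<beta> X, \<beta> Y, \<beta> Z, beta_mor X Y u, beta_mor Y Z v,
    Cmp Q (\<beta> Z) (\<beta> (susp \<C> X)) (susp \<C> (\<beta> X)) (beta_susp X) (beta_mor Z (susp \<C> X) w)) \<in> Dist Q"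
proof -
  from t have X: "X \<in> tac" and Y: "Y \<in> tac" and Z: "Z \<in> tac" and D: "(X, Y, Z, u, v, w) \<in> Dist K"
    by (simp_all add: Ktac_simps)
  obtain s p q C D f a a' b b' c c' where uvw: "u = hclass \<C> X Y s" "v = hclass \<C> Y Z p" "w = hclass \<C> Z (susp \<C> X) q"
    and s: "keq X Y s s" and p: "keq Y Z p p" and q: "keq Z (susp \<C> X) q q"
    and f: "keq C D f f" and a: "hequiv X C a a'" and b: "hequiv Y D b b'" and c: "hequiv Z (mapping_cone \<C> C D f) c c'"
    and sq1: "keq X D (cc X Y D b s) (cc X C D f a)"
    and sq2: "keq Y (mapping_cone \<C> C D f) (cc Y Z (mapping_cone \<C> C D f) c p)
      (cc Y D (mapping_cone \<C> C D f) (cone_incl \<C> C D) b)"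
    and sq3: "keq Z (susp \<C> C) (cc Z (susp \<C> X) (susp \<C> C) (susp_map a) q)
      (cc Z (mapping_cone \<C> C D f) (susp \<C> C) (cone_proj \<C> C D) c)"
    by (rule Dist_K_D[OF D])
  let ?E = "mapping_cone \<C> C D f" and ?f = "brutal_map \<C> 0 f"
  let ?E' = "mapping_cone \<C> (\<beta> C) (\<beta> D) ?f"
  \<comment> \<open>The standard triangle inherits total acyclicity along the equivalences; for its
    cone this yields that the truncated cone \<open>?E'\<close> is eventually acyclic.\<close>
  have C: "C \<in> tac" and D: "D \<in> tac" and E: "?E \<in> tac"
    using tac_hequiv[OF X hequiv_sym[OF a]] tac_hequiv[OF Y hequiv_sym[OF b]] tac_hequiv[OF Z hequiv_sym[OF c]] .
  have fc: "C \<in> complexes \<C>" "D \<in> complexes \<C>" "f \<in> chain_maps \<C> C D" using f by (auto simp: keq_self)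
  have bf: "keq (\<beta> C) (\<beta> D) ?f ?f" by (rule brutal_map_keq[OF f])
  then have bfc: "\<beta> C \<in> complexes \<C>" "\<beta> D \<in> complexes \<C>" "?f \<in> chain_maps \<C> (\<beta> C) (\<beta> D)" by (auto simp: keq_self)
  note EE = ev_eq_cone_brutal[OF f]
  have E': "?E' \<in> strict_mb" by (rule strict_mb_ev_eq_tac[OF E EE bounded_below_cone_brutal[OF f]])
  have S: "\<beta> X \<in> strict_mb" "\<beta> Y \<in> strict_mb" "\<beta> Z \<in> strict_mb" "\<beta> C \<in> strict_mb" "\<beta> D \<in> strict_mb"
    using X Y Z C D by (simp_all add: brutal_tac)
  note SS = susp_strict_mb[OF S(1)] susp_strict_mb[OF S(4)]
  note ev = ev_eq_tac[OF X] ev_eq_tac[OF Y] ev_eq_tac[OF Z] ev_eq_tac[OF C] ev_eq_tac[OF D] ev_eq_susp_tac[OF X] ev_eq_susp_tac[OF C]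
  have i: "keq D ?E (cone_incl \<C> C D) (cone_incl \<C> C D)" and pr: "keq ?E (susp \<C> C) (cone_proj \<C> C D) (cone_proj \<C> C D)"
    using fc tacD(1)[OF E] cone_incl_chain_maps[OF fc] cone_proj_chain_maps[OF fc] by (simp_all add: keq_self susp_complexes)
  have i': "keq (\<beta> D) ?E' (cone_incl \<C> (\<beta> C) (\<beta> D)) (cone_incl \<C> (\<beta> C) (\<beta> D))"
    and pr': "keq ?E' (susp \<C> (\<beta> C)) (cone_proj \<C> (\<beta> C) (\<beta> D)) (cone_proj \<C> (\<beta> C) (\<beta> D))"
    using bfc cone_complexes[OF bfc] cone_incl_chain_maps[OF bfc] cone_proj_chain_maps[OF bfc] by (simp_all add: keq_self susp_complexes)
  \<comment> \<open>In the quotient, the truncated triangle consists of the germs of the untruncated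
    \<open>f\<close>, inclusion and projection.\<close>
  have qf: "quot_mor (Kmb \<C>) (Obj (Kb \<C>)) (\<beta> C) (\<beta> D) (hclass \<C> (\<beta> C) (\<beta> D) ?f) = germ_class (\<beta> C) (\<beta> D) f"
    by (rule quot_mor_brutal_map[OF C D f])
  have qi: "quot_mor (Kmb \<C>) (Obj (Kb \<C>)) (\<beta> D) ?E' (hclass \<C> (\<beta> D) ?E' (cone_incl \<C> (\<beta> C) (\<beta> D))) = germ_class (\<beta> D) ?E' (cone_incl \<C> C D)"
    unfolding quot_mor_germ_class[OF S(5) E' i']
    by (rule germ_class_cong[OF S(5) E' geq_eq[OF geq_if_keq[OF i'] cone_incl_brutal[OF f]]])
  have qp: "quot_mor (Kmb \<C>) (Obj (Kb \<C>)) ?E' (susp \<C> (\<beta> C)) (hclass \<C> ?E' (susp \<C> (\<beta> C)) (cone_proj \<C> (\<beta> C) (\<beta> D)))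
      = germ_class ?E' (susp \<C> (\<beta> C)) (cone_proj \<C> C D)"
    unfolding quot_mor_germ_class[OF E' SS(2) pr']
    by (rule germ_class_cong[OF E' SS(2) geq_eq[OF geq_if_keq[OF pr'] cone_proj_brutal[OF f]]])
  have Dm: "(\<beta> C, \<beta> D, ?E', hclass \<C> (\<beta> C) (\<beta> D) ?f, hclass \<C> (\<beta> D) ?E' (cone_incl \<C> (\<beta> C) (\<beta> D)),
      hclass \<C> ?E' (susp \<C> (\<beta> C)) (cone_proj \<C> (\<beta> C) (\<beta> D))) \<in> Dist (Kmb \<C>)"
    unfolding Kmb_simps(7) using cone_Dist_K[OF bfc] S E' strict_mb_Obj_Kmb by blast
  note k = hequivD(1)[OF a] hequivD(1)[OF b] hequivD(1)[OF c]
  note G = geq_if_keq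
  have w: "Cmp Q (\<beta> Z) (\<beta> (susp \<C> X)) (susp \<C> (\<beta> X)) (beta_susp X) (beta_mor Z (susp \<C> X) w) = germ_class (\<beta> Z) (susp \<C> (\<beta> X)) q"
    unfolding uvw by (rule beta_susp_comp[OF X Z q])
  have ti: "triangle_iso Q (\<beta> X, \<beta> Y, \<beta> Z, germ_class (\<beta> X) (\<beta> Y) s, germ_class (\<beta> Y) (\<beta> Z) p, germ_class (\<beta> Z) (susp \<C> (\<beta> X)) q)
    (\<beta> C, \<beta> D, ?E', germ_class (\<beta> C) (\<beta> D) f, germ_class (\<beta> D) ?E' (cone_incl \<C> C D), germ_class ?E' (susp \<C> (\<beta> C)) (cone_proj \<C> C D))"
    unfolding triangle_iso.simps Q_simps(6)
  proof (intro exI conjI)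
    show "iso_mor Q (\<beta> X) (\<beta> C) (germ_class (\<beta> X) (\<beta> C) a)" by (rule iso_mor_Q_ev_eq[OF S(1,4) ev(1,4) a])
    show "iso_mor Q (\<beta> Y) (\<beta> D) (germ_class (\<beta> Y) (\<beta> D) b)" by (rule iso_mor_Q_ev_eq[OF S(2,5) ev(2,5) b])
    show "iso_mor Q (\<beta> Z) ?E' (germ_class (\<beta> Z) ?E' c)" by (rule iso_mor_Q_ev_eq[OF S(3) E' ev(3) EE c])
    show "Cmp Q (\<beta> X) (\<beta> Y) (\<beta> D) (germ_class (\<beta> Y) (\<beta> D) b) (germ_class (\<beta> X) (\<beta> Y) s) =
      Cmp Q (\<beta> X) (\<beta> C) (\<beta> D) (germ_class (\<beta> C) (\<beta> D) f) (germ_class (\<beta> X) (\<beta> C) a)"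
      unfolding germ_class_ev_eq_comp[OF S(1,2,5) ev(1,2,5) G[OF s] G[OF k(2)]]
        germ_class_ev_eq_comp[OF S(1,4,5) ev(1,4,5) G[OF k(1)] G[OF f]]
      by (rule germ_class_cong[OF S(1,5) geq_ev_eq[OF ev(1,5) G[OF sq1]]])
    show "Cmp Q (\<beta> Y) (\<beta> Z) ?E' (germ_class (\<beta> Z) ?E' c) (germ_class (\<beta> Y) (\<beta> Z) p) =
      Cmp Q (\<beta> Y) (\<beta> D) ?E' (germ_class (\<beta> D) ?E' (cone_incl \<C> C D)) (germ_class (\<beta> Y) (\<beta> D) b)"
      unfolding germ_class_ev_eq_comp[OF S(2,3) E' ev(2,3) EE G[OF p] G[OF k(3)]]
        germ_class_ev_eq_comp[OF S(2,5) E' ev(2,5) EE G[OF k(2)] G[OF i]]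
      by (rule germ_class_cong[OF S(2) E' geq_ev_eq[OF ev(2) EE G[OF sq2]]])
    have a0: "geq (\<beta> X) (\<beta> C) a a" by (rule geq_ev_eq[OF ev(1,4) G[OF k(1)]])
    show "Cmp Q (\<beta> Z) (susp \<C> (\<beta> X)) (susp \<C> (\<beta> C)) (SuspM Q (\<beta> X) (\<beta> C) (germ_class (\<beta> X) (\<beta> C) a)) (germ_class (\<beta> Z) (susp \<C> (\<beta> X)) q) =
      Cmp Q (\<beta> Z) ?E' (susp \<C> (\<beta> C)) (germ_class ?E' (susp \<C> (\<beta> C)) (cone_proj \<C> C D)) (germ_class (\<beta> Z) ?E' c)"
      unfolding SuspM_Q[OF S(1,4) a0] germ_class_ev_eq_comp[OF S(3) SS ev(3,6,7) G[OF q] heq_susp[OF at_top G[OF k(1)]]]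
        germ_class_ev_eq_comp[OF S(3) E' SS(2) ev(3) EE ev(7) G[OF k(3)] G[OF pr]]
      by (rule germ_class_cong[OF S(3) SS(2) geq_ev_eq[OF ev(3,7) G[OF sq3]]])
  qed
  have "(\<beta> X, \<beta> Y, \<beta> Z, germ_class (\<beta> X) (\<beta> Y) s, germ_class (\<beta> Y) (\<beta> Z) p, germ_class (\<beta> Z) (susp \<C> (\<beta> X)) q) \<in> triangles Q"
    unfolding triangles_def Q_simps(1,6) using S SS strict_mb_Obj_Kmb
    by (auto intro!: germ_class_mor_Q geq_ev_eq[OF ev(1,2) G[OF s]] geq_ev_eq[OF ev(2,3) G[OF p]] geq_ev_eq[OF ev(3,6) G[OF q]])
  then show ?thesis
    unfolding Dist_Q w unfolding uvw beta_mor_hclass[OF X Y s] beta_mor_hclass[OF Y Z p]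
    using Dm ti[folded qf qi qp] by blast
qed

lemma triangle_functor_beta: "triangle_functor (Ktac \<C>) Q \<beta> beta_mor beta_susp"
  unfolding triangle_functor_def Ktac_simps(1,5) Q_simps(6)
proof (intro conjI ballI allI impI)
  fix X assume X: "X \<in> tac"
  have S: "\<beta> (susp \<C> X) \<in> strict_mb" "susp \<C> (\<beta> X) \<in> strict_mb"
    using X by (simp_all add: brutal_tac susp_strict_mb susp_tac)
  show "iso_mor Q (\<beta> (susp \<C> X)) (susp \<C> (\<beta> X)) (beta_susp X)"
    unfolding beta_susp_def
    by (rule iso_mor_Q_ev_eq[OF S ev_eq_tac[OF susp_tac[OF X]] ev_eq_susp_tac[OF X] hequiv_id[OF tacD(1)[OF susp_tac[OF X]]]])
next
  fix X Y \<phi> assume X: "X \<in> tac" and Y: "Y \<in> tac" and "\<phi> \<in> mor (Ktac \<C>) X Y"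
  then obtain f where f: "\<phi> = hclass \<C> X Y f" "keq X Y f f" using mor_Ktac by blast
  note SX = susp_tac[OF X] and SY = susp_tac[OF Y]
  have sf: "keq (susp \<C> X) (susp \<C> Y) (susp_map f) (susp_map f)" by (rule heq_susp[OF all_deg f(2)])
  have sM: "SuspM (Ktac \<C>) X Y \<phi> = hclass \<C> (susp \<C> X) (susp \<C> Y) (susp_map f)"
    using f by (simp add: Ktac_simps keq_self K_susp)
  have S: "\<beta> (susp \<C> X) \<in> strict_mb" "susp \<C> (\<beta> X) \<in> strict_mb" "susp \<C> (\<beta> Y) \<in> strict_mb"
    using X Y by (simp_all add: brutal_tac susp_strict_mb susp_tac)
  have id: "keq (susp \<C> X) (susp \<C> X) (chain_id (susp \<C> X)) (chain_id (susp \<C> X))" by (rule keq_id[OF tacD(1)[OF SX]])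
  have fb: "geq (\<beta> X) (\<beta> Y) f f" by (rule geq_ev_eq[OF ev_eq_tac[OF X] ev_eq_tac[OF Y] geq_if_keq[OF f(2)]])
  have "Cmp Q (\<beta> (susp \<C> X)) (susp \<C> (\<beta> X)) (susp \<C> (\<beta> Y)) (SuspM Q (\<beta> X) (\<beta> Y) (beta_mor X Y \<phi>)) (beta_susp X)
      = germ_class (\<beta> (susp \<C> X)) (susp \<C> (\<beta> Y)) (cc (susp \<C> X) (susp \<C> X) (susp \<C> Y) (susp_map f) (chain_id (susp \<C> X)))"
    unfolding f(1) beta_mor_hclass[OF X Y f(2)] SuspM_Q[OF brutal_tac[OF X] brutal_tac[OF Y] fb] beta_susp_def
    by (rule germ_class_ev_eq_comp[OF S ev_eq_tac[OF SX] ev_eq_susp_tac[OF X] ev_eq_susp_tac[OF Y] geq_if_keq[OF id] geq_if_keq[OF sf]])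
  also have "\<dots> = germ_class (\<beta> (susp \<C> X)) (susp \<C> (\<beta> Y)) (susp_map f)"
    by (rule germ_class_cong[OF S(1,3) geq_ev_eq[OF ev_eq_tac[OF SX] ev_eq_susp_tac[OF Y] geq_if_keq[OF keq_id_right[OF sf]]]])
  also have "\<dots> = Cmp Q (\<beta> (susp \<C> X)) (\<beta> (susp \<C> Y)) (susp \<C> (\<beta> Y)) (beta_susp Y)
      (beta_mor (susp \<C> X) (susp \<C> Y) (SuspM (Ktac \<C>) X Y \<phi>))"
    unfolding sM by (rule beta_susp_comp[OF Y SX sf, symmetric])
  finally show "Cmp Q (\<beta> (susp \<C> X)) (\<beta> (susp \<C> Y)) (susp \<C> (\<beta> Y)) (beta_susp Y)
      (beta_mor (susp \<C> X) (susp \<C> Y) (SuspM (Ktac \<C>) X Y \<phi>)) =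
    Cmp Q (\<beta> (susp \<C> X)) (susp \<C> (\<beta> X)) (susp \<C> (\<beta> Y)) (SuspM Q (\<beta> X) (\<beta> Y) (beta_mor X Y \<phi>)) (beta_susp X)" ..
qed (use additive_functor_beta beta_Dist in blast)+

text \<open>A germ between truncations is a germ from \<open>X\<close> to \<open>Y\<close>, and
  \<open>extend_germ\<close> continues it to a chain map because the Hom complexes out of
  \<open>X\<close> are exact.\<close>

lemma full_functor_beta: "full_functor (Ktac \<C>) Q \<beta> beta_mor"
  unfolding full_functor_def Ktac_simps(1)
proof (intro ballI subset_antisym subsetI)
  fix X Y \<phi> assume X: "X \<in> tac" and Y: "Y \<in> tac" and "\<phi> \<in> beta_mor X Y ` mor (Ktac \<C>) X Y"
  then obtain f where f: "\<phi> = beta_mor X Y (hclass \<C> X Y f)" "keq X Y f f" using mor_Ktac[OF X Y] by blast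
  show "\<phi> \<in> mor Q (\<beta> X) (\<beta> Y)"
    unfolding f(1) beta_mor_hclass[OF X Y f(2)]
    by (rule germ_class_mor_Q[OF brutal_tac[OF X] brutal_tac[OF Y] geq_ev_eq[OF ev_eq_tac[OF X] ev_eq_tac[OF Y] geq_if_keq[OF f(2)]]])
next
  fix X Y \<phi> assume X: "X \<in> tac" and Y: "Y \<in> tac" and "\<phi> \<in> mor Q (\<beta> X) (\<beta> Y)"
  then obtain g where g: "geq (\<beta> X) (\<beta> Y) g g" "\<phi> = germ_class (\<beta> X) (\<beta> Y) g"
    using mor_Q[OF brutal_tac[OF X] brutal_tac[OF Y]] by blast
  have "ev_eq (\<beta> X) X" "ev_eq (\<beta> Y) Y" using ev_eq_tac[OF X] ev_eq_tac[OF Y] by (auto simp: ev_eq_def elim: eventually_mono)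
  then have "geq X Y g g" using geq_ev_eq g(1) by blast
  then obtain f where f: "keq X Y f f" "\<forall>\<^sub>F n in at_top. f n = g n"
    using extend_germ[OF tacD(1)[OF X] tacD(1)[OF Y] tacD(3)[OF X]] by blast
  have "geq (\<beta> X) (\<beta> Y) f g" by (rule geq_eq[OF geq_ev_eq[OF ev_eq_tac[OF X] ev_eq_tac[OF Y] geq_if_keq[OF f(1)]] f(2)])
  then have "\<phi> = beta_mor X Y (hclass \<C> X Y f)"
    unfolding g(2) beta_mor_hclass[OF X Y f(1)] using germ_class_cong[OF brutal_tac[OF X] brutal_tac[OF Y]] by metis
  then show "\<phi> \<in> beta_mor X Y ` mor (Ktac \<C>) X Y"
    unfolding Ktac_simps(2) using keq_mor_K[OF f(1)] by blast
qed

text \<open>Equal images mean equal germs up to homotopy, and \<open>keq_if_geq\<close> extends the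
  germ of the homotopy to all degrees.\<close>

lemma faithful_functor_beta: "faithful_functor (Ktac \<C>) beta_mor"
  unfolding faithful_functor_def Ktac_simps(1)
proof (intro ballI inj_onI)
  fix X Y \<phi> \<psi> assume X: "X \<in> tac" and Y: "Y \<in> tac" and "\<phi> \<in> mor (Ktac \<C>) X Y" "\<psi> \<in> mor (Ktac \<C>) X Y"
    and eq: "beta_mor X Y \<phi> = beta_mor X Y \<psi>"
  then obtain f g where f: "\<phi> = hclass \<C> X Y f" "keq X Y f f" and g: "\<psi> = hclass \<C> X Y g" "keq X Y g g"
    using mor_Ktac[OF X Y] by metis
  have gf: "geq (\<beta> X) (\<beta> Y) f f" and gg: "geq (\<beta> X) (\<beta> Y) g g"
    using geq_ev_eq[OF ev_eq_tac[OF X] ev_eq_tac[OF Y] geq_if_keq] f(2) g(2) by blast+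
  have "geq (\<beta> X) (\<beta> Y) f g"
    using eq germ_class_eq_iff[OF brutal_tac[OF X] brutal_tac[OF Y] gf gg]
    by (simp add: f(1) g(1) beta_mor_hclass[OF X Y f(2)] beta_mor_hclass[OF X Y g(2)])
  moreover have "ev_eq (\<beta> X) X" "ev_eq (\<beta> Y) Y"
    using ev_eq_tac[OF X] ev_eq_tac[OF Y] by (auto simp: ev_eq_def elim: eventually_mono)
  ultimately have "geq X Y f g" using geq_ev_eq by blast
  then have "keq X Y f g" using keq_if_geq[OF f(2) g(2) tacD(3)[OF X]] by blast
  then show "\<phi> = \<psi>" unfolding f(1) g(1) by (rule hclass_keq)
qed

end

theorem theorem3p1:
  fixes \<P> :: "('o, 'm) cat"
  assumes "additive_category \<P>"
  shows "\<exists>F \<theta>.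
    triangle_functor (Ktac \<P>) (verdier_quotient (Kmb \<P>) (Obj (Kb \<P>))) (brutal \<P> 0) F \<theta> \<and>
    full_functor (Ktac \<P>) (verdier_quotient (Kmb \<P>) (Obj (Kb \<P>))) (brutal \<P> 0) F \<and>
    faithful_functor (Ktac \<P>) F \<and>
    (\<forall>C\<in>Obj (Ktac \<P>). \<forall>D\<in>Obj (Ktac \<P>). \<forall>f\<in>chain_maps \<P> C D.
      F C D (hclass \<P> C D f) =
      quot_mor (Kmb \<P>) (Obj (Kb \<P>)) (brutal \<P> 0 C) (brutal \<P> 0 D)
        (hclass \<P> (brutal \<P> 0 C) (brutal \<P> 0 D) (brutal_map \<P> 0 f)))"
proof -
  interpret additive_category \<P> by (rule assms)
  \<comment> \<open>The left side depends on the homotopy class only. Holding for every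
    representative \<open>f\<close>, the equation thus contains the well-definedness of truncation
    on classes.\<close>
  have "beta_mor C D (hclass \<P> C D f) =
      quot_mor (Kmb \<P>) (Obj (Kb \<P>)) (brutal \<P> 0 C) (brutal \<P> 0 D)
        (hclass \<P> (brutal \<P> 0 C) (brutal \<P> 0 D) (brutal_map \<P> 0 f))"
    if "C \<in> Obj (Ktac \<P>)" "D \<in> Obj (Ktac \<P>)" "f \<in> chain_maps \<P> C D" for C D f
  proof -
    have C: "C \<in> tac" and D: "D \<in> tac" using that by (simp_all add: Ktac_simps)
    then have f: "keq C D f f" using that tacD(1) by (simp add: keq_self)
    show ?thesis unfolding beta_mor_hclass[OF C D f] by (rule quot_mor_brutal_map[OF C D f, symmetric])
  qed
  then show ?thesis
    using triangle_functor_beta full_functor_beta faithful_functor_beta by blast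
qed

end
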